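(* Let $\xi=h(X_T)$, where $h:\Gamma\to\mathbb{R}$ is $\mathcal{E}$-measurable and $\mathbb{E}|h(X_T)|^2<\infty$. Let $f$ be a generator (in the sense of the context) such that: (1) for almost all $(s,\omega)$, the map $(y,z)\mapsto f(s,X_s(\omega),y,z(\cdot))$ is continuous on $\mathbb{R}\times L^2(\Gamma,\mathcal{E},v(s,X_s(\omega),dy))$; (2) there exist $\lambda>0$ and $\alpha\in(0,1)$ such that $|f(s,x,y,z(\cdot))|\le \lambda\left[1+|y|^{\alpha}+\|z(\cdot)\|^{\alpha}\right]$ for all $s,x,y,z$; (3) for every integer $M\ge 1$ there is a constant $L_M>0$ such that, $\mathbb{P}$-a.s., for all $s$ and with $x=X_s$, $$|f(s,x,y,z(\cdot))-f(s,x,y',z'(\cdot))|\le L_M\left(|y-y'|+\|z(\cdot)-z'(\cdot)\|\right)$$ for all $y,y',z,z'$ with $|y|<M$, $|y'|<M$, $\|z(\cdot)\|<M$, $\|z'(\cdot)\|<M$. If there exists a positive constant $L$ such that $L_M\le L+\sqrt{\log M}$ for every integer $M\ge 1$, then the backward stochastic differential equation $$Y_s=h(X_T)+\int_s^T f(r,X_r,Y_r,Z_r(\cdot))\,dr-\int_s^T\int_\Gamma Z_r(y)\,q(dr\,dy),\qquad s\in[t,T],$$ has a unique solution $(Y,Z)$ belonging to $\mathcal{B}$.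
   Context: Fix $T>0$ and $t\in[0,T)$. $(\Gamma,\mathcal{E})$ is a measurable space whose $\sigma$-algebra contains all one-point sets. $X$ is a normal jump Markov process on $\Gamma$ with laws $\mathbb{P}^{t,x}$: (a) $\mathbb{P}^{t,x}(X_t=x)=1$; (b) for $t\le s$, $A\in\mathcal{E}$, the map $x\mapsto\mathbb{P}^{t,x}(X_s\in A)$ is $\mathcal{E}$-measurable; (c) for $r\le t\le s$, $A\in\mathcal{E}$, $\mathbb{P}^{r,x}(X_s\in A\mid\mathcal{F}_{[r,t]})=\mathbb{P}^{t,X_t}(X_s\in A)$, $\mathbb{P}^{r,x}$-a.s.; (d) for every $\omega$ and $t\ge0$ there is $\delta>0$ with $X_s(\omega)=X_t(\omega)$ for $s\in[t,t+\delta]$; (e) each trajectory has finitely many jumps on every bounded interval. A starting point $x\in\Gamma$ at time $t$ is fixed; $\mathbb{P}=\mathbb{P}^{t,x}$ and $\mathbb{E}$ is its expectation. $\mathbb{F}^t=(\mathcal{F}_{[t,s]})_{s\ge t}$ is the filtration generated by $X$ from time $t$ on, completed by the $\mathbb{P}$-null sets. $v(s,x,A)$, $s\in[0,T]$, $x\in\Gamma$, $A\in\mathcal{E}$, is the rate (transition) measure of $X$, with $\sup_{s\in[0,T],x\in\Gamma}v(s,x,\Gamma)<\infty$ and $v(s,x,\{x\})=0$. With $T_n$ the jump times of $X$ after $t$, $p(ds\,dy)=\sum_n\delta_{(T_n,X_{T_n})}$ is the associated random measure; its compensator (dual predictable projection) is $v(s,X_{s-},dy)\,ds$, and $q(ds\,dy)=p(ds\,dy)-v(s,X_{s-},dy)\,ds$.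 For $z\in L^2(\Gamma,\mathcal{E},v(s,x,dy))$, $\|z(\cdot)\|=\left(\int_\Gamma|z(y)|^2v(s,x,dy)\right)^{1/2}$; for a process, $\|Z_s(\cdot)\|$ is computed with $v(s,X_s,dy)$. $\mathcal{B}$ is the Banach space of pairs $(Y,Z)$ on $[t,T]$, with $Y$ real-valued and progressively measurable and $Z=(Z_s(\omega,y))$ real-valued and $\mathcal{P}\otimes\mathcal{E}$-measurable ($\mathcal{P}$ the predictable $\sigma$-algebra), such that $\|(Y,Z)\|_{\mathcal{B}}^2=\mathbb{E}\int_t^T|Y_r|^2dr+\mathbb{E}\int_t^T\|Z_r(\cdot)\|^2dr<\infty$ (elements at zero distance being identified). A solution of the BSDE is a pair in $\mathcal{B}$ satisfying the equation. A generator is a family of maps $f(s,x,y,\cdot):L^2(\Gamma,\mathcal{E},v(s,x,dy))\to\mathbb{R}$, for $s\in[0,T]$, $x\in\Gamma$, $y\in\mathbb{R}$, such that for every bounded $\mathcal{E}$-measurable $z:\Gamma\to\mathbb{R}$ the map $(s,x,y)\mapsto f(s,x,y,z(\cdot))$ is $B([0,T])\otimes\mathcal{E}\otimes B(\mathbb{R})$-measurable, and such that $(\omega,s)\mapsto f(s,X_s,Y_s,Z_s(\cdot))$ is progressively measurable whenever $Y$ is progressively measurable and $Z$ is $\mathcal{P}\otimes\mathcal{E}$-measurable with $\mathbb{E}\int_t^T\|Z_s(\cdot)\|^2ds<\infty$. *)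

theory Defs
  imports "HOL-Probability.Probability"
begin

text \<open>
  Throughout, the measurable space of states is a value \<open>\<Gamma> :: 'g measure\<close>, of which only
  \<open>space\<close> and \<open>sets\<close> are used.  A process is a function \<open>X :: real \<Rightarrow> 'w \<Rightarrow> 'g\<close> whose values at
  negative times are irrelevant.
\<close>

definition process_algebra ::
    "'g measure \<Rightarrow> 'w set \<Rightarrow> (real \<Rightarrow> 'w \<Rightarrow> 'g) \<Rightarrow> real set \<Rightarrow> 'w measure" where
  "process_algebra \<Gamma> \<Omega> X I = sigma \<Omega> {X r -` A \<inter> \<Omega> | r A. r \<in> I \<and> A \<in> sets \<Gamma>}"

text \<open>
  A jump time is a point where the path fails to be left continuous for the discrete topology
  on the state space; the left limit below is taken in the same topology.
\<close>

definition jump_times :: "(real \<Rightarrow> 'w \<Rightarrow> 'g) \<Rightarrow> 'w \<Rightarrow> real set" where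
  "jump_times X \<omega> = {s. 0 < s \<and> \<not> (\<forall>\<^sub>F r in at_left s. X r \<omega> = X s \<omega>)}"

definition left_limit :: "(real \<Rightarrow> 'w \<Rightarrow> 'g) \<Rightarrow> real \<Rightarrow> 'w \<Rightarrow> 'g" where
  "left_limit X s \<omega> = (THE x. \<forall>\<^sub>F r in at_left s. X r \<omega> = x)"

text \<open>The sum of the Dirac masses at \<open>(s, X\<^sub>s)\<close>, for \<open>s\<close> a jump time after \<open>t\<close>.\<close>

definition jump_measure ::
    "'g measure \<Rightarrow> (real \<Rightarrow> 'w \<Rightarrow> 'g) \<Rightarrow> real \<Rightarrow> 'w \<Rightarrow> (real \<times> 'g) measure" where
  "jump_measure \<Gamma> X t \<omega> =
     distr (count_space (jump_times X \<omega> \<inter> {t<..})) (restrict_space borel {t<..} \<Otimes>\<^sub>M \<Gamma>)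
       (\<lambda>s. (s, X s \<omega>))"

locale normal_jump_markov_process =
  fixes \<Gamma> :: "'g measure"
    and \<Omega> :: "'w set"
    and X :: "real \<Rightarrow> 'w \<Rightarrow> 'g"
    and P :: "real \<Rightarrow> 'g \<Rightarrow> 'w measure"
  assumes singleton_sets: "x \<in> space \<Gamma> \<Longrightarrow> {x} \<in> sets \<Gamma>"
    and X_in_space: "0 \<le> s \<Longrightarrow> \<omega> \<in> \<Omega> \<Longrightarrow> X s \<omega> \<in> space \<Gamma>"
    and prob_space_P: "0 \<le> t \<Longrightarrow> x \<in> space \<Gamma> \<Longrightarrow> prob_space (P t x)"
    and subalgebra_P:
      "0 \<le> t \<Longrightarrow> x \<in> space \<Gamma> \<Longrightarrow> subalgebra (P t x) (process_algebra \<Gamma> \<Omega> X {t..})"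
    and normal:
      "0 \<le> t \<Longrightarrow> x \<in> space \<Gamma> \<Longrightarrow> measure (P t x) {\<omega> \<in> \<Omega>. X t \<omega> = x} = 1"
    and measurable_law:
      "0 \<le> t \<Longrightarrow> t \<le> s \<Longrightarrow> A \<in> sets \<Gamma> \<Longrightarrow>
        (\<lambda>x. measure (P t x) {\<omega> \<in> \<Omega>. X s \<omega> \<in> A}) \<in> borel_measurable \<Gamma>"
    and markov:
      "0 \<le> r \<Longrightarrow> r \<le> t \<Longrightarrow> t \<le> s \<Longrightarrow> x \<in> space \<Gamma> \<Longrightarrow> A \<in> sets \<Gamma> \<Longrightarrow>
        AE \<omega> in P r x.
          real_cond_exp (P r x) (process_algebra \<Gamma> \<Omega> X {r..t})
            (indicator {\<omega>' \<in> \<Omega>. X s \<omega>' \<in> A}) \<omega>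
          = measure (P t (X t \<omega>)) {\<omega>' \<in> \<Omega>. X s \<omega>' \<in> A}"
    and right_constant:
      "\<omega> \<in> \<Omega> \<Longrightarrow> 0 \<le> t \<Longrightarrow> \<exists>\<delta>>0. \<forall>s\<in>{t..t + \<delta>}. X s \<omega> = X t \<omega>"
    and finite_jumps: "\<omega> \<in> \<Omega> \<Longrightarrow> finite (jump_times X \<omega> \<inter> {0..b})"

text \<open>
  For the law \<open>Q\<close> started at time \<open>t\<close>.  Using the null sets of \<open>completion Q\<close> adds all
  subsets of \<open>Q\<close>-null events.
\<close>

definition completed_filtration ::
    "'g measure \<Rightarrow> (real \<Rightarrow> 'w \<Rightarrow> 'g) \<Rightarrow> 'w measure \<Rightarrow> real \<Rightarrow> real \<Rightarrow> 'w measure" where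
  "completed_filtration \<Gamma> X Q t s =
     sigma (space Q)
       (sets (process_algebra \<Gamma> (space Q) X {t..s}) \<union> null_sets (completion Q))"

definition progressive ::
    "(real \<Rightarrow> 'w measure) \<Rightarrow> real \<Rightarrow> real \<Rightarrow> (real \<Rightarrow> 'w \<Rightarrow> real) \<Rightarrow> bool" where
  "progressive F t T Y \<longleftrightarrow>
     (\<forall>s\<in>{t..T}. (\<lambda>(\<omega>, r). Y r \<omega>) \<in> borel_measurable (F s \<Otimes>\<^sub>M restrict_space borel {t..s}))"

definition predictable_algebra ::
    "(real \<Rightarrow> 'w measure) \<Rightarrow> real \<Rightarrow> real \<Rightarrow> ('w \<times> real) measure" where
  "predictable_algebra F t T =
     sigma (space (F t) \<times> {t..T})
       ({A \<times> {t} | A. A \<in> sets (F t)} \<union>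
        {A \<times> {a<..b} | A a b. t \<le> a \<and> a \<le> b \<and> b \<le> T \<and> A \<in> sets (F a)})"

definition predictable_field ::
    "'g measure \<Rightarrow> (real \<Rightarrow> 'w measure) \<Rightarrow> real \<Rightarrow> real \<Rightarrow>
     (real \<Rightarrow> 'w \<Rightarrow> 'g \<Rightarrow> 'a::topological_space) \<Rightarrow> bool" where
  "predictable_field \<Gamma> F t T Z \<longleftrightarrow>
     (\<lambda>((\<omega>, s), y). Z s \<omega> y) \<in> borel_measurable (predictable_algebra F t T \<Otimes>\<^sub>M \<Gamma>)"

text \<open>
  The rate measure is characterised, for every starting point, by the fact that
  \<open>v(s, X\<^sub>s\<^sub>-, dy) ds\<close> is the dual predictable projection of the random jump measure.
\<close>

definition is_compensator ::
    "'g measure \<Rightarrow> (real \<Rightarrow> 'w \<Rightarrow> 'g) \<Rightarrow> 'w measure \<Rightarrow> real \<Rightarrow> real \<Rightarrow>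
     (real \<Rightarrow> 'g \<Rightarrow> 'g measure) \<Rightarrow> bool" where
  "is_compensator \<Gamma> X Q t T v \<longleftrightarrow>
     (\<forall>H :: real \<Rightarrow> 'w \<Rightarrow> 'g \<Rightarrow> ennreal.
        predictable_field \<Gamma> (completed_filtration \<Gamma> X Q t) t T H \<longrightarrow>
        (\<integral>\<^sup>+\<omega>. (\<integral>\<^sup>+u\<in>{t<..T} \<times> space \<Gamma>. H (fst u) \<omega> (snd u) \<partial>jump_measure \<Gamma> X t \<omega>) \<partial>completion Q)
        = (\<integral>\<^sup>+\<omega>. (\<integral>\<^sup>+s\<in>{t<..T}. (\<integral>\<^sup>+y. H s \<omega> y \<partial>v s (left_limit X s \<omega>)) \<partial>lborel) \<partial>completion Q))"

locale jump_markov_process_with_rate = normal_jump_markov_process +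
  fixes T :: real
    and v :: "real \<Rightarrow> 'a \<Rightarrow> 'a measure"
  assumes T_pos: "0 < T"
    and sets_v: "s \<in> {0..T} \<Longrightarrow> x \<in> space \<Gamma> \<Longrightarrow> sets (v s x) = sets \<Gamma>"
    and measurable_v:
      "A \<in> sets \<Gamma> \<Longrightarrow>
        (\<lambda>(s, x). emeasure (v s x) A) \<in> borel_measurable (restrict_space borel {0..T} \<Otimes>\<^sub>M \<Gamma>)"
    and bounded_v: "(SUP s\<in>{0..T}. SUP x\<in>space \<Gamma>. emeasure (v s x) (space \<Gamma>)) < \<infinity>"
    and no_self_jump: "s \<in> {0..T} \<Longrightarrow> x \<in> space \<Gamma> \<Longrightarrow> emeasure (v s x) {x} = 0"
    and compensator:
      "t \<in> {0..T} \<Longrightarrow> x \<in> space \<Gamma> \<Longrightarrow> is_compensator \<Gamma> X (P t x) t T v"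

definition L2 :: "'g measure \<Rightarrow> ('g \<Rightarrow> real) set" where
  "L2 \<mu> = {z \<in> borel_measurable \<mu>. integrable \<mu> (\<lambda>y. (z y)\<^sup>2)}"

definition L2_norm :: "'g measure \<Rightarrow> ('g \<Rightarrow> real) \<Rightarrow> real" where
  "L2_norm \<mu> z = sqrt (\<integral>y. (z y)\<^sup>2 \<partial>\<mu>)"

definition Y_sqnorm :: "'w measure \<Rightarrow> real \<Rightarrow> real \<Rightarrow> (real \<Rightarrow> 'w \<Rightarrow> real) \<Rightarrow> ennreal" where
  "Y_sqnorm M t T Y = (\<integral>\<^sup>+\<omega>. (\<integral>\<^sup>+r\<in>{t..T}. ennreal ((Y r \<omega>)\<^sup>2) \<partial>lborel) \<partial>M)"

definition Z_sqnorm ::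
    "'w measure \<Rightarrow> (real \<Rightarrow> 'w \<Rightarrow> 'g) \<Rightarrow> (real \<Rightarrow> 'g \<Rightarrow> 'g measure) \<Rightarrow> real \<Rightarrow> real \<Rightarrow>
     (real \<Rightarrow> 'w \<Rightarrow> 'g \<Rightarrow> real) \<Rightarrow> ennreal" where
  "Z_sqnorm M X v t T Z =
     (\<integral>\<^sup>+\<omega>. (\<integral>\<^sup>+r\<in>{t..T}. (\<integral>\<^sup>+y. ennreal ((Z r \<omega> y)\<^sup>2) \<partial>v r (X r \<omega>)) \<partial>lborel) \<partial>M)"

definition B_sqnorm ::
    "'w measure \<Rightarrow> (real \<Rightarrow> 'w \<Rightarrow> 'g) \<Rightarrow> (real \<Rightarrow> 'g \<Rightarrow> 'g measure) \<Rightarrow> real \<Rightarrow> real \<Rightarrow>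
     (real \<Rightarrow> 'w \<Rightarrow> real) \<Rightarrow> (real \<Rightarrow> 'w \<Rightarrow> 'g \<Rightarrow> real) \<Rightarrow> ennreal" where
  "B_sqnorm M X v t T Y Z = Y_sqnorm M t T Y + Z_sqnorm M X v t T Z"

text \<open>Representatives of elements of the Banach space; see \<open>B_equal\<close> for the identification.\<close>

definition in_B ::
    "'g measure \<Rightarrow> 'w measure \<Rightarrow> (real \<Rightarrow> 'w measure) \<Rightarrow> (real \<Rightarrow> 'w \<Rightarrow> 'g) \<Rightarrow>
     (real \<Rightarrow> 'g \<Rightarrow> 'g measure) \<Rightarrow> real \<Rightarrow> real \<Rightarrow>
     (real \<Rightarrow> 'w \<Rightarrow> real) \<Rightarrow> (real \<Rightarrow> 'w \<Rightarrow> 'g \<Rightarrow> real) \<Rightarrow> bool" where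
  "in_B \<Gamma> M F X v t T Y Z \<longleftrightarrow>
     progressive F t T Y \<and> predictable_field \<Gamma> F t T Z \<and> B_sqnorm M X v t T Y Z < \<infinity>"

definition B_equal ::
    "'w measure \<Rightarrow> (real \<Rightarrow> 'w \<Rightarrow> 'g) \<Rightarrow> (real \<Rightarrow> 'g \<Rightarrow> 'g measure) \<Rightarrow> real \<Rightarrow> real \<Rightarrow>
     (real \<Rightarrow> 'w \<Rightarrow> real) \<Rightarrow> (real \<Rightarrow> 'w \<Rightarrow> 'g \<Rightarrow> real) \<Rightarrow>
     (real \<Rightarrow> 'w \<Rightarrow> real) \<Rightarrow> (real \<Rightarrow> 'w \<Rightarrow> 'g \<Rightarrow> real) \<Rightarrow> bool" where
  "B_equal M X v t T Y Z Y' Z' \<longleftrightarrow>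
     B_sqnorm M X v t T (\<lambda>r \<omega>. Y r \<omega> - Y' r \<omega>) (\<lambda>r \<omega> y. Z r \<omega> y - Z' r \<omega> y) = 0"

type_synonym 'g gen = "real \<Rightarrow> 'g \<Rightarrow> real \<Rightarrow> ('g \<Rightarrow> real) \<Rightarrow> real"

text \<open>
  The map \<open>f(s, x, y, \<cdot>)\<close> is only meaningful on square integrable functions.  A field \<open>Z\<close> with
  finite norm may fail to be square integrable at exceptional \<open>(\<omega>, s)\<close>; there the
  generator is given the value \<open>0\<close>.
\<close>

definition gen_eval :: "(real \<Rightarrow> 'g \<Rightarrow> 'g measure) \<Rightarrow> 'g gen \<Rightarrow> 'g gen" where
  "gen_eval v f s x y z = (if z \<in> L2 (v s x) then f s x y z else 0)"

text \<open>
  The first condition says that \<open>f(s, x, y, \<cdot>)\<close> is well defined on equivalence classes.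
\<close>

definition generator ::
    "'g measure \<Rightarrow> 'w measure \<Rightarrow> (real \<Rightarrow> 'w measure) \<Rightarrow> (real \<Rightarrow> 'w \<Rightarrow> 'g) \<Rightarrow>
     (real \<Rightarrow> 'g \<Rightarrow> 'g measure) \<Rightarrow> real \<Rightarrow> real \<Rightarrow> 'g gen \<Rightarrow> bool" where
  "generator \<Gamma> M F X v t T f \<longleftrightarrow>
     (\<forall>s\<in>{0..T}. \<forall>x\<in>space \<Gamma>. \<forall>y. \<forall>z\<in>L2 (v s x). \<forall>z'\<in>L2 (v s x).
        (AE u in v s x. z u = z' u) \<longrightarrow> f s x y z = f s x y z') \<and>
     (\<forall>z\<in>borel_measurable \<Gamma>. bounded (z ` space \<Gamma>) \<longrightarrow>
        (\<lambda>(s, x, y). f s x y z)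
          \<in> borel_measurable (restrict_space borel {0..T} \<Otimes>\<^sub>M \<Gamma> \<Otimes>\<^sub>M borel)) \<and>
     (\<forall>Y Z. progressive F t T Y \<longrightarrow> predictable_field \<Gamma> F t T Z \<longrightarrow>
        Z_sqnorm M X v t T Z < \<infinity> \<longrightarrow>
        progressive F t T (\<lambda>s \<omega>. gen_eval v f s (X s \<omega>) (Y s \<omega>) (Z s \<omega>)))"

text \<open>Continuity on \<open>\<real> \<times> L\<^sup>2(\<mu>)\<close>, the second factor with the distance given by \<open>L2_norm\<close>.\<close>

definition continuous_on_real_L2 ::
    "'g measure \<Rightarrow> (real \<Rightarrow> ('g \<Rightarrow> real) \<Rightarrow> real) \<Rightarrow> bool" where
  "continuous_on_real_L2 \<mu> g \<longleftrightarrow>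
     (\<forall>y. \<forall>z\<in>L2 \<mu>. \<forall>\<epsilon>>0. \<exists>\<delta>>0. \<forall>y'. \<forall>z'\<in>L2 \<mu>.
        \<bar>y' - y\<bar> < \<delta> \<and> L2_norm \<mu> (\<lambda>u. z' u - z u) < \<delta> \<longrightarrow> \<bar>g y' z' - g y z\<bar> < \<epsilon>)"

text \<open>The integral of \<open>Z\<close> with respect to \<open>q = p - v(s, X\<^sub>s\<^sub>-, dy) ds\<close> over \<open>(s, T] \<times> \<Gamma>\<close>.\<close>

definition q_integral ::
    "'g measure \<Rightarrow> (real \<Rightarrow> 'w \<Rightarrow> 'g) \<Rightarrow> (real \<Rightarrow> 'g \<Rightarrow> 'g measure) \<Rightarrow> real \<Rightarrow> real \<Rightarrow> real \<Rightarrow>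
     (real \<Rightarrow> 'w \<Rightarrow> 'g \<Rightarrow> real) \<Rightarrow> 'w \<Rightarrow> real" where
  "q_integral \<Gamma> X v t s T Z \<omega> =
     (LINT u:{s<..T} \<times> space \<Gamma>|jump_measure \<Gamma> X t \<omega>. Z (fst u) \<omega> (snd u))
     - (LINT r:{s<..T}|lborel. (\<integral>y. Z r \<omega> y \<partial>v r (left_limit X r \<omega>)))"

text \<open>
  The two integrability clauses only express that the integrals in the equation exist, so that
  the default value of a non-existing integral is never used; the integral with respect to
  \<open>jump_measure\<close> is a finite sum.
\<close>

definition bsde_solution ::
    "'g measure \<Rightarrow> 'w measure \<Rightarrow> (real \<Rightarrow> 'w measure) \<Rightarrow> (real \<Rightarrow> 'w \<Rightarrow> 'g) \<Rightarrow>
     (real \<Rightarrow> 'g \<Rightarrow> 'g measure) \<Rightarrow> real \<Rightarrow> real \<Rightarrow> 'g gen \<Rightarrow> ('g \<Rightarrow> real) \<Rightarrow>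
     (real \<Rightarrow> 'w \<Rightarrow> real) \<Rightarrow> (real \<Rightarrow> 'w \<Rightarrow> 'g \<Rightarrow> real) \<Rightarrow> bool" where
  "bsde_solution \<Gamma> M F X v t T f h Y Z \<longleftrightarrow>
     in_B \<Gamma> M F X v t T Y Z \<and>
     (AE \<omega> in M.
        set_integrable lborel {t<..T} (\<lambda>r. gen_eval v f r (X r \<omega>) (Y r \<omega>) (Z r \<omega>)) \<and>
        (\<integral>\<^sup>+r\<in>{t<..T}. (\<integral>\<^sup>+y. ennreal \<bar>Z r \<omega> y\<bar> \<partial>v r (left_limit X r \<omega>)) \<partial>lborel) < \<infinity> \<and>
        (\<forall>s\<in>{t..T}.
           Y s \<omega> = h (X T \<omega>)
             + (LINT r:{s<..T}|lborel. gen_eval v f r (X r \<omega>) (Y r \<omega>) (Z r \<omega>))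
             - q_integral \<Gamma> X v t s T Z \<omega>))"

end

theory Submission
  imports Defs
begin

text \<open>Along each trajectory the equation is an ordinary integral equation with finitely many jumps, and
  the chain rule for \<open>Y\<^sup>2\<close>, followed by the compensator formula, gives the energy identity
  \<open>E Y\<^sub>s\<^sup>2 + E \<integral> \<parallel>Z\<parallel>\<^sup>2 = E Y\<^sub>T\<^sup>2 + 2 E \<integral> Y g\<close> for a generator \<open>g\<close> that does not depend on \<open>(Y, Z)\<close>.
  Such equations are solvable once every square integrable functional of the process is a
  constant plus a stochastic integral against \<open>q\<close>; for functionals of finitely many values of
  \<open>X\<close> this follows from the backward Kolmogorov equation and the Markov property, and the general case
  by an \<open>L\<^sup>2\<close> limit.

  For the nonlinear equation \<open>f\<close> is neither regularised nor truncated: Picard iteration is run with \<open>f\<close> itself.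
  Where both arguments stay below a level \<open>N\<close>, the difference of the generators is controlled by the
  local Lipschitz constant, whose square is of order \<open>log N\<close> and is absorbed by an exponential weight; where one
  exceeds it, sublinear growth makes the difference small by a negative power of \<open>N\<close>. Hence the Picard map
  halves the weighted distance up to an error that tends to \<open>0\<close> as \<open>N\<close> grows.\<close>

section \<open>Preliminaries from analysis\<close>

text \<open>The state space has no topology and its diagonal need not be measurable, so neither the
  jump times nor sums over them are random variables for free, and the compensator formula yields
  only a lower integral. What rescues expectations is that the jumps of a solution \<open>Y\<close>
  reveal the sum. Left limits are reached through values on grids, which makes them predictable; the
  compensator uses the state just before a jump, and this differs from \<open>X\<close> at finitely
  many times of a path.

  Lipschitz constants of order \<open>sqrt (ln M)\<close> are a critical case. With a fixed level
  \<open>M\<close> the weight grows to a power of \<open>M\<close> proportional to the length of the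
  interval, while the tail gains only the power \<open>2 * (1 - \<alpha>)\<close>; long intervals
  would have to be cut into pieces, and a level that grows with time avoids this. The remaining
  error multiplies the norms of the arguments and not their distance, so the contraction principle
  does not apply as such: a bound common to all Picard iterates is needed as well, and uniqueness
  comes from letting the level tend to infinity.\<close>

lemma locally_constant_imp_eq:
  fixes A :: "real \<Rightarrow> 'b"
  assumes "a \<le> b"
    and "\<And>r. r \<in> {a..b} \<Longrightarrow> \<exists>\<delta>>0. \<forall>s\<in>{a..b}. \<bar>s - r\<bar> < \<delta> \<longrightarrow> A s = A r"
  shows "A a = A b"
proof -
  have "A constant_on {a..b}"
  proof (rule locally_constant_imp_constant)
    fix r assume r: "r \<in> {a..b}"
    then obtain \<delta> where d: "\<delta> > 0" "\<forall>s\<in>{a..b}. \<bar>s - r\<bar> < \<delta> \<longrightarrow> A s = A r"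
      using assms(2) by blast
    show "\<exists>U. openin (top_of_set {a..b}) U \<and> r \<in> U \<and> (\<forall>x\<in>U. A x = A r)"
    proof (intro exI conjI ballI)
      show "openin (top_of_set {a..b}) ({a..b} \<inter> ball r \<delta>)" by (rule openin_open_Int) simp
      show "A s = A r" if "s \<in> {a..b} \<inter> ball r \<delta>" for s
        using that d(2) by (simp add: dist_real_def abs_minus_commute)
    qed (use r d in simp)
  qed simp
  then show ?thesis using assms(1) by (auto simp: constant_on_def)
qed

text \<open>Fubini for \<open>a r * b q\<close> on the triangle \<open>r < q\<close>. It stands in
  for integration by parts below, where tail integrals are only absolutely continuous and need not
  be differentiable at every point.\<close>

lemma integral_triangle_swap:
  fixes a b :: "real \<Rightarrow> real"
  assumes a: "integrable lborel a" and b: "integrable lborel b"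
  shows "(\<integral>r. a r * (\<integral>q. indicator {r<..} q * b q \<partial>lborel) \<partial>lborel)
       = (\<integral>q. b q * (\<integral>r. indicator {..<q} r * a r \<partial>lborel) \<partial>lborel)"
proof -
  have int: "integrable (lborel \<Otimes>\<^sub>M lborel) (\<lambda>(r, q). a r * b q)"
  proof (rule lborel_pair.Fubini_integrable)
    have [measurable]: "a \<in> borel_measurable borel" "b \<in> borel_measurable borel"
      using a b by (simp_all add: borel_measurable_integrable)
    show "(\<lambda>(r, q). a r * b q) \<in> borel_measurable (lborel \<Otimes>\<^sub>M lborel)" by measurable
  qed (use a b in \<open>simp_all add: abs_mult\<close>)
  have int': "integrable (lborel \<Otimes>\<^sub>M lborel)
      (\<lambda>(r, q). indicator {p. fst p < snd p} (r, q) * (a r * b q))"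
  proof -
    have "{p :: real \<times> real. fst p < snd p} \<in> sets (lborel \<Otimes>\<^sub>M lborel)"
      by (simp only: lborel_prod sets_lborel)
        (intro borel_open open_Collect_less continuous_intros)
    from integrable_mult_indicator[OF this int] show ?thesis by (simp add: case_prod_beta')
  qed
  have "(\<integral>q. (\<integral>r. indicator {p. fst p < snd p} (r, q) * (a r * b q) \<partial>lborel) \<partial>lborel)
      = (\<integral>r. (\<integral>q. indicator {p. fst p < snd p} (r, q) * (a r * b q) \<partial>lborel) \<partial>lborel)"
    by (rule lborel_pair.Fubini_integral[OF int'])
  moreover have "(\<integral>r. indicator {p. fst p < snd p} (r, q) * (a r * b q) \<partial>lborel)
      = b q * (\<integral>r. indicator {..<q} r * a r \<partial>lborel)" for q
  proof -
    have "indicator {p. fst p < snd p} (r, q) * (a r * b q) = b q * (indicator {..<q} r * a r)" for r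
      by (simp add: indicator_def)
    then show ?thesis by (simp only: integral_mult_right_zero)
  qed
  moreover have "(\<integral>q. indicator {p. fst p < snd p} (r, q) * (a r * b q) \<partial>lborel)
      = a r * (\<integral>q. indicator {r<..} q * b q \<partial>lborel)" for r
  proof -
    have "indicator {p. fst p < snd p} (r, q) * (a r * b q) = a r * (indicator {r<..} q * b q)" for q
      by (simp add: indicator_def)
    then show ?thesis by (simp only: integral_mult_right_zero)
  qed
  ultimately show ?thesis by simp
qed

text \<open>Only \<open>f\<close> has to be measurable: \<open>g\<close> inherits it, because
  changing a function at finitely many points keeps it Borel.\<close>

lemma lborel_integral_cong_except:
  fixes f g :: "real \<Rightarrow> real"
  assumes "f \<in> borel_measurable lborel" "finite C" "\<And>r. r \<notin> C \<Longrightarrow> f r = g r"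
  shows "(\<integral>r. f r \<partial>lborel) = (\<integral>r. g r \<partial>lborel)"
proof -
  have ae: "AE r in lborel. f r = g r"
    using assms(2,3) by (intro AE_I'[of C]) (auto intro: finite_imp_null_set_lborel)
  have "(\<lambda>r. g r) \<in> borel_measurable lborel"
  proof -
    have "g = (\<lambda>r. if r \<in> C then g r else f r)" using assms(3) by auto
    moreover have "(\<lambda>r. if r \<in> C then g r else f r) \<in> borel_measurable borel"
    proof (rule measurable_discrete_difference[where X=C])
      show "f \<in> measurable borel borel" using assms(1) by simp
    qed (use assms in \<open>auto simp: countable_finite\<close>)
    ultimately show ?thesis by simp
  qed
  then show ?thesis using ae assms(1) by (intro integral_cong_AE) auto
qed

text \<open>The chain rule for squares of absolutely continuous functions, obtained from Fubini's
  theorem on the triangle.\<close>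

lemma square_integral_formula:
  fixes a Y :: "real \<Rightarrow> real"
  assumes "s \<le> e" and a: "set_integrable lborel {s<..e} a"
    and Y: "\<And>r. r \<in> {s..e} \<Longrightarrow> Y r = c + (LINT q:{r<..e}|lborel. a q)"
  shows "(Y s)\<^sup>2 = c\<^sup>2 + 2 * (LINT r:{s<..e}|lborel. Y r * a r)"
    and "set_integrable lborel {s<..e} (\<lambda>r. Y r * a r)"
proof -
  define b where "b = (\<lambda>r. indicator {s<..e} r * a r)"
  have b: "integrable lborel b"
    using a by (simp add: set_integrable_def b_def)
  define A where "A r = (\<integral>q. indicator {r<..} q * b q \<partial>lborel)" for r
  define A' where "A' r = (\<integral>q. indicator {..<r} q * b q \<partial>lborel)" for r
  define I where "I = (\<integral>q. b q \<partial>lborel)"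
  have bi: "integrable lborel (\<lambda>q. indicator C q * b q)" if "C \<in> sets borel" for C
    using integrable_mult_indicator[of C lborel b] b that by simp
  have split: "A r + A' r = I" for r
  proof -
    have "A r + A' r = (\<integral>q. (indicator {r<..} q + indicator {..<r} q) * b q \<partial>lborel)"
      unfolding A_def A'_def distrib_right
      by (rule Bochner_Integration.integral_add[symmetric]) (auto intro!: bi)
    also have "\<dots> = I" unfolding I_def
      using b by (intro lborel_integral_cong_except[where C="{r}"]) (auto simp: indicator_def)
    finally show ?thesis .
  qed
  \<comment> \<open>The square of the total integral is the sum over the two triangles on either
    side of the diagonal. By symmetry they contribute equally, which produces the factor 2 of the
    chain rule.\<close>
  have swap: "(\<integral>r. b r * A r \<partial>lborel) = (\<integral>r. b r * A' r \<partial>lborel)"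
    unfolding A_def A'_def by (rule integral_triangle_swap[OF b b])
  have A_meas: "A \<in> borel_measurable borel"
    unfolding A_def greaterThan_def using borel_measurable_integrable[OF b] by simp measurable
  have A_bd: "\<bar>A r\<bar> \<le> (\<integral>q. \<bar>b q\<bar> \<partial>lborel)" for r
    unfolding A_def
  proof (rule order.trans[OF integral_abs_bound], rule integral_mono)
    show "integrable lborel (\<lambda>q. \<bar>indicator {r<..} q * b q\<bar>)"
      by (intro integrable_abs bi) simp
  qed (use b in \<open>auto simp: abs_mult indicator_def\<close>)
  have bA: "integrable lborel (\<lambda>r. b r * A r)"
    using b A_meas A_bd
    by (intro Bochner_Integration.integrable_bound[OF integrable_mult_left[OF integrable_norm[OF b], of "\<integral>q. \<bar>b q\<bar> \<partial>lborel"]])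
      (auto simp: abs_mult intro!: mult_left_mono order.trans[OF A_bd])
  have "I * I = (\<integral>r. b r * A r + b r * A' r \<partial>lborel)"
    by (simp add: distrib_left[symmetric] split I_def)
  also have "\<dots> = (\<integral>r. b r * A r \<partial>lborel) + (\<integral>r. b r * A' r \<partial>lborel)"
  proof (rule Bochner_Integration.integral_add[OF bA])
    have "b r * A' r = b r * I - b r * A r" for r
      unfolding split[of r, symmetric] by (simp add: algebra_simps)
    then show "integrable lborel (\<lambda>r. b r * A' r)" using b bA by simp
  qed
  finally have I2: "I * I = 2 * (\<integral>r. b r * A r \<partial>lborel)" using swap by simp
  have YA: "Y r = c + A r" if "r \<in> {s..e}" for r
    unfolding Y[OF that] A_def b_def set_lebesgue_integral_def using that
    by (auto intro!: Bochner_Integration.integral_cong simp: indicator_def)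
  have YI: "Y s = c + I"
    unfolding Y[of s, simplified, OF \<open>s \<le> e\<close>] I_def b_def set_lebesgue_integral_def by simp
  have eq: "indicator {s<..e} r *\<^sub>R (Y r * a r) = c * b r + b r * A r" for r
    using YA[of r] by (auto simp: b_def indicator_def algebra_simps)
  have "(LINT r:{s<..e}|lborel. Y r * a r) = c * I + (\<integral>r. b r * A r \<partial>lborel)"
    unfolding set_lebesgue_integral_def eq using b bA by (simp add: I_def)
  then show "(Y s)\<^sup>2 = c\<^sup>2 + 2 * (LINT r:{s<..e}|lborel. Y r * a r)"
    using I2 by (simp add: YI power2_eq_square algebra_simps)
  show "set_integrable lborel {s<..e} (\<lambda>r. Y r * a r)"
    unfolding set_integrable_def eq using b bA by simp
qed

lemma set_integral_cong_except:
  fixes f g :: "real \<Rightarrow> real"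
  assumes "set_integrable lborel B f" "finite C" "\<And>r. r \<in> B \<Longrightarrow> r \<notin> C \<Longrightarrow> f r = g r"
  shows "(LINT r:B|lborel. f r) = (LINT r:B|lborel. g r)" "set_integrable lborel B g"
proof -
  show "(LINT r:B|lborel. f r) = (LINT r:B|lborel. g r)"
    unfolding set_lebesgue_integral_def
    by (rule lborel_integral_cong_except[where C=C]) (use assms in \<open>auto simp: set_integrable_def indicator_def\<close>)
  have "(\<lambda>r. indicator B r *\<^sub>R g r) \<in> borel_measurable borel"
  proof (rule measurable_discrete_difference[where X=C])
    show "(\<lambda>r. indicator B r *\<^sub>R f r) \<in> measurable borel borel"
      using assms(1) by (auto simp: set_integrable_def)
  qed (use assms in \<open>auto simp: countable_finite indicator_def\<close>)
  moreover have "AE r in lborel. indicator B r *\<^sub>R f r = indicator B r *\<^sub>R g r"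
    using assms(2,3) by (intro AE_I'[of C]) (auto intro: finite_imp_null_set_lborel simp: indicator_def)
  ultimately show "set_integrable lborel B g"
    using assms(1) unfolding set_integrable_def
    by (subst integrable_cong_AE[symmetric, where f="\<lambda>r. indicator B r *\<^sub>R f r"]) auto
qed

lemma set_integral_Ioc_split:
  fixes f :: "real \<Rightarrow> real"
  assumes "set_integrable lborel {a<..c} f" "a \<le> b" "b \<le> c"
  shows "(LINT r:{a<..c}|lborel. f r) = (LINT r:{a<..b}|lborel. f r) + (LINT r:{b<..c}|lborel. f r)"
    and "set_integrable lborel {a<..b} f" and "set_integrable lborel {b<..c} f"
proof -
  show 1: "set_integrable lborel {a<..b} f" and 2: "set_integrable lborel {b<..c} f"
    using assms by (auto intro: set_integrable_subset)
  have "{a<..c} = {a<..b} \<union> {b<..c}" using assms by auto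
  then show "(LINT r:{a<..c}|lborel. f r) = (LINT r:{a<..b}|lborel. f r) + (LINT r:{b<..c}|lborel. f r)"
    using set_integral_Un[OF _ 1 2] by auto
qed

text \<open>Induction on the jumps, the earliest one being split off. The sum runs over jumps
  strictly after \<open>r\<close>, so \<open>Y\<close> is right continuous and its left limit at a
  jump \<open>m\<close> is \<open>Y m + b m\<close>; crossing the jump accounts for
  \<open>(Y m + b m)\<^sup>2 - (Y m)\<^sup>2\<close>.\<close>

lemma square_jump_formula:
  fixes a Y b :: "real \<Rightarrow> real"
  assumes "finite J" "J \<subseteq> {s<..e}" "s \<le> e" "set_integrable lborel {s<..e} a"
    and "\<And>r. r \<in> {s..e} \<Longrightarrow> Y r = c + (LINT q:{r<..e}|lborel. a q) + (\<Sum>\<tau>\<in>J \<inter> {r<..}. b \<tau>)"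
  shows "(Y s)\<^sup>2 = c\<^sup>2 + 2 * (LINT r:{s<..e}|lborel. Y r * a r) + (\<Sum>\<tau>\<in>J. 2 * Y \<tau> * b \<tau> + (b \<tau>)\<^sup>2)
    \<and> set_integrable lborel {s<..e} (\<lambda>r. Y r * a r)"
  using assms
proof (induction J arbitrary: s Y rule: finite_linorder_min_induct)
  case empty
  then show ?case using square_integral_formula[of s e a Y c] by simp
next
  case (insert m A)
  have m: "s < m" "m \<le> e" "m \<notin> A" using insert by auto
  have int: "set_integrable lborel {s<..m} a" "set_integrable lborel {m<..e} a"
    using set_integral_Ioc_split[OF insert.prems(3)] m by auto
  have IH: "(Y m)\<^sup>2 = c\<^sup>2 + 2 * (LINT r:{m<..e}|lborel. Y r * a r) + (\<Sum>\<tau>\<in>A. 2 * Y \<tau> * b \<tau> + (b \<tau>)\<^sup>2)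
    \<and> set_integrable lborel {m<..e} (\<lambda>r. Y r * a r)"
  proof (rule insert.IH)
    show "A \<subseteq> {m<..e}" using insert by auto
    fix r assume r: "r \<in> {m..e}"
    then have "insert m A \<inter> {r<..} = A \<inter> {r<..}" by auto
    then show "Y r = c + (LINT q:{r<..e}|lborel. a q) + (\<Sum>\<tau>\<in>A \<inter> {r<..}. b \<tau>)"
      using insert.prems(4)[of r] r m by auto
  qed (use m int in auto)
  \<comment> \<open>Replacing the value at \<open>m\<close> by the left limit makes the path
    absolutely continuous on the closed interval up to \<open>m\<close>, so the formula without
    jumps applies there; a single point does not affect the integral.\<close>
  define Y' where "Y' r = (if r = m then Y m + b m else Y r)" for r
  have Ym: "Y m = c + (LINT q:{m<..e}|lborel. a q) + (\<Sum>\<tau>\<in>A. b \<tau>)"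
  proof -
    have "insert m A \<inter> {m<..} = A" using insert by auto
    then show ?thesis using insert.prems(4)[of m] m by auto
  qed
  have Y'_eq: "Y' r = (Y m + b m) + (LINT q:{r<..m}|lborel. a q)" if "r \<in> {s..m}" for r
  proof (cases "r = m")
    case False
    have "insert m A \<inter> {r<..} = insert m A" using that False insert by auto
    moreover have "set_integrable lborel {r<..e} a"
      using that m by (intro set_integrable_subset[OF insert.prems(3)]) auto
    ultimately show ?thesis
      using insert.prems(4)[of r] that False m Ym insert.hyps
        set_integral_Ioc_split(1)[of r e a m] by (simp add: Y'_def)
  qed (simp add: Y'_def set_lebesgue_integral_def)
  note sq = square_integral_formula[of s m a Y', OF _ int(1) Y'_eq, simplified]
  have sq1: "(Y s)\<^sup>2 = (Y m + b m)\<^sup>2 + 2 * (LINT r:{s<..m}|lborel. Y' r * a r)"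
    using sq(1) m by (simp add: Y'_def)
  have sq2: "set_integrable lborel {s<..m} (\<lambda>r. Y' r * a r)" using sq(2) m by simp
  have sq3: "(LINT r:{s<..m}|lborel. Y' r * a r) = (LINT r:{s<..m}|lborel. Y r * a r)"
     "set_integrable lborel {s<..m} (\<lambda>r. Y r * a r)"
    using set_integral_cong_except[OF sq2, of "{m}" "\<lambda>r. Y r * a r"] by (auto simp: Y'_def)
  have un: "{s<..e} = {s<..m} \<union> {m<..e}" using m by auto
  have si: "set_integrable lborel {s<..e} (\<lambda>r. Y r * a r)"
    unfolding un using sq3(2) IH by (intro set_integrable_Un) auto
  have I: "(LINT r:{s<..e}|lborel. Y r * a r)
      = (LINT r:{s<..m}|lborel. Y r * a r) + (LINT r:{m<..e}|lborel. Y r * a r)"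
    using m by (intro set_integral_Ioc_split(1)[OF si]) auto
  have "(Y m + b m)\<^sup>2 = (Y m)\<^sup>2 + (2 * Y m * b m + (b m)\<^sup>2)" by (simp add: power2_sum)
  moreover have "(\<Sum>\<tau>\<in>insert m A. 2 * Y \<tau> * b \<tau> + (b \<tau>)\<^sup>2)
    = (2 * Y m * b m + (b m)\<^sup>2) + (\<Sum>\<tau>\<in>A. 2 * Y \<tau> * b \<tau> + (b \<tau>)\<^sup>2)"
    using insert.hyps(1) m(3) by (rule sum.insert)
  ultimately have "(Y s)\<^sup>2 = c\<^sup>2 + 2 * (LINT r:{s<..e}|lborel. Y r * a r)
      + (\<Sum>\<tau>\<in>insert m A. 2 * Y \<tau> * b \<tau> + (b \<tau>)\<^sup>2)"
    using IH[THEN conjunct1] sq1 sq3(1) I by linarith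
  then show ?case using si by (rule conjI)
qed

text \<open>Integration by parts for a weight against a tail integral: the triangle swap with
  \<open>a = W'\<close>, whose inner integral is \<open>W q - W t\<close> by the fundamental
  theorem. In this way an identity valid at every time turns into a weighted one.\<close>

lemma weight_fubini:
  fixes k W W' :: "real \<Rightarrow> real"
  assumes "t \<le> T" and k: "set_integrable lborel {t<..T} k"
    and W: "\<And>r. (W has_real_derivative W' r) (at r)"
    and W': "continuous_on UNIV W'"
  shows "(LINT s:{t<..T}|lborel. W' s * (LINT r:{s<..T}|lborel. k r))
    = (LINT r:{t<..T}|lborel. W r * k r) - W t * (LINT r:{t<..T}|lborel. k r)"
    and "set_integrable lborel {t<..T} (\<lambda>r. W r * k r)"
    and "set_integrable lborel {t<..T} (\<lambda>s. W' s * (LINT r:{s<..T}|lborel. k r))"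
proof -
  define b where "b = (\<lambda>r. indicator {t<..T} r * k r)"
  have b: "integrable lborel b" using k by (simp add: set_integrable_def b_def)
  define a where "a = (\<lambda>r. indicator {t<..T} r * W' r)"
  have a0: "set_integrable lborel {t..T} W'"
    using borel_integrable_atLeastAtMost'[OF continuous_on_subset[OF W']] by simp
  have a: "integrable lborel a"
    using set_integrable_subset[OF a0, of "{t<..T}"] by (simp add: set_integrable_def a_def subset_eq)
  have FTC: "(\<integral>r. indicator {..<q} r * a r \<partial>lborel) = W q - W t" if "q \<in> {t<..T}" for q
  proof -
    have "(\<integral>r. W' r * indicator {t..q} r \<partial>lborel) = W q - W t"
      by (rule integral_FTC_Icc_real)
        (use that W W' in \<open>auto simp: continuous_on_eq_continuous_at\<close>)
    moreover have "(\<integral>r. indicator {..<q} r * a r \<partial>lborel) = (\<integral>r. W' r * indicator {t..q} r \<partial>lborel)"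
      using a that by (intro lborel_integral_cong_except[where C="{t,q}"]) (auto simp: a_def indicator_def)
    ultimately show ?thesis by simp
  qed
  have Wc: "continuous_on UNIV W"
    using W by (meson DERIV_isCont continuous_at_imp_continuous_on)
  then have "bounded (W ` {t..T})"
    by (intro compact_imp_bounded compact_continuous_image) (auto intro: continuous_on_subset)
  then obtain K where "\<forall>x\<in>W ` {t..T}. norm x \<le> K"
    unfolding bounded_iff by blast
  then have K: "\<bar>W r\<bar> \<le> K" if "r \<in> {t..T}" for r using that by auto
  have Wm: "W \<in> borel_measurable borel" by (rule borel_measurable_continuous_onI[OF Wc])
  have Wb: "integrable lborel (\<lambda>r. W r * b r)"
  proof (rule Bochner_Integration.integrable_bound[of _ "\<lambda>r. K * b r"])
    show "AE r in lborel. norm (W r * b r) \<le> norm (K * b r)"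
      using K by (auto simp: b_def abs_mult indicator_def intro!: AE_I2 mult_right_mono order.trans[OF K abs_ge_self])
  qed (use b Wm in auto)
  then show "set_integrable lborel {t<..T} (\<lambda>r. W r * k r)"
    by (simp add: set_integrable_def b_def mult_ac)
  have eq1: "indicator {t<..T} s *\<^sub>R (W' s * (LINT r:{s<..T}|lborel. k r))
      = a s * (\<integral>q. indicator {s<..} q * b q \<partial>lborel)" for s
    by (auto simp: a_def b_def set_lebesgue_integral_def indicator_def intro!: Bochner_Integration.integral_cong arg_cong[where f="\<lambda>z. _ * z"])
  have eq2: "b q * (\<integral>r. indicator {..<q} r * a r \<partial>lborel) = W q * b q - W t * b q" for q
    by (cases "q \<in> {t<..T}") (simp_all only: FTC, simp_all add: b_def algebra_simps)
  show "(LINT s:{t<..T}|lborel. W' s * (LINT r:{s<..T}|lborel. k r))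
    = (LINT r:{t<..T}|lborel. W r * k r) - W t * (LINT r:{t<..T}|lborel. k r)"
    unfolding set_lebesgue_integral_def[of _ _ "\<lambda>s. W' s * _ s"] eq1 integral_triangle_swap[OF a b] eq2
    using Wb b by (simp add: set_lebesgue_integral_def b_def mult_ac)
  show "set_integrable lborel {t<..T} (\<lambda>s. W' s * (LINT r:{s<..T}|lborel. k r))"
    unfolding set_integrable_def eq1
  proof (rule Bochner_Integration.integrable_bound[OF integrable_mult_left[OF integrable_norm[OF a], of "\<integral>q. \<bar>b q\<bar> \<partial>lborel"]])
    show "(\<lambda>s. a s * (\<integral>q. indicator {s<..} q * b q \<partial>lborel)) \<in> borel_measurable lborel"
      unfolding greaterThan_def
      using borel_measurable_integrable[OF a] borel_measurable_integrable[OF b] by simp measurable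
    have bi: "integrable lborel (\<lambda>q. indicator {s<..} q * b q)" for s
      using integrable_mult_indicator[of "{s<..}" lborel b] b by simp
    have "\<bar>\<integral>q. indicator {s<..} q * b q \<partial>lborel\<bar> \<le> (\<integral>q. \<bar>b q\<bar> \<partial>lborel)" for s
      by (rule order.trans[OF integral_abs_bound], rule integral_mono)
        (use b bi[THEN integrable_abs] in \<open>auto simp: abs_mult indicator_def\<close>)
    then show "AE s in lborel. norm (a s * (\<integral>q. indicator {s<..} q * b q \<partial>lborel)) \<le> norm (norm (a s) * (\<integral>q. \<bar>b q\<bar> \<partial>lborel))"
      by (intro AE_I2) (simp add: abs_mult mult_left_mono order.trans[OF _ abs_ge_self])
  qed
qed

section \<open>Grids\<close>

text \<open>The cells are \<open>(t + k/n, t + (k+1)/n]\<close>. Ceiling minus one, instead of a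
  floor, places the grid point strictly before \<open>r\<close>, so that values at grid points
  approximate left limits and stay predictable.\<close>

definition grid_index :: "real \<Rightarrow> nat \<Rightarrow> real \<Rightarrow> nat" where
  "grid_index t n r = nat (\<lceil>(r - t) * real n\<rceil> - 1)"

definition grid_point :: "real \<Rightarrow> real \<Rightarrow> nat \<Rightarrow> nat \<Rightarrow> real" where
  "grid_point t T n k = min T (t + real k / real n)"

lemma grid_index_eq_iff:
  assumes "0 < n" "t < r"
  shows "grid_index t n r = k \<longleftrightarrow> t + real k / real n < r \<and> r \<le> t + real (Suc k) / real n"
proof -
  have "grid_index t n r = k \<longleftrightarrow> \<lceil>(r - t) * real n\<rceil> = int k + 1"
  proof -
    have "0 < (r - t) * real n" using assms by simp
    then have "0 < \<lceil>(r - t) * real n\<rceil>" by simp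
    then show ?thesis unfolding grid_index_def by linarith
  qed
  also have "\<dots> \<longleftrightarrow> real k < (r - t) * real n \<and> (r - t) * real n \<le> real k + 1"
    by (simp add: ceiling_eq_iff)
  also have "\<dots> \<longleftrightarrow> t + real k / real n < r \<and> r \<le> t + real (Suc k) / real n"
    using assms by (auto simp: field_simps)
  finally show ?thesis .
qed

lemma grid_point_range: "t \<le> T \<Longrightarrow> grid_point t T n k \<in> {t..T}"
  by (auto simp: grid_point_def)

lemma grid_point_index:
  assumes "0 < n" "r \<in> {t<..T}"
  shows "grid_point t T n (grid_index t n r) < r"
    and "r - 1 / real n \<le> grid_point t T n (grid_index t n r)"
    and "t \<le> grid_point t T n (grid_index t n r)"
proof -
  define q where "q = real (grid_index t n r) / real n"
  have "t + q < r" "r \<le> t + (1 / real n + q)" "0 \<le> q" "t < r" "r \<le> T"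
    using grid_index_eq_iff[of n t r "grid_index t n r"] assms by (simp_all add: q_def add_divide_distrib)
  then show "grid_point t T n (grid_index t n r) < r"
    and "r - 1 / real n \<le> grid_point t T n (grid_index t n r)"
    and "t \<le> grid_point t T n (grid_index t n r)"
    unfolding grid_point_def q_def[symmetric] by (auto simp: min_def)
qed

lemma grid_point_tendsto_left:
  assumes "r \<in> {t<..T}"
  shows "filterlim (\<lambda>n. grid_point t T n (grid_index t n r)) (at_left r) sequentially"
  unfolding filterlim_at
proof
  have 1: "\<forall>\<^sub>F n in sequentially. 0 < n" by (rule eventually_gt_at_top)
  show "\<forall>\<^sub>F n in sequentially. grid_point t T n (grid_index t n r) \<in> {..<r} \<and> grid_point t T n (grid_index t n r) \<noteq> r"
    using 1 by eventually_elim (simp add: grid_point_index(1)[OF _ assms] less_imp_neq)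
  show "(\<lambda>n. grid_point t T n (grid_index t n r)) \<longlonglongrightarrow> r"
  proof (rule tendsto_sandwich)
    show "\<forall>\<^sub>F n in sequentially. r - 1 / real n \<le> grid_point t T n (grid_index t n r)"
      using 1 by eventually_elim (rule grid_point_index(2)[OF _ assms])
    show "\<forall>\<^sub>F n in sequentially. grid_point t T n (grid_index t n r) \<le> r"
      using 1 by eventually_elim (rule less_imp_le[OF grid_point_index(1)[OF _ assms]])
    show "(\<lambda>n. r - 1 / real n) \<longlonglongrightarrow> r"
      using tendsto_diff[OF tendsto_const lim_1_over_n, of r] by simp
  qed simp
qed

lemma grid_increment_sum:
  fixes b :: "real \<Rightarrow> real"
  assumes "finite J" "J \<subseteq> {t<..T}" "0 < n"
  shows "(\<Sum>\<tau>\<in>J \<inter> {grid_point t T n k<..}. b \<tau>) - (\<Sum>\<tau>\<in>J \<inter> {grid_point t T n (Suc k)<..}. b \<tau>)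
    = (\<Sum>\<tau>\<in>{\<tau>\<in>J. grid_index t n \<tau> = k}. b \<tau>)"
proof -
  let ?A = "J \<inter> {grid_point t T n k<..}" and ?B = "J \<inter> {grid_point t T n (Suc k)<..}"
  have "t + real k / real n \<le> t + real (Suc k) / real n" by (simp add: divide_right_mono)
  then have le: "grid_point t T n k \<le> grid_point t T n (Suc k)"
    unfolding grid_point_def by linarith
  have iff: "grid_index t n \<tau> = k \<longleftrightarrow> grid_point t T n k < \<tau> \<and> \<not> grid_point t T n (Suc k) < \<tau>"
    if "\<tau> \<in> J" for \<tau>
    using grid_index_eq_iff[OF assms(3), of t \<tau> k] subsetD[OF assms(2) that]
    unfolding grid_point_def by auto
  have "{\<tau>\<in>J. grid_index t n \<tau> = k} = ?A - ?B"
    using iff by blast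
  moreover have "(\<Sum>\<tau>\<in>?A - ?B. b \<tau>) = (\<Sum>\<tau>\<in>?A. b \<tau>) - (\<Sum>\<tau>\<in>?B. b \<tau>)"
    using assms(1) le by (intro sum_diff) auto
  ultimately show ?thesis by simp
qed

text \<open>Once the mesh is below the smallest distance of two jumps, every cell contains at most
  one of them, and the sum over cells equals a sum over jumps with \<open>U\<close> read at the
  preceding grid point. Empty cells disappear because of \<open>\<phi> u 0 = 0\<close>;
  \<open>m\<close> bounds the length of the interval, so that \<open>n * m\<close> cells cover
  it.\<close>

lemma grid_sum_tendsto:
  fixes b U u :: "real \<Rightarrow> real" and \<phi> :: "real \<Rightarrow> real \<Rightarrow> real"
  assumes J: "finite J" "J \<subseteq> {t<..T}" and m: "T \<le> t + real m"
    and zero: "\<And>u. \<phi> u 0 = 0"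
    and U: "\<And>\<tau>. \<tau> \<in> J \<Longrightarrow> (\<lambda>n. U (grid_point t T n (grid_index t n \<tau>))) \<longlonglongrightarrow> u \<tau>"
    and cont: "\<And>\<tau>. \<tau> \<in> J \<Longrightarrow> isCont (\<lambda>u. \<phi> u (b \<tau>)) (u \<tau>)"
  shows "(\<lambda>n. \<Sum>k<n * m. \<phi> (U (grid_point t T n k))
      ((\<Sum>\<tau>\<in>J \<inter> {grid_point t T n k<..}. b \<tau>) - (\<Sum>\<tau>\<in>J \<inter> {grid_point t T n (Suc k)<..}. b \<tau>)))
    \<longlonglongrightarrow> (\<Sum>\<tau>\<in>J. \<phi> (u \<tau>) (b \<tau>))"
proof -
  have "\<forall>\<^sub>F n in sequentially. \<tau> \<noteq> \<sigma> \<longrightarrow> grid_index t n \<tau> \<noteq> grid_index t n \<sigma>"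
    if "\<tau> \<in> J" "\<sigma> \<in> J" for \<tau> \<sigma>
  proof (cases "\<tau> = \<sigma>")
    case False
    obtain N where N: "0 < N" "1 / real N < \<bar>\<tau> - \<sigma>\<bar>"
      using False reals_Archimedean[of "\<bar>\<tau> - \<sigma>\<bar>"] by (metis inverse_eq_divide of_nat_Suc zero_less_Suc zero_less_abs_iff right_minus_eq)
    have "\<tau> = \<sigma> \<or> grid_index t n \<tau> \<noteq> grid_index t n \<sigma>" if n: "N \<le> n" for n
    proof (rule ccontr)
      assume "\<not> ?thesis"
      then have eq: "grid_index t n \<tau> = grid_index t n \<sigma>" by auto
      have "0 < n" using N n by auto
      then have "\<bar>\<tau> - \<sigma>\<bar> \<le> 1 / real n"
        using eq grid_index_eq_iff[of n t \<tau> "grid_index t n \<sigma>"] grid_index_eq_iff[of n t \<sigma> "grid_index t n \<sigma>"]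
          subsetD[OF J(2) \<open>\<tau> \<in> J\<close>] subsetD[OF J(2) \<open>\<sigma> \<in> J\<close>] by (simp add: add_divide_distrib abs_le_iff)
      also have "\<dots> \<le> 1 / real N" using n N by (simp add: frac_le)
      finally show False using N by simp
    qed
    then show ?thesis using False by (auto simp: eventually_sequentially)
  qed simp
  then have "\<forall>\<^sub>F n in sequentially. \<forall>\<tau>\<in>J. \<forall>\<sigma>\<in>J. \<tau> \<noteq> \<sigma> \<longrightarrow> grid_index t n \<tau> \<noteq> grid_index t n \<sigma>"
    using J(1) by (auto intro!: eventually_ball_finite)
  then have ev: "\<forall>\<^sub>F n in sequentially. inj_on (grid_index t n) J"
    by eventually_elim (auto simp: inj_on_def)
  have "\<forall>\<^sub>F n in sequentially. (\<Sum>\<tau>\<in>J. \<phi> (U (grid_point t T n (grid_index t n \<tau>))) (b \<tau>))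
    = (\<Sum>k<n * m. \<phi> (U (grid_point t T n k))
      ((\<Sum>\<tau>\<in>J \<inter> {grid_point t T n k<..}. b \<tau>) - (\<Sum>\<tau>\<in>J \<inter> {grid_point t T n (Suc k)<..}. b \<tau>)))"
    using ev eventually_gt_at_top[of 0]
  proof eventually_elim
    case (elim n)
    have sub: "grid_index t n ` J \<subseteq> {..<n * m}"
    proof safe
      fix \<tau> assume "\<tau> \<in> J"
      then have "t < \<tau>" "\<tau> \<le> T" using J(2) by auto
      then have "t + real (grid_index t n \<tau>) / real n < t + real m"
        using grid_index_eq_iff[of n t \<tau> "grid_index t n \<tau>"] elim m by auto
      then have "real (grid_index t n \<tau>) < real (n * m)" using elim by (simp add: field_simps)
      then show "grid_index t n \<tau> < n * m" by (simp only: of_nat_less_iff)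
    qed
    have "(\<Sum>k<n * m. \<phi> (U (grid_point t T n k)) (\<Sum>\<tau>\<in>{\<tau>\<in>J. grid_index t n \<tau> = k}. b \<tau>))
      = (\<Sum>k\<in>grid_index t n ` J. \<phi> (U (grid_point t T n k)) (\<Sum>\<tau>\<in>{\<tau>\<in>J. grid_index t n \<tau> = k}. b \<tau>))"
    proof (rule sum.mono_neutral_right[OF _ sub], safe)
      fix k assume "k \<notin> grid_index t n ` J"
      then have "{\<tau>\<in>J. grid_index t n \<tau> = k} = {}" by auto
      then show "\<phi> (U (grid_point t T n k)) (\<Sum>\<tau>\<in>{\<tau>\<in>J. grid_index t n \<tau> = k}. b \<tau>) = 0"
        by (simp only: sum.empty zero)
    qed
    also have "\<dots> = (\<Sum>\<tau>\<in>J. \<phi> (U (grid_point t T n (grid_index t n \<tau>))) (b \<tau>))"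
    proof (subst sum.reindex[OF elim(1)], rule sum.cong[OF refl])
      fix \<tau> assume "\<tau> \<in> J"
      then have "{\<sigma>\<in>J. grid_index t n \<sigma> = grid_index t n \<tau>} = {\<tau>}"
        using elim(1) by (auto simp: inj_on_def)
      then show "((\<lambda>k. \<phi> (U (grid_point t T n k)) (\<Sum>\<tau>\<in>{\<tau>\<in>J. grid_index t n \<tau> = k}. b \<tau>)) \<circ> grid_index t n) \<tau>
        = \<phi> (U (grid_point t T n (grid_index t n \<tau>))) (b \<tau>)" by simp
    qed
    finally show ?case unfolding grid_increment_sum[OF J elim(2)] by (rule sym)
  qed
  moreover have "(\<lambda>n. \<Sum>\<tau>\<in>J. \<phi> (U (grid_point t T n (grid_index t n \<tau>))) (b \<tau>)) \<longlonglongrightarrow> (\<Sum>\<tau>\<in>J. \<phi> (u \<tau>) (b \<tau>))"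
    by (intro tendsto_sum isCont_tendsto_compose[OF cont] U)
  ultimately show ?thesis by (rule Lim_transform_eventually[rotated])
qed

section \<open>Measure theory\<close>

text \<open>Iterating \<open>(a + b)\<^sup>2 \<le> 2 * a\<^sup>2 + 2 * b\<^sup>2\<close> bounds all
  later differences by one series with weights \<open>2 * 2 ^ j\<close>; the rate \<open>1/4\<close>
  leaves \<open>1/2\<close> after the weights, so the series is integrable. Taking
  \<open>lim\<close> at every point gives a limit that inherits measurability from the sequence for
  any sigma-algebra, in particular predictability.\<close>

lemma fast_Cauchy_L2:
  fixes u :: "nat \<Rightarrow> 'a \<Rightarrow> real"
  assumes [measurable]: "\<And>n. u n \<in> borel_measurable \<mu>"
    and c: "0 \<le> c" "\<And>n. (\<integral>\<^sup>+x. ennreal ((u (Suc n) x - u n x)\<^sup>2) \<partial>\<mu>) \<le> ennreal (c * (1/4)^n)"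
  shows "AE x in \<mu>. (\<lambda>n. u n x) \<longlonglongrightarrow> lim (\<lambda>n. u n x)"
    and "(\<integral>\<^sup>+x. ennreal ((lim (\<lambda>n. u n x) - u n x)\<^sup>2) \<partial>\<mu>) \<le> ennreal (4 * c * (1/4)^n)"
proof -
  define d where "d k x = (u (Suc k) x - u k x)\<^sup>2" for k x
  have [measurable]: "d k \<in> borel_measurable \<mu>" for k unfolding d_def by measurable
  define S where "S n x = (\<Sum>j. ennreal (2 * 2 ^ j * d (n + j) x))" for n x
  have bound: "ennreal ((u (n + j) x - u n x)\<^sup>2) \<le> S n x" for n j x
  proof -
    have "(u (n + j) x - u n x)\<^sup>2 \<le> (\<Sum>i<j. 2 * 2 ^ i * d (n + i) x)"
    proof (induction j arbitrary: n)
      case (Suc j)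
      have "(u (n + Suc j) x - u n x)\<^sup>2 = ((u (Suc n + j) x - u (Suc n) x) + (u (Suc n) x - u n x))\<^sup>2" by simp
      also have "\<dots> \<le> 2 * (u (Suc n + j) x - u (Suc n) x)\<^sup>2 + 2 * (u (Suc n) x - u n x)\<^sup>2"
        using sum_squares_bound[of "u (Suc n + j) x - u (Suc n) x" "u (Suc n) x - u n x"]
        unfolding power2_sum by linarith
      also have "\<dots> \<le> 2 * (\<Sum>i<j. 2 * 2 ^ i * d (Suc n + i) x) + 2 * d n x"
        using Suc.IH[of "Suc n"] by (simp add: d_def)
      also have "\<dots> = (\<Sum>i<Suc j. 2 * 2 ^ i * d (n + i) x)"
        by (subst sum.lessThan_Suc_shift) (simp add: sum_distrib_left mult_ac)
      finally show ?case .
    qed simp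
    then have "ennreal ((u (n + j) x - u n x)\<^sup>2) \<le> ennreal (\<Sum>i<j. 2 * 2 ^ i * d (n + i) x)"
      by (rule ennreal_leI)
    also have "\<dots> = (\<Sum>i<j. ennreal (2 * 2 ^ i * d (n + i) x))"
      by (rule sum_ennreal[symmetric]) (simp add: d_def)
    also have "\<dots> \<le> S n x" unfolding S_def by (rule sum_le_suminf) auto
    finally show ?thesis .
  qed
  have S_int: "(\<integral>\<^sup>+x. S n x \<partial>\<mu>) \<le> ennreal (4 * c * (1/4)^n)" for n
  proof -
    have "(\<integral>\<^sup>+x. S n x \<partial>\<mu>) = (\<Sum>j. (\<integral>\<^sup>+x. ennreal (2 * 2 ^ j * d (n + j) x) \<partial>\<mu>))"
      unfolding S_def by (rule nn_integral_suminf) simp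
    also have "\<dots> \<le> (\<Sum>j. ennreal (2 * c * (1/4)^n * (1/2) ^ j))"
    proof (rule suminf_le)
      fix j
      have "(\<integral>\<^sup>+x. ennreal (2 * 2 ^ j * d (n + j) x) \<partial>\<mu>) = ennreal (2 * 2 ^ j) * (\<integral>\<^sup>+x. ennreal (d (n + j) x) \<partial>\<mu>)"
        by (subst nn_integral_cmult[symmetric]) (auto simp: ennreal_mult' d_def)
      also have "\<dots> \<le> ennreal (2 * 2 ^ j) * ennreal (c * (1/4)^(n + j))"
        using c(2)[of "n + j"] by (intro mult_left_mono) (auto simp: d_def)
      also have "\<dots> = ennreal (2 * c * (1/4)^n * (1/2) ^ j)"
      proof -
        have "(2::real) ^ j * (1/4)^j = (1/2)^j" by (simp add: power_mult_distrib[symmetric])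
        then have "2 * 2 ^ j * (c * (1/4)^(n + j)) = 2 * c * (1/4)^n * (1/2) ^ j"
          by (simp add: power_add mult_ac)
        moreover have "ennreal (2 * 2 ^ j) * ennreal (c * (1/4)^(n + j)) = ennreal (2 * 2 ^ j * (c * (1/4)^(n + j)))"
          by (rule ennreal_mult'[symmetric]) simp
        ultimately show ?thesis by (simp only:)
      qed
      finally show "(\<integral>\<^sup>+x. ennreal (2 * 2 ^ j * d (n + j) x) \<partial>\<mu>) \<le> ennreal (2 * c * (1/4)^n * (1/2) ^ j)" .
    qed auto
    also have "\<dots> = ennreal (\<Sum>j. 2 * c * (1/4)^n * (1/2) ^ j)"
      using c(1) by (intro suminf_ennreal2) (auto intro!: summable_mult)
    also have "(\<Sum>j. 2 * c * (1/4)^n * (1/2) ^ j) = 4 * c * (1/4 :: real)^n"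
      by (subst suminf_mult) (auto simp: suminf_geometric)
    finally show ?thesis .
  qed
  have fin: "AE x in \<mu>. \<forall>n. S n x \<noteq> \<infinity>"
  proof (intro AE_all_countable[THEN iffD2] allI)
    fix n show "AE x in \<mu>. S n x \<noteq> \<infinity>"
    proof (rule nn_integral_PInf_AE)
      show "S n \<in> borel_measurable \<mu>" unfolding S_def by measurable
      show "(\<integral>\<^sup>+x. S n x \<partial>\<mu>) \<noteq> \<infinity>" using S_int[of n] by (auto simp: top_unique)
    qed
  qed
  have conv: "convergent (\<lambda>n. u n x)" if "S 0 x \<noteq> \<infinity>" for x
  proof -
    have "summable (\<lambda>j. 2 * 2 ^ j * d j x)"
      using that unfolding S_def by (intro summable_suminf_not_top) (auto simp: d_def)
    then have "summable (\<lambda>j. (1/2)^j + 2 * 2 ^ j * d j x)"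
      by (intro summable_add) auto
    moreover have "\<bar>u (Suc j) x - u j x\<bar> \<le> (1/2)^j + 2 * 2 ^ j * d j x" for j
    proof -
      define p where "p = \<bar>u (Suc j) x - u j x\<bar>"
      \<comment> \<open>Young's inequality with weight \<open>2 ^ j\<close>: it trades summability
        of weighted squares for absolute summability of the increments.\<close>
      have "0 \<le> (1 - 2 ^ j * p)\<^sup>2" by simp
      then have "2 * (2 ^ j * p) \<le> 1 + 2 ^ j * (2 ^ j * d j x)"
        by (simp add: power2_diff d_def p_def power2_eq_square algebra_simps)
      then have "2 ^ j * (2 * p) \<le> 2 ^ j * ((1/2)^j + 2 ^ j * d j x)"
        by (simp add: distrib_left power_mult_distrib[symmetric] mult_ac)
      then have "2 * p \<le> (1/2)^j + 2 ^ j * d j x" by simp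
      moreover have lin: "x \<le> a + 2 * e" if "2 * x \<le> a + e" "0 \<le> a" "0 \<le> e" for x a e :: real
        using that by linarith
      ultimately show ?thesis
        unfolding p_def mult.assoc by (intro lin) (simp_all add: d_def)
    qed
    ultimately have "summable (\<lambda>j. u (Suc j) x - u j x)"
      by (intro summable_comparison_test[of "\<lambda>j. u (Suc j) x - u j x"]) auto
    then have "convergent (\<lambda>n. \<Sum>j<n. u (Suc j) x - u j x)"
      by (simp add: summable_iff_convergent)
    then have "convergent (\<lambda>n. u n x - u 0 x)"
      unfolding sum_lessThan_telescope[of "\<lambda>n. u n x"] .
    then have "convergent (\<lambda>n. (u n x - u 0 x) + u 0 x)"
      by (intro convergent_add convergent_const)
    then show ?thesis by simp
  qed
  show ae: "AE x in \<mu>. (\<lambda>n. u n x) \<longlonglongrightarrow> lim (\<lambda>n. u n x)"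
    using fin by eventually_elim (use conv convergent_LIMSEQ_iff in auto)
  have "(\<integral>\<^sup>+x. ennreal ((lim (\<lambda>n. u n x) - u n x)\<^sup>2) \<partial>\<mu>) \<le> (\<integral>\<^sup>+x. S n x \<partial>\<mu>)"
  proof (rule nn_integral_mono_AE, use ae in eventually_elim)
    fix x assume l: "(\<lambda>n. u n x) \<longlonglongrightarrow> lim (\<lambda>n. u n x)"
    have "(\<lambda>j. ennreal ((u (j + n) x - u n x)\<^sup>2)) \<longlonglongrightarrow> ennreal ((lim (\<lambda>n. u n x) - u n x)\<^sup>2)"
      using LIMSEQ_ignore_initial_segment[OF l, of n] by (intro tendsto_intros tendsto_ennrealI)
    then show "ennreal ((lim (\<lambda>n. u n x) - u n x)\<^sup>2) \<le> S n x"
      by (rule LIMSEQ_le_const2) (use bound[of n _ x] in \<open>auto simp: add.commute\<close>)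
  qed
  also note S_int[of n]
  finally show "(\<integral>\<^sup>+x. ennreal ((lim (\<lambda>n. u n x) - u n x)\<^sup>2) \<partial>\<mu>) \<le> ennreal (4 * c * (1/4)^n)" .
qed

text \<open>Library kernels are sub-probability kernels; bounded kernels are reduced to these by
  scaling.\<close>

locale bounded_kernel =
  fixes A :: "'a measure" and B :: "'b measure" and k :: "'a \<Rightarrow> 'b measure" and K :: real
  assumes ne: "space B \<noteq> {}" and K: "0 < K"
    and sets_k: "a \<in> space A \<Longrightarrow> sets (k a) = sets B"
    and bound_k: "a \<in> space A \<Longrightarrow> emeasure (k a) (space B) \<le> ennreal K"
    and meas_k: "C \<in> sets B \<Longrightarrow> (\<lambda>a. emeasure (k a) C) \<in> borel_measurable A"
begin

lemma scaled: "(\<lambda>a. scale_measure (ennreal (1/K)) (k a)) \<in> measurable A (subprob_algebra B)"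
proof (rule measurable_subprob_algebra)
  fix a assume a: "a \<in> space A"
  have sp: "space (k a) = space B" using sets_k[OF a] by (rule sets_eq_imp_space_eq)
  show "subprob_space (scale_measure (ennreal (1/K)) (k a))"
  proof
    have "ennreal (1/K) * emeasure (k a) (space B) \<le> ennreal (1/K) * ennreal K"
      using bound_k[OF a] by (intro mult_left_mono) auto
    also have "\<dots> = 1" using K by (simp add: ennreal_mult'[symmetric])
    finally show "emeasure (scale_measure (ennreal (1/K)) (k a)) (space (scale_measure (ennreal (1/K)) (k a))) \<le> 1"
      by (simp add: sp[symmetric] space_scale_measure)
    show "space (scale_measure (ennreal (1/K)) (k a)) \<noteq> {}" using sp ne by (simp add: space_scale_measure)
  qed
qed (use sets_k meas_k in auto)

lemma nn_integral_scaled: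
  assumes f: "f \<in> borel_measurable B" and a: "a \<in> space A"
  shows "ennreal K * (\<integral>\<^sup>+y. f y \<partial>scale_measure (ennreal (1/K)) (k a)) = (\<integral>\<^sup>+y. f y \<partial>k a)"
proof -
  have "f \<in> borel_measurable (k a)"
    using f measurable_cong_sets[OF sets_k[OF a] refl] by blast
  then have "ennreal K * (\<integral>\<^sup>+y. f y \<partial>scale_measure (ennreal (1/K)) (k a))
    = (ennreal K * ennreal (1/K)) * (\<integral>\<^sup>+y. f y \<partial>k a)"
    by (simp only: nn_integral_scale_measure mult.assoc)
  also have "ennreal K * ennreal (1/K) = 1" using K by (simp add: ennreal_mult'[symmetric])
  finally show ?thesis by simp
qed

lemma nn_measurable:
  assumes f: "f \<in> borel_measurable (A \<Otimes>\<^sub>M B)"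
  shows "(\<lambda>a. \<integral>\<^sup>+y. f (a, y) \<partial>k a) \<in> borel_measurable A"
proof -
  have "(\<lambda>a. \<integral>\<^sup>+y. f (a, y) \<partial>scale_measure (ennreal (1/K)) (k a)) \<in> borel_measurable A"
    using f by (intro nn_integral_measurable_subprob_algebra2[OF _ scaled]) auto
  then have "(\<lambda>a. ennreal K * (\<integral>\<^sup>+y. f (a, y) \<partial>scale_measure (ennreal (1/K)) (k a))) \<in> borel_measurable A"
    by measurable
  then show ?thesis
    by (rule measurable_cong[THEN iffD1, rotated])
      (rule nn_integral_scaled[OF measurable_compose[OF measurable_Pair1' f]])
qed

text \<open>The integral is 0 by convention where \<open>f (a, _)\<close> is not integrable; the
  formula in \<open>eq\<close> makes this case visible, and the set where it occurs is
  measurable.\<close>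

lemma integral_measurable:
  fixes f :: "'a \<times> 'b \<Rightarrow> real"
  assumes f: "f \<in> borel_measurable (A \<Otimes>\<^sub>M B)"
  shows "(\<lambda>a. \<integral>y. f (a, y) \<partial>k a) \<in> borel_measurable A"
proof -
  have eq: "(\<integral>y. f (a, y) \<partial>k a) = (if (\<integral>\<^sup>+y. ennreal \<bar>f (a, y)\<bar> \<partial>k a) < \<infinity> then
      enn2real (\<integral>\<^sup>+y. ennreal (f (a, y)) \<partial>k a) - enn2real (\<integral>\<^sup>+y. ennreal (- f (a, y)) \<partial>k a) else 0)"
    if a: "a \<in> space A" for a
  proof -
    have "(\<lambda>y. f (a, y)) \<in> borel_measurable (k a)"
      using measurable_compose[OF measurable_Pair1'[OF a] f] measurable_cong_sets[OF sets_k[OF a] refl]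
      by blast
    then show ?thesis
      by (auto simp: real_lebesgue_integral_def integrable_iff_bounded not_integrable_integral_eq)
  qed
  have [measurable]: "(\<lambda>a. \<integral>\<^sup>+y. ennreal (f (a, y)) \<partial>k a) \<in> borel_measurable A"
    "(\<lambda>a. \<integral>\<^sup>+y. ennreal (- f (a, y)) \<partial>k a) \<in> borel_measurable A"
    "(\<lambda>a. \<integral>\<^sup>+y. ennreal \<bar>f (a, y)\<bar> \<partial>k a) \<in> borel_measurable A"
    by (rule nn_measurable[of "\<lambda>p. ennreal (f p)"] nn_measurable[of "\<lambda>p. ennreal (- f p)"]
        nn_measurable[of "\<lambda>p. ennreal \<bar>f p\<bar>"], use f in measurable)+
  show ?thesis by (subst measurable_cong[OF eq]) measurable
qed

text \<open>The measure \<open>A(da) k(a, dy)\<close>. It is the monadic bind of the scaled kernels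
  pushed to the product, scaled back by \<open>K\<close>; bind degenerates over an empty base space,
  hence the separate case.\<close>

lemma ex_semidirect:
  "\<exists>\<mu>. sets \<mu> = sets (A \<Otimes>\<^sub>M B) \<and>
    (\<forall>f\<in>borel_measurable (A \<Otimes>\<^sub>M B). (\<integral>\<^sup>+p. f p \<partial>\<mu>) = (\<integral>\<^sup>+a. \<integral>\<^sup>+y. f (a, y) \<partial>k a \<partial>A))"
proof (cases "space A = {}")
  case True
  then show ?thesis
    by (intro exI[of _ "A \<Otimes>\<^sub>M B"]) (auto simp: nn_integral_empty space_pair_measure)
next
  case False
  define N where "N a = distr (scale_measure (ennreal (1/K)) (k a)) (A \<Otimes>\<^sub>M B) (Pair a)" for a
  have N: "N \<in> measurable A (subprob_algebra (A \<Otimes>\<^sub>M B))"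
    unfolding N_def by (rule measurable_distr2[OF _ scaled]) simp
  show ?thesis
  proof (intro exI conjI ballI)
    have sb: "sets (A \<bind> N) = sets (A \<Otimes>\<^sub>M B)"
      by (rule sets_bind) (use False in \<open>auto simp: N_def\<close>)
    then show "sets (scale_measure (ennreal K) (A \<bind> N)) = sets (A \<Otimes>\<^sub>M B)" by simp
    fix f :: "'a \<times> 'b \<Rightarrow> ennreal" assume f: "f \<in> borel_measurable (A \<Otimes>\<^sub>M B)"
    have "(\<integral>\<^sup>+p. f p \<partial>scale_measure (ennreal K) (A \<bind> N)) = ennreal K * (\<integral>\<^sup>+p. f p \<partial>(A \<bind> N))"
      using f measurable_cong_sets[OF sb refl] by (intro nn_integral_scale_measure) blast
    also have "\<dots> = ennreal K * (\<integral>\<^sup>+a. \<integral>\<^sup>+p. f p \<partial>N a \<partial>A)"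
      by (simp add: nn_integral_bind[OF f N])
    also have "\<dots> = (\<integral>\<^sup>+a. ennreal K * (\<integral>\<^sup>+p. f p \<partial>N a) \<partial>A)"
      by (rule nn_integral_cmult[symmetric])
        (rule measurable_compose[OF N nn_integral_measurable_subprob_algebra[OF f]])
    also have "\<dots> = (\<integral>\<^sup>+a. \<integral>\<^sup>+y. f (a, y) \<partial>k a \<partial>A)"
    proof (rule nn_integral_cong)
      fix a assume a: "a \<in> space A"
      have "(\<integral>\<^sup>+p. f p \<partial>N a) = (\<integral>\<^sup>+y. f (a, y) \<partial>scale_measure (ennreal (1/K)) (k a))"
        unfolding N_def
      proof (rule nn_integral_distr)
        show "f \<in> borel_measurable (distr (scale_measure (ennreal (1/K)) (k a)) (A \<Otimes>\<^sub>M B) (Pair a))"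
          using f by simp
        show "Pair a \<in> scale_measure (ennreal (1/K)) (k a) \<rightarrow>\<^sub>M A \<Otimes>\<^sub>M B"
        proof -
          have "sets (scale_measure (ennreal (1/K)) (k a)) = sets B" using sets_k[OF a] by simp
          from measurable_cong_sets[OF this refl] show ?thesis using measurable_Pair1'[OF a, of B] by blast
        qed
      qed
      then show "ennreal K * (\<integral>\<^sup>+p. f p \<partial>N a) = (\<integral>\<^sup>+y. f (a, y) \<partial>k a)"
        using nn_integral_scaled[OF measurable_compose[OF measurable_Pair1'[OF a] f] a] by (simp only:)
    qed
    finally show "(\<integral>\<^sup>+p. f p \<partial>scale_measure (ennreal K) (A \<bind> N)) = (\<integral>\<^sup>+a. \<integral>\<^sup>+y. f (a, y) \<partial>k a \<partial>A)" .
  qed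
qed

end

section \<open>Paths, filtration and predictable fields\<close>

locale jump_markov_started =
  jump_markov_process_with_rate \<Gamma> \<Omega> X P T v
  for \<Gamma> :: "'g measure" and \<Omega> :: "'w set" and X :: "real \<Rightarrow> 'w \<Rightarrow> 'g"
    and P :: "real \<Rightarrow> 'g \<Rightarrow> 'w measure" and T :: real and v :: "real \<Rightarrow> 'g \<Rightarrow> 'g measure" +
  fixes t :: real and x :: 'g
  assumes t_nonneg: "0 \<le> t" and t_less: "t < T" and x_space: "x \<in> space \<Gamma>"
begin

definition M :: "'w measure" where "M = completion (P t x)"
definition F :: "real \<Rightarrow> 'w measure" where "F = completed_filtration \<Gamma> X (P t x) t"
definition time :: "real measure" where "time = restrict_space lborel {t..T}"
abbreviation PA :: "('w \<times> real) measure" where "PA \<equiv> predictable_algebra F t T"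
abbreviation PM :: "('w \<times> real) measure" where "PM \<equiv> M \<Otimes>\<^sub>M time"
definition J :: "'w \<Rightarrow> real set" where "J \<omega> = jump_times X \<omega> \<inter> {t<..T}"
text \<open>At time \<open>t\<close> the left limit would look at the path before \<open>t\<close>,
  which the filtration does not see. The starting state is put there instead; it is the almost sure
  value of \<open>X t\<close>. This makes \<open>Xm\<close>, and hence \<open>kernel\<close>,
  predictable on the whole interval.\<close>

definition Xm :: "real \<Rightarrow> 'w \<Rightarrow> 'g" where "Xm s \<omega> = (if t < s then left_limit X s \<omega> else x)"
definition kernel :: "'w \<times> real \<Rightarrow> 'g measure" where "kernel p = v (snd p) (Xm (snd p) (fst p))"
abbreviation adapted :: "(real \<Rightarrow> 'w \<Rightarrow> real) \<Rightarrow> bool" where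
  "adapted Y \<equiv> \<forall>s\<in>{t..T}. Y s \<in> borel_measurable (F s)"

lemma space_P: "space (P t x) = \<Omega>"
  using subalgebra_P[OF t_nonneg x_space]
  by (simp add: subalgebra_def process_algebra_def space_measure_of_conv)

lemma space_M [simp]: "space M = \<Omega>"
  by (simp add: M_def space_P)

sublocale prob_space M
  unfolding M_def using prob_space_P[OF t_nonneg x_space] by (rule prob_space.prob_space_completion)

lemma space_F [simp]: "space (F s) = \<Omega>"
  by (simp add: F_def completed_filtration_def space_measure_of_conv space_P)

lemma sets_process_algebra:
  "sets (process_algebra \<Gamma> \<Omega> X I) = sigma_sets \<Omega> {X r -` A \<inter> \<Omega> | r A. r \<in> I \<and> A \<in> sets \<Gamma>}"
  unfolding process_algebra_def by (rule sets_measure_of) blast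

lemma process_algebra_mono:
  "I \<subseteq> I' \<Longrightarrow> sets (process_algebra \<Gamma> \<Omega> X I) \<subseteq> sets (process_algebra \<Gamma> \<Omega> X I')"
  unfolding sets_process_algebra by (rule sigma_sets_mono') blast

lemma process_algebra_into_P: "I \<subseteq> {t..} \<Longrightarrow> sets (process_algebra \<Gamma> \<Omega> X I) \<subseteq> sets (P t x)"
  using process_algebra_mono[of I "{t..}"] subalgebra_P[OF t_nonneg x_space]
  unfolding subalgebra_def by blast

lemma sets_F: "sets (F s) = sigma_sets \<Omega> (sets (process_algebra \<Gamma> \<Omega> X {t..s}) \<union> null_sets M)"
proof -
  have "sets (process_algebra \<Gamma> \<Omega> X {t..s}) \<subseteq> Pow \<Omega>"
    using process_algebra_into_P[of "{t..s}"] sets.sets_into_space[of _ "P t x"] space_P by fastforce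
  moreover have "null_sets M \<subseteq> Pow \<Omega>"
    using sets.sets_into_space[of _ M] by (auto simp: null_sets_def)
  ultimately show ?thesis
    unfolding F_def completed_filtration_def space_P M_def by (subst sets_measure_of) auto
qed

lemma sets_F_subset_M: "sets (F s) \<subseteq> sets M"
  unfolding sets_F
proof (rule sets.sigma_sets_subset[where M=M, simplified])
  show "sets (process_algebra \<Gamma> \<Omega> X {t..s}) \<union> null_sets M \<subseteq> sets M"
    using process_algebra_into_P[of "{t..s}"] by (auto simp: M_def)
qed

lemma sets_F_mono: "r \<le> s \<Longrightarrow> sets (F r) \<subseteq> sets (F s)"
  unfolding sets_F
proof (rule sigma_sets_mono')
  assume "r \<le> s"
  then show "sets (process_algebra \<Gamma> \<Omega> X {t..r}) \<union> null_sets M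
      \<subseteq> sets (process_algebra \<Gamma> \<Omega> X {t..s}) \<union> null_sets M"
    using process_algebra_mono[of "{t..r}" "{t..s}"] by fastforce
qed

lemma measurable_F_mono: "f \<in> F r \<rightarrow>\<^sub>M N \<Longrightarrow> r \<le> s \<Longrightarrow> f \<in> F s \<rightarrow>\<^sub>M N"
  using sets_F_mono[of r s] by (auto simp: measurable_def)

lemma measurable_F_M: "f \<in> F r \<rightarrow>\<^sub>M N \<Longrightarrow> f \<in> M \<rightarrow>\<^sub>M N"
  using sets_F_subset_M[of r] by (auto simp: measurable_def)

lemma null_sets_in_F: "N \<in> null_sets M \<Longrightarrow> N \<in> sets (F s)"
  unfolding sets_F by auto

lemma subset_null_sets: "A \<subseteq> N \<Longrightarrow> N \<in> null_sets M \<Longrightarrow> A \<in> null_sets M"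
  unfolding M_def by (rule completion.complete2)

lemma AE_null_set: "(AE \<omega> in M. Q \<omega>) \<Longrightarrow> {\<omega>\<in>\<Omega>. \<not> Q \<omega>} \<in> null_sets M"
proof -
  assume "AE \<omega> in M. Q \<omega>"
  then obtain N where N: "{\<omega>\<in>space M. \<not> Q \<omega>} \<subseteq> N" "emeasure M N = 0" "N \<in> sets M"
    by (rule AE_E)
  then show ?thesis using subset_null_sets[of _ N] by (simp add: null_sets_def)
qed

text \<open>Every \<open>F s\<close> contains all subsets of null events, so modifications on
  exceptional paths preserve adaptedness.\<close>

lemma measurable_F_AE:
  fixes f g :: "'w \<Rightarrow> real"
  assumes f: "f \<in> borel_measurable (F s)" and ae: "AE \<omega> in M. f \<omega> = g \<omega>"
  shows "g \<in> borel_measurable (F s)"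
proof (rule measurableI)
  fix A :: "real set" assume A: "A \<in> sets borel"
  let ?N = "{\<omega>\<in>\<Omega>. f \<omega> \<noteq> g \<omega>}"
  have N: "?N \<in> null_sets M" by (rule AE_null_set[OF ae])
  have "f -` A \<inter> \<Omega> \<in> sets (F s)" using measurable_sets[OF f A] by simp
  moreover have "?N \<in> sets (F s)" "(g -` A \<inter> \<Omega>) \<inter> ?N \<in> sets (F s)"
    using N by (auto intro!: null_sets_in_F intro: subset_null_sets)
  moreover have "g -` A \<inter> \<Omega> = ((f -` A \<inter> \<Omega>) - ?N) \<union> ((g -` A \<inter> \<Omega>) \<inter> ?N)" by auto
  ultimately show "g -` A \<inter> space (F s) \<in> sets (F s)"
    using sets.Un[OF sets.Diff, of "f -` A \<inter> \<Omega>" "F s" ?N "(g -` A \<inter> \<Omega>) \<inter> ?N"] by (simp only: space_F)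
qed simp

lemma X_measurable_F: "r \<in> {t..s} \<Longrightarrow> X r \<in> F s \<rightarrow>\<^sub>M \<Gamma>"
proof (rule measurableI)
  assume r: "r \<in> {t..s}"
  then show "X r \<omega> \<in> space \<Gamma>" if "\<omega> \<in> space (F s)" for \<omega>
    using that t_nonneg by (auto intro!: X_in_space)
  fix A assume A: "A \<in> sets \<Gamma>"
  have "X r -` A \<inter> \<Omega> \<in> sets (process_algebra \<Gamma> \<Omega> X {t..s})"
    unfolding sets_process_algebra using r A by (intro sigma_sets.Basic) blast
  then show "X r -` A \<inter> space (F s) \<in> sets (F s)" unfolding sets_F by auto
qed

lemma X_start: "AE \<omega> in M. X t \<omega> = x"
proof -
  interpret P: prob_space "P t x" using prob_space_P[OF t_nonneg x_space] .
  have one: "measure (P t x) {\<omega> \<in> \<Omega>. X t \<omega> = x} = 1" using normal[OF t_nonneg x_space] .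
  \<comment> \<open>A set outside the sigma-algebra would get measure 0 by convention.\<close>
  then have "{\<omega> \<in> \<Omega>. X t \<omega> = x} \<in> sets (P t x)"
    by (rule_tac ccontr) (simp add: measure_notin_sets)
  with one have "AE \<omega> in P t x. \<omega> \<in> {\<omega> \<in> \<Omega>. X t \<omega> = x}"
    by (simp add: P.prob_eq_1)
  then show ?thesis unfolding M_def by (intro AE_completion) auto
qed

lemma finite_J: "\<omega> \<in> \<Omega> \<Longrightarrow> finite (J \<omega>)"
  using finite_jumps[of \<omega> T] t_nonneg by (auto simp: J_def intro: finite_subset[rotated])

lemma J_subset: "J \<omega> \<subseteq> {t<..T}" by (auto simp: J_def)

text \<open>Just after each time the path is constant by \<open>right_constant\<close>, just before
  it by the absence of a jump; connectedness of the interval joins the two.\<close>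

lemma path_constant:
  assumes "0 \<le> s1" "s1 \<le> s2" "\<omega> \<in> \<Omega>" "jump_times X \<omega> \<inter> {s1<..s2} = {}"
  shows "X s1 \<omega> = X s2 \<omega>"
proof (rule locally_constant_imp_eq[OF assms(2)])
  fix r assume r: "r \<in> {s1..s2}"
  obtain d1 where d1: "d1 > 0" "\<forall>s\<in>{r..r + d1}. X s \<omega> = X r \<omega>"
    using right_constant[OF assms(3), of r] r assms(1) by auto
  show "\<exists>\<delta>>0. \<forall>s\<in>{s1..s2}. \<bar>s - r\<bar> < \<delta> \<longrightarrow> X s \<omega> = X r \<omega>"
  proof (cases "r = s1")
    case True
    have "X s \<omega> = X r \<omega>" if "s \<in> {s1..s2}" "\<bar>s - r\<bar> < d1" for s
    proof -
      have "s \<in> {r..r + d1}" using that True by simp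
      then show ?thesis using d1(2) by blast
    qed
    then show ?thesis using d1(1) by blast
  next
    case False
    then have "r \<notin> jump_times X \<omega>" "0 < r" using r assms by auto
    then have "\<forall>\<^sub>F q in at_left r. X q \<omega> = X r \<omega>" by (simp add: jump_times_def)
    then obtain b where b: "b < r" "\<forall>y>b. y < r \<longrightarrow> X y \<omega> = X r \<omega>"
      using \<open>0 < r\<close> by (auto simp: eventually_at_left[OF \<open>0 < r\<close>])
    show ?thesis
    proof (intro exI[of _ "min d1 (r - b)"] conjI ballI impI)
      fix s assume "s \<in> {s1..s2}" "\<bar>s - r\<bar> < min d1 (r - b)"
      then have *: "s - r < d1" "b < s" by (auto simp: abs_less_iff)
      show "X s \<omega> = X r \<omega>"
      proof (cases "s < r")
        case True
        then show ?thesis using * b(2) by blast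
      next
        case False
        then have "s \<in> {r..r + d1}" using * by simp
        then show ?thesis using d1(2) by blast
      qed
    next
      show "0 < min d1 (r - b)" using d1(1) b(1) by simp
    qed
  qed
qed

lemma left_limit_props:
  assumes "0 \<le> s1" "s1 < s" "\<omega> \<in> \<Omega>" "jump_times X \<omega> \<inter> {s1<..<s} = {}"
  shows "r \<in> {s1..<s} \<Longrightarrow> X r \<omega> = left_limit X s \<omega>"
    and "\<forall>\<^sub>F r in at_left s. X r \<omega> = left_limit X s \<omega>"
proof -
  have c: "X r \<omega> = X s1 \<omega>" if "r \<in> {s1..<s}" for r
  proof -
    have "jump_times X \<omega> \<inter> {s1<..r} \<subseteq> jump_times X \<omega> \<inter> {s1<..<s}" using that by auto
    then show ?thesis using path_constant[of s1 r \<omega>] that assms by simp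
  qed
  have "\<forall>\<^sub>F r in at_left s. r \<in> {s1<..<s}"
    unfolding eventually_at_left[OF assms(2)] using assms(2) by (intro exI[of _ s1]) simp
  then have ev: "\<forall>\<^sub>F r in at_left s. X r \<omega> = X s1 \<omega>"
    by eventually_elim (rule c, simp)
  have "left_limit X s \<omega> = X s1 \<omega>"
    unfolding left_limit_def
  proof (rule the_equality)
    show "\<forall>\<^sub>F r in at_left s. X r \<omega> = X s1 \<omega>" by (rule ev)
    fix y assume "\<forall>\<^sub>F r in at_left s. X r \<omega> = y"
    with ev have "\<forall>\<^sub>F r in at_left s. y = X s1 \<omega>" by eventually_elim simp
    then show "y = X s1 \<omega>" by simp
  qed
  then show "r \<in> {s1..<s} \<Longrightarrow> X r \<omega> = left_limit X s \<omega>"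
    and "\<forall>\<^sub>F r in at_left s. X r \<omega> = left_limit X s \<omega>" using c[of r] ev by simp_all
qed

lemma ex_jump_free_left:
  assumes "t < s" "\<omega> \<in> \<Omega>"
  obtains s1 where "t \<le> s1" "s1 < s" "jump_times X \<omega> \<inter> {s1<..<s} = {}"
proof -
  let ?A = "insert t (jump_times X \<omega> \<inter> {t..<s})"
  have fin: "finite ?A"
    using finite_jumps[OF assms(2), of s] t_nonneg by (auto intro: finite_subset[rotated])
  have "Max ?A \<in> ?A" using fin by (intro Max_in) auto
  then have "t \<le> Max ?A" "Max ?A < s" using assms(1) by auto
  moreover have "jump_times X \<omega> \<inter> {Max ?A<..<s} = {}"
  proof (rule ccontr)
    assume "\<not> ?thesis"
    then obtain r where r: "r \<in> jump_times X \<omega>" "Max ?A < r" "r < s" by auto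
    then have "r \<in> ?A" using \<open>t \<le> Max ?A\<close> by auto
    then show False using Max_ge[OF fin] r(2) by force
  qed
  ultimately show ?thesis using that by blast
qed

lemma eventually_Xm:
  assumes "t < s" "\<omega> \<in> \<Omega>" shows "\<forall>\<^sub>F r in at_left s. X r \<omega> = Xm s \<omega>"
proof -
  obtain s1 where "t \<le> s1" "s1 < s" "jump_times X \<omega> \<inter> {s1<..<s} = {}"
    using ex_jump_free_left[OF assms] by blast
  then show ?thesis using left_limit_props(2)[of s1 s \<omega>] assms t_nonneg by (simp add: Xm_def)
qed

lemma Xm_in_space: "\<omega> \<in> \<Omega> \<Longrightarrow> Xm s \<omega> \<in> space \<Gamma>"
proof (cases "t < s")
  case True
  assume o: "\<omega> \<in> \<Omega>"
  obtain s1 where s1: "t \<le> s1" "s1 < s" "jump_times X \<omega> \<inter> {s1<..<s} = {}"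
    using ex_jump_free_left[OF True o] by blast
  then have "X s1 \<omega> = Xm s \<omega>"
    using left_limit_props(1)[of s1 s \<omega> s1] o t_nonneg True by (simp add: Xm_def)
  then show ?thesis using X_in_space[of s1 \<omega>] o s1 t_nonneg by auto
qed (simp add: Xm_def x_space)

lemma Xm_eq_X:
  assumes "\<omega> \<in> \<Omega>" "s \<in> {t<..T}" "s \<notin> J \<omega>" shows "Xm s \<omega> = X s \<omega>"
proof -
  have "\<forall>\<^sub>F r in at_left s. X r \<omega> = X s \<omega>"
    using assms t_nonneg by (auto simp: J_def jump_times_def)
  moreover have "\<forall>\<^sub>F r in at_left s. X r \<omega> = Xm s \<omega>"
    using eventually_Xm[of s \<omega>] assms by simp
  ultimately have "\<forall>\<^sub>F r in at_left s. Xm s \<omega> = X s \<omega>"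
    by eventually_elim simp
  then show ?thesis using trivial_limit_at_left_real[of s] by (simp add: eventually_const)
qed

lemma space_PA: "space PA = \<Omega> \<times> {t..T}"
  by (simp add: predictable_algebra_def space_measure_of_conv)

lemma PA_sets:
  "A \<in> sets (F t) \<Longrightarrow> A \<times> {t} \<in> sets PA"
  "t \<le> a \<Longrightarrow> a \<le> b \<Longrightarrow> b \<le> T \<Longrightarrow> A \<in> sets (F a) \<Longrightarrow> A \<times> {a<..b} \<in> sets PA"
proof -
  have sub: "{A \<times> {t} | A. A \<in> sets (F t)} \<union>
        {A \<times> {a<..b} | A a b. t \<le> a \<and> a \<le> b \<and> b \<le> T \<and> A \<in> sets (F a)} \<subseteq> Pow (space (F t) \<times> {t..T})"
    using t_less sets.sets_into_space[of _ "F _"] by fastforce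
  show "A \<in> sets (F t) \<Longrightarrow> A \<times> {t} \<in> sets PA"
    unfolding predictable_algebra_def using sub by (subst sets_measure_of) auto
  show "t \<le> a \<Longrightarrow> a \<le> b \<Longrightarrow> b \<le> T \<Longrightarrow> A \<in> sets (F a) \<Longrightarrow> A \<times> {a<..b} \<in> sets PA"
    unfolding predictable_algebra_def using sub by (subst sets_measure_of) auto
qed

lemma after_in_PA: "a \<in> {t..T} \<Longrightarrow> A \<in> sets (F a) \<Longrightarrow> {p\<in>space PA. a < snd p \<and> fst p \<in> A} \<in> sets PA"
proof -
  assume a: "a \<in> {t..T}" "A \<in> sets (F a)"
  have "{p\<in>space PA. a < snd p \<and> fst p \<in> A} = A \<times> {a<..T}"
    using a sets.sets_into_space[OF a(2)] by (auto simp: space_PA)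
  then show ?thesis using PA_sets(2)[of a T A] a by simp
qed

text \<open>What is known at time \<open>a\<close> may be used by a predictable integrand strictly
  after \<open>a\<close>; up to then a constant has to stand in.\<close>

lemma PA_measurable_after:
  assumes a: "a \<in> {t..T}" and f: "f \<in> F a \<rightarrow>\<^sub>M N" and c: "c \<in> space N"
  shows "(\<lambda>p. if a < snd p then f (fst p) else c) \<in> PA \<rightarrow>\<^sub>M N"
proof (rule measurableI)
  show "(if a < snd p then f (fst p) else c) \<in> space N" if "p \<in> space PA" for p
    using that measurable_space[OF f] c by (auto simp: space_PA)
  fix A assume A: "A \<in> sets N"
  have 1: "{p\<in>space PA. a < snd p \<and> fst p \<in> f -` A \<inter> \<Omega>} \<in> sets PA"
    using measurable_sets[OF f A] by (intro after_in_PA[OF a]) simp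
  have "\<Omega> \<in> sets (F a)" using sets.top[of "F a"] by simp
  then have 2: "space PA - {p\<in>space PA. a < snd p \<and> fst p \<in> \<Omega>} \<in> sets PA"
    using after_in_PA[OF a] by (intro sets.compl_sets) simp
  have "(\<lambda>p. if a < snd p then f (fst p) else c) -` A \<inter> space PA
    = {p\<in>space PA. a < snd p \<and> fst p \<in> f -` A \<inter> \<Omega>} \<union>
      (if c \<in> A then space PA - {p\<in>space PA. a < snd p \<and> fst p \<in> \<Omega>} else {})"
    by (auto simp: space_PA split: if_splits)
  then show "(\<lambda>p. if a < snd p then f (fst p) else c) -` A \<inter> space PA \<in> sets PA"
    using 1 2 by (simp split: if_split)
qed

lemma PA_snd: "snd \<in> borel_measurable PA"
proof (rule borel_measurableI_le)
  fix y :: real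
  consider "y < t" | "T \<le> y" | "y \<in> {t..T}" by force
  then show "{p \<in> space PA. snd p \<le> y} \<in> sets PA"
  proof cases
    case 1
    then have "{p \<in> space PA. snd p \<le> y} = {}" by (auto simp: space_PA)
    then show ?thesis by (simp only: sets.empty_sets)
  next
    case 2
    then have "{p \<in> space PA. snd p \<le> y} = space PA" by (auto simp: space_PA)
    then show ?thesis by (simp only: sets.top)
  next
    case 3
    have "\<Omega> \<in> sets (F y)" using sets.top[of "F y"] by simp
    then have "space PA - {p\<in>space PA. y < snd p \<and> fst p \<in> \<Omega>} \<in> sets PA"
      using after_in_PA[OF 3] by (intro sets.compl_sets) simp
    moreover have "{p \<in> space PA. snd p \<le> y} = space PA - {p\<in>space PA. y < snd p \<and> fst p \<in> \<Omega>}"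
      by (auto simp: space_PA)
    ultimately show ?thesis by simp
  qed
qed

text \<open>The value of \<open>Y\<close> at the last grid point strictly before \<open>r\<close>.
  Such a step process is predictable for every adapted \<open>Y\<close>, whatever its paths look
  like.\<close>

definition grid_left :: "(real \<Rightarrow> 'w \<Rightarrow> real) \<Rightarrow> nat \<Rightarrow> real \<Rightarrow> 'w \<Rightarrow> real" where
  "grid_left Y n r \<omega> = (if t < r then Y (grid_point t T n (grid_index t n r)) \<omega> else 0)"

lemma grid_left_PA:
  assumes Y: "adapted Y" and n: "0 < n"
  shows "(\<lambda>p. grid_left Y n (snd p) (fst p)) \<in> borel_measurable PA"
proof -
  define u where "u k p = (if grid_point t T n k < snd p then Y (grid_point t T n k) (fst p) else 0)"
    for k :: nat and p :: "'w \<times> real"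
  have g: "grid_point t T n k \<in> {t..T}" for k using grid_point_range t_less by simp
  have "u k \<in> borel_measurable PA" for k
    unfolding u_def using Y g by (intro PA_measurable_after) auto
  moreover have "(\<lambda>p. grid_index t n (snd p)) \<in> measurable PA (count_space UNIV)"
  proof (rule measurable_compose[OF PA_snd])
    show "grid_index t n \<in> measurable borel (count_space UNIV)"
      unfolding grid_index_def by measurable
  qed
  ultimately have "(\<lambda>p. u (grid_index t n (snd p)) p) \<in> borel_measurable PA"
    by (rule measurable_compose_countable)
  also have "(\<lambda>p. u (grid_index t n (snd p)) p) \<in> borel_measurable PA \<longleftrightarrow> ?thesis"
  proof (rule measurable_cong)
    fix p assume "p \<in> space PA"
    then have p: "t \<le> snd p" "snd p \<le> T" by (auto simp: space_PA)
    have "grid_point t T n (grid_index t n (snd p)) < snd p" if "t < snd p"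
      using grid_point_index(1)[OF n, of "snd p" t T] that p by simp
    moreover have "\<not> grid_point t T n (grid_index t n (snd p)) < snd p" if "\<not> t < snd p"
      using g[of "grid_index t n (snd p)"] that p by simp
    ultimately show "u (grid_index t n (snd p)) p = grid_left Y n (snd p) (fst p)"
      unfolding u_def grid_left_def by auto
  qed
  finally show ?thesis .
qed

text \<open>The left limit of \<open>Y\<close> wherever that exists. Defining it by grid values
  makes it predictable without any regularity of the paths.\<close>

definition Ym :: "(real \<Rightarrow> 'w \<Rightarrow> real) \<Rightarrow> real \<Rightarrow> 'w \<Rightarrow> real" where
  "Ym Y r \<omega> = lim (\<lambda>n. grid_left Y (Suc n) r \<omega>)"

lemma Ym_PA: "adapted Y \<Longrightarrow> (\<lambda>p. Ym Y (snd p) (fst p)) \<in> borel_measurable PA"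
  unfolding Ym_def by (rule borel_measurable_lim_metric) (rule grid_left_PA, simp_all)

lemma grid_left_tendsto:
  assumes "r \<in> {t<..T}" "((\<lambda>s. Y s \<omega>) \<longlongrightarrow> y) (at_left r)"
  shows "(\<lambda>n. Y (grid_point t T n (grid_index t n r)) \<omega>) \<longlonglongrightarrow> y"
  using filterlim_compose[OF assms(2) grid_point_tendsto_left[OF assms(1)]] .

lemma Ym_eq:
  assumes "r \<in> {t<..T}" "((\<lambda>s. Y s \<omega>) \<longlongrightarrow> y) (at_left r)"
  shows "Ym Y r \<omega> = y"
  unfolding Ym_def
proof (rule limI)
  show "(\<lambda>n. grid_left Y (Suc n) r \<omega>) \<longlonglongrightarrow> y"
    using LIMSEQ_Suc[OF grid_left_tendsto[of r Y \<omega> y]] assms by (simp add: grid_left_def)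
qed

text \<open>States have no limits, but indicators of measurable sets along the path do: just before
  \<open>r\<close> the path is constant, so the left limit of
  \<open>indicator A (X s \<omega>)\<close> is the indicator at \<open>Xm\<close>. At
  \<open>t\<close> itself only the fixed state \<open>x\<close> matters.\<close>

lemma Xm_PA: "(\<lambda>p. Xm (snd p) (fst p)) \<in> PA \<rightarrow>\<^sub>M \<Gamma>"
proof (rule measurableI)
  show "Xm (snd p) (fst p) \<in> space \<Gamma>" if "p \<in> space PA" for p
    using that by (intro Xm_in_space) (auto simp: space_PA)
  fix A assume A: "A \<in> sets \<Gamma>"
  define Y where "Y s \<omega> = (indicator A (X s \<omega>) :: real)" for s \<omega>
  have "adapted Y"
    unfolding Y_def using X_measurable_F A by (auto intro!: borel_measurable_indicator measurable_compose[of "X _" _ \<Gamma>])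
  then have m: "(\<lambda>p. Ym Y (snd p) (fst p)) \<in> borel_measurable PA" by (rule Ym_PA)
  have Y_eq: "Ym Y r \<omega> = indicator A (Xm r \<omega>)" if r: "r \<in> {t<..T}" "\<omega> \<in> \<Omega>" for r \<omega>
  proof (rule Ym_eq[OF r(1)], rule tendsto_eventually)
    show "\<forall>\<^sub>F s in at_left r. Y s \<omega> = indicator A (Xm r \<omega>)"
      using eventually_Xm[of r \<omega>] r by (auto simp: Y_def elim: eventually_mono)
  qed
  have "{p\<in>space PA. t < snd p \<and> Ym Y (snd p) (fst p) = 1} \<in> sets PA"
    using m PA_snd by measurable
  moreover have "{p\<in>space PA. snd p \<le> t \<and> x \<in> A} \<in> sets PA"
    using PA_snd by measurable
  moreover have "(\<lambda>p. Xm (snd p) (fst p)) -` A \<inter> space PA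
    = {p\<in>space PA. t < snd p \<and> Ym Y (snd p) (fst p) = 1} \<union> {p\<in>space PA. snd p \<le> t \<and> x \<in> A}"
  proof (rule set_eqI)
    fix p :: "'w \<times> real"
    show "p \<in> (\<lambda>p. Xm (snd p) (fst p)) -` A \<inter> space PA \<longleftrightarrow>
      p \<in> {p\<in>space PA. t < snd p \<and> Ym Y (snd p) (fst p) = 1} \<union> {p\<in>space PA. snd p \<le> t \<and> x \<in> A}"
    proof (cases "t < snd p")
      case True
      then show ?thesis using Y_eq[of "snd p" "fst p"] by (auto simp: space_PA indicator_def split: if_splits)
    qed (auto simp: Xm_def)
  qed
  ultimately show "(\<lambda>p. Xm (snd p) (fst p)) -` A \<inter> space PA \<in> sets PA" by simp
qed

text \<open>Predictable sets cut at time \<open>s\<close> lie in the product of \<open>F s\<close>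
  and the Borel sets, that is, predictability implies progressive measurability. With
  \<open>s = T\<close> this also places predictable objects on the product of \<open>M\<close> and
  time.\<close>

lemma id_PA:
  assumes "s \<in> {t..T}"
  shows "(\<lambda>p. p) \<in> F s \<Otimes>\<^sub>M restrict_space borel {t..s} \<rightarrow>\<^sub>M PA"
  unfolding predictable_algebra_def
proof (rule measurable_measure_of)
  show "{A \<times> {t} | A. A \<in> sets (F t)} \<union>
        {A \<times> {a<..b} | A a b. t \<le> a \<and> a \<le> b \<and> b \<le> T \<and> A \<in> sets (F a)} \<subseteq> Pow (space (F t) \<times> {t..T})"
    using t_less sets.sets_into_space[of _ "F _"] by fastforce
  show "(\<lambda>p. p) \<in> space (F s \<Otimes>\<^sub>M restrict_space borel {t..s}) \<rightarrow> space (F t) \<times> {t..T}"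
    using assms by (auto simp: space_pair_measure space_restrict_space)
  fix y assume "y \<in> {A \<times> {t} | A. A \<in> sets (F t)} \<union>
        {A \<times> {a<..b} | A a b. t \<le> a \<and> a \<le> b \<and> b \<le> T \<and> A \<in> sets (F a)}"
  then consider A where "y = A \<times> {t}" "A \<in> sets (F t)"
    | A a b where "y = A \<times> {a<..b}" "A \<in> sets (F a)" "t \<le> a" by auto
  then show "(\<lambda>p. p) -` y \<inter> space (F s \<Otimes>\<^sub>M restrict_space borel {t..s})
      \<in> sets (F s \<Otimes>\<^sub>M restrict_space borel {t..s})"
  proof cases
    case (1 A)
    have "(\<lambda>p. p) -` y \<inter> space (F s \<Otimes>\<^sub>M restrict_space borel {t..s}) = A \<times> ({t} \<inter> {t..s})"
      using 1 sets.sets_into_space[OF 1(2)] by (auto simp: space_pair_measure space_restrict_space)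
    moreover have "A \<in> sets (F s)" using 1 sets_F_mono[of t s] assms by auto
    moreover have "{t} \<inter> {t..s} \<in> sets (restrict_space borel {t..s})"
      unfolding sets_restrict_space by (rule image_eqI[of _ _ "{t}"]) auto
    ultimately show ?thesis by (simp only:) (rule pair_measureI)
  next
    case (2 A a b)
    have eq: "(\<lambda>p. p) -` y \<inter> space (F s \<Otimes>\<^sub>M restrict_space borel {t..s}) = A \<times> ({t..s} \<inter> {a<..b})"
      using 2 sets.sets_into_space[OF 2(2)] by (auto simp: space_pair_measure space_restrict_space)
    show ?thesis
    proof (cases "a \<le> s")
      case True
      then have "A \<in> sets (F s)" using 2 sets_F_mono[of a s] by auto
      moreover have "{t..s} \<inter> {a<..b} \<in> sets (restrict_space borel {t..s})"
        unfolding sets_restrict_space by (rule image_eqI[of _ _ "{a<..b}"]) auto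
      ultimately show ?thesis unfolding eq by (rule pair_measureI)
    next
      case False
      then have "{t..s} \<inter> {a<..b} = {}" by auto
      then show ?thesis unfolding eq by simp
    qed
  qed
qed

lemma sets_time: "sets time = sets (restrict_space borel {t..T})"
  unfolding time_def by (intro sets_restrict_space_cong) simp

lemma space_time [simp]: "space time = {t..T}"
  by (simp add: time_def space_restrict_space)

lemma measurable_FT_PM: "f \<in> F T \<Otimes>\<^sub>M restrict_space borel {t..T} \<rightarrow>\<^sub>M N \<Longrightarrow> f \<in> PM \<rightarrow>\<^sub>M N"
proof -
  assume f: "f \<in> F T \<Otimes>\<^sub>M restrict_space borel {t..T} \<rightarrow>\<^sub>M N"
  have "(\<lambda>p. p) \<in> PM \<rightarrow>\<^sub>M F T \<Otimes>\<^sub>M restrict_space borel {t..T}"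
  proof (rule measurable_pair)
    have "fst \<in> PM \<rightarrow>\<^sub>M M" by simp
    then show "fst \<circ> (\<lambda>p. p) \<in> PM \<rightarrow>\<^sub>M F T"
      using sets_F_subset_M[of T] by (auto simp: measurable_def comp_def)
    have "snd \<in> PM \<rightarrow>\<^sub>M time" by simp
    then show "snd \<circ> (\<lambda>p. p) \<in> PM \<rightarrow>\<^sub>M restrict_space borel {t..T}"
      using measurable_cong_sets[OF refl sets_time, of PM] by (simp add: comp_def)
  qed
  from measurable_compose[OF this f] show ?thesis by simp
qed

lemma id_PA_PM: "(\<lambda>p. p) \<in> PM \<rightarrow>\<^sub>M PA"
  by (rule measurable_FT_PM[OF id_PA]) (use t_less in simp)

end

section \<open>The compensator kernel, predictable fields and jump sums\<close>

context jump_markov_started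
begin

text \<open>The summand 1 keeps the bound positive even if the process never jumps, since
  \<open>K\<close> serves as a divisor.\<close>

definition K :: real where
  "K = enn2real (SUP s\<in>{0..T}. SUP y\<in>space \<Gamma>. emeasure (v s y) (space \<Gamma>)) + 1"

lemma K_pos: "0 < K" by (simp add: K_def add_nonneg_pos)

lemma v_bound: "s \<in> {0..T} \<Longrightarrow> y \<in> space \<Gamma> \<Longrightarrow> emeasure (v s y) (space \<Gamma>) \<le> ennreal K"
proof -
  assume s: "s \<in> {0..T}" "y \<in> space \<Gamma>"
  let ?S = "SUP s\<in>{0..T}. SUP y\<in>space \<Gamma>. emeasure (v s y) (space \<Gamma>)"
  have "emeasure (v s y) (space \<Gamma>) \<le> ?S"
    using s by (intro SUP_upper2[of s] SUP_upper) auto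
  also have "?S = ennreal (enn2real ?S)" using bounded_v by (intro ennreal_enn2real[symmetric]) (simp add: less_top)
  also have "\<dots> \<le> ennreal K" unfolding K_def by (intro ennreal_leI) simp
  finally show ?thesis .
qed

lemma kernel_on:
  assumes "(\<lambda>p. p) \<in> A \<rightarrow>\<^sub>M PA"
  shows "bounded_kernel A \<Gamma> kernel K"
proof
  have sp: "p \<in> space PA" if "p \<in> space A" for p using measurable_space[OF assms that] .
  have rng: "snd p \<in> {0..T}" "Xm (snd p) (fst p) \<in> space \<Gamma>" if "p \<in> space A" for p
    using sp[OF that] t_nonneg by (auto simp: space_PA Xm_in_space)
  show "space \<Gamma> \<noteq> {}" using x_space by auto
  show "0 < K" by (rule K_pos)
  show "sets (kernel p) = sets \<Gamma>" if "p \<in> space A" for p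
    unfolding kernel_def using rng[OF that] by (rule sets_v)
  show "emeasure (kernel p) (space \<Gamma>) \<le> ennreal K" if "p \<in> space A" for p
    unfolding kernel_def using rng[OF that] by (rule v_bound)
  fix C assume C: "C \<in> sets \<Gamma>"
  have "(\<lambda>p. (snd p, Xm (snd p) (fst p))) \<in> PA \<rightarrow>\<^sub>M restrict_space borel {0..T} \<Otimes>\<^sub>M \<Gamma>"
    by (intro measurable_Pair Xm_PA measurable_restrict_space2 PA_snd)
      (use t_nonneg in \<open>auto simp: space_PA\<close>)
  from measurable_compose[OF this measurable_v[OF C]]
  have "(\<lambda>p. emeasure (kernel p) C) \<in> borel_measurable PA"
    by (simp add: kernel_def)
  then show "(\<lambda>p. emeasure (kernel p) C) \<in> borel_measurable A"
    by (rule measurable_compose[OF assms, simplified comp_def])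
qed

sublocale PK: bounded_kernel PM \<Gamma> kernel K
  by (rule kernel_on[OF id_PA_PM])

abbreviation field :: "(real \<Rightarrow> 'w \<Rightarrow> 'g \<Rightarrow> 'c::topological_space) \<Rightarrow> bool" where
  "field Z \<equiv> predictable_field \<Gamma> F t T Z"

definition flat :: "(real \<Rightarrow> 'w \<Rightarrow> 'g \<Rightarrow> 'c) \<Rightarrow> (('w \<times> real) \<times> 'g) \<Rightarrow> 'c" where
  "flat Z = (\<lambda>u. Z (snd (fst u)) (fst (fst u)) (snd u))"

lemma flat_simp [simp]: "flat Z ((\<omega>, r), y) = Z r \<omega> y" "flat Z (p, y) = Z (snd p) (fst p) y"
  by (simp_all add: flat_def)

lemma field_iff: "field Z \<longleftrightarrow> flat Z \<in> borel_measurable (PA \<Otimes>\<^sub>M \<Gamma>)"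
  by (simp add: predictable_field_def flat_def case_prod_beta')

lemma field_on:
  assumes "field Z" "(\<lambda>p. p) \<in> A \<rightarrow>\<^sub>M PA"
  shows "flat Z \<in> borel_measurable (A \<Otimes>\<^sub>M \<Gamma>)"
proof -
  have "(\<lambda>u. (fst u, snd u)) \<in> A \<Otimes>\<^sub>M \<Gamma> \<rightarrow>\<^sub>M PA \<Otimes>\<^sub>M \<Gamma>"
    by (intro measurable_Pair measurable_compose[OF measurable_fst assms(2)] measurable_snd)
  from measurable_compose[OF this assms(1)[unfolded field_iff]] show ?thesis by simp
qed

lemma field_PM: "field Z \<Longrightarrow> flat Z \<in> borel_measurable (PM \<Otimes>\<^sub>M \<Gamma>)"
  by (rule field_on[OF _ id_PA_PM])

lemma section_PA: "\<omega> \<in> \<Omega> \<Longrightarrow> (\<lambda>r. (\<omega>, r)) \<in> restrict_space borel {t..T} \<rightarrow>\<^sub>M PA"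
  using measurable_compose[OF measurable_Pair1' id_PA[of T], of \<omega>] t_less by simp

lemma field_section:
  "field Z \<Longrightarrow> \<omega> \<in> \<Omega> \<Longrightarrow>
    (\<lambda>u. Z (fst u) \<omega> (snd u)) \<in> borel_measurable (restrict_space borel {t..T} \<Otimes>\<^sub>M \<Gamma>)"
proof -
  assume Z: "field Z" and o: "\<omega> \<in> \<Omega>"
  have "(\<lambda>u. ((\<omega>, fst u), snd u)) \<in> restrict_space borel {t..T} \<Otimes>\<^sub>M \<Gamma> \<rightarrow>\<^sub>M PA \<Otimes>\<^sub>M \<Gamma>"
    by (intro measurable_Pair measurable_compose[OF measurable_fst section_PA[OF o]] measurable_snd)
  from measurable_compose[OF this Z[unfolded field_iff]] show ?thesis by simp
qed

lemma field_y:
  assumes "field Z" "\<omega> \<in> \<Omega>" "r \<in> {t..T}" shows "Z r \<omega> \<in> borel_measurable \<Gamma>"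
  using measurable_compose[OF measurable_Pair1' field_section[OF assms(1,2)], of r] assms(3)
  by (simp add: space_restrict_space)

lemma sets_kernel: "\<omega> \<in> \<Omega> \<Longrightarrow> r \<in> {t..T} \<Longrightarrow> sets (kernel (\<omega>, r)) = sets \<Gamma>"
  using PK.sets_k[of "(\<omega>, r)"] by (simp add: space_pair_measure)

lemma measurable_kernel: "f \<in> \<Gamma> \<rightarrow>\<^sub>M N \<Longrightarrow> \<omega> \<in> \<Omega> \<Longrightarrow> r \<in> {t..T} \<Longrightarrow> f \<in> kernel (\<omega>, r) \<rightarrow>\<^sub>M N"
  using measurable_cong_sets[OF sets_kernel refl, of \<omega> r N] by blast

lemma field_lift:
  assumes "field Z" "g \<in> borel \<rightarrow>\<^sub>M borel"
  shows "field (\<lambda>r \<omega> y. g (Z r \<omega> y))"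
  using measurable_compose[OF assms(1)[unfolded field_iff] assms(2)]
  unfolding field_iff flat_def .

lemma field_predictable:
  "(\<lambda>p. U (snd p) (fst p)) \<in> borel_measurable PA \<Longrightarrow> field (\<lambda>r \<omega> y. U r \<omega>)"
  unfolding field_iff flat_def by (rule measurable_compose[OF measurable_fst])

lemma field_algebra:
  fixes Z Z' :: "real \<Rightarrow> 'w \<Rightarrow> 'g \<Rightarrow> real"
  assumes "field Z" "field Z'"
  shows "field (\<lambda>r \<omega> y. Z r \<omega> y + Z' r \<omega> y)"
    and "field (\<lambda>r \<omega> y. Z r \<omega> y - Z' r \<omega> y)"
    and "field (\<lambda>r \<omega> y. Z r \<omega> y * Z' r \<omega> y)"
  using assms unfolding field_iff flat_def by auto

lemma field_square: "field Z \<Longrightarrow> field (\<lambda>r \<omega> y. (Z r \<omega> y)\<^sup>2)"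
  and field_scale: "field Z \<Longrightarrow> field (\<lambda>r \<omega> y. c * Z r \<omega> y)"
  for Z :: "real \<Rightarrow> 'w \<Rightarrow> 'g \<Rightarrow> real"
  unfolding field_iff flat_def by (auto intro!: borel_measurable_power)

lemma field_after:
  fixes Z :: "real \<Rightarrow> 'w \<Rightarrow> 'g \<Rightarrow> real"
  assumes "field Z"
  shows "field (\<lambda>r \<omega> y. if s < r then Z r \<omega> y else 0)"
  unfolding field_iff flat_def
proof (rule measurable_If)
  show "(\<lambda>u. Z (snd (fst u)) (fst (fst u)) (snd u)) \<in> borel_measurable (PA \<Otimes>\<^sub>M \<Gamma>)"
    using assms unfolding field_iff flat_def .
  have "(\<lambda>u. snd (fst u)) \<in> borel_measurable (PA \<Otimes>\<^sub>M \<Gamma>)"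
    by (rule measurable_compose[OF measurable_fst PA_snd])
  then show "{u \<in> space (PA \<Otimes>\<^sub>M \<Gamma>). s < snd (fst u)} \<in> sets (PA \<Otimes>\<^sub>M \<Gamma>)" by measurable
qed simp

lemma field_lim:
  fixes Z :: "nat \<Rightarrow> real \<Rightarrow> 'w \<Rightarrow> 'g \<Rightarrow> real"
  assumes "\<And>n. field (Z n)"
  shows "field (\<lambda>r \<omega> y. lim (\<lambda>n. Z n r \<omega> y))"
  using assms unfolding field_iff flat_def by (intro borel_measurable_lim_metric)

subsection \<open>Integrals in time\<close>

lemma nn_integral_time: "(\<integral>\<^sup>+r. f r \<partial>time) = (\<integral>\<^sup>+r\<in>{t..T}. f r \<partial>lborel)"
  unfolding time_def by (rule nn_integral_restrict_space) simp

lemma nn_integral_time': "(\<integral>\<^sup>+r. f r \<partial>time) = (\<integral>\<^sup>+r\<in>{t<..T}. f r \<partial>lborel)"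
  unfolding nn_integral_time
  by (intro nn_integral_cong_AE AE_I'[of "{t}"]) (auto simp: indicator_def)

sublocale time: finite_measure time
proof
  have "emeasure time {t..T} \<noteq> \<infinity>"
    unfolding time_def using t_less by (subst emeasure_restrict_space) auto
  then show "emeasure time (space time) \<noteq> \<infinity>" by simp
qed

sublocale PMs: pair_sigma_finite M time ..
sublocale PMf: finite_measure PM
  using finite_measure_pair_measure finite_measure_axioms time.finite_measure_axioms by blast

lemma AE_time: "(AE r in time. Q r) \<longleftrightarrow> (AE r in lborel. r \<in> {t..T} \<longrightarrow> Q r)"
  unfolding time_def by (subst AE_restrict_space_iff) auto

lemma AE_time_except:
  assumes "finite C" "\<And>r. r \<in> {t<..T} \<Longrightarrow> r \<notin> C \<Longrightarrow> Q r"
  shows "AE r in time. Q r"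
  unfolding AE_time
proof (rule AE_I'[of "insert t C"])
  show "{r \<in> space lborel. \<not> (r \<in> {t..T} \<longrightarrow> Q r)} \<subseteq> insert t C"
    using assms(2) by force
qed (use assms(1) in \<open>auto intro: finite_imp_null_set_lborel\<close>)

text \<open>This reconciles the norms of the Banach space, taken with \<open>v\<close> at
  \<open>X\<close>, with the compensator, which sees the state before the jump: the two states
  differ at finitely many times of a path.\<close>

lemma AE_time_Xm: "\<omega> \<in> \<Omega> \<Longrightarrow> AE r in time. Xm r \<omega> = X r \<omega>"
  using finite_J Xm_eq_X by (intro AE_time_except[of "J \<omega>"]) auto

lemma integrable_time_iff: "integrable time f \<longleftrightarrow> set_integrable lborel {t<..T} f"
  for f :: "real \<Rightarrow> real"
proof -
  have "integrable time f \<longleftrightarrow> set_integrable lborel {t..T} f"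
    unfolding time_def set_integrable_def by (subst integrable_restrict_space) auto
  also have "\<dots> \<longleftrightarrow> set_integrable lborel {t<..T} f"
    unfolding set_integrable_def
    by (rule integrable_discrete_difference[of "{t}"]) (auto simp: indicator_def)
  finally show ?thesis .
qed

lemma integral_time: "(\<integral>r. f r \<partial>time) = (LINT r:{t<..T}|lborel. f r)"
  for f :: "real \<Rightarrow> real"
proof -
  have "(\<integral>r. f r \<partial>time) = (LINT r:{t..T}|lborel. f r)"
    unfolding time_def set_lebesgue_integral_def by (subst integral_restrict_space) auto
  also have "\<dots> = (LINT r:{t<..T}|lborel. f r)"
    unfolding set_lebesgue_integral_def
    by (rule integral_discrete_difference[of "{t}"]) (auto simp: indicator_def)
  finally show ?thesis .
qed

lemma integral_time_after:
  fixes f :: "real \<Rightarrow> real"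
  assumes "t \<le> s"
  shows "(LINT r:{s<..T}|lborel. f r) = (\<integral>r. indicator {s<..} r * f r \<partial>time)"
  unfolding integral_time set_lebesgue_integral_def using assms
  by (intro Bochner_Integration.integral_cong) (auto simp: indicator_def)

lemma nn_integral_PM:
  "f \<in> borel_measurable PM \<Longrightarrow> (\<integral>\<^sup>+\<omega>. \<integral>\<^sup>+r. f (\<omega>, r) \<partial>time \<partial>M) = (\<integral>\<^sup>+p. f p \<partial>PM)"
  by (rule time.nn_integral_fst)

lemma AE_PM:
  assumes "{p\<in>space PM. Q p} \<in> sets PM" "AE \<omega> in M. AE r in time. Q (\<omega>, r)"
  shows "AE p in PM. Q p"
  by (rule PMs.AE_pair_measure[OF assms])

lemma AE_PM_D: "AE p in PM. Q p \<Longrightarrow> AE \<omega> in M. AE r in time. Q (\<omega>, r)"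
  by (rule PMs.AE_pair)

subsection \<open>Integrals against the compensator\<close>

text \<open>The Doleans measure of the compensator, \<open>P(d\<omega>) ds v(s, Xm s, dy)\<close>.
  With it the norm of a field \<open>Z\<close> becomes an ordinary \<open>L2\<close> norm, and
  limits of fields are limits in one \<open>L2\<close> space.\<close>

definition mu :: "(('w \<times> real) \<times> 'g) measure" where
  "mu = (SOME \<mu>. sets \<mu> = sets (PM \<Otimes>\<^sub>M \<Gamma>) \<and>
    (\<forall>f\<in>borel_measurable (PM \<Otimes>\<^sub>M \<Gamma>). (\<integral>\<^sup>+p. f p \<partial>\<mu>) = (\<integral>\<^sup>+a. \<integral>\<^sup>+y. f (a, y) \<partial>kernel a \<partial>PM)))"

lemma mu_props: "sets mu = sets (PM \<Otimes>\<^sub>M \<Gamma>) \<and>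
    (\<forall>f\<in>borel_measurable (PM \<Otimes>\<^sub>M \<Gamma>). (\<integral>\<^sup>+p. f p \<partial>mu) = (\<integral>\<^sup>+a. \<integral>\<^sup>+y. f (a, y) \<partial>kernel a \<partial>PM))"
  unfolding mu_def by (rule someI_ex[OF PK.ex_semidirect])

lemma sets_mu [measurable_cong]: "sets mu = sets (PM \<Otimes>\<^sub>M \<Gamma>)"
  using mu_props by simp

lemma measurable_mu: "f \<in> PM \<Otimes>\<^sub>M \<Gamma> \<rightarrow>\<^sub>M N \<Longrightarrow> f \<in> mu \<rightarrow>\<^sub>M N"
  using measurable_cong_sets[OF sets_mu refl, of N] by blast

lemma field_mu: "field Z \<Longrightarrow> flat Z \<in> borel_measurable mu"
  by (rule measurable_mu[OF field_PM])

lemma nn_integral_mu: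
  "f \<in> borel_measurable (PM \<Otimes>\<^sub>M \<Gamma>) \<Longrightarrow> (\<integral>\<^sup>+u. f u \<partial>mu) = (\<integral>\<^sup>+p. \<integral>\<^sup>+y. f (p, y) \<partial>kernel p \<partial>PM)"
  using mu_props by blast

lemma space_mu: "space mu = space PM \<times> space \<Gamma>"
  using sets_eq_imp_space_eq[OF sets_mu] by (simp add: space_pair_measure)

sublocale mu: finite_measure mu
proof
  have "emeasure mu (space mu) = (\<integral>\<^sup>+u. 1 \<partial>mu)" by simp
  also have "\<dots> = (\<integral>\<^sup>+p. emeasure (kernel p) (space (kernel p)) \<partial>PM)"
    by (subst nn_integral_mu) auto
  also have "\<dots> \<le> (\<integral>\<^sup>+p. ennreal K \<partial>PM)"
    by (rule nn_integral_mono) (metis PK.bound_k PK.sets_k sets_eq_imp_space_eq)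
  also have "\<dots> < \<infinity>"
    using PMf.emeasure_finite[of "space PM"] by (auto simp: less_top[symmetric] ennreal_mult_eq_top_iff)
  finally show "emeasure mu (space mu) \<noteq> \<infinity>" by simp
qed

lemma AE_mu:
  assumes "AE u in mu. Q u"
  shows "AE p in PM. AE y in kernel p. Q (p, y)"
proof -
  obtain N where N: "{u\<in>space mu. \<not> Q u} \<subseteq> N" "emeasure mu N = 0" "N \<in> sets mu"
    using assms by (rule AE_E)
  have N': "N \<in> sets (PM \<Otimes>\<^sub>M \<Gamma>)" using N(3) by (simp add: sets_mu)
  have m: "(\<lambda>u. indicator N u :: ennreal) \<in> borel_measurable (PM \<Otimes>\<^sub>M \<Gamma>)" using N' by simp
  have "(\<integral>\<^sup>+p. \<integral>\<^sup>+y. indicator N (p, y) \<partial>kernel p \<partial>PM) = 0"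
    using N by (simp add: nn_integral_mu[OF m, symmetric])
  then have ae: "AE p in PM. (\<integral>\<^sup>+y. indicator N (p, y) \<partial>kernel p) = (0::ennreal)"
    by (subst (asm) nn_integral_0_iff_AE) (auto intro!: PK.nn_measurable m)
  show ?thesis
  proof (rule AE_mp[OF ae AE_I2[OF impI]])
    fix p assume p: "p \<in> space PM" and z: "(\<integral>\<^sup>+y. indicator N (p, y) \<partial>kernel p) = (0::ennreal)"
    have meas: "(\<lambda>y. indicator N (p, y) :: ennreal) \<in> borel_measurable (kernel p)"
      using measurable_compose[OF measurable_Pair1'[OF p] m] measurable_cong_sets[OF PK.sets_k[OF p] refl] by blast
    have "AE y in kernel p. (indicator N (p, y) :: ennreal) = 0"
      using z meas by (simp add: nn_integral_0_iff_AE)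
    moreover have "space (kernel p) = space \<Gamma>" using PK.sets_k[OF p] by (rule sets_eq_imp_space_eq)
    ultimately show "AE y in kernel p. Q (p, y)"
      using N(1) p by (elim AE_mp, intro AE_I2) (auto simp: space_mu indicator_def split: if_splits)
  qed
qed

text \<open>Fubini for a kernel instead of a product measure: the nonnegative case characterises
  \<open>mu\<close>, and splitting into positive and negative parts, both finite for almost every
  \<open>p\<close>, gives the signed one.\<close>

lemma integral_mu:
  fixes D :: "(('w \<times> real) \<times> 'g) \<Rightarrow> real"
  assumes m: "D \<in> borel_measurable (PM \<Otimes>\<^sub>M \<Gamma>)" and i: "integrable mu D"
  shows "AE p in PM. integrable (kernel p) (\<lambda>y. D (p, y))"
    and "integrable PM (\<lambda>p. \<integral>y. D (p, y) \<partial>kernel p)"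
    and "(\<integral>p. (\<integral>y. D (p, y) \<partial>kernel p) \<partial>PM) = (\<integral>u. D u \<partial>mu)"
proof -
  have mk: "(\<lambda>y. D (p, y)) \<in> borel_measurable (kernel p)" if p: "p \<in> space PM" for p
    using measurable_compose[OF measurable_Pair1'[OF p] m] measurable_cong_sets[OF PK.sets_k[OF p] refl] by blast
  have [measurable]: "D \<in> borel_measurable (PM \<Otimes>\<^sub>M \<Gamma>)" by (rule m)
  define pos where "pos p = (\<integral>\<^sup>+y. ennreal (D (p, y)) \<partial>kernel p)" for p
  define neg where "neg p = (\<integral>\<^sup>+y. ennreal (- D (p, y)) \<partial>kernel p)" for p
  define ab where "ab p = (\<integral>\<^sup>+y. ennreal \<bar>D (p, y)\<bar> \<partial>kernel p)" for p
  have [measurable]: "pos \<in> borel_measurable PM" "neg \<in> borel_measurable PM" "ab \<in> borel_measurable PM"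
    unfolding pos_def neg_def ab_def
    by (rule PK.nn_measurable[of "\<lambda>u. ennreal (D u)"] PK.nn_measurable[of "\<lambda>u. ennreal (- D u)"]
      PK.nn_measurable[of "\<lambda>u. ennreal \<bar>D u\<bar>"], measurable)+
  have ab_fin: "(\<integral>\<^sup>+p. ab p \<partial>PM) < \<infinity>"
    unfolding ab_def using i
    by (subst nn_integral_mu[symmetric, where f="\<lambda>u. ennreal \<bar>D u\<bar>"]) (auto simp: integrable_iff_bounded)
  have ab_AE: "AE p in PM. ab p \<noteq> \<infinity>"
    using ab_fin by (intro nn_integral_PInf_AE) auto
  have le: "pos p \<le> ab p" "neg p \<le> ab p" for p
    unfolding pos_def neg_def ab_def by (intro nn_integral_mono ennreal_leI, simp)+
  show int: "AE p in PM. integrable (kernel p) (\<lambda>y. D (p, y))"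
    using ab_AE by (rule AE_mp, intro AE_I2 impI)
      (auto simp: integrable_iff_bounded ab_def less_top intro!: mk)
  have eq: "AE p in PM. (\<integral>y. D (p, y) \<partial>kernel p) = enn2real (pos p) - enn2real (neg p)"
    using int by eventually_elim (simp add: real_lebesgue_integral_def pos_def neg_def)
  have fin: "(\<integral>\<^sup>+p. pos p \<partial>PM) < \<infinity>" "(\<integral>\<^sup>+p. neg p \<partial>PM) < \<infinity>"
    using ab_fin by (auto intro: le_less_trans[OF nn_integral_mono] le)
  have AEf: "AE p in PM. pos p \<noteq> \<infinity>" "AE p in PM. neg p \<noteq> \<infinity>"
    by (rule nn_integral_PInf_AE, measurable, use fin in simp)+
  have nn: "(\<integral>\<^sup>+p. ennreal (enn2real (pos p)) \<partial>PM) = (\<integral>\<^sup>+p. pos p \<partial>PM)"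
    "(\<integral>\<^sup>+p. ennreal (enn2real (neg p)) \<partial>PM) = (\<integral>\<^sup>+p. neg p \<partial>PM)"
    by (intro nn_integral_cong_AE, use AEf in \<open>eventually_elim, simp add: less_top\<close>)+
  have ints: "integrable PM (\<lambda>p. enn2real (pos p))" "integrable PM (\<lambda>p. enn2real (neg p))"
    using fin nn by (auto intro!: integrableI_bounded)
  show "integrable PM (\<lambda>p. \<integral>y. D (p, y) \<partial>kernel p)"
    by (subst integrable_cong_AE[OF _ _ eq]) (auto intro!: PK.integral_measurable m ints)
  have "(\<integral>p. (\<integral>y. D (p, y) \<partial>kernel p) \<partial>PM) = (\<integral>p. enn2real (pos p) - enn2real (neg p) \<partial>PM)"
    by (intro integral_cong_AE eq) (auto intro!: PK.integral_measurable m)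
  also have "\<dots> = enn2real (\<integral>\<^sup>+p. pos p \<partial>PM) - enn2real (\<integral>\<^sup>+p. neg p \<partial>PM)"
    using ints by (simp add: integral_eq_nn_integral nn)
  also have "\<dots> = (\<integral>u. D u \<partial>mu)"
    unfolding real_lebesgue_integral_def[OF i] pos_def neg_def
    by (subst (1 2) nn_integral_mu) auto
  finally show "(\<integral>p. (\<integral>y. D (p, y) \<partial>kernel p) \<partial>PM) = (\<integral>u. D u \<partial>mu)" .
qed

subsection \<open>Sums over the jumps\<close>

definition jump_sum :: "(real \<Rightarrow> 'w \<Rightarrow> 'g \<Rightarrow> real) \<Rightarrow> real \<Rightarrow> 'w \<Rightarrow> real" where
  "jump_sum Z s \<omega> = (\<Sum>\<tau>\<in>J \<omega> \<inter> {s<..}. Z \<tau> \<omega> (X \<tau> \<omega>))"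

definition comp :: "(real \<Rightarrow> 'w \<Rightarrow> 'g \<Rightarrow> real) \<Rightarrow> 'w \<times> real \<Rightarrow> real" where
  "comp Z p = (\<integral>y. Z (snd p) (fst p) y \<partial>kernel p)"

text \<open>The jump measure lives on all times after \<open>t\<close>, whereas a field is
  measurable only up to \<open>T\<close>; freezing the time at \<open>T\<close> extends it without
  changing the values that are integrated.\<close>

lemma field_jump_measurable:
  assumes "field Z" "\<omega> \<in> \<Omega>"
  shows "(\<lambda>u. Z (min T (fst u)) \<omega> (snd u)) \<in> borel_measurable (restrict_space borel {t<..} \<Otimes>\<^sub>M \<Gamma>)"
proof -
  have "(\<lambda>u. min T (fst u)) \<in> restrict_space borel {t<..} \<Otimes>\<^sub>M \<Gamma> \<rightarrow>\<^sub>M restrict_space borel {t..T}"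
  proof (rule measurable_restrict_space2)
    have "(\<lambda>r. min T r) \<in> restrict_space borel {t<..} \<rightarrow>\<^sub>M borel"
      by (rule measurable_restrict_space1) measurable
    then show "(\<lambda>u. min T (fst u)) \<in> restrict_space borel {t<..} \<Otimes>\<^sub>M \<Gamma> \<rightarrow>\<^sub>M borel"
      by (rule measurable_compose[OF measurable_fst])
  qed (use t_less in \<open>auto simp: space_pair_measure space_restrict_space\<close>)
  then have "(\<lambda>u. (min T (fst u), snd u)) \<in> restrict_space borel {t<..} \<Otimes>\<^sub>M \<Gamma> \<rightarrow>\<^sub>M restrict_space borel {t..T} \<Otimes>\<^sub>M \<Gamma>"
    by (intro measurable_Pair measurable_snd)
  from measurable_compose[OF this field_section[OF assms]] show ?thesis by simp
qed

lemma jump_map_measurable: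
  "\<omega> \<in> \<Omega> \<Longrightarrow> (\<lambda>s. (s, X s \<omega>)) \<in> count_space (jump_times X \<omega> \<inter> {t<..}) \<rightarrow>\<^sub>M restrict_space borel {t<..} \<Otimes>\<^sub>M \<Gamma>"
  using t_nonneg by (auto simp: measurable_count_space_eq1 space_pair_measure space_restrict_space intro!: X_in_space)

lemma indicator_jump_measurable:
  "(\<lambda>u. indicator ({s<..T} \<times> space \<Gamma>) u :: real) \<in> borel_measurable (restrict_space borel {t<..} \<Otimes>\<^sub>M \<Gamma>)"
proof -
  have "(\<lambda>r. indicator {s<..T} r :: real) \<in> borel_measurable (restrict_space borel {t<..})"
    by (rule measurable_restrict_space1) measurable
  moreover have "(\<lambda>y. indicator (space \<Gamma>) y :: real) \<in> borel_measurable \<Gamma>" by measurable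
  ultimately have "(\<lambda>u. indicator {s<..T} (fst u) * indicator (space \<Gamma>) (snd u) :: real)
      \<in> borel_measurable (restrict_space borel {t<..} \<Otimes>\<^sub>M \<Gamma>)"
    by (intro borel_measurable_times measurable_compose[OF measurable_fst] measurable_compose[OF measurable_snd])
  moreover have "(\<lambda>u. indicator {s<..T} (fst u) * indicator (space \<Gamma>) (snd u) :: real)
    = indicator ({s<..T} \<times> space \<Gamma>)" by (auto simp: indicator_def fun_eq_iff)
  ultimately show ?thesis by simp
qed

lemma nn_integral_jump_measure:
  fixes H :: "real \<Rightarrow> 'w \<Rightarrow> 'g \<Rightarrow> ennreal"
  assumes H: "field H" and o: "\<omega> \<in> \<Omega>"
  shows "(\<integral>\<^sup>+u\<in>{t<..T} \<times> space \<Gamma>. H (fst u) \<omega> (snd u) \<partial>jump_measure \<Gamma> X t \<omega>) = (\<Sum>\<tau>\<in>J \<omega>. H \<tau> \<omega> (X \<tau> \<omega>))"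
proof -
  have eq: "H (fst u) \<omega> (snd u) * indicator ({t<..T} \<times> space \<Gamma>) u
    = H (min T (fst u)) \<omega> (snd u) * ennreal (indicator ({t<..T} \<times> space \<Gamma>) u)" for u
    by (auto simp: indicator_def)
  have "(\<integral>\<^sup>+u\<in>{t<..T} \<times> space \<Gamma>. H (fst u) \<omega> (snd u) \<partial>jump_measure \<Gamma> X t \<omega>)
    = (\<integral>\<^sup>+\<tau>. H (min T \<tau>) \<omega> (X \<tau> \<omega>) * ennreal (indicator ({t<..T} \<times> space \<Gamma>) (\<tau>, X \<tau> \<omega>))
        \<partial>count_space (jump_times X \<omega> \<inter> {t<..}))"
    unfolding eq jump_measure_def
    using field_jump_measurable[OF H o] indicator_jump_measurable[of t]
    by (subst nn_integral_distr[OF jump_map_measurable[OF o]]) (simp_all add: borel_measurable_times)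
  also have "\<dots> = (\<Sum>\<tau>\<in>J \<omega>. H (min T \<tau>) \<omega> (X \<tau> \<omega>) * ennreal (indicator ({t<..T} \<times> space \<Gamma>) (\<tau>, X \<tau> \<omega>)))"
    by (rule nn_integral_count_space'[OF finite_J[OF o]]) (auto simp: J_def indicator_def)
  also have "\<dots> = (\<Sum>\<tau>\<in>J \<omega>. H \<tau> \<omega> (X \<tau> \<omega>))"
    using o t_nonneg by (intro sum.cong refl) (auto simp: J_def indicator_def X_in_space)
  finally show ?thesis .
qed

text \<open>Strictly after \<open>t\<close> the left limit and \<open>Xm\<close> are the same, so
  the second integral is that of \<open>comp\<close>; the first one is a sum over the finitely many
  jumps in \<open>(s, T]\<close>.\<close>

lemma q_integral_eq:
  assumes Z: "field Z" and o: "\<omega> \<in> \<Omega>" and s: "s \<in> {t..T}"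
  shows "q_integral \<Gamma> X v t s T Z \<omega> = jump_sum Z s \<omega> - (LINT r:{s<..T}|lborel. comp Z (\<omega>, r))"
proof -
  have eq: "indicator ({s<..T} \<times> space \<Gamma>) u *\<^sub>R Z (fst u) \<omega> (snd u)
    = indicator ({s<..T} \<times> space \<Gamma>) u * Z (min T (fst u)) \<omega> (snd u)" for u
    by (auto simp: indicator_def)
  have "(LINT u:{s<..T} \<times> space \<Gamma>|jump_measure \<Gamma> X t \<omega>. Z (fst u) \<omega> (snd u))
    = (\<integral>\<tau>. indicator ({s<..T} \<times> space \<Gamma>) (\<tau>, X \<tau> \<omega>) * Z (min T \<tau>) \<omega> (X \<tau> \<omega>)
        \<partial>count_space (jump_times X \<omega> \<inter> {t<..}))"
    unfolding set_lebesgue_integral_def eq jump_measure_def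
    using field_jump_measurable[OF Z o] indicator_jump_measurable[of s]
    by (subst integral_distr[OF jump_map_measurable[OF o]]) (simp_all add: borel_measurable_times)
  also have "\<dots> = (\<Sum>\<tau>\<in>J \<omega> \<inter> {s<..}. indicator ({s<..T} \<times> space \<Gamma>) (\<tau>, X \<tau> \<omega>) * Z (min T \<tau>) \<omega> (X \<tau> \<omega>))"
  proof (subst lebesgue_integral_count_space_finite_support)
    let ?S = "{\<tau> \<in> jump_times X \<omega> \<inter> {t<..}. indicat_real ({s<..T} \<times> space \<Gamma>) (\<tau>, X \<tau> \<omega>) * Z (min T \<tau>) \<omega> (X \<tau> \<omega>) \<noteq> 0}"
    have sub: "?S \<subseteq> J \<omega> \<inter> {s<..}" by (auto simp: J_def indicator_def split: if_splits)
    then show "finite ?S" using finite_J[OF o] by (auto intro: finite_subset)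
    show "(\<Sum>\<tau>\<in>?S. indicat_real ({s<..T} \<times> space \<Gamma>) (\<tau>, X \<tau> \<omega>) * Z (min T \<tau>) \<omega> (X \<tau> \<omega>))
      = (\<Sum>\<tau>\<in>J \<omega> \<inter> {s<..}. indicat_real ({s<..T} \<times> space \<Gamma>) (\<tau>, X \<tau> \<omega>) * Z (min T \<tau>) \<omega> (X \<tau> \<omega>))"
      by (rule sum.mono_neutral_left[OF _ sub]) (use finite_J[OF o] in \<open>auto simp: J_def\<close>)
  qed
  also have "\<dots> = jump_sum Z s \<omega>"
    unfolding jump_sum_def using o t_nonneg
    by (intro sum.cong refl) (auto simp: J_def indicator_def X_in_space)
  finally have "(LINT u:{s<..T} \<times> space \<Gamma>|jump_measure \<Gamma> X t \<omega>. Z (fst u) \<omega> (snd u)) = jump_sum Z s \<omega>" .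
  moreover have "(LINT r:{s<..T}|lborel. (\<integral>y. Z r \<omega> y \<partial>v r (left_limit X r \<omega>)))
    = (LINT r:{s<..T}|lborel. comp Z (\<omega>, r))"
    unfolding set_lebesgue_integral_def comp_def kernel_def using s
    by (intro Bochner_Integration.integral_cong refl) (auto simp: Xm_def indicator_def)
  ultimately show ?thesis unfolding q_integral_def by simp
qed

text \<open>The sum over the jumps need not be measurable, since the diagonal of \<open>\<Gamma>\<close> is not assumed
  measurable; the left-hand side is a lower integral in general.\<close>

lemma compensator_formula:
  fixes H :: "real \<Rightarrow> 'w \<Rightarrow> 'g \<Rightarrow> ennreal"
  assumes H: "field H"
  shows "(\<integral>\<^sup>+\<omega>. (\<Sum>\<tau>\<in>J \<omega>. H \<tau> \<omega> (X \<tau> \<omega>)) \<partial>M) = (\<integral>\<^sup>+u. flat H u \<partial>mu)"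
proof -
  have "(\<integral>\<^sup>+\<omega>. (\<Sum>\<tau>\<in>J \<omega>. H \<tau> \<omega> (X \<tau> \<omega>)) \<partial>M)
    = (\<integral>\<^sup>+\<omega>. (\<integral>\<^sup>+u\<in>{t<..T} \<times> space \<Gamma>. H (fst u) \<omega> (snd u) \<partial>jump_measure \<Gamma> X t \<omega>) \<partial>M)"
    by (intro nn_integral_cong nn_integral_jump_measure[symmetric] H) simp
  also have "\<dots> = (\<integral>\<^sup>+\<omega>. (\<integral>\<^sup>+s\<in>{t<..T}. (\<integral>\<^sup>+y. H s \<omega> y \<partial>v s (left_limit X s \<omega>)) \<partial>lborel) \<partial>M)"
    using compensator[of t x] H t_nonneg t_less x_space unfolding is_compensator_def M_def F_def by auto
  also have "\<dots> = (\<integral>\<^sup>+\<omega>. (\<integral>\<^sup>+r. (\<integral>\<^sup>+y. H r \<omega> y \<partial>kernel (\<omega>, r)) \<partial>time) \<partial>M)"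
    unfolding nn_integral_time'
    by (intro nn_integral_cong) (auto simp: kernel_def Xm_def indicator_def)
  also have "\<dots> = (\<integral>\<^sup>+p. (\<integral>\<^sup>+y. flat H (p, y) \<partial>kernel p) \<partial>PM)"
    using PK.nn_measurable[OF field_PM[OF H]] by (subst nn_integral_PM[symmetric]) auto
  also have "\<dots> = (\<integral>\<^sup>+u. flat H u \<partial>mu)" by (rule nn_integral_mu[OF field_PM[OF H], symmetric])
  finally show ?thesis .
qed

end

section \<open>The energy identity\<close>

lemma tail_integral_continuous:
  fixes a :: "real \<Rightarrow> real"
  assumes a: "set_integrable lborel {t<..T} a"
  shows "continuous_on {t..T} (\<lambda>r. LINT q:{r<..T}|lborel. a q)"
proof (cases "t \<le> T")
  case True
  have closed: "set_integrable lborel {t..r} a" if "r \<le> T" for r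
  proof -
    have "set_integrable lborel {t<..r} a"
      using a that by (auto intro: set_integrable_subset)
    moreover have "set_integrable lborel {t<..r} a \<longleftrightarrow> set_integrable lborel {t..r} a"
      unfolding set_integrable_def
      by (rule integrable_discrete_difference[of "{t}"]) (auto simp: indicator_def)
    ultimately show ?thesis by simp
  qed
  have eq: "(LINT q:{r<..T}|lborel. a q) = (LINT q:{t<..T}|lborel. a q) - integral {t..r} a" if r: "r \<in> {t..T}" for r
  proof -
    have "(LINT q:{t<..r}|lborel. a q) = (LINT q:{t..r}|lborel. a q)"
      unfolding set_lebesgue_integral_def
      by (rule integral_discrete_difference[of "{t}"]) (auto simp: indicator_def)
    also have "\<dots> = integral {t..r} a"
      using set_borel_integral_eq_integral(2)[OF closed] r by simp
    finally show ?thesis using set_integral_Ioc_split(1)[OF a, of r] r by simp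
  qed
  have "continuous_on {t..T} (\<lambda>r. (LINT q:{t<..T}|lborel. a q) - integral {t..r} a)"
    using set_borel_integral_eq_integral(1)[OF closed[of T]]
    by (intro continuous_intros indefinite_integral_continuous_1) simp
  then show ?thesis by (rule continuous_on_eq) (rule eq[symmetric])
qed simp

context jump_markov_started
begin

text \<open>Here the generator \<open>g\<close> is a given process. The terminal value enters as
  \<open>Y T\<close> itself, so that linear combinations of solutions are solutions, and a terminal
  condition is imposed separately when needed.\<close>

definition linear_bsde :: "(real \<Rightarrow> 'w \<Rightarrow> real) \<Rightarrow> (real \<Rightarrow> 'w \<Rightarrow> real) \<Rightarrow> (real \<Rightarrow> 'w \<Rightarrow> 'g \<Rightarrow> real) \<Rightarrow> bool" where
  "linear_bsde g Y Z \<longleftrightarrow>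
    progressive F t T Y \<and> field Z \<and>
    integrable PM (\<lambda>p. (Y (snd p) (fst p))\<^sup>2) \<and> integrable mu (\<lambda>u. (flat Z u)\<^sup>2) \<and>
    (\<lambda>p. g (snd p) (fst p)) \<in> borel_measurable PM \<and> integrable PM (\<lambda>p. (g (snd p) (fst p))\<^sup>2) \<and>
    (AE \<omega> in M. \<forall>s\<in>{t..T}. Y s \<omega> = Y T \<omega> + (LINT r:{s<..T}|lborel. g r \<omega>)
      - (jump_sum Z s \<omega> - (LINT r:{s<..T}|lborel. comp Z (\<omega>, r))))"

lemma progressive_on:
  "progressive F t T Y \<Longrightarrow> s \<in> {t..T} \<Longrightarrow> (\<lambda>p. Y (snd p) (fst p)) \<in> borel_measurable (F s \<Otimes>\<^sub>M restrict_space borel {t..s})"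
  by (simp add: progressive_def case_prod_beta')

lemma progressive_PM: "progressive F t T Y \<Longrightarrow> (\<lambda>p. Y (snd p) (fst p)) \<in> borel_measurable PM"
  using progressive_on[of Y T] t_less by (intro measurable_FT_PM) simp

lemma progressive_adapted: "progressive F t T Y \<Longrightarrow> adapted Y"
proof
  fix s assume Y: "progressive F t T Y" and s: "s \<in> {t..T}"
  have "(\<lambda>\<omega>. (\<omega>, s)) \<in> F s \<rightarrow>\<^sub>M F s \<Otimes>\<^sub>M restrict_space borel {t..s}"
    using s by (intro measurable_Pair2') (simp add: space_restrict_space)
  from measurable_compose[OF this progressive_on[OF Y s]] show "Y s \<in> borel_measurable (F s)" by simp
qed

lemma measurable_M_AE:
  fixes f g :: "'w \<Rightarrow> real"
  assumes f: "f \<in> borel_measurable M" and ae: "AE \<omega> in M. f \<omega> = g \<omega>"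
  shows "g \<in> borel_measurable M"
proof (rule measurableI)
  fix A :: "real set" assume A: "A \<in> sets borel"
  let ?N = "{\<omega>\<in>\<Omega>. f \<omega> \<noteq> g \<omega>}"
  have N: "?N \<in> null_sets M" by (rule AE_null_set[OF ae])
  have "f -` A \<inter> \<Omega> \<in> sets M" using measurable_sets[OF f A] by simp
  moreover have "?N \<in> sets M" "(g -` A \<inter> \<Omega>) \<inter> ?N \<in> sets M"
    using N subset_null_sets[OF _ N, of "(g -` A \<inter> \<Omega>) \<inter> ?N"] by auto
  moreover have "g -` A \<inter> \<Omega> = ((f -` A \<inter> \<Omega>) - ?N) \<union> ((g -` A \<inter> \<Omega>) \<inter> ?N)" by auto
  ultimately show "g -` A \<inter> space M \<in> sets M"
    using sets.Un[OF sets.Diff, of "f -` A \<inter> \<Omega>" M ?N "(g -` A \<inter> \<Omega>) \<inter> ?N"] by (simp only: space_M)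
qed simp

lemma integrable_square_mult:
  fixes f g :: "'c \<Rightarrow> real"
  assumes "f \<in> borel_measurable N" "g \<in> borel_measurable N"
    "integrable N (\<lambda>x. (f x)\<^sup>2)" "integrable N (\<lambda>x. (g x)\<^sup>2)"
  shows "integrable N (\<lambda>x. f x * g x)"
proof (rule Bochner_Integration.integrable_bound[of _ "\<lambda>x. (f x)\<^sup>2 + (g x)\<^sup>2"])
  have "\<bar>a * b\<bar> \<le> a\<^sup>2 + b\<^sup>2" for a b :: real
  proof -
    have "2 * \<bar>a * b\<bar> \<le> a\<^sup>2 + b\<^sup>2" using sum_squares_bound[of "\<bar>a\<bar>" "\<bar>b\<bar>"] by (simp add: abs_mult)
    then show ?thesis using abs_ge_zero[of "a * b"] by linarith
  qed
  then show "AE x in N. norm (f x * g x) \<le> norm ((f x)\<^sup>2 + (g x)\<^sup>2)" by simp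
qed (use assms in auto)

lemma integrable_PM_L1:
  "f \<in> borel_measurable PM \<Longrightarrow> integrable PM (\<lambda>p. (f p)\<^sup>2) \<Longrightarrow> integrable PM f" for f :: "_ \<Rightarrow> real"
  by (rule PMf.square_integrable_imp_integrable)

lemma integrable_mu_L1:
  "field Z \<Longrightarrow> integrable mu (\<lambda>u. (flat Z u)\<^sup>2) \<Longrightarrow> integrable mu (flat Z)"
  for Z :: "real \<Rightarrow> 'w \<Rightarrow> 'g \<Rightarrow> real"
  by (rule mu.square_integrable_imp_integrable[OF field_mu])

lemma integrable_comp:
  assumes Z: "field Z" and i: "integrable mu (flat Z)"
  shows "integrable PM (comp Z)" "(\<integral>p. comp Z p \<partial>PM) = (\<integral>u. flat Z u \<partial>mu)"
    "AE p in PM. integrable (kernel p) (Z (snd p) (fst p))"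
  using integral_mu[OF field_PM[OF Z] i] by (simp_all add: comp_def[abs_def])

lemma AE_PM_integrable:
  fixes f :: "_ \<Rightarrow> real"
  assumes "integrable PM f"
  shows "AE \<omega> in M. set_integrable lborel {t<..T} (\<lambda>r. f (\<omega>, r))"
  using PMs.AE_integrable_fst'[OF assms] by (simp add: integrable_time_iff)

lemma integral_PM_after:
  fixes f :: "_ \<Rightarrow> real"
  assumes f: "integrable PM f" and s: "t \<le> s"
  shows "integrable M (\<lambda>\<omega>. LINT r:{s<..T}|lborel. f (\<omega>, r))"
    and "(\<integral>\<omega>. (LINT r:{s<..T}|lborel. f (\<omega>, r)) \<partial>M) = (\<integral>p. indicator {s<..} (snd p) * f p \<partial>PM)"
    and "integrable PM (\<lambda>p. indicator {s<..} (snd p) * f p)"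
proof -
  have "{p\<in>space PM. s < snd p} \<in> sets PM"
    using measurable_compose[OF id_PA_PM PA_snd] by measurable
  from integrable_mult_indicator[OF this f]
  have "integrable PM (\<lambda>p. indicator {p\<in>space PM. s < snd p} p *\<^sub>R f p)" .
  then show 1: "integrable PM (\<lambda>p. indicator {s<..} (snd p) * f p)"
    by (rule Bochner_Integration.integrable_cong[THEN iffD1, rotated -1]) (auto simp: indicator_def)
  from PMs.integrable_fst'[OF 1] show "integrable M (\<lambda>\<omega>. LINT r:{s<..T}|lborel. f (\<omega>, r))"
    by (simp add: integral_time_after[OF s])
  from PMs.integral_fst'[OF 1] show "(\<integral>\<omega>. (LINT r:{s<..T}|lborel. f (\<omega>, r)) \<partial>M) = (\<integral>p. indicator {s<..} (snd p) * f p \<partial>PM)"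
    by (simp add: integral_time_after[OF s])
qed

lemma linear_bsdeD:
  assumes "linear_bsde g Y Z"
  shows "progressive F t T Y" "field Z" "integrable PM (\<lambda>p. (Y (snd p) (fst p))\<^sup>2)"
    "integrable mu (\<lambda>u. (flat Z u)\<^sup>2)" "(\<lambda>p. g (snd p) (fst p)) \<in> borel_measurable PM"
    "integrable PM (\<lambda>p. (g (snd p) (fst p))\<^sup>2)"
    "AE \<omega> in M. \<forall>s\<in>{t..T}. Y s \<omega> = Y T \<omega> + (LINT r:{s<..T}|lborel. g r \<omega>)
      - (jump_sum Z s \<omega> - (LINT r:{s<..T}|lborel. comp Z (\<omega>, r)))"
  using assms unfolding linear_bsde_def by blast+

definition drift :: "(real \<Rightarrow> 'w \<Rightarrow> real) \<Rightarrow> (real \<Rightarrow> 'w \<Rightarrow> 'g \<Rightarrow> real) \<Rightarrow> real \<Rightarrow> 'w \<Rightarrow> real" where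
  "drift g Z r \<omega> = g r \<omega> + comp Z (\<omega>, r)"

lemma linear_bsde_integrable:
  assumes "linear_bsde g Y Z"
  shows "integrable PM (\<lambda>p. drift g Z (snd p) (fst p))"
    "integrable PM (\<lambda>p. g (snd p) (fst p))" "integrable PM (comp Z)"
  using integrable_comp(1)[OF linear_bsdeD(2)[OF assms] integrable_mu_L1[OF linear_bsdeD(2,4)[OF assms]]]
    integrable_PM_L1[OF linear_bsdeD(5,6)[OF assms]]
  by (auto simp: drift_def)

text \<open>The compensator integral is to be merged with the generator into one drift
  \<open>a\<close>: what remains along a path is an absolutely continuous part and finitely many
  jumps, and the calculus becomes deterministic.\<close>

definition path_equation :: "(real \<Rightarrow> 'w \<Rightarrow> real) \<Rightarrow> (real \<Rightarrow> 'w \<Rightarrow> real) \<Rightarrow> (real \<Rightarrow> 'w \<Rightarrow> 'g \<Rightarrow> real) \<Rightarrow> 'w \<Rightarrow> bool" where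
  "path_equation a Y Z \<omega> \<longleftrightarrow> \<omega> \<in> \<Omega> \<and> set_integrable lborel {t<..T} (\<lambda>r. a r \<omega>) \<and>
    (\<forall>s\<in>{t..T}. Y s \<omega> = Y T \<omega> + (LINT r:{s<..T}|lborel. a r \<omega>) - jump_sum Z s \<omega>)"

lemma linear_bsde_path:
  assumes "linear_bsde g Y Z"
  shows "AE \<omega> in M. path_equation (drift g Z) Y Z \<omega>"
proof -
  note I = linear_bsde_integrable[OF assms, THEN AE_PM_integrable]
  show ?thesis
    using linear_bsdeD(7)[OF assms] I(1)[simplified] I(2)[simplified] I(3) AE_space
  proof eventually_elim
    case (elim \<omega>)
    have split: "(LINT r:{s<..T}|lborel. drift g Z r \<omega>)
      = (LINT r:{s<..T}|lborel. g r \<omega>) + (LINT r:{s<..T}|lborel. comp Z (\<omega>, r))" if "s \<in> {t..T}" for s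
      unfolding drift_def using that
      by (intro set_integral_add(2) set_integrable_subset[OF elim(3)] set_integrable_subset[OF elim(4)]) auto
    have "Y s \<omega> = Y T \<omega> + (LINT r:{s<..T}|lborel. drift g Z r \<omega>) - jump_sum Z s \<omega>"
      if "s \<in> {t..T}" for s using split[OF that] bspec[OF elim(1) that] by linarith
    then show ?case using elim(2,5) unfolding path_equation_def space_M by blast
  qed
qed

lemma path_left_limit:
  assumes eq: "path_equation a Y Z \<omega>" and r: "r \<in> {t<..T}"
  shows "((\<lambda>s. Y s \<omega>) \<longlongrightarrow> Y r \<omega> - (if r \<in> J \<omega> then Z r \<omega> (X r \<omega>) else 0)) (at_left r)"
proof -
  have o: "\<omega> \<in> \<Omega>" and ai: "set_integrable lborel {t<..T} (\<lambda>r. a r \<omega>)"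
    and Y: "\<And>s. s \<in> {t..T} \<Longrightarrow> Y s \<omega> = Y T \<omega> + (LINT r:{s<..T}|lborel. a r \<omega>) - jump_sum Z s \<omega>"
    using eq unfolding path_equation_def by blast+
  obtain s1 where s1: "t \<le> s1" "s1 < r" "jump_times X \<omega> \<inter> {s1<..<r} = {}"
    using ex_jump_free_left[of r \<omega>] o r by auto
  have js: "jump_sum Z s \<omega> = jump_sum Z r \<omega> + (if r \<in> J \<omega> then Z r \<omega> (X r \<omega>) else 0)" if s: "s \<in> {s1<..<r}" for s
  proof -
    have "J \<omega> \<inter> {s<..} = (J \<omega> \<inter> {r<..}) \<union> (if r \<in> J \<omega> then {r} else {})"
    proof -
      have "q \<notin> J \<omega>" if "s < q" "q < r" for q using s1(3) s that by (auto simp: J_def)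
      then show ?thesis using s by (auto simp: not_less) (metis less_eq_real_def linorder_not_le)+
    qed
    then show ?thesis unfolding jump_sum_def using finite_J[OF o] by (simp add: add.commute)
  qed
  have "continuous_on {t..r} (\<lambda>s. LINT q:{s<..T}|lborel. a q \<omega>)"
    using r by (intro continuous_on_subset[OF tail_integral_continuous[OF ai]]) auto
  from continuous_on_Icc_at_leftD[OF this] r
  have lim: "((\<lambda>s. LINT q:{s<..T}|lborel. a q \<omega>) \<longlongrightarrow> (LINT q:{r<..T}|lborel. a q \<omega>)) (at_left r)" by simp
  let ?j = "if r \<in> J \<omega> then Z r \<omega> (X r \<omega>) else 0"
  have "((\<lambda>s. Y T \<omega> + (LINT q:{s<..T}|lborel. a q \<omega>) - (jump_sum Z r \<omega> + ?j))
    \<longlongrightarrow> Y T \<omega> + (LINT q:{r<..T}|lborel. a q \<omega>) - (jump_sum Z r \<omega> + ?j)) (at_left r)"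
    by (intro tendsto_intros lim)
  moreover have "\<forall>\<^sub>F s in at_left r. Y T \<omega> + (LINT q:{s<..T}|lborel. a q \<omega>) - (jump_sum Z r \<omega> + ?j) = Y s \<omega>"
  proof -
    have "\<forall>\<^sub>F s in at_left r. s \<in> {s1<..<r}"
      unfolding eventually_at_left[OF s1(2)] using s1(2) by (intro exI[of _ s1]) simp
    then show ?thesis
    proof eventually_elim
      case (elim s)
      then have "s \<in> {t..T}" using s1 r by simp
      then show ?case using Y[of s] js[OF elim] by linarith
    qed
  qed
  ultimately have "((\<lambda>s. Y s \<omega>) \<longlongrightarrow> Y T \<omega> + (LINT q:{r<..T}|lborel. a q \<omega>) - (jump_sum Z r \<omega> + ?j)) (at_left r)"
    by (rule Lim_transform_eventually)
  moreover have "Y T \<omega> + (LINT q:{r<..T}|lborel. a q \<omega>) - (jump_sum Z r \<omega> + ?j) = Y r \<omega> - ?j"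
  proof -
    have "r \<in> {t..T}" using r by simp
    from Y[OF this] show ?thesis by linarith
  qed
  ultimately show ?thesis by (simp only:)
qed

lemma path_Ym: "path_equation a Y Z \<omega> \<Longrightarrow> r \<in> {t<..T} \<Longrightarrow>
    Ym Y r \<omega> = Y r \<omega> - (if r \<in> J \<omega> then Z r \<omega> (X r \<omega>) else 0)"
  by (rule Ym_eq) (auto dest: path_left_limit)

text \<open>A jump changes the square by \<open>2 * Y * Z - Z\<^sup>2\<close> in terms of the value
  after the jump. Writing this as \<open>2 * Ym * Z + Z\<^sup>2\<close> with the left limit makes
  the summand a predictable field, as the compensator formula requires.\<close>

lemma path_square:
  assumes eq: "path_equation a Y Z \<omega>" and s: "s \<in> {t..T}"
  shows "(Y s \<omega>)\<^sup>2 = (Y T \<omega>)\<^sup>2 + 2 * (LINT r:{s<..T}|lborel. Y r \<omega> * a r \<omega>)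
    - jump_sum (\<lambda>r \<omega> y. 2 * Ym Y r \<omega> * Z r \<omega> y + (Z r \<omega> y)\<^sup>2) s \<omega>"
proof -
  have o: "\<omega> \<in> \<Omega>" and ai: "set_integrable lborel {t<..T} (\<lambda>r. a r \<omega>)"
    and Y: "\<And>s. s \<in> {t..T} \<Longrightarrow> Y s \<omega> = Y T \<omega> + (LINT r:{s<..T}|lborel. a r \<omega>) - jump_sum Z s \<omega>"
    using eq unfolding path_equation_def by blast+
  have "(Y s \<omega>)\<^sup>2 = (Y T \<omega>)\<^sup>2 + 2 * (LINT r:{s<..T}|lborel. Y r \<omega> * a r \<omega>)
    + (\<Sum>\<tau>\<in>J \<omega> \<inter> {s<..}. 2 * Y \<tau> \<omega> * (- Z \<tau> \<omega> (X \<tau> \<omega>)) + (- Z \<tau> \<omega> (X \<tau> \<omega>))\<^sup>2)"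
  proof (rule square_jump_formula[where Y="\<lambda>s. Y s \<omega>" and a="\<lambda>s. a s \<omega>", THEN conjunct1])
    show "J \<omega> \<inter> {s<..} \<subseteq> {s<..T}" using J_subset[of \<omega>] by auto
    show "set_integrable lborel {s<..T} (\<lambda>s. a s \<omega>)" using s by (intro set_integrable_subset[OF ai]) auto
    fix r assume r: "r \<in> {s..T}"
    then have "J \<omega> \<inter> {s<..} \<inter> {r<..} = J \<omega> \<inter> {r<..}" by auto
    then show "Y r \<omega> = Y T \<omega> + (LINT q:{r<..T}|lborel. a q \<omega>) + (\<Sum>\<tau>\<in>J \<omega> \<inter> {s<..} \<inter> {r<..}. - Z \<tau> \<omega> (X \<tau> \<omega>))"
      using Y[of r] r s by (simp add: jump_sum_def sum_negf)
  qed (use finite_J[OF o] s in auto)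
  also have "(\<Sum>\<tau>\<in>J \<omega> \<inter> {s<..}. 2 * Y \<tau> \<omega> * (- Z \<tau> \<omega> (X \<tau> \<omega>)) + (- Z \<tau> \<omega> (X \<tau> \<omega>))\<^sup>2)
    = (\<Sum>\<tau>\<in>J \<omega> \<inter> {s<..}. - (2 * Ym Y \<tau> \<omega> * Z \<tau> \<omega> (X \<tau> \<omega>) + (Z \<tau> \<omega> (X \<tau> \<omega>))\<^sup>2))"
  proof (rule sum.cong[OF refl])
    fix \<tau> assume "\<tau> \<in> J \<omega> \<inter> {s<..}"
    then have *: "Ym Y \<tau> \<omega> = Y \<tau> \<omega> - Z \<tau> \<omega> (X \<tau> \<omega>)"
      using path_Ym[OF eq, of \<tau>] J_subset[of \<omega>] by auto
    show "2 * Y \<tau> \<omega> * (- Z \<tau> \<omega> (X \<tau> \<omega>)) + (- Z \<tau> \<omega> (X \<tau> \<omega>))\<^sup>2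
      = - (2 * Ym Y \<tau> \<omega> * Z \<tau> \<omega> (X \<tau> \<omega>) + (Z \<tau> \<omega> (X \<tau> \<omega>))\<^sup>2)"
      unfolding * by (simp add: power2_eq_square algebra_simps)
  qed
  also have "(\<Sum>\<tau>\<in>J \<omega> \<inter> {s<..}. - (2 * Ym Y \<tau> \<omega> * Z \<tau> \<omega> (X \<tau> \<omega>) + (Z \<tau> \<omega> (X \<tau> \<omega>))\<^sup>2))
    = - jump_sum (\<lambda>r \<omega> y. 2 * Ym Y r \<omega> * Z r \<omega> y + (Z r \<omega> y)\<^sup>2) s \<omega>"
    unfolding jump_sum_def by (rule sum_negf)
  finally show ?thesis by simp
qed

text \<open>Measurability is not read off the sum but off the equation, in which every other term is
  measurable.\<close>

lemma jump_sum_measurable: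
  assumes lin: "linear_bsde g Y Z" and s: "s \<in> {t..T}"
  shows "jump_sum Z s \<in> borel_measurable M"
proof (rule measurable_M_AE)
  have Y: "Y q \<in> borel_measurable M" if "q \<in> {t..T}" for q
    using progressive_adapted[OF linear_bsdeD(1)[OF lin]] that by (auto intro: measurable_F_M)
  have "integrable M (\<lambda>\<omega>. LINT r:{s<..T}|lborel. drift g Z r \<omega>)"
    using integral_PM_after(1)[OF linear_bsde_integrable(1)[OF lin], of s] s by simp
  then show "(\<lambda>\<omega>. Y T \<omega> - Y s \<omega> + (LINT r:{s<..T}|lborel. drift g Z r \<omega>)) \<in> borel_measurable M"
    using Y[of T] Y[OF s] t_less by (auto dest: borel_measurable_integrable)
  show "AE \<omega> in M. Y T \<omega> - Y s \<omega> + (LINT r:{s<..T}|lborel. drift g Z r \<omega>) = jump_sum Z s \<omega>"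
    using linear_bsde_path[OF lin] by eventually_elim (unfold path_equation_def, use s in fastforce)
qed

text \<open>The jumps of \<open>Y\<close> are exactly the values \<open>Z\<^sub>\<tau>(X\<^sub>\<tau>)\<close>, so sums of functions of them are
  measurable, although the jump times of \<open>X\<close> need not be.\<close>

lemma jump_functional_measurable:
  assumes lin: "linear_bsde g Y Z" and s: "s \<in> {t..T}"
    and \<phi>: "(\<lambda>p. \<phi> (fst p) (snd p)) \<in> borel_measurable (borel \<Otimes>\<^sub>M borel)"
    and zero: "\<And>u. \<phi> u 0 = 0" and cont: "\<And>z u. isCont (\<lambda>u. \<phi> u z) u"
  shows "jump_sum (\<lambda>r \<omega> y. \<phi> (Ym Y r \<omega>) (Z r \<omega> y)) s \<in> borel_measurable M"
proof -
  obtain m :: nat where m: "T \<le> s + real m"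
    using real_arch_simple[of "T - s"] by (auto simp: algebra_simps)
  \<comment> \<open>Increments of \<open>jump_sum Z\<close> over the cells of a fine grid isolate
    the individual jumps, and \<open>Y\<close> at the left end of a cell tends to the left limit at
    the jump; both are random variables.\<close>
  define f where "f n \<omega> = (\<Sum>k<n * m. \<phi> (Y (grid_point s T n k) \<omega>)
    (jump_sum Z (grid_point s T n k) \<omega> - jump_sum Z (grid_point s T n (Suc k)) \<omega>))" for n \<omega>
  have gp: "grid_point s T n k \<in> {t..T}" for n k using grid_point_range[of s T n k] s by auto
  have Y: "Y q \<in> borel_measurable M" if "q \<in> {t..T}" for q
    using progressive_adapted[OF linear_bsdeD(1)[OF lin]] that by (auto intro: measurable_F_M)
  have fm: "f n \<in> borel_measurable M" for n
    unfolding f_def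
  proof (rule borel_measurable_sum)
    fix k
    have "(\<lambda>\<omega>. (Y (grid_point s T n k) \<omega>, jump_sum Z (grid_point s T n k) \<omega> - jump_sum Z (grid_point s T n (Suc k)) \<omega>)) \<in> M \<rightarrow>\<^sub>M borel \<Otimes>\<^sub>M borel"
      by (intro measurable_Pair borel_measurable_diff Y jump_sum_measurable[OF lin] gp)
    from measurable_compose[OF this \<phi>]
    show "(\<lambda>\<omega>. \<phi> (Y (grid_point s T n k) \<omega>)
      (jump_sum Z (grid_point s T n k) \<omega> - jump_sum Z (grid_point s T n (Suc k)) \<omega>)) \<in> borel_measurable M" by simp
  qed
  have "AE \<omega> in M. lim (\<lambda>n. f n \<omega>) = jump_sum (\<lambda>r \<omega> y. \<phi> (Ym Y r \<omega>) (Z r \<omega> y)) s \<omega>"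
    using linear_bsde_path[OF lin]
  proof eventually_elim
    case (elim \<omega>)
    then have o: "\<omega> \<in> \<Omega>" by (simp add: path_equation_def)
    let ?J = "J \<omega> \<inter> {s<..}"
    have J: "finite ?J" "?J \<subseteq> {s<..T}" using finite_J[OF o] J_subset[of \<omega>] by auto
    have js: "jump_sum Z (grid_point s T n k) \<omega> = (\<Sum>\<tau>\<in>?J \<inter> {grid_point s T n k<..}. Z \<tau> \<omega> (X \<tau> \<omega>))" for n k
    proof -
      have "?J \<inter> {grid_point s T n k<..} = J \<omega> \<inter> {grid_point s T n k<..}"
        using grid_point_range[of s T n k] s by auto
      then show ?thesis by (simp add: jump_sum_def)
    qed
    have "(\<lambda>n. f n \<omega>) \<longlonglongrightarrow> (\<Sum>\<tau>\<in>?J. \<phi> (Ym Y \<tau> \<omega>) (Z \<tau> \<omega> (X \<tau> \<omega>)))"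
      unfolding f_def js
    proof (rule grid_sum_tendsto[where \<phi>=\<phi> and U="\<lambda>q. Y q \<omega>" and u="\<lambda>\<tau>. Ym Y \<tau> \<omega>", OF J m])
      show "\<phi> u 0 = 0" for u by (rule zero)
      show "isCont (\<lambda>u. \<phi> u (Z \<tau> \<omega> (X \<tau> \<omega>))) (Ym Y \<tau> \<omega>)" for \<tau> by (rule cont)
      fix \<tau> assume \<tau>: "\<tau> \<in> ?J"
      then have t1: "\<tau> \<in> {t<..T}" and t2: "\<tau> \<in> {s<..T}" using J_subset[of \<omega>] by auto
      have "((\<lambda>s. Y s \<omega>) \<longlongrightarrow> Ym Y \<tau> \<omega>) (at_left \<tau>)"
        using path_left_limit[OF elim t1] path_Ym[OF elim t1] by simp
      then show "(\<lambda>n. Y (grid_point s T n (grid_index s n \<tau>)) \<omega>) \<longlonglongrightarrow> Ym Y \<tau> \<omega>"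
        by (rule filterlim_compose[OF _ grid_point_tendsto_left[OF t2]])
    qed
    then show ?case unfolding jump_sum_def by (rule limI)
  qed
  moreover have "(\<lambda>\<omega>. lim (\<lambda>n. f n \<omega>)) \<in> borel_measurable M"
    by (rule borel_measurable_lim_metric[OF fm])
  ultimately show ?thesis by (rule measurable_M_AE[rotated])
qed

text \<open>The assumed measurability turns the lower integral of the compensator formula into an
  expectation. Signed fields are treated through their positive and negative parts, each of which
  needs this measurability separately.\<close>

lemma jump_sum_expectation_nonneg:
  assumes D: "field D" "\<And>r \<omega> y. 0 \<le> D r \<omega> y" and i: "integrable mu (flat D)"
    and s: "s \<in> {t..T}" and m: "jump_sum D s \<in> borel_measurable M"
  shows "integrable M (jump_sum D s)" "(\<integral>\<omega>. jump_sum D s \<omega> \<partial>M) = (\<integral>u. indicator {s<..} (snd (fst u)) * flat D u \<partial>mu)"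
    "integrable mu (\<lambda>u. indicator {s<..} (snd (fst u)) * flat D u)"
proof -
  define Ds where "Ds r \<omega> y = (if s < r then D r \<omega> y else 0)" for r \<omega> y
  have Ds: "field Ds" unfolding Ds_def by (rule field_after[OF D(1)])
  have fl: "flat Ds = (\<lambda>u. indicator {s<..} (snd (fst u)) * flat D u)"
    by (auto simp: flat_def Ds_def fun_eq_iff)
  show ii: "integrable mu (\<lambda>u. indicator {s<..} (snd (fst u)) * flat D u)"
    unfolding fl[symmetric]
    by (rule Bochner_Integration.integrable_bound[OF i field_mu[OF Ds]]) (auto simp: fl indicator_def)
  have fe: "field (\<lambda>r \<omega> y. ennreal (Ds r \<omega> y))"
    by (rule field_lift[OF Ds]) measurable
  have "(\<integral>\<^sup>+\<omega>. ennreal (jump_sum D s \<omega>) \<partial>M) = (\<integral>\<^sup>+\<omega>. (\<Sum>\<tau>\<in>J \<omega>. ennreal (Ds \<tau> \<omega> (X \<tau> \<omega>))) \<partial>M)"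
  proof (rule nn_integral_cong)
    fix \<omega> assume "\<omega> \<in> space M"
    then have fin: "finite (J \<omega>)" using finite_J by simp
    have "jump_sum D s \<omega> = (\<Sum>\<tau>\<in>J \<omega>. Ds \<tau> \<omega> (X \<tau> \<omega>))"
      unfolding jump_sum_def Ds_def using fin by (subst sum.inter_restrict) (auto intro!: sum.cong)
    then show "ennreal (jump_sum D s \<omega>) = (\<Sum>\<tau>\<in>J \<omega>. ennreal (Ds \<tau> \<omega> (X \<tau> \<omega>)))"
      using D(2) by (simp add: sum_ennreal Ds_def)
  qed
  also have "\<dots> = (\<integral>\<^sup>+u. ennreal (flat Ds u) \<partial>mu)"
    using compensator_formula[OF fe] by (simp add: flat_def)
  also have "\<dots> = ennreal (\<integral>u. flat Ds u \<partial>mu)"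
    by (intro nn_integral_eq_integral) (use ii D(2) in \<open>simp_all add: fl\<close>, simp add: flat_def)
  finally have eq: "(\<integral>\<^sup>+\<omega>. ennreal (jump_sum D s \<omega>) \<partial>M) = ennreal (\<integral>u. flat Ds u \<partial>mu)" .
  have nn: "0 \<le> jump_sum D s \<omega>" for \<omega> using D(2) by (auto simp: jump_sum_def intro: sum_nonneg)
  show "integrable M (jump_sum D s)"
    using m eq nn by (intro integrableI_bounded) auto
  show "(\<integral>\<omega>. jump_sum D s \<omega> \<partial>M) = (\<integral>u. indicator {s<..} (snd (fst u)) * flat D u \<partial>mu)"
    using eq nn m D(2) unfolding fl[symmetric]
    by (subst integral_eq_nn_integral) (auto simp: flat_def Ds_def intro!: enn2real_ennreal integral_nonneg_AE)
qed

lemma integrable_mu_fst: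
  fixes f :: "'w \<times> real \<Rightarrow> real"
  assumes f: "integrable PM f" shows "integrable mu (\<lambda>u. f (fst u))"
proof (rule integrableI_bounded)
  have [measurable]: "f \<in> borel_measurable PM" using f by simp
  show "(\<lambda>u. f (fst u)) \<in> borel_measurable mu" by (rule measurable_mu) measurable
  have "(\<integral>\<^sup>+u. ennreal (norm (f (fst u))) \<partial>mu) = (\<integral>\<^sup>+p. ennreal (norm (f p)) * emeasure (kernel p) (space (kernel p)) \<partial>PM)"
    by (subst nn_integral_mu) auto
  also have "\<dots> \<le> (\<integral>\<^sup>+p. ennreal (norm (f p)) * ennreal K \<partial>PM)"
  proof (rule nn_integral_mono, rule mult_left_mono)
    fix p assume p: "p \<in> space PM"
    show "emeasure (kernel p) (space (kernel p)) \<le> ennreal K"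
      using PK.bound_k[OF p] sets_eq_imp_space_eq[OF PK.sets_k[OF p]] by simp
  qed simp
  also have "\<dots> = (\<integral>\<^sup>+p. ennreal (norm (f p)) \<partial>PM) * ennreal K"
    by (rule nn_integral_multc) measurable
  also have "\<dots> < \<infinity>"
    using f by (auto simp: integrable_iff_bounded ennreal_mult_less_top)
  finally show "(\<integral>\<^sup>+u. ennreal (norm (f (fst u))) \<partial>mu) < \<infinity>" .
qed

lemma Ym_PM: "progressive F t T Y \<Longrightarrow> (\<lambda>p. Ym Y (snd p) (fst p)) \<in> borel_measurable PM"
  using measurable_compose[OF id_PA_PM Ym_PA[OF progressive_adapted]] by simp

lemma Ym_AE:
  assumes lin: "linear_bsde g Y Z"
  shows "AE p in PM. Ym Y (snd p) (fst p) = Y (snd p) (fst p)"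
proof (rule AE_PM)
  note [measurable] = Ym_PM[OF linear_bsdeD(1)[OF lin]] progressive_PM[OF linear_bsdeD(1)[OF lin]]
  show "{p \<in> space PM. Ym Y (snd p) (fst p) = Y (snd p) (fst p)} \<in> sets PM" by measurable
  show "AE \<omega> in M. AE r in time. Ym Y (snd (\<omega>, r)) (fst (\<omega>, r)) = Y (snd (\<omega>, r)) (fst (\<omega>, r))"
    using linear_bsde_path[OF lin]
  proof eventually_elim
    case (elim \<omega>)
    then have "finite (J \<omega>)" using finite_J by (simp add: path_equation_def)
    then show ?case
      by (rule AE_time_except) (use path_Ym[OF elim] in auto)
  qed
qed

text \<open>This is the expectation of \<open>path_square\<close>. The drift contributes
  \<open>2 * Y * (g + comp Z)\<close>, the jumps contribute \<open>2 * Ym * comp Z\<close> and the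
  squared norm of \<open>Z\<close>; since \<open>Ym = Y\<close> at almost every time, the cross
  terms cancel.\<close>

theorem energy_identity:
  assumes lin: "linear_bsde g Y Z" and s: "s \<in> {t..T}" and T2: "integrable M (\<lambda>\<omega>. (Y T \<omega>)\<^sup>2)"
  shows "integrable M (\<lambda>\<omega>. (Y s \<omega>)\<^sup>2)"
    and "(\<integral>\<omega>. (Y s \<omega>)\<^sup>2 \<partial>M) + (\<integral>u. indicator {s<..} (snd (fst u)) * (flat Z u)\<^sup>2 \<partial>mu)
      = (\<integral>\<omega>. (Y T \<omega>)\<^sup>2 \<partial>M) + 2 * (\<integral>p. indicator {s<..} (snd p) * (Y (snd p) (fst p) * g (snd p) (fst p)) \<partial>PM)"
    and "integrable mu (\<lambda>u. indicator {s<..} (snd (fst u)) * (flat Z u)\<^sup>2)"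
proof -
  note D = linear_bsdeD[OF lin]
  note [measurable] = Ym_PM[OF D(1)] progressive_PM[OF D(1)] D(5)
  define H where "H = (\<lambda>r \<omega> y. 2 * Ym Y r \<omega> * Z r \<omega> y + (Z r \<omega> y)\<^sup>2)"
  \<comment> \<open>\<open>H\<close> has no sign. Its positive and negative parts are still
    continuous in \<open>Ym\<close> and vanish for a zero jump, so each of their jump sums is
    measurable.\<close>
  define H1 where "H1 = (\<lambda>r \<omega> y. max 0 (H r \<omega> y))"
  define H2 where "H2 = (\<lambda>r \<omega> y. max 0 (- H r \<omega> y))"
  let ?i = "\<lambda>u::('w \<times> real) \<times> 'g. indicator {s<..} (snd (fst u)) :: real"
  have fY: "field (\<lambda>r \<omega> y. Ym Y r \<omega>)"
    by (intro field_predictable Ym_PA progressive_adapted D)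
  have fYZ: "field (\<lambda>r \<omega> y. Ym Y r \<omega> * Z r \<omega> y)" by (intro field_algebra fY D)
  have fH: "field H"
    using field_algebra(1)[OF field_scale[OF fYZ, of 2] field_square[OF D(2)]]
    unfolding H_def by (simp add: mult.assoc)
  have fH12: "field H1" "field H2"
    unfolding H1_def H2_def by (rule field_lift[OF fH]; measurable)+
  have Ym2: "integrable PM (\<lambda>p. (Ym Y (snd p) (fst p))\<^sup>2)"
    by (rule integrable_cong_AE_imp[OF D(3)], measurable) (use Ym_AE[OF lin] in \<open>eventually_elim, simp\<close>)
  have iYZ: "integrable mu (flat (\<lambda>r \<omega> y. Ym Y r \<omega> * Z r \<omega> y))"
    using integrable_square_mult[OF field_mu[OF fY] field_mu[OF D(2)] _ D(4)] integrable_mu_fst[OF Ym2]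
    by (simp add: flat_def)
  have flatH: "flat H = (\<lambda>u. 2 * flat (\<lambda>r \<omega> y. Ym Y r \<omega> * Z r \<omega> y) u + (flat Z u)\<^sup>2)"
    by (auto simp: H_def flat_def fun_eq_iff)
  have iH: "integrable mu (flat H)"
    unfolding flatH using iYZ D(4) by simp
  have iH12: "integrable mu (flat H1)" "integrable mu (flat H2)"
  proof -
    have "flat H1 = (\<lambda>u. max 0 (flat H u))" "flat H2 = (\<lambda>u. max 0 (- flat H u))"
      by (auto simp: H1_def H2_def flat_def)
    then show "integrable mu (flat H1)" "integrable mu (flat H2)" using iH by auto
  qed
  have cont: "isCont (\<lambda>u. max 0 (2 * u * z + z\<^sup>2)) u" "isCont (\<lambda>u. max 0 (- (2 * u * z + z\<^sup>2))) u" for u z :: real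
    unfolding isCont_def by (intro tendsto_max tendsto_intros)+
  have mH12: "jump_sum H1 s \<in> borel_measurable M" "jump_sum H2 s \<in> borel_measurable M"
    unfolding H1_def H2_def H_def
    by (rule jump_functional_measurable[OF lin s, of "\<lambda>u z. max 0 (2 * u * z + z\<^sup>2)", OF _ _ cont(1)];
        (measurable | simp))
      (rule jump_functional_measurable[OF lin s, of "\<lambda>u z. max 0 (- (2 * u * z + z\<^sup>2))", OF _ _ cont(2)];
        (measurable | simp))
  note E1 = jump_sum_expectation_nonneg[OF fH12(1) _ iH12(1) s mH12(1)]
  note E2 = jump_sum_expectation_nonneg[OF fH12(2) _ iH12(2) s mH12(2)]
  have nn: "0 \<le> H1 r \<omega> y" "0 \<le> H2 r \<omega> y" for r \<omega> y by (simp_all add: H1_def H2_def)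
  have H_diff: "jump_sum H s \<omega> = jump_sum H1 s \<omega> - jump_sum H2 s \<omega>" for \<omega>
    unfolding jump_sum_def sum_subtractf[symmetric] by (intro sum.cong) (auto simp: H1_def H2_def)
  have flat_diff: "?i u * flat H u = ?i u * flat H1 u - ?i u * flat H2 u" for u
    by (auto simp: H1_def H2_def flat_def indicator_def)
  have iJH: "integrable M (jump_sum H s)"
    unfolding H_diff[abs_def] using E1(1) E2(1) nn by simp
  have EJH: "(\<integral>\<omega>. jump_sum H s \<omega> \<partial>M) = (\<integral>u. ?i u * flat H u \<partial>mu)"
    unfolding H_diff flat_diff using E1 E2 nn by simp
  have ind: "integrable mu (\<lambda>u. ?i u * f u)" if "integrable mu f" for f :: "_ \<Rightarrow> real"
  proof (rule Bochner_Integration.integrable_bound[OF that])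
    have "(\<lambda>u. snd (fst u)) \<in> borel_measurable mu"
      by (rule measurable_mu) (rule measurable_compose[OF measurable_fst measurable_compose[OF id_PA_PM PA_snd]])
    then show "(\<lambda>u. ?i u * f u) \<in> borel_measurable mu"
      using that by (auto intro!: borel_measurable_times measurable_compose[where N=borel and g="indicator {s<..}"])
  qed (auto simp: indicator_def)
  show iZ2: "integrable mu (\<lambda>u. ?i u * (flat Z u)\<^sup>2)" by (rule ind[OF D(4)])
  have EH: "(\<integral>u. ?i u * flat H u \<partial>mu) = 2 * (\<integral>u. ?i u * flat (\<lambda>r \<omega> y. Ym Y r \<omega> * Z r \<omega> y) u \<partial>mu) + (\<integral>u. ?i u * (flat Z u)\<^sup>2 \<partial>mu)"
    unfolding flatH distrib_left using iZ2 ind[OF iYZ] by (subst Bochner_Integration.integral_add) (auto simp: mult.left_commute[of _ 2])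
  have cross: "integrable PM (\<lambda>p. Y (snd p) (fst p) * comp Z p)"
    "(\<integral>p. indicator {s<..} (snd p) * (Y (snd p) (fst p) * comp Z p) \<partial>PM) = (\<integral>u. ?i u * flat (\<lambda>r \<omega> y. Ym Y r \<omega> * Z r \<omega> y) u \<partial>mu)"
  proof -
    let ?G = "\<lambda>r \<omega> y. if s < r then Ym Y r \<omega> * Z r \<omega> y else 0"
    have fG: "field ?G" by (rule field_after[OF fYZ])
    have flG: "flat ?G = (\<lambda>u. ?i u * flat (\<lambda>r \<omega> y. Ym Y r \<omega> * Z r \<omega> y) u)"
      by (auto simp: flat_def indicator_def fun_eq_iff)
    have iG: "integrable mu (flat ?G)" unfolding flG by (rule ind[OF iYZ])
    have cG: "comp ?G p = indicator {s<..} (snd p) * (Ym Y (snd p) (fst p) * comp Z p)" for p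
      by (simp add: comp_def indicator_def)
    have c1: "comp (\<lambda>r \<omega> y. Ym Y r \<omega> * Z r \<omega> y) p = Ym Y (snd p) (fst p) * comp Z p" for p
      by (simp add: comp_def)
    have i1: "integrable PM (\<lambda>p. Ym Y (snd p) (fst p) * comp Z p)"
      using integrable_comp(1)[OF fYZ iYZ] by (simp add: c1[abs_def] c1)
    have [measurable]: "comp Z \<in> borel_measurable PM"
      using linear_bsde_integrable(3)[OF lin] by simp
    have [measurable]: "(\<lambda>p. indicator {s<..} (snd p) :: real) \<in> borel_measurable PM"
      by (rule measurable_compose[OF measurable_compose[OF id_PA_PM PA_snd]]) simp
    show "integrable PM (\<lambda>p. Y (snd p) (fst p) * comp Z p)"
      by (rule integrable_cong_AE_imp[OF i1], measurable) (use Ym_AE[OF lin] in \<open>eventually_elim, simp\<close>)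
    have "(\<integral>p. indicator {s<..} (snd p) * (Y (snd p) (fst p) * comp Z p) \<partial>PM) = (\<integral>p. comp ?G p \<partial>PM)"
      unfolding cG
    proof (rule integral_cong_AE)
      show "AE p in PM. indicator {s<..} (snd p) * (Y (snd p) (fst p) * comp Z p)
        = indicator {s<..} (snd p) * (Ym Y (snd p) (fst p) * comp Z p)"
        using Ym_AE[OF lin] by eventually_elim simp
    qed measurable
    also have "\<dots> = (\<integral>u. flat ?G u \<partial>mu)" by (rule integrable_comp(2)[OF fG iG])
    finally show "(\<integral>p. indicator {s<..} (snd p) * (Y (snd p) (fst p) * comp Z p) \<partial>PM)
      = (\<integral>u. ?i u * flat (\<lambda>r \<omega> y. Ym Y r \<omega> * Z r \<omega> y) u \<partial>mu)" unfolding flG .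
  qed
  have iYg: "integrable PM (\<lambda>p. Y (snd p) (fst p) * g (snd p) (fst p))"
    by (rule integrable_square_mult) (use D in auto)
  note P1 = integral_PM_after[OF iYg, of s] and P2 = integral_PM_after[OF cross(1), of s]
  have eq: "AE \<omega> in M. (Y T \<omega>)\<^sup>2 + 2 * (LINT r:{s<..T}|lborel. Y r \<omega> * g r \<omega>)
      + 2 * (LINT r:{s<..T}|lborel. Y r \<omega> * comp Z (\<omega>, r)) - jump_sum H s \<omega> = (Y s \<omega>)\<^sup>2"
    using linear_bsde_path[OF lin] AE_PM_integrable[OF iYg] AE_PM_integrable[OF cross(1)]
  proof eventually_elim
    case (elim \<omega>)
    have "(LINT r:{s<..T}|lborel. Y r \<omega> * drift g Z r \<omega>)
      = (LINT r:{s<..T}|lborel. Y r \<omega> * g r \<omega>) + (LINT r:{s<..T}|lborel. Y r \<omega> * comp Z (\<omega>, r))"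
      unfolding drift_def distrib_left using s elim(2,3)
      by (intro set_integral_add(2) set_integrable_subset[of _ "{t<..T}" _ "{s<..T}"]) auto
    then show ?case using path_square[OF elim(1) s] unfolding H_def by linarith
  qed
  have Ys: "(\<lambda>\<omega>. (Y s \<omega>)\<^sup>2) \<in> borel_measurable M"
    using progressive_adapted[OF D(1)] s by (auto intro!: borel_measurable_power measurable_F_M)
  have iA: "integrable M (\<lambda>\<omega>. (Y T \<omega>)\<^sup>2 + 2 * (LINT r:{s<..T}|lborel. Y r \<omega> * g r \<omega>)
      + 2 * (LINT r:{s<..T}|lborel. Y r \<omega> * comp Z (\<omega>, r)) - jump_sum H s \<omega>)"
    using T2 P1(1) P2(1) iJH s by simp
  show "integrable M (\<lambda>\<omega>. (Y s \<omega>)\<^sup>2)"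
    using iA Ys eq by (rule integrable_cong_AE_imp)
  have "(\<integral>\<omega>. (Y s \<omega>)\<^sup>2 \<partial>M) = (\<integral>\<omega>. (Y T \<omega>)\<^sup>2 + 2 * (LINT r:{s<..T}|lborel. Y r \<omega> * g r \<omega>)
      + 2 * (LINT r:{s<..T}|lborel. Y r \<omega> * comp Z (\<omega>, r)) - jump_sum H s \<omega> \<partial>M)"
    using iA Ys by (intro integral_cong_AE) (auto, use eq in \<open>eventually_elim, simp\<close>)
  also have "\<dots> = (\<integral>\<omega>. (Y T \<omega>)\<^sup>2 \<partial>M) + 2 * (\<integral>\<omega>. (LINT r:{s<..T}|lborel. Y r \<omega> * g r \<omega>) \<partial>M)
      + 2 * (\<integral>\<omega>. (LINT r:{s<..T}|lborel. Y r \<omega> * comp Z (\<omega>, r)) \<partial>M) - (\<integral>\<omega>. jump_sum H s \<omega> \<partial>M)"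
    using T2 P1(1) P2(1) iJH s by simp
  finally show "(\<integral>\<omega>. (Y s \<omega>)\<^sup>2 \<partial>M) + (\<integral>u. ?i u * (flat Z u)\<^sup>2 \<partial>mu)
      = (\<integral>\<omega>. (Y T \<omega>)\<^sup>2 \<partial>M) + 2 * (\<integral>p. indicator {s<..} (snd p) * (Y (snd p) (fst p) * g (snd p) (fst p)) \<partial>PM)"
    using P1(2) P2(2) EJH EH cross(2) s by simp
qed

end

section \<open>Weighted energy inequality and linearity of the equation\<close>

context jump_markov_started
begin

lemma weight_PM:
  fixes f :: "'w \<times> real \<Rightarrow> real"
  assumes f: "integrable PM f" and c: "continuous_on UNIV c"
  shows "integrable PM (\<lambda>p. c (snd p) * f p)"
    and "(\<integral>p. c (snd p) * f p \<partial>PM) = (LINT r:{t<..T}|lborel. c r * (\<integral>\<omega>. f (\<omega>, r) \<partial>M))"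
    and "set_integrable lborel {t<..T} (\<lambda>r. c r * (\<integral>\<omega>. f (\<omega>, r) \<partial>M))"
proof -
  have "bounded (c ` {t..T})"
    by (intro compact_imp_bounded compact_continuous_image) (auto intro: continuous_on_subset[OF c])
  then obtain B where "\<forall>y\<in>c ` {t..T}. norm y \<le> B" unfolding bounded_iff by blast
  then have B: "\<bar>c r\<bar> \<le> B" if "r \<in> {t..T}" for r using that by auto
  have cm: "c \<in> borel_measurable borel" by (rule borel_measurable_continuous_onI[OF c])
  have [measurable]: "(\<lambda>p. c (snd p)) \<in> borel_measurable PM"
    by (rule measurable_compose[OF measurable_compose[OF id_PA_PM PA_snd] cm])
  show i: "integrable PM (\<lambda>p. c (snd p) * f p)"
  proof (rule Bochner_Integration.integrable_bound[of _ "\<lambda>p. B * f p"])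
    show "AE p in PM. norm (c (snd p) * f p) \<le> norm (B * f p)"
    proof (rule AE_I2)
      fix p assume "p \<in> space PM"
      then have "\<bar>c (snd p)\<bar> \<le> B" by (intro B) (auto simp: space_pair_measure)
      then show "norm (c (snd p) * f p) \<le> norm (B * f p)"
        by (auto simp: abs_mult intro!: mult_right_mono)
    qed
  qed (use f in auto)
  have i': "integrable PM (\<lambda>(\<omega>, r). c r * f (\<omega>, r))" using i by (simp add: case_prod_beta')
  show "(\<integral>p. c (snd p) * f p \<partial>PM) = (LINT r:{t<..T}|lborel. c r * (\<integral>\<omega>. f (\<omega>, r) \<partial>M))"
    unfolding integral_time[symmetric] using PMs.integral_snd[OF i'] by (simp add: case_prod_beta')
  show "set_integrable lborel {t<..T} (\<lambda>r. c r * (\<integral>\<omega>. f (\<omega>, r) \<partial>M))"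
    unfolding integrable_time_iff[symmetric] using PMs.integrable_snd[OF i'] by (simp add: case_prod_beta')
qed

lemma tail_PM:
  fixes f :: "'w \<times> real \<Rightarrow> real"
  assumes f: "integrable PM f" and s: "t \<le> s"
  shows "(\<integral>p. indicator {s<..} (snd p) * f p \<partial>PM) = (LINT r:{s<..T}|lborel. (\<integral>\<omega>. f (\<omega>, r) \<partial>M))"
proof -
  have i': "integrable PM (\<lambda>(\<omega>, r). indicator {s<..} r * f (\<omega>, r))"
    using integral_PM_after(3)[OF f s] by (simp add: case_prod_beta')
  show ?thesis
    unfolding integral_time_after[OF s] using PMs.integral_snd[OF i'] by (simp add: case_prod_beta')
qed

text \<open>The energy identity at time \<open>s\<close> is multiplied by \<open>W' s\<close> and
  integrated over \<open>s\<close>; exchanging the order of integration turns the double integrals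
  into weights \<open>W\<close>. The boundary term, \<open>W t\<close> times the second moment of
  \<open>Y t\<close>, is discarded, which explains both the inequality and the condition
  \<open>0 \<le> W t\<close>.\<close>

theorem weighted_energy:
  assumes lin: "linear_bsde g Y Z" and T2: "integrable M (\<lambda>\<omega>. (Y T \<omega>)\<^sup>2)"
    and W: "\<And>r. (W has_real_derivative W' r) (at r)" and W': "continuous_on UNIV W'" and W0: "0 \<le> W t"
  shows "(\<integral>p. W' (snd p) * (Y (snd p) (fst p))\<^sup>2 \<partial>PM) + (\<integral>p. W (snd p) * comp (\<lambda>r \<omega> y. (Z r \<omega> y)\<^sup>2) p \<partial>PM)
    \<le> W T * (\<integral>\<omega>. (Y T \<omega>)\<^sup>2 \<partial>M) + 2 * (\<integral>p. W (snd p) * (Y (snd p) (fst p) * g (snd p) (fst p)) \<partial>PM)"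
proof -
  note D = linear_bsdeD[OF lin]
  have Wc: "continuous_on UNIV W"
    using W by (meson DERIV_isCont continuous_at_imp_continuous_on)
  let ?Z2 = "\<lambda>r \<omega> y. (Z r \<omega> y)\<^sup>2"
  have fZ2: "field ?Z2" by (rule field_square[OF D(2)])
  have iZ2: "integrable mu (flat ?Z2)" using D(4) by (simp add: flat_def)
  note iC = integrable_comp(1)[OF fZ2 iZ2]
  have iYg: "integrable PM (\<lambda>p. Y (snd p) (fst p) * g (snd p) (fst p))"
    by (rule integrable_square_mult[OF progressive_PM[OF D(1)] D(5,3,6)])
  define A where "A s = (\<integral>\<omega>. (Y s \<omega>)\<^sup>2 \<partial>M)" for s
  define \<zeta> where "\<zeta> r = (\<integral>\<omega>. comp ?Z2 (\<omega>, r) \<partial>M)" for r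
  define \<rho> where "\<rho> r = (\<integral>\<omega>. Y r \<omega> * g r \<omega> \<partial>M)" for r
  have one: "continuous_on UNIV (\<lambda>_::real. 1::real)" by simp
  have \<zeta>i: "set_integrable lborel {t<..T} \<zeta>" and \<rho>i: "set_integrable lborel {t<..T} \<rho>"
    using weight_PM(3)[OF iC one] weight_PM(3)[OF iYg one] by (simp_all add: \<zeta>_def[abs_def] \<rho>_def[abs_def])
  have E: "A s + (LINT r:{s<..T}|lborel. \<zeta> r) = A T + 2 * (LINT r:{s<..T}|lborel. \<rho> r)" if s: "s \<in> {t..T}" for s
  proof -
    have fG: "field (\<lambda>r \<omega> y. if s < r then ?Z2 r \<omega> y else 0)" by (rule field_after[OF fZ2])
    have flG: "flat (\<lambda>r \<omega> y. if s < r then ?Z2 r \<omega> y else 0) = (\<lambda>u. indicator {s<..} (snd (fst u)) * (flat Z u)\<^sup>2)"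
      by (auto simp: flat_def indicator_def fun_eq_iff)
    have "(\<integral>u. indicator {s<..} (snd (fst u)) * (flat Z u)\<^sup>2 \<partial>mu)
      = (\<integral>p. comp (\<lambda>r \<omega> y. if s < r then ?Z2 r \<omega> y else 0) p \<partial>PM)"
      unfolding flG[symmetric]
      by (rule integrable_comp(2)[OF fG, symmetric]) (simp add: flG energy_identity(3)[OF lin s T2])
    also have "\<dots> = (\<integral>p. indicator {s<..} (snd p) * comp ?Z2 p \<partial>PM)"
      by (rule Bochner_Integration.integral_cong) (simp_all add: comp_def indicator_def)
    also have "\<dots> = (LINT r:{s<..T}|lborel. \<zeta> r)"
      unfolding \<zeta>_def using s by (intro tail_PM iC) simp
    finally show ?thesis
      using energy_identity(2)[OF lin s T2] tail_PM[OF iYg, of s] s by (simp add: A_def \<rho>_def)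
  qed
  have FTC: "(LINT s:{t<..T}|lborel. W' s) = W T - W t" and W'i: "set_integrable lborel {t<..T} W'"
  proof -
    have "(\<integral>r. W' r * indicator {t..T} r \<partial>lborel) = W T - W t"
      by (rule integral_FTC_Icc_real)
        (use t_less W W' in \<open>auto simp: continuous_on_eq_continuous_at\<close>)
    moreover have "(LINT s:{t<..T}|lborel. W' s) = (\<integral>r. W' r * indicator {t..T} r \<partial>lborel)"
      unfolding set_lebesgue_integral_def
      by (rule integral_discrete_difference[of "{t}"]) (auto simp: indicator_def)
    ultimately show "(LINT s:{t<..T}|lborel. W' s) = W T - W t" by simp
    show "set_integrable lborel {t<..T} W'"
      by (rule set_integrable_subset[of _ "{t..T}"])
        (auto intro!: borel_integrable_atLeastAtMost' continuous_on_subset[OF W'])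
  qed
  note wz = weight_fubini[OF less_imp_le[OF t_less] \<zeta>i W W'] and wr = weight_fubini[OF less_imp_le[OF t_less] \<rho>i W W']
  have "(LINT s:{t<..T}|lborel. W' s * A s)
    = (LINT s:{t<..T}|lborel. A T * W' s + 2 * (W' s * (LINT r:{s<..T}|lborel. \<rho> r)) - W' s * (LINT r:{s<..T}|lborel. \<zeta> r))"
    unfolding set_lebesgue_integral_def[of _ "{t<..T}"]
  proof (rule Bochner_Integration.integral_cong[OF refl])
    fix s
    have "W' s * A s = A T * W' s + 2 * (W' s * (LINT r:{s<..T}|lborel. \<rho> r)) - W' s * (LINT r:{s<..T}|lborel. \<zeta> r)"
      if "s \<in> {t<..T}"
    proof -
      have As: "A s = A T + 2 * (LINT r:{s<..T}|lborel. \<rho> r) - (LINT r:{s<..T}|lborel. \<zeta> r)" using E[of s] that by simp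
      show ?thesis unfolding As by (simp add: algebra_simps)
    qed
    then show "indicator {t<..T} s *\<^sub>R (W' s * A s) = indicator {t<..T} s *\<^sub>R
      (A T * W' s + 2 * (W' s * (LINT r:{s<..T}|lborel. \<rho> r)) - W' s * (LINT r:{s<..T}|lborel. \<zeta> r))"
      by (auto simp: indicator_def)
  qed
  also have "\<dots> = A T * (W T - W t) + 2 * (LINT s:{t<..T}|lborel. W' s * (LINT r:{s<..T}|lborel. \<rho> r))
      - (LINT s:{t<..T}|lborel. W' s * (LINT r:{s<..T}|lborel. \<zeta> r))"
    using W'i wz(3) wr(3) FTC by (simp add: set_integral_add set_integral_diff)
  finally have I: "(LINT s:{t<..T}|lborel. W' s * A s) = A T * (W T - W t)
      + 2 * ((LINT r:{t<..T}|lborel. W r * \<rho> r) - W t * (LINT r:{t<..T}|lborel. \<rho> r))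
      - ((LINT r:{t<..T}|lborel. W r * \<zeta> r) - W t * (LINT r:{t<..T}|lborel. \<zeta> r))"
    unfolding wz(1) wr(1) .
  have "W t * A t + W t * (LINT r:{t<..T}|lborel. \<zeta> r) = W t * A T + 2 * (W t * (LINT r:{t<..T}|lborel. \<rho> r))"
    using arg_cong[OF E[of t], of "\<lambda>z. W t * z"] t_less by (simp add: distrib_left)
  moreover have "0 \<le> W t * A t" using W0 by (simp add: A_def)
  ultimately have "(LINT s:{t<..T}|lborel. W' s * A s) + (LINT r:{t<..T}|lborel. W r * \<zeta> r)
    \<le> W T * A T + 2 * (LINT r:{t<..T}|lborel. W r * \<rho> r)"
    unfolding I by (simp add: algebra_simps)
  then show ?thesis
    unfolding weight_PM(2)[OF D(3) W'] weight_PM(2)[OF iC Wc] weight_PM(2)[OF iYg Wc] A_def \<zeta>_def \<rho>_def by simp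
qed

lemma progressive_lincomb:
  assumes "progressive F t T Y" "progressive F t T Y'"
  shows "progressive F t T (\<lambda>r \<omega>. a * Y r \<omega> + b * Y' r \<omega>)"
  unfolding progressive_def case_prod_beta'
  by (intro ballI borel_measurable_add borel_measurable_times borel_measurable_const
    progressive_on[OF assms(1)] progressive_on[OF assms(2)])

lemma jump_sum_lincomb:
  "jump_sum (\<lambda>r \<omega> y. a * Z r \<omega> y + b * Z' r \<omega> y) s \<omega> = a * jump_sum Z s \<omega> + b * jump_sum Z' s \<omega>"
  unfolding jump_sum_def by (simp add: sum.distrib sum_distrib_left)

lemma field_lincomb:
  fixes Z Z' :: "real \<Rightarrow> 'w \<Rightarrow> 'g \<Rightarrow> real"
  assumes "field Z" "field Z'"
  shows "field (\<lambda>r \<omega> y. a * Z r \<omega> y + b * Z' r \<omega> y)"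
  by (intro field_algebra(1) field_scale assms)

lemma integrable_square_lincomb:
  fixes f g :: "'c \<Rightarrow> real"
  assumes [measurable]: "f \<in> borel_measurable N" "g \<in> borel_measurable N"
    and i: "integrable N (\<lambda>x. (f x)\<^sup>2)" "integrable N (\<lambda>x. (g x)\<^sup>2)"
  shows "integrable N (\<lambda>x. (a * f x + b * g x)\<^sup>2)"
proof -
  have "(\<lambda>x. (a * f x + b * g x)\<^sup>2) = (\<lambda>x. a\<^sup>2 * (f x)\<^sup>2 + b\<^sup>2 * (g x)\<^sup>2 + 2 * a * b * (f x * g x))"
    by (simp add: power2_eq_square algebra_simps)
  then show ?thesis using i integrable_square_mult[OF assms] by simp
qed

text \<open>The inner integral is linear only where both fields are integrable in \<open>y\<close>;
  this holds at almost every time, which suffices after integrating in time.\<close>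

lemma comp_lincomb:
  fixes Z Z' :: "real \<Rightarrow> 'w \<Rightarrow> 'g \<Rightarrow> real"
  assumes Z: "field Z" "integrable mu (flat Z)" and Z': "field Z'" "integrable mu (flat Z')"
  shows "AE \<omega> in M. \<forall>s\<in>{t..T}. (LINT r:{s<..T}|lborel. comp (\<lambda>r \<omega> y. a * Z r \<omega> y + b * Z' r \<omega> y) (\<omega>, r))
    = a * (LINT r:{s<..T}|lborel. comp Z (\<omega>, r)) + b * (LINT r:{s<..T}|lborel. comp Z' (\<omega>, r))"
proof -
  let ?L = "\<lambda>r \<omega> y. a * Z r \<omega> y + b * Z' r \<omega> y"
  have fL: "field ?L" by (rule field_lincomb[OF Z(1) Z'(1)])
  have iL: "integrable mu (flat ?L)"
    using Z(2) Z'(2) by (simp add: flat_def)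
  show ?thesis
    using AE_PM_D[OF integrable_comp(3)[OF Z]] AE_PM_D[OF integrable_comp(3)[OF Z']]
      AE_PM_integrable[OF integrable_comp(1)[OF Z]] AE_PM_integrable[OF integrable_comp(1)[OF Z']]
      AE_PM_integrable[OF integrable_comp(1)[OF fL iL]]
  proof eventually_elim
    case (elim \<omega>)
    have ae: "AE r in time. comp ?L (\<omega>, r) = a * comp Z (\<omega>, r) + b * comp Z' (\<omega>, r)"
      using elim(1,2) by eventually_elim (simp add: comp_def)
    show ?case
    proof
      fix s assume s: "s \<in> {t..T}"
      have si: "set_integrable lborel {s<..T} f" if "set_integrable lborel {t<..T} f" for f :: "real \<Rightarrow> real"
        using s by (intro set_integrable_subset[OF that]) auto
      have "(LINT r:{s<..T}|lborel. comp ?L (\<omega>, r)) = (LINT r:{s<..T}|lborel. a * comp Z (\<omega>, r) + b * comp Z' (\<omega>, r))"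
        unfolding set_lebesgue_integral_def
      proof (rule integral_cong_AE)
        show "AE r in lborel. indicator {s<..T} r *\<^sub>R comp ?L (\<omega>, r) = indicator {s<..T} r *\<^sub>R (a * comp Z (\<omega>, r) + b * comp Z' (\<omega>, r))"
          using ae[unfolded AE_time] by eventually_elim (use s in \<open>auto simp: indicator_def\<close>)
        show "(\<lambda>r. indicator {s<..T} r *\<^sub>R comp ?L (\<omega>, r)) \<in> borel_measurable lborel"
          using si[OF elim(5)] unfolding set_integrable_def by (rule borel_measurable_integrable)
        have "set_integrable lborel {s<..T} (\<lambda>r. a * comp Z (\<omega>, r) + b * comp Z' (\<omega>, r))"
          using si[OF elim(3)] si[OF elim(4)] by (intro set_integral_add(1) set_integrable_mult_right) auto
        then show "(\<lambda>r. indicator {s<..T} r *\<^sub>R (a * comp Z (\<omega>, r) + b * comp Z' (\<omega>, r))) \<in> borel_measurable lborel"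
          unfolding set_integrable_def by (rule borel_measurable_integrable)
      qed
      then show "(LINT r:{s<..T}|lborel. comp ?L (\<omega>, r))
        = a * (LINT r:{s<..T}|lborel. comp Z (\<omega>, r)) + b * (LINT r:{s<..T}|lborel. comp Z' (\<omega>, r))"
        using si[OF elim(3)] si[OF elim(4)] by (simp add: set_integral_add(2))
    qed
  qed
qed

lemma linear_bsde_lincomb:
  assumes l: "linear_bsde g Y Z" and l': "linear_bsde g' Y' Z'"
  shows "linear_bsde (\<lambda>r \<omega>. a * g r \<omega> + b * g' r \<omega>) (\<lambda>r \<omega>. a * Y r \<omega> + b * Y' r \<omega>)
    (\<lambda>r \<omega> y. a * Z r \<omega> y + b * Z' r \<omega> y)"
proof -
  note D = linear_bsdeD[OF l] and D' = linear_bsdeD[OF l']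
  note m = progressive_PM[OF D(1)] progressive_PM[OF D'(1)]
  note iZ = integrable_mu_L1[OF D(2,4)] integrable_mu_L1[OF D'(2,4)]
  have "AE \<omega> in M. \<forall>s\<in>{t..T}. a * Y s \<omega> + b * Y' s \<omega> = (a * Y T \<omega> + b * Y' T \<omega>)
      + (LINT r:{s<..T}|lborel. a * g r \<omega> + b * g' r \<omega>)
      - (jump_sum (\<lambda>r \<omega> y. a * Z r \<omega> y + b * Z' r \<omega> y) s \<omega>
        - (LINT r:{s<..T}|lborel. comp (\<lambda>r \<omega> y. a * Z r \<omega> y + b * Z' r \<omega> y) (\<omega>, r)))"
    using D(7) D'(7) comp_lincomb[OF D(2) iZ(1) D'(2) iZ(2), of a b]
      AE_PM_integrable[OF linear_bsde_integrable(2)[OF l]] AE_PM_integrable[OF linear_bsde_integrable(2)[OF l']]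
  proof eventually_elim
    case (elim \<omega>)
    show ?case
    proof
      fix s assume s: "s \<in> {t..T}"
      have si: "set_integrable lborel {s<..T} f" if "set_integrable lborel {t<..T} f" for f :: "real \<Rightarrow> real"
        using s by (intro set_integrable_subset[OF that]) auto
      have g: "(LINT r:{s<..T}|lborel. a * g r \<omega> + b * g' r \<omega>)
        = a * (LINT r:{s<..T}|lborel. g r \<omega>) + b * (LINT r:{s<..T}|lborel. g' r \<omega>)"
        using si[OF elim(4)] si[OF elim(5)] by (simp add: set_integral_add(2))
      show "a * Y s \<omega> + b * Y' s \<omega> = (a * Y T \<omega> + b * Y' T \<omega>)
        + (LINT r:{s<..T}|lborel. a * g r \<omega> + b * g' r \<omega>)
        - (jump_sum (\<lambda>r \<omega> y. a * Z r \<omega> y + b * Z' r \<omega> y) s \<omega>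
          - (LINT r:{s<..T}|lborel. comp (\<lambda>r \<omega> y. a * Z r \<omega> y + b * Z' r \<omega> y) (\<omega>, r)))"
        unfolding g jump_sum_lincomb bspec[OF elim(3) s]
        using bspec[OF elim(1) s] bspec[OF elim(2) s] by algebra
    qed
  qed
  then show ?thesis
    unfolding linear_bsde_def
    using D D' m progressive_lincomb[OF D(1) D'(1)] field_lincomb[OF D(2) D'(2)]
      integrable_square_lincomb[OF m D(3) D'(3)]
      integrable_square_lincomb[OF field_mu[OF D(2)] field_mu[OF D'(2)] D(4) D'(4)]
      integrable_square_lincomb[OF D(5) D'(5) D(6) D'(6)]
    by (simp add: flat_def)
qed

end

section \<open>Martingale representation\<close>

context jump_markov_started
begin

lemma right_continuous_progressive:
  assumes Y: "adapted Y"
    and rc: "\<And>\<omega> r. \<omega> \<in> \<Omega> \<Longrightarrow> r \<in> {t..<T} \<Longrightarrow> ((\<lambda>s. Y s \<omega>) \<longlongrightarrow> Y r \<omega>) (at_right r)"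
  shows "progressive F t T Y"
  unfolding progressive_def case_prod_beta'
proof
  fix s assume s: "s \<in> {t..T}"
  \<comment> \<open>Floor plus one puts the grid point strictly to the right of \<open>r\<close>, as
    right continuity demands; the cut-off at \<open>s\<close> keeps it in the past of
    \<open>s\<close>, and for \<open>r = s\<close> it returns \<open>s\<close> itself.\<close>
  define pt where "pt n k = min s (t + real (Suc k) / real (Suc n))" for n k :: nat
  define ix where "ix n r = nat \<lfloor>(r - t) * real (Suc n)\<rfloor>" for n :: nat and r :: real
  let ?N = "F s \<Otimes>\<^sub>M restrict_space borel {t..s}"
  have pt: "pt n k \<in> {t..s}" for n k using s by (auto simp: pt_def)
  show "(\<lambda>p. Y (snd p) (fst p)) \<in> borel_measurable ?N"
  proof (rule borel_measurable_LIMSEQ_metric)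
    fix n
    have "(\<lambda>p. Y (pt n k) (fst p)) \<in> borel_measurable ?N" for k
    proof (rule measurable_compose[OF measurable_fst])
      show "Y (pt n k) \<in> borel_measurable (F s)"
      proof (rule measurable_F_mono)
        show "Y (pt n k) \<in> borel_measurable (F (pt n k))" using pt[of n k] s by (intro bspec[OF Y]) simp
        show "pt n k \<le> s" using pt[of n k] by simp
      qed
    qed
    moreover have "(\<lambda>p. ix n (snd p)) \<in> measurable ?N (count_space UNIV)"
    proof (rule measurable_compose[OF measurable_snd])
      show "ix n \<in> measurable (restrict_space borel {t..s}) (count_space UNIV)"
        unfolding ix_def by (rule measurable_restrict_space1) measurable
    qed
    ultimately show "(\<lambda>p. Y (pt n (ix n (snd p))) (fst p)) \<in> borel_measurable ?N"
      by (rule measurable_compose_countable)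
  next
    fix p assume "p \<in> space ?N"
    then obtain \<omega> r where p: "p = (\<omega>, r)" "\<omega> \<in> \<Omega>" "t \<le> r" "r \<le> s"
      by (cases p) (auto simp: space_pair_measure space_restrict_space)
    have "(\<lambda>n. Y (pt n (ix n r)) \<omega>) \<longlonglongrightarrow> Y r \<omega>"
    proof (cases "r = s")
      case True
      have "pt n (ix n r) = s" for n
      proof -
        have "(s - t) * real (Suc n) < real_of_int \<lfloor>(s - t) * real (Suc n)\<rfloor> + 1" by linarith
        also have "real_of_int \<lfloor>(s - t) * real (Suc n)\<rfloor> = real (ix n s)"
          unfolding ix_def using p True by (subst of_nat_nat) (auto simp: zero_le_mult_iff)
        finally have "s - t < real (Suc (ix n s)) / real (Suc n)"
          by (simp add: pos_less_divide_eq)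
        then show ?thesis unfolding pt_def True by linarith
      qed
      then show ?thesis using True by simp
    next
      case False
      have b: "r < pt n (ix n r)" "pt n (ix n r) \<le> r + 1 / real (Suc n)" for n
      proof -
        have e: "real_of_int \<lfloor>(r - t) * real (Suc n)\<rfloor> = real (ix n r)"
          unfolding ix_def using p by (subst of_nat_nat) (auto simp: zero_le_mult_iff)
        have "(r - t) * real (Suc n) < real (ix n r) + 1" "real (ix n r) \<le> (r - t) * real (Suc n)"
          unfolding e[symmetric] by linarith+
        then have "r - t < real (Suc (ix n r)) / real (Suc n)" "real (ix n r) / real (Suc n) \<le> r - t"
          by (simp_all add: pos_less_divide_eq pos_divide_le_eq)
        moreover have "real (Suc (ix n r)) / real (Suc n) = real (ix n r) / real (Suc n) + 1 / real (Suc n)"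
          by (simp add: add_divide_distrib)
        ultimately show "r < pt n (ix n r)" "pt n (ix n r) \<le> r + 1 / real (Suc n)"
          unfolding pt_def using False p by linarith+
      qed
      have "filterlim (\<lambda>n. pt n (ix n r)) (at_right r) sequentially"
        unfolding filterlim_at
      proof
        show "\<forall>\<^sub>F n in sequentially. pt n (ix n r) \<in> {r<..} \<and> pt n (ix n r) \<noteq> r"
          using b(1) by (auto intro!: always_eventually simp: less_imp_neq[symmetric])
        have "(\<lambda>n. r + 1 / real (Suc n)) \<longlonglongrightarrow> r + 0"
          by (intro tendsto_intros LIMSEQ_Suc[OF lim_1_over_n])
        then show "(\<lambda>n. pt n (ix n r)) \<longlonglongrightarrow> r"
          by (intro tendsto_sandwich[OF _ _ tendsto_const[of r], of "\<lambda>n. pt n (ix n r)" sequentially "\<lambda>n. r + 1 / real (Suc n)"])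
            (use b in \<open>auto intro!: always_eventually less_imp_le\<close>)
      qed
      from filterlim_compose[OF rc this] show ?thesis using p False s by auto
    qed
    then show "(\<lambda>n. Y (pt n (ix n (snd p))) (fst p)) \<longlonglongrightarrow> Y (snd p) (fst p)" using p by simp
  qed
qed

subsection \<open>The backward Kolmogorov equation\<close>

abbreviation SG :: "(real \<times> 'g) measure" where "SG \<equiv> restrict_space borel {0..T} \<Otimes>\<^sub>M \<Gamma>"

text \<open>The time-dependent generator of the jump process, acting in the state variable
  only.\<close>

definition gen :: "(real \<times> 'g \<Rightarrow> real) \<Rightarrow> real \<times> 'g \<Rightarrow> real" where
  "gen w p = (\<integral>z. (w (fst p, z) - w p) \<partial>v (fst p) (snd p))"

lemma space_SG: "space SG = {0..T} \<times> space \<Gamma>"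
  by (simp add: space_pair_measure space_restrict_space)

lemma kernel_SG: "bounded_kernel SG \<Gamma> (\<lambda>p. v (fst p) (snd p)) K"
proof
  show "space \<Gamma> \<noteq> {}" using x_space by auto
  show "0 < K" by (rule K_pos)
  show "sets (v (fst p) (snd p)) = sets \<Gamma>" if "p \<in> space SG" for p
    using that by (intro sets_v) (auto simp: space_SG)
  show "emeasure (v (fst p) (snd p)) (space \<Gamma>) \<le> ennreal K" if "p \<in> space SG" for p
    using that by (intro v_bound) (auto simp: space_SG)
  show "(\<lambda>p. emeasure (v (fst p) (snd p)) C) \<in> borel_measurable SG" if "C \<in> sets \<Gamma>" for C
    using measurable_v[OF that] by (simp add: case_prod_beta')
qed

lemma gen_measurable:
  assumes w: "w \<in> borel_measurable SG" shows "gen w \<in> borel_measurable SG"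
proof -
  interpret k: bounded_kernel SG \<Gamma> "\<lambda>p. v (fst p) (snd p)" K by (rule kernel_SG)
  have "(\<lambda>u. (fst (fst u), snd u)) \<in> SG \<Otimes>\<^sub>M \<Gamma> \<rightarrow>\<^sub>M SG"
    by (intro measurable_Pair measurable_snd measurable_compose[OF measurable_fst measurable_fst])
  from measurable_compose[OF this w]
  have "(\<lambda>u. w (fst (fst u), snd u) - w (fst u)) \<in> borel_measurable (SG \<Otimes>\<^sub>M \<Gamma>)"
    by (intro borel_measurable_diff measurable_compose[OF measurable_fst w])
  from k.integral_measurable[OF this] show ?thesis unfolding gen_def[abs_def] by simp
qed

lemma w_section: "w \<in> borel_measurable SG \<Longrightarrow> r \<in> {0..T} \<Longrightarrow> (\<lambda>z. w (r, z)) \<in> borel_measurable \<Gamma>"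
  by (rule measurable_compose[OF measurable_Pair1']) (simp_all add: space_restrict_space)

lemma finite_v: "r \<in> {0..T} \<Longrightarrow> y \<in> space \<Gamma> \<Longrightarrow> finite_measure (v r y)"
  and measure_v_le: "r \<in> {0..T} \<Longrightarrow> y \<in> space \<Gamma> \<Longrightarrow> measure (v r y) (space (v r y)) \<le> K"
proof -
  assume r: "r \<in> {0..T}" "y \<in> space \<Gamma>"
  have sp: "space (v r y) = space \<Gamma>" using sets_v[OF r] by (rule sets_eq_imp_space_eq)
  show "finite_measure (v r y)"
    by (rule finite_measureI) (use v_bound[OF r] in \<open>auto simp: sp top_unique\<close>)
  then interpret finite_measure "v r y" .
  show "measure (v r y) (space (v r y)) \<le> K"
    using v_bound[OF r] K_pos by (simp add: sp emeasure_eq_measure)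
qed

lemma gen_integrable:
  fixes w :: "real \<times> 'g \<Rightarrow> real"
  assumes w: "w \<in> borel_measurable SG" and b: "\<And>z. z \<in> space \<Gamma> \<Longrightarrow> \<bar>w (r, z)\<bar> \<le> C"
    and r: "r \<in> {0..T}" and y: "y \<in> space \<Gamma>"
  shows "integrable (v r y) (\<lambda>z. w (r, z))"
proof -
  interpret finite_measure "v r y" by (rule finite_v[OF r y])
  have sp: "space (v r y) = space \<Gamma>" using sets_v[OF r y] by (rule sets_eq_imp_space_eq)
  show ?thesis
    by (rule integrable_const_bound[where B=C])
      (use b w_section[OF w r] measurable_cong_sets[OF sets_v[OF r y] refl] in \<open>auto simp: sp\<close>)
qed

lemma gen_diff_bound:
  assumes w: "w \<in> borel_measurable SG" "\<And>z. z \<in> space \<Gamma> \<Longrightarrow> \<bar>w (r, z)\<bar> \<le> C"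
    and w': "w' \<in> borel_measurable SG" "\<And>z. z \<in> space \<Gamma> \<Longrightarrow> \<bar>w' (r, z)\<bar> \<le> C'"
    and d: "\<And>z. z \<in> space \<Gamma> \<Longrightarrow> \<bar>w (r, z) - w' (r, z)\<bar> \<le> D"
    and r: "r \<in> {0..T}" and y: "y \<in> space \<Gamma>"
  shows "\<bar>gen w (r, y) - gen w' (r, y)\<bar> \<le> 2 * K * D"
proof -
  interpret finite_measure "v r y" by (rule finite_v[OF r y])
  have sp: "space (v r y) = space \<Gamma>" using sets_v[OF r y] by (rule sets_eq_imp_space_eq)
  note i = gen_integrable[OF w r y] gen_integrable[OF w' r y]
  have D0: "0 \<le> D" using d[OF y] by linarith
  have "gen w (r, y) - gen w' (r, y) = (\<integral>z. (w (r, z) - w (r, y)) - (w' (r, z) - w' (r, y)) \<partial>v r y)"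
    unfolding gen_def using i by simp
  also have "\<bar>\<dots>\<bar> \<le> (\<integral>z. \<bar>(w (r, z) - w (r, y)) - (w' (r, z) - w' (r, y))\<bar> \<partial>v r y)"
    by (rule integral_abs_bound)
  also have "\<dots> \<le> (\<integral>z. 2 * D \<partial>v r y)"
  proof (rule integral_mono)
    fix z assume "z \<in> space (v r y)"
    then show "\<bar>(w (r, z) - w (r, y)) - (w' (r, z) - w' (r, y))\<bar> \<le> 2 * D"
      using d[of z] d[OF y] by (simp add: sp)
  qed (use i in auto)
  also have "\<dots> = measure (v r y) (space (v r y)) * (2 * D)" by simp
  also have "\<dots> \<le> K * (2 * D)" using measure_v_le[OF r y] D0 by (intro mult_right_mono) auto
  finally show ?thesis by simp
qed

text \<open>A fixed point solves the backward Kolmogorov equation with terminal value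
  \<open>\<phi>\<close> at time \<open>u\<close>, in integrated form. After \<open>u\<close> the
  interval of integration is empty and the value is \<open>\<phi>\<close>, so no restriction
  \<open>fst p \<le> u\<close> has to be carried along.\<close>

definition kstep :: "('g \<Rightarrow> real) \<Rightarrow> real \<Rightarrow> (real \<times> 'g \<Rightarrow> real) \<Rightarrow> real \<times> 'g \<Rightarrow> real" where
  "kstep \<phi> u w p = \<phi> (snd p) + (LINT r:{fst p<..u}|lborel. gen w (r, snd p))"

primrec kiter :: "('g \<Rightarrow> real) \<Rightarrow> real \<Rightarrow> nat \<Rightarrow> real \<times> 'g \<Rightarrow> real" where
  "kiter \<phi> u 0 = (\<lambda>p. \<phi> (snd p))"
| "kiter \<phi> u (Suc n) = kstep \<phi> u (kiter \<phi> u n)"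

lemma set_integral_time0:
  fixes f :: "real \<Rightarrow> real"
  assumes "0 \<le> s" "u \<le> T"
  shows "(LINT r:{s<..u}|lborel. f r) = (\<integral>r. indicator {s<..u} r * f r \<partial>restrict_space lborel {0..T})"
  unfolding set_lebesgue_integral_def using assms
  by (subst integral_restrict_space) (auto intro!: Bochner_Integration.integral_cong simp: indicator_def)

lemma kstep_measurable:
  assumes w: "w \<in> borel_measurable SG" and \<phi>: "\<phi> \<in> borel_measurable \<Gamma>" and u: "u \<le> T"
  shows "kstep \<phi> u w \<in> borel_measurable SG"
proof -
  let ?L = "restrict_space lborel {0..T}"
  interpret L: finite_measure ?L
    by (rule finite_measureI) (use T_pos in \<open>auto simp: emeasure_restrict_space space_restrict_space\<close>)
  have snd: "(\<lambda>p. p) \<in> ?L \<rightarrow>\<^sub>M restrict_space borel {0..T}"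
    by (intro measurable_restrict_space3) auto
  have "(\<lambda>q. (snd q, snd (fst q))) \<in> SG \<Otimes>\<^sub>M ?L \<rightarrow>\<^sub>M SG"
    by (intro measurable_Pair measurable_compose[OF measurable_snd snd] measurable_compose[OF measurable_fst measurable_snd])
  from measurable_compose[OF this gen_measurable[OF w]]
  have 1: "(\<lambda>q. gen w (snd q, snd (fst q))) \<in> borel_measurable (SG \<Otimes>\<^sub>M ?L)" .
  have fs: "(\<lambda>q. fst (fst q)) \<in> borel_measurable (SG \<Otimes>\<^sub>M ?L)" "(\<lambda>q. snd q) \<in> borel_measurable (SG \<Otimes>\<^sub>M ?L)"
    by (rule measurable_compose[OF measurable_fst], rule measurable_compose[OF measurable_fst], rule measurable_restrict_space1, simp)
      (rule measurable_compose[OF measurable_snd], rule measurable_restrict_space1, simp)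
  have "(\<lambda>q. indicator {q. fst (fst q) < snd q \<and> snd q \<le> u} q * gen w (snd q, snd (fst q))) \<in> borel_measurable (SG \<Otimes>\<^sub>M ?L)"
    using fs 1 by measurable
  also have "(\<lambda>q. indicator {q. fst (fst q) < snd q \<and> snd q \<le> u} q * gen w (snd q, snd (fst q)))
    = (\<lambda>(p, r). indicator {fst p<..u} r * gen w (r, snd p))"
    by (auto simp: indicator_def fun_eq_iff)
  finally have "(\<lambda>p. \<integral>r. indicator {fst p<..u} r * gen w (r, snd p) \<partial>?L) \<in> borel_measurable SG"
    by (rule L.borel_measurable_lebesgue_integral)
  then have "(\<lambda>p. \<phi> (snd p) + (\<integral>r. indicator {fst p<..u} r * gen w (r, snd p) \<partial>?L)) \<in> borel_measurable SG"
    by (intro borel_measurable_add measurable_compose[OF measurable_snd \<phi>])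
  then show ?thesis
    by (rule measurable_cong[THEN iffD1, rotated])
      (auto simp: kstep_def set_integral_time0[OF _ u] space_SG)
qed

text \<open>The weight of a Bielecki norm. In the supremum norm \<open>gen\<close> has Lipschitz
  constant \<open>2 * K\<close>; the rate \<open>4 * K\<close> is twice that, and so
  \<open>kstep\<close> contracts by \<open>1/2\<close> on all of \<open>[0, T]\<close>.\<close>

definition EK :: "real \<Rightarrow> real" where "EK s = exp (4 * K * (T - s))"

lemma EK_ge: "s \<le> T \<Longrightarrow> 1 \<le> EK s"
  using K_pos by (simp add: EK_def)

lemma EK_mono: "s \<le> r \<Longrightarrow> EK r \<le> EK s"
  using K_pos by (simp add: EK_def)

lemma EK_integral:
  assumes "s \<le> u"
  shows "set_integrable lborel {s<..u} EK" "(LINT r:{s<..u}|lborel. EK r) \<le> EK s / (4 * K)"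
proof -
  have "continuous_on {s..u} EK" unfolding EK_def by (intro continuous_intros)
  then show "set_integrable lborel {s<..u} EK"
    by (intro set_integrable_subset[OF borel_integrable_atLeastAtMost']) auto
  have "(LINT r:{s<..u}|lborel. EK r) = (\<integral>r. EK r * indicator {s..u} r \<partial>lborel)"
    unfolding set_lebesgue_integral_def
    by (rule integral_discrete_difference[of "{s}"]) (auto simp: indicator_def)
  also have "\<dots> = - EK u / (4 * K) - (- EK s / (4 * K))"
  proof (rule integral_FTC_Icc_real[OF assms])
    show "DERIV (\<lambda>r. - EK r / (4 * K)) r :> EK r" for r
      unfolding EK_def using K_pos by (auto intro!: derivative_eq_intros)
    show "isCont EK r" for r unfolding EK_def by (intro continuous_intros)
  qed
  also have "\<dots> \<le> EK s / (4 * K)" using K_pos by (simp add: EK_def)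
  finally show "(LINT r:{s<..u}|lborel. EK r) \<le> EK s / (4 * K)" .
qed

lemma gen_zero: "gen (\<lambda>_. 0) p = 0"
  by (simp add: gen_def)

lemma gen_set_integrable:
  fixes w :: "real \<times> 'g \<Rightarrow> real"
  assumes w: "w \<in> borel_measurable SG" "\<And>r z. r \<in> {0..T} \<Longrightarrow> z \<in> space \<Gamma> \<Longrightarrow> \<bar>w (r, z)\<bar> \<le> C"
    and s: "0 \<le> s" "u \<le> T" and y: "y \<in> space \<Gamma>"
  shows "set_integrable lborel {s<..u} (\<lambda>r. gen w (r, y))"
proof -
  have "(\<lambda>r. gen w (r, y)) \<in> borel_measurable (restrict_space borel {0..T})"
    using y by (intro measurable_compose[OF measurable_Pair2' gen_measurable[OF w(1)]])
  then have m: "(\<lambda>r. indicator {0..T} r *\<^sub>R gen w (r, y)) \<in> borel_measurable lborel"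
    by (subst (asm) borel_measurable_restrict_space_iff) (auto simp: mult.commute)
  have "set_integrable lborel {0..T} (\<lambda>r. gen w (r, y))"
    unfolding set_integrable_def
  proof (rule Bochner_Integration.integrable_bound[of _ "\<lambda>r. indicator {0..T} r * (2 * K * C)"])
    show "integrable lborel (\<lambda>r. indicator {0..T} r * (2 * K * C))" using T_pos by simp
    show "AE r in lborel. norm (indicator {0..T} r *\<^sub>R gen w (r, y)) \<le> norm (indicator {0..T} r * (2 * K * C))"
    proof (rule AE_I2)
      fix r
      have "\<bar>gen w (r, y)\<bar> \<le> \<bar>2 * K * C\<bar>" if r: "r \<in> {0..T}"
      proof -
        have "\<bar>gen w (r, y) - gen (\<lambda>_. 0) (r, y)\<bar> \<le> 2 * K * C"
          by (rule gen_diff_bound[OF w(1) w(2)[OF r] _ _ _ r y, where C'=0]) (use w(2)[OF r] in auto)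
        then show ?thesis by (simp add: gen_zero)
      qed
      then show "norm (indicator {0..T} r *\<^sub>R gen w (r, y)) \<le> norm (indicator {0..T} r * (2 * K * C))"
        by (cases "r \<in> {0..T}") simp_all
    qed
  qed (rule m)
  then show ?thesis by (rule set_integrable_subset) (use s in auto)
qed

lemma kstep_diff:
  fixes w w' :: "real \<times> 'g \<Rightarrow> real"
  assumes w: "w \<in> borel_measurable SG" "\<And>r z. r \<in> {0..T} \<Longrightarrow> z \<in> space \<Gamma> \<Longrightarrow> \<bar>w (r, z)\<bar> \<le> C"
    and w': "w' \<in> borel_measurable SG" "\<And>r z. r \<in> {0..T} \<Longrightarrow> z \<in> space \<Gamma> \<Longrightarrow> \<bar>w' (r, z)\<bar> \<le> C'"
    and d: "\<And>r z. r \<in> {0..T} \<Longrightarrow> z \<in> space \<Gamma> \<Longrightarrow> \<bar>w (r, z) - w' (r, z)\<bar> \<le> D * EK r"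
    and s: "s \<in> {0..T}" "u \<le> T" and y: "y \<in> space \<Gamma>"
  shows "\<bar>kstep \<phi> u w (s, y) - kstep \<phi> u w' (s, y)\<bar> \<le> D / 2 * EK s"
proof -
  have D0: "0 \<le> D"
  proof -
    have "0 \<le> D * EK T" using d[of T y] y T_pos by (auto intro: order.trans[OF abs_ge_zero])
    then show ?thesis by (simp add: EK_def)
  qed
  note i = gen_set_integrable[OF w _ s(2) y, of s] gen_set_integrable[OF w' _ s(2) y, of s]
  show ?thesis
  proof (cases "s \<le> u")
    case True
    have "kstep \<phi> u w (s, y) - kstep \<phi> u w' (s, y) = (LINT r:{s<..u}|lborel. gen w (r, y) - gen w' (r, y))"
      unfolding kstep_def using i s by (simp add: set_integral_diff(2))
    also have "\<bar>\<dots>\<bar> \<le> (LINT r:{s<..u}|lborel. \<bar>gen w (r, y) - gen w' (r, y)\<bar>)"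
      using set_integral_norm_bound[OF set_integral_diff(1)[OF i]] s by simp
    also have "\<dots> \<le> (LINT r:{s<..u}|lborel. 2 * K * D * EK r)"
    proof (rule set_integral_mono)
      show "set_integrable lborel {s<..u} (\<lambda>r. \<bar>gen w (r, y) - gen w' (r, y)\<bar>)"
        using set_integrable_norm[OF set_integral_diff(1)[OF i]] s by simp
      show "set_integrable lborel {s<..u} (\<lambda>r. 2 * K * D * EK r)"
        using EK_integral(1)[OF True] by simp
      fix r assume "r \<in> {s<..u}"
      then have r: "r \<in> {0..T}" using s by auto
      have "\<bar>gen w (r, y) - gen w' (r, y)\<bar> \<le> 2 * K * (D * EK r)"
        by (rule gen_diff_bound[OF w(1) w(2)[OF r] w'(1) w'(2)[OF r] d[OF r] r y])
      then show "\<bar>gen w (r, y) - gen w' (r, y)\<bar> \<le> 2 * K * D * EK r" by (simp add: mult.assoc)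
    qed
    also have "\<dots> = 2 * K * D * (LINT r:{s<..u}|lborel. EK r)" by (rule set_integral_mult_right)
    also have "\<dots> \<le> 2 * K * D * (EK s / (4 * K))"
      using EK_integral(2)[OF True] K_pos D0 by (intro mult_left_mono) auto
    also have "\<dots> = D / 2 * EK s" using K_pos by simp
    finally show ?thesis .
  next
    case False
    then show ?thesis using D0 by (simp add: kstep_def set_lebesgue_integral_def EK_def)
  qed
qed

text \<open>The estimate of the increments needs bounded and measurable iterates, since these make
  the jump generator well defined; therefore the claims are proved together. The factor
  \<open>2 - (1/2)^n\<close> sums the initial term and the first \<open>n\<close>
  increments.\<close>

lemma kiter_props:
  assumes \<phi>: "\<phi> \<in> borel_measurable \<Gamma>" "\<And>z. z \<in> space \<Gamma> \<Longrightarrow> \<bar>\<phi> z\<bar> \<le> C" and u: "u \<le> T"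
  shows "kiter \<phi> u n \<in> borel_measurable SG \<and>
    (\<forall>s\<in>{0..T}. \<forall>y\<in>space \<Gamma>. \<bar>kiter \<phi> u n (s, y)\<bar> \<le> (2 - (1/2)^n) * C * EK s) \<and>
    (\<forall>s\<in>{0..T}. \<forall>y\<in>space \<Gamma>. \<bar>kiter \<phi> u (Suc n) (s, y) - kiter \<phi> u n (s, y)\<bar> \<le> (1/2)^(Suc n) * C * EK s)"
proof -
  have C0: "0 \<le> C" using \<phi>(2)[OF x_space] by linarith
  have bd: "(2 - (1/2)^n) * C * EK s \<le> 2 * C * EK 0" if "s \<in> {0..T}" for n s
  proof -
    have "(2 - (1/2)^n) * C * EK s \<le> 2 * C * EK s" using C0 by (intro mult_right_mono) (auto simp: EK_def)
    also have "\<dots> \<le> 2 * C * EK 0" using that C0 by (intro mult_left_mono EK_mono) auto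
    finally show ?thesis .
  qed
  show ?thesis
  proof (induction n)
    case 0
    have m: "(\<lambda>p. \<phi> (snd p)) \<in> borel_measurable SG"
      by (rule measurable_compose[OF measurable_snd \<phi>(1)])
    have CE: "C \<le> C * EK s" if "s \<in> {0..T}" for s using C0 EK_ge[of s] that by (simp add: mult_le_cancel_left1)
    have "\<bar>kstep \<phi> u (\<lambda>p. \<phi> (snd p)) (s, y) - kstep \<phi> u (\<lambda>_. 0) (s, y)\<bar> \<le> C / 2 * EK s"
      if "s \<in> {0..T}" "y \<in> space \<Gamma>" for s y
      by (rule kstep_diff[OF m _ _ _ _ that(1) u that(2), where C=C and C'=0])
        (use \<phi>(2) CE in \<open>auto intro: order.trans\<close>)
    then have "\<bar>kstep \<phi> u (\<lambda>p. \<phi> (snd p)) (s, y) - \<phi> y\<bar> \<le> C / 2 * EK s" if "s \<in> {0..T}" "y \<in> space \<Gamma>" for s y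
      using that by (simp add: kstep_def gen_zero set_lebesgue_integral_def)
    moreover have "\<bar>\<phi> y\<bar> \<le> C * EK s" if "s \<in> {0..T}" "y \<in> space \<Gamma>" for s y
      by (rule order.trans[OF \<phi>(2)[OF that(2)] CE[OF that(1)]])
    ultimately show ?case using m by simp
  next
    case (Suc n)
    have m: "kiter \<phi> u (Suc n) \<in> borel_measurable SG"
      using Suc.IH \<phi>(1) u by (simp add: kstep_measurable)
    have b: "\<bar>kiter \<phi> u (Suc n) (s, y)\<bar> \<le> (2 - (1/2)^(Suc n)) * C * EK s" if "s \<in> {0..T}" "y \<in> space \<Gamma>" for s y
    proof -
      have "\<bar>kiter \<phi> u (Suc n) (s, y)\<bar> \<le> \<bar>kiter \<phi> u n (s, y)\<bar> + \<bar>kiter \<phi> u (Suc n) (s, y) - kiter \<phi> u n (s, y)\<bar>" by linarith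
      also have "\<dots> \<le> (2 - (1/2)^n) * C * EK s + (1/2)^(Suc n) * C * EK s"
        using Suc.IH that by (intro add_mono) blast+
      also have "\<dots> = (2 - (1/2)^(Suc n)) * C * EK s" by (simp add: algebra_simps)
      finally show ?thesis .
    qed
    have "\<bar>kstep \<phi> u (kiter \<phi> u (Suc n)) (s, y) - kstep \<phi> u (kiter \<phi> u n) (s, y)\<bar> \<le> ((1/2)^(Suc n) * C) / 2 * EK s"
      if s: "s \<in> {0..T}" "y \<in> space \<Gamma>" for s y
    proof (rule kstep_diff[OF m _ _ _ _ s(1) u s(2), where C="2 * C * EK 0" and C'="2 * C * EK 0"])
      show "kiter \<phi> u n \<in> borel_measurable SG" using Suc.IH by blast
      fix r z assume r: "r \<in> {0..T}" and z: "z \<in> space \<Gamma>"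
      show "\<bar>kiter \<phi> u (Suc n) (r, z)\<bar> \<le> 2 * C * EK 0" using b[OF r z] bd[OF r, of "Suc n"] by linarith
      have "\<bar>kiter \<phi> u n (r, z)\<bar> \<le> (2 - (1/2)^n) * C * EK r" using Suc.IH r z by blast
      then show "\<bar>kiter \<phi> u n (r, z)\<bar> \<le> 2 * C * EK 0" using bd[OF r, of n] by linarith
      show "\<bar>kiter \<phi> u (Suc n) (r, z) - kiter \<phi> u n (r, z)\<bar> \<le> (1/2)^(Suc n) * C * EK r" using Suc.IH r z by blast
    qed
    then show ?case using m b by simp
  qed
qed

definition kw :: "('g \<Rightarrow> real) \<Rightarrow> real \<Rightarrow> real \<times> 'g \<Rightarrow> real" where
  "kw \<phi> u p = lim (\<lambda>n. kiter \<phi> u n p)"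

lemma kw_props:
  assumes \<phi>: "\<phi> \<in> borel_measurable \<Gamma>" "\<And>z. z \<in> space \<Gamma> \<Longrightarrow> \<bar>\<phi> z\<bar> \<le> C" and u: "u \<le> T"
  shows "kw \<phi> u \<in> borel_measurable SG"
    and "\<And>s y. s \<in> {0..T} \<Longrightarrow> y \<in> space \<Gamma> \<Longrightarrow> \<bar>kw \<phi> u (s, y)\<bar> \<le> 2 * C * EK 0"
    and "\<And>s y. s \<in> {0..T} \<Longrightarrow> y \<in> space \<Gamma> \<Longrightarrow>
      kw \<phi> u (s, y) = \<phi> y + (LINT r:{s<..u}|lborel. gen (kw \<phi> u) (r, y))"
proof -
  note P = kiter_props[OF \<phi> u]
  have C0: "0 \<le> C" using \<phi>(2)[OF x_space] by linarith
  show m: "kw \<phi> u \<in> borel_measurable SG"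
    unfolding kw_def[abs_def] by (rule borel_measurable_lim_metric) (use P in blast)
  have tele: "\<bar>kiter \<phi> u (n + k) (s, y) - kiter \<phi> u n (s, y)\<bar> \<le> ((1/2)^n - (1/2)^(n + k)) * C * EK s"
    if "s \<in> {0..T}" "y \<in> space \<Gamma>" for s y n k
  proof (induction k)
    case (Suc k)
    have "\<bar>kiter \<phi> u (Suc (n + k)) (s, y) - kiter \<phi> u (n + k) (s, y)\<bar> \<le> (1/2)^(Suc (n + k)) * C * EK s"
      using P[of "n + k"] that by blast
    then have "\<bar>kiter \<phi> u (n + Suc k) (s, y) - kiter \<phi> u n (s, y)\<bar>
      \<le> ((1/2)^n - (1/2)^(n + k)) * C * EK s + (1/2)^(Suc (n + k)) * C * EK s"
      using Suc.IH unfolding add_Suc_right by linarith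
    also have "\<dots> = ((1/2)^n - (1/2)^(n + Suc k)) * C * EK s" by (simp add: algebra_simps)
    finally show ?case .
  qed simp
  have conv: "(\<lambda>n. kiter \<phi> u n (s, y)) \<longlonglongrightarrow> kw \<phi> u (s, y)" if "s \<in> {0..T}" "y \<in> space \<Gamma>" for s y
  proof -
    have "summable (\<lambda>n. (1/2)^(Suc n) * C * EK s)"
      by (intro summable_mult2) (simp add: summable_mult)
    then have "summable (\<lambda>n. kiter \<phi> u (Suc n) (s, y) - kiter \<phi> u n (s, y))"
      by (rule summable_comparison_test[rotated]) (use P that in \<open>auto simp del: kiter.simps\<close>)
    then have "convergent (\<lambda>n. \<Sum>j<n. kiter \<phi> u (Suc j) (s, y) - kiter \<phi> u j (s, y))"
      by (simp add: summable_iff_convergent)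
    then have "convergent (\<lambda>n. kiter \<phi> u n (s, y) - kiter \<phi> u 0 (s, y))"
      unfolding sum_lessThan_telescope[of "\<lambda>n. kiter \<phi> u n (s, y)"] .
    then have "convergent (\<lambda>n. (kiter \<phi> u n (s, y) - kiter \<phi> u 0 (s, y)) + kiter \<phi> u 0 (s, y))"
      by (intro convergent_add convergent_const)
    then show ?thesis unfolding kw_def by (simp add: convergent_LIMSEQ_iff)
  qed
  have tail: "\<bar>kw \<phi> u (s, y) - kiter \<phi> u n (s, y)\<bar> \<le> ((1/2)^n * C) * EK s"
    if "s \<in> {0..T}" "y \<in> space \<Gamma>" for s y n
  proof (rule LIMSEQ_le_const2)
    show "(\<lambda>k. \<bar>kiter \<phi> u (k + n) (s, y) - kiter \<phi> u n (s, y)\<bar>) \<longlonglongrightarrow> \<bar>kw \<phi> u (s, y) - kiter \<phi> u n (s, y)\<bar>"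
      by (intro tendsto_intros LIMSEQ_ignore_initial_segment conv that)
    have "\<bar>kiter \<phi> u (k + n) (s, y) - kiter \<phi> u n (s, y)\<bar> \<le> ((1/2)^n * C) * EK s" for k
    proof -
      have "((1/2)^n - (1/2)^(n + k)) * C * EK s \<le> (1/2)^n * C * EK s"
        using C0 by (intro mult_right_mono) (auto simp: EK_def)
      then show ?thesis using tele[OF that, of n k] by (simp add: add.commute)
    qed
    then show "\<exists>N. \<forall>k\<ge>N. \<bar>kiter \<phi> u (k + n) (s, y) - kiter \<phi> u n (s, y)\<bar> \<le> ((1/2)^n * C) * EK s" by blast
  qed
  have bd: "\<bar>kiter \<phi> u n (s, y)\<bar> \<le> 2 * C * EK 0" if "s \<in> {0..T}" "y \<in> space \<Gamma>" for s y n
  proof -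
    have "\<bar>kiter \<phi> u n (s, y)\<bar> \<le> (2 - (1/2)^n) * C * EK s" using P[of n] that by blast
    also have "\<dots> \<le> 2 * C * EK s" using C0 by (intro mult_right_mono) (auto simp: EK_def)
    also have "\<dots> \<le> 2 * C * EK 0" using that C0 by (intro mult_left_mono EK_mono) auto
    finally show ?thesis .
  qed
  show b: "\<bar>kw \<phi> u (s, y)\<bar> \<le> 2 * C * EK 0" if "s \<in> {0..T}" "y \<in> space \<Gamma>" for s y
    by (rule LIMSEQ_le_const2[OF tendsto_rabs[OF conv[OF that]]]) (use bd[OF that] in blast)
  show "kw \<phi> u (s, y) = \<phi> y + (LINT r:{s<..u}|lborel. gen (kw \<phi> u) (r, y))"
    if s: "s \<in> {0..T}" "y \<in> space \<Gamma>" for s y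
  proof -
    have d: "\<bar>kstep \<phi> u (kw \<phi> u) (s, y) - kstep \<phi> u (kiter \<phi> u n) (s, y)\<bar> \<le> ((1/2)^n * C) / 2 * EK s" for n
      by (rule kstep_diff[OF m b _ bd tail s(1) u s(2)]; (assumption | rule P[THEN conjunct1]))
    have "(\<lambda>n. ((1/2)^n * C) / 2 * EK s) \<longlonglongrightarrow> (0 * C) / 2 * EK s"
      by (intro tendsto_intros LIMSEQ_realpow_zero) auto
    then have g0: "(\<lambda>n. ((1/2)^n * C) / 2 * EK s) \<longlonglongrightarrow> 0" by simp
    have "(\<lambda>n. kstep \<phi> u (kiter \<phi> u n) (s, y) - kstep \<phi> u (kw \<phi> u) (s, y)) \<longlonglongrightarrow> 0"
    proof (rule Lim_null_comparison[OF _ g0])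
      show "\<forall>\<^sub>F n in sequentially. norm (kstep \<phi> u (kiter \<phi> u n) (s, y) - kstep \<phi> u (kw \<phi> u) (s, y)) \<le> ((1/2)^n * C) / 2 * EK s"
        unfolding real_norm_def by (subst abs_minus_commute) (intro always_eventually allI d)
    qed
    then have "(\<lambda>n. kstep \<phi> u (kiter \<phi> u n) (s, y)) \<longlonglongrightarrow> kstep \<phi> u (kw \<phi> u) (s, y)" by (rule LIM_zero_cancel)
    moreover have "(\<lambda>n. kstep \<phi> u (kiter \<phi> u n) (s, y)) \<longlonglongrightarrow> kw \<phi> u (s, y)"
      using LIMSEQ_Suc[OF conv[OF s]] by simp
    ultimately have "kstep \<phi> u (kw \<phi> u) (s, y) = kw \<phi> u (s, y)" by (rule LIMSEQ_unique)
    then show ?thesis by (simp add: kstep_def)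
  qed
qed

end

section \<open>Representation of increments between two times\<close>

context jump_markov_started
begin

lemma path_right_continuous:
  assumes eq: "path_equation a Y Z \<omega>" and r: "r \<in> {t..<T}"
  shows "((\<lambda>s. Y s \<omega>) \<longlongrightarrow> Y r \<omega>) (at_right r)"
proof -
  have o: "\<omega> \<in> \<Omega>" and ai: "set_integrable lborel {t<..T} (\<lambda>r. a r \<omega>)"
    and Y: "\<And>s. s \<in> {t..T} \<Longrightarrow> Y s \<omega> = Y T \<omega> + (LINT r:{s<..T}|lborel. a r \<omega>) - jump_sum Z s \<omega>"
    using eq unfolding path_equation_def by blast+
  obtain d where d: "d > 0" "\<forall>q\<in>J \<omega>. q \<noteq> r \<longrightarrow> d \<le> dist r q"
    using finite_set_avoid[OF finite_J[OF o], of r] by auto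
  have js: "jump_sum Z s \<omega> = jump_sum Z r \<omega>" if s: "s \<in> {r<..<r + d}" for s
  proof -
    have "q \<notin> J \<omega>" if "r < q" "q \<le> s" for q using d(2) s that by (force simp: dist_real_def)
    then have "J \<omega> \<inter> {s<..} = J \<omega> \<inter> {r<..}" using s by force
    then show ?thesis unfolding jump_sum_def by simp
  qed
  have "continuous_on {r..T} (\<lambda>s. LINT q:{s<..T}|lborel. a q \<omega>)"
    using r by (intro continuous_on_subset[OF tail_integral_continuous[OF ai]]) auto
  from continuous_on_Icc_at_rightD[OF this] r
  have lim: "((\<lambda>s. LINT q:{s<..T}|lborel. a q \<omega>) \<longlongrightarrow> (LINT q:{r<..T}|lborel. a q \<omega>)) (at_right r)" by simp
  have "((\<lambda>s. Y T \<omega> + (LINT q:{s<..T}|lborel. a q \<omega>) - jump_sum Z r \<omega>)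
    \<longlongrightarrow> Y T \<omega> + (LINT q:{r<..T}|lborel. a q \<omega>) - jump_sum Z r \<omega>) (at_right r)"
    by (intro tendsto_intros lim)
  moreover have "\<forall>\<^sub>F s in at_right r. Y T \<omega> + (LINT q:{s<..T}|lborel. a q \<omega>) - jump_sum Z r \<omega> = Y s \<omega>"
  proof -
    have "\<forall>\<^sub>F s in at_right r. s \<in> {r<..<min T (r + d)}"
      using r d(1) by (intro eventually_at_right_real) simp
    then show ?thesis
    proof eventually_elim
      case (elim s)
      then have "s \<in> {t..T}" "s \<in> {r<..<r + d}" using r by auto
      then show ?case using Y[of s] js[of s] by linarith
    qed
  qed
  ultimately have "((\<lambda>s. Y s \<omega>) \<longlongrightarrow> Y T \<omega> + (LINT q:{r<..T}|lborel. a q \<omega>) - jump_sum Z r \<omega>) (at_right r)"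
    by (rule Lim_transform_eventually)
  moreover have "Y T \<omega> + (LINT q:{r<..T}|lborel. a q \<omega>) - jump_sum Z r \<omega> = Y r \<omega>"
  proof -
    have "r \<in> {t..T}" using r by simp
    from Y[OF this] show ?thesis by linarith
  qed
  ultimately show ?thesis by (simp only:)
qed

text \<open>Right continuity upgrades adaptedness to progressive measurability, but the equation
  provides it only off a null event. There the paths are set to 0, which keeps adaptedness because
  the filtration is complete.\<close>

lemma linear_bsdeI_path:
  assumes ad: "adapted Y" and Z: "field Z" "integrable mu (\<lambda>u. (flat Z u)\<^sup>2)"
    and eq: "AE \<omega> in M. path_equation (\<lambda>r \<omega>. g r \<omega> + comp Z (\<omega>, r)) Y Z \<omega>"
  shows "\<exists>Y'. progressive F t T Y' \<and> (AE \<omega> in M. \<forall>s. Y' s \<omega> = Y s \<omega>)"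
proof -
  let ?N = "{\<omega>\<in>\<Omega>. \<not> path_equation (\<lambda>r \<omega>. g r \<omega> + comp Z (\<omega>, r)) Y Z \<omega>}"
  have N: "?N \<in> null_sets M" by (rule AE_null_set[OF eq])
  define Y' where "Y' s \<omega> = (if \<omega> \<in> ?N then 0 else Y s \<omega>)" for s \<omega>
  have ae: "AE \<omega> in M. \<forall>s. Y' s \<omega> = Y s \<omega>"
    using AE_not_in[OF N] by eventually_elim (auto simp: Y'_def)
  have "progressive F t T Y'"
  proof (rule right_continuous_progressive)
    show "adapted Y'"
    proof
      fix s assume s: "s \<in> {t..T}"
      have "AE \<omega> in M. Y s \<omega> = Y' s \<omega>" using ae by eventually_elim simp
      then show "Y' s \<in> borel_measurable (F s)" by (rule measurable_F_AE[rotated]) (use ad s in blast)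
    qed
    fix \<omega> r assume o: "\<omega> \<in> \<Omega>" and r: "r \<in> {t..<T}"
    show "((\<lambda>s. Y' s \<omega>) \<longlongrightarrow> Y' r \<omega>) (at_right r)"
    proof (cases "\<omega> \<in> ?N")
      case False
      then have "path_equation (\<lambda>r \<omega>. g r \<omega> + comp Z (\<omega>, r)) Y Z \<omega>" using o by blast
      moreover have "Y' q \<omega> = Y q \<omega>" for q unfolding Y'_def using False by (rule if_not_P)
      ultimately show ?thesis using path_right_continuous[of _ Y Z \<omega>, OF _ r] by (simp only:)
    qed (simp add: Y'_def)
  qed
  then show ?thesis using ae by blast
qed

subsection \<open>The pathwise formula for solutions of the Kolmogorov equation\<close>

context
  fixes \<phi> :: "'g \<Rightarrow> real" and C u :: real and w :: "real \<times> 'g \<Rightarrow> real"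
  assumes \<phi>: "\<phi> \<in> borel_measurable \<Gamma>" "\<And>z. z \<in> space \<Gamma> \<Longrightarrow> \<bar>\<phi> z\<bar> \<le> C" and u: "u \<in> {t..T}"
  defines "w \<equiv> kw \<phi> u"
begin

lemma w_meas: "w \<in> borel_measurable SG"
  and w_bound: "\<And>s y. s \<in> {0..T} \<Longrightarrow> y \<in> space \<Gamma> \<Longrightarrow> \<bar>w (s, y)\<bar> \<le> 2 * C * EK 0"
  and w_eq: "\<And>s y. s \<in> {0..T} \<Longrightarrow> y \<in> space \<Gamma> \<Longrightarrow> w (s, y) = \<phi> y + (LINT r:{s<..u}|lborel. gen w (r, y))"
  using kw_props[OF \<phi>, of u] u unfolding w_def by auto

lemma w_terminal: "y \<in> space \<Gamma> \<Longrightarrow> w (u, y) = \<phi> y"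
  using w_eq[of u y] u t_nonneg by (simp add: set_lebesgue_integral_def)

lemma w_gen_integrable:
  assumes o: "\<omega> \<in> \<Omega>" shows "set_integrable lborel {t<..T} (\<lambda>r. gen w (r, Xm r \<omega>))"
  unfolding integrable_time_iff[symmetric]
proof (rule time.integrable_const_bound[where B="2 * K * (2 * C * EK 0)"])
  show "AE r in time. norm (gen w (r, Xm r \<omega>)) \<le> 2 * K * (2 * C * EK 0)"
  proof (rule AE_I2)
    fix r assume "r \<in> space time"
    then have r: "r \<in> {0..T}" using t_nonneg by auto
    have "\<bar>gen w (r, Xm r \<omega>) - gen (\<lambda>_. 0) (r, Xm r \<omega>)\<bar> \<le> 2 * K * (2 * C * EK 0)"
      by (rule gen_diff_bound[OF w_meas w_bound[OF r] _ _ _ r Xm_in_space[OF o], where C'=0])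
        (use w_bound[OF r] in auto)
    then show "norm (gen w (r, Xm r \<omega>)) \<le> 2 * K * (2 * C * EK 0)" by (simp add: gen_zero)
  qed
  have "(\<lambda>r. (\<omega>, r)) \<in> time \<rightarrow>\<^sub>M PA"
    using section_PA[OF o] measurable_cong_sets[OF sets_time refl] by blast
  from measurable_compose[OF this Xm_PA]
  have "(\<lambda>r. Xm r \<omega>) \<in> time \<rightarrow>\<^sub>M \<Gamma>" by simp
  moreover have "(\<lambda>r. r) \<in> time \<rightarrow>\<^sub>M restrict_space borel {0..T}"
    unfolding time_def using t_nonneg by (intro measurable_restrict_space3) auto
  ultimately have "(\<lambda>r. (r, Xm r \<omega>)) \<in> time \<rightarrow>\<^sub>M SG" by (intro measurable_Pair)
  from measurable_compose[OF this gen_measurable[OF w_meas]]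
  show "(\<lambda>r. gen w (r, Xm r \<omega>)) \<in> borel_measurable time" .
qed

text \<open>Dynkin's formula path by path. Between jumps the state is a constant \<open>c\<close>,
  and \<open>w (_, c)\<close> changes only through its time integral; at a jump \<open>w\<close>
  changes through the state alone, being continuous in time for a fixed state.\<close>

lemma path_kolmogorov:
  assumes o: "\<omega> \<in> \<Omega>" and q: "t \<le> q1" "q1 \<le> q2" "q2 \<le> u"
  shows "w (q2, X q2 \<omega>) - w (q1, X q1 \<omega>)
    = (\<Sum>\<tau>\<in>J \<omega> \<inter> {q1<..q2}. w (\<tau>, X \<tau> \<omega>) - w (\<tau>, Xm \<tau> \<omega>)) - (LINT r:{q1<..q2}|lborel. gen w (r, Xm r \<omega>))"
proof -
  define A where "A q = w (q, X q \<omega>) - (\<Sum>\<tau>\<in>J \<omega> \<inter> {q1<..q}. w (\<tau>, X \<tau> \<omega>) - w (\<tau>, Xm \<tau> \<omega>))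
    + (LINT r:{q1<..q}|lborel. gen w (r, Xm r \<omega>))" for q
  \<comment> \<open>The interval may end in a jump at \<open>b\<close>. The state is
    \<open>c\<close> from \<open>a\<close> until just before \<open>b\<close>, so the left limits at
    all points of \<open>(a, b]\<close> are \<open>c\<close>, including the one at
    \<open>b\<close>.\<close>
  have step: "A a = A b" if ab: "q1 \<le> a" "a < b" "b \<le> q2" and Jab: "J \<omega> \<inter> {a<..<b} = {}" for a b
  proof -
    have at: "t \<le> a" "b \<le> T" "0 \<le> a" "b \<le> u" using ab q u t_nonneg by auto
    have jt: "jump_times X \<omega> \<inter> {a<..<b} = {}" using Jab at by (auto simp: J_def)
    define c where "c = X a \<omega>"
    have c: "c \<in> space \<Gamma>" unfolding c_def using at o by (intro X_in_space)
    have Xmc: "Xm r \<omega> = c" if r: "r \<in> {a<..b}" for r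
    proof -
      have "jump_times X \<omega> \<inter> {a<..<r} \<subseteq> jump_times X \<omega> \<inter> {a<..<b}" using r by auto
      then have "jump_times X \<omega> \<inter> {a<..<r} = {}" using jt by blast
      then show ?thesis using left_limit_props(1)[of a r \<omega> a] r at o by (simp add: Xm_def c_def)
    qed
    have gi: "set_integrable lborel {a<..u} (\<lambda>r. gen w (r, c))"
      by (rule gen_set_integrable[OF w_meas w_bound]) (use at u c in auto)
    have 1: "w (b, c) - w (a, c) = - (LINT r:{a<..b}|lborel. gen w (r, c))"
      using w_eq[of b c] w_eq[of a c] set_integral_Ioc_split(1)[OF gi, of b] at ab c by simp
    have 2: "(LINT r:{a<..b}|lborel. gen w (r, c)) = (LINT r:{a<..b}|lborel. gen w (r, Xm r \<omega>))"
      unfolding set_lebesgue_integral_def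
      by (intro Bochner_Integration.integral_cong) (auto simp: indicator_def Xmc)
    have "set_integrable lborel {q1<..b} (\<lambda>r. gen w (r, Xm r \<omega>))"
      by (rule set_integrable_subset[OF w_gen_integrable[OF o]]) (use q at in auto)
    from set_integral_Ioc_split(1)[OF this, of a] ab
    have 3: "(LINT r:{q1<..b}|lborel. gen w (r, Xm r \<omega>))
      = (LINT r:{q1<..a}|lborel. gen w (r, Xm r \<omega>)) + (LINT r:{a<..b}|lborel. gen w (r, Xm r \<omega>))" by simp
    have "J \<omega> \<inter> {q1<..b} = (J \<omega> \<inter> {q1<..a}) \<union> (if b \<in> J \<omega> then {b} else {})"
    proof -
      have "\<tau> \<le> a \<or> \<tau> = b" if "\<tau> \<in> J \<omega>" "\<tau> \<le> b" for \<tau> using Jab that by force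
      note * = this
      have "\<tau> \<in> J \<omega> \<inter> {q1<..b} \<longleftrightarrow> \<tau> \<in> (J \<omega> \<inter> {q1<..a}) \<union> (if b \<in> J \<omega> then {b} else {})" for \<tau>
        using *[of \<tau>] ab by (cases "\<tau> = b") auto
      then show ?thesis by blast
    qed
    moreover have "b \<notin> J \<omega> \<inter> {q1<..a}" using ab by auto
    ultimately have 4: "(\<Sum>\<tau>\<in>J \<omega> \<inter> {q1<..b}. w (\<tau>, X \<tau> \<omega>) - w (\<tau>, Xm \<tau> \<omega>))
      = (\<Sum>\<tau>\<in>J \<omega> \<inter> {q1<..a}. w (\<tau>, X \<tau> \<omega>) - w (\<tau>, Xm \<tau> \<omega>)) + (if b \<in> J \<omega> then w (b, X b \<omega>) - w (b, Xm b \<omega>) else 0)"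
      using finite_J[OF o] by simp
    have 5: "w (b, X b \<omega>) - w (b, c) = (if b \<in> J \<omega> then w (b, X b \<omega>) - w (b, Xm b \<omega>) else 0)"
      using Xmc[of b] Xm_eq_X[OF o, of b] ab at by auto
    show ?thesis unfolding A_def 3 4 5[symmetric] using 1 2 unfolding c_def by linarith
  qed
  have "A q1 = A q2"
  proof (rule locally_constant_imp_eq[OF q(2)])
    fix r assume r: "r \<in> {q1..q2}"
    obtain d where d: "d > 0" "\<forall>q\<in>J \<omega>. q \<noteq> r \<longrightarrow> d \<le> dist r q"
      using finite_set_avoid[OF finite_J[OF o], of r] by auto
    have "A s = A r" if s: "s \<in> {q1..q2}" "\<bar>s - r\<bar> < d" for s
    proof (cases s r rule: linorder_cases)
      case less
      have "J \<omega> \<inter> {s<..<r} = {}" using d(2) s by (force simp: dist_real_def)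
      then show ?thesis using step[of s r] less s r by auto
    next
      case greater
      have "J \<omega> \<inter> {r<..<s} = {}" using d(2) s by (force simp: dist_real_def)
      then show ?thesis using step[of r s] greater s r by auto
    qed simp
    then show "\<exists>\<delta>>0. \<forall>s\<in>{q1..q2}. \<bar>s - r\<bar> < \<delta> \<longrightarrow> A s = A r" using d(1) by blast
  qed
  then show ?thesis by (simp add: A_def set_lebesgue_integral_def)
qed

end

text \<open>With zero generator the equation says that \<open>N T\<close> is \<open>N t\<close> plus
  the integral of \<open>Z\<close> against \<open>q\<close> over \<open>(t, T]\<close>: this is the
  predictable representation property of \<open>\<eta>\<close>.\<close>

definition Rep :: "('w \<Rightarrow> real) \<Rightarrow> bool" where
  "Rep \<eta> \<longleftrightarrow> (\<exists>N Z. linear_bsde (\<lambda>_ _. 0) N Z \<and> integrable M (\<lambda>\<omega>. (N T \<omega>)\<^sup>2) \<and> (AE \<omega> in M. N T \<omega> = \<eta> \<omega>))"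

text \<open>By \<open>path_kolmogorov\<close>, \<open>w (r, X r)\<close> moves by the jumps
  \<open>w (r, y) - w (r, Xm r)\<close> minus their compensator. A factor known at time
  \<open>s\<close> may multiply the increments after \<open>s\<close>, and the integrand stays
  predictable.\<close>

lemma Rep_step:
  assumes \<phi>: "\<phi> \<in> borel_measurable \<Gamma>" "\<And>z. z \<in> space \<Gamma> \<Longrightarrow> \<bar>\<phi> z\<bar> \<le> C"
    and s: "s \<in> {t..T}" and u: "s \<le> u" "u \<le> T"
    and B: "B \<in> borel_measurable (F s)" "\<And>\<omega>. \<omega> \<in> \<Omega> \<Longrightarrow> \<bar>B \<omega>\<bar> \<le> b"
  shows "Rep (\<lambda>\<omega>. B \<omega> * (\<phi> (X u \<omega>) - kw \<phi> u (s, X s \<omega>)))"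
proof -
  have u': "u \<in> {t..T}" using s u by auto
  define w where "w = kw \<phi> u"
  have w_meas: "w \<in> borel_measurable SG"
    and w_bound: "\<And>s y. s \<in> {0..T} \<Longrightarrow> y \<in> space \<Gamma> \<Longrightarrow> \<bar>w (s, y)\<bar> \<le> 2 * C * EK 0"
    and w_eq: "\<And>s y. s \<in> {0..T} \<Longrightarrow> y \<in> space \<Gamma> \<Longrightarrow> w (s, y) = \<phi> y + (LINT r:{s<..u}|lborel. gen w (r, y))"
    and w_terminal: "\<And>y. y \<in> space \<Gamma> \<Longrightarrow> w (u, y) = \<phi> y"
    unfolding w_def
    by (rule w_meas[OF \<phi>(1) _ u'] w_bound[OF \<phi>(1) _ u'] w_eq[OF \<phi>(1) _ u'] w_terminal[OF \<phi>(1) _ u'];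
        (assumption | rule \<phi>(2), assumption))+
  have path: "w (q2, X q2 \<omega>) - w (q1, X q1 \<omega>)
    = (\<Sum>\<tau>\<in>J \<omega> \<inter> {q1<..q2}. w (\<tau>, X \<tau> \<omega>) - w (\<tau>, Xm \<tau> \<omega>)) - (LINT r:{q1<..q2}|lborel. gen w (r, Xm r \<omega>))"
    if "\<omega> \<in> \<Omega>" "t \<le> q1" "q1 \<le> q2" "q2 \<le> u" for \<omega> q1 q2
    unfolding w_def
    by (rule path_kolmogorov[OF \<phi>(1) _ u']; (rule that | rule \<phi>(2), assumption))
  define D where "D = 2 * C * EK 0"
  \<comment> \<open>Clamping the time to \<open>[s, u]\<close> makes \<open>N\<close> vanish before
    \<open>s\<close> and stay constant after \<open>u\<close>, so that it is defined on all of
    \<open>[t, T]\<close> and its terminal value is already reached at \<open>u\<close>.\<close>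
  define c where "c q = max s (min q u)" for q
  have c_range: "c q \<in> {s..u}" "c q \<in> {t..T}" "c q \<in> {0..T}" for q using s u t_nonneg by (auto simp: c_def)
  define N where "N q \<omega> = B \<omega> * (w (c q, X (c q) \<omega>) - w (s, X s \<omega>))" for q \<omega>
  define Z where "Z r \<omega> y = (if s < r then B \<omega> else 0) * (if r \<le> u then w (r, y) - w (r, Xm r \<omega>) else 0)" for r \<omega> y
  have b0: "0 \<le> b" if "\<omega> \<in> \<Omega>" for \<omega> using B(2)[OF that] by linarith
  have wX: "(\<lambda>\<omega>. w (q, X q \<omega>)) \<in> borel_measurable (F q)" if "q \<in> {t..T}" for q
  proof -
    have "q \<in> {0..T}" using that t_nonneg by auto
    then show ?thesis using X_measurable_F[of q q] that by (intro measurable_compose[OF _ w_section[OF w_meas]]) auto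
  qed
  have bd: "\<bar>w (q, X q \<omega>)\<bar> \<le> D" if "q \<in> {t..T}" "\<omega> \<in> \<Omega>" for q \<omega>
    unfolding D_def using that t_nonneg by (intro w_bound X_in_space) auto
  have prod_bd: "\<bar>a * (p - p')\<bar> \<le> b * (2 * D)" if "\<bar>a\<bar> \<le> b" "\<bar>p\<bar> \<le> D" "\<bar>p'\<bar> \<le> D" for a p p' :: real
    unfolding abs_mult using that by (intro mult_mono) linarith+
  have N_bound: "\<bar>N q \<omega>\<bar> \<le> b * (2 * D)" if "\<omega> \<in> \<Omega>" for q \<omega>
    unfolding N_def using that c_range s by (intro prod_bd B bd) auto
  have ad: "adapted N"
  proof
    fix q assume q: "q \<in> {t..T}"
    show "N q \<in> borel_measurable (F q)"
    proof (cases "q \<le> s")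
      case True
      then have "c q = s" using u by (auto simp: c_def)
      then show ?thesis by (simp add: N_def[abs_def])
    next
      case False
      then have cq: "s \<le> c q" "c q \<le> q" using u by (auto simp: c_def)
      show ?thesis unfolding N_def
        using measurable_F_mono[OF B(1), of q] measurable_F_mono[OF wX[OF c_range(2)] cq(2)]
          measurable_F_mono[OF wX[OF s], of q] False by simp
    qed
  qed
  have prog: "progressive F t T N"
  proof (rule right_continuous_progressive[OF ad])
    fix \<omega> r assume o: "\<omega> \<in> \<Omega>" and r: "r \<in> {t..<T}"
    define y where "y = X (c r) \<omega>"
    have y: "y \<in> space \<Gamma>" unfolding y_def using c_range o by (intro X_in_space) auto
    obtain \<delta> where \<delta>: "\<delta> > 0" "\<forall>q\<in>{c r..c r + \<delta>}. X q \<omega> = y"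
      using right_constant[OF o, of "c r"] c_range(3)[of r] unfolding y_def by auto
    have gi: "set_integrable lborel {0<..u} (\<lambda>q. gen w (q, y))"
      by (rule gen_set_integrable[OF w_meas w_bound]) (use u y in auto)
    have "continuous_on {0..u} (\<lambda>q. w (q, y))"
    proof (rule continuous_on_eq)
      show "continuous_on {0..u} (\<lambda>q. \<phi> y + (LINT r:{q<..u}|lborel. gen w (r, y)))"
        by (intro continuous_intros tail_integral_continuous[OF gi])
      show "\<phi> y + (LINT r:{q<..u}|lborel. gen w (r, y)) = w (q, y)" if "q \<in> {0..u}" for q
        using w_eq[of q y] that u y by auto
    qed
    moreover have cc: "continuous_on UNIV c" unfolding c_def by (intro continuous_intros)
    moreover have "c ` UNIV \<subseteq> {0..u}" using c_range t_nonneg s by force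
    ultimately have "continuous_on UNIV (\<lambda>q. w (c q, y))" by (intro continuous_on_compose2[of "{0..u}" "\<lambda>q. w (q, y)" UNIV c]) auto
    then have "((\<lambda>q. w (c q, y)) \<longlongrightarrow> w (c r, y)) (at_right r)"
      by (auto simp: continuous_on_eq_continuous_within intro: continuous_within_subset simp: continuous_within filterlim_at_split)
    then have "((\<lambda>q. B \<omega> * (w (c q, y) - w (s, X s \<omega>))) \<longlongrightarrow> B \<omega> * (w (c r, y) - w (s, X s \<omega>))) (at_right r)"
      by (intro tendsto_intros)
    moreover have "\<forall>\<^sub>F q in at_right r. B \<omega> * (w (c q, y) - w (s, X s \<omega>)) = N q \<omega>"
    proof -
      have "\<forall>\<^sub>F q in at_right r. q \<in> {r<..<r + \<delta>}" using \<delta>(1) by (intro eventually_at_right_real) simp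
      then show ?thesis
      proof eventually_elim
        case (elim q)
        then have "c q \<in> {c r..c r + \<delta>}" by (auto simp: c_def)
        then show ?case using \<delta>(2) by (simp add: N_def)
      qed
    qed
    ultimately show "((\<lambda>q. N q \<omega>) \<longlongrightarrow> N r \<omega>) (at_right r)"
      unfolding N_def[of r] y_def[symmetric] by (rule Lim_transform_eventually)
  qed
  have fZ: "field Z"
  proof -
    have idr: "(\<lambda>u. snd (fst u)) \<in> PA \<Otimes>\<^sub>M \<Gamma> \<rightarrow>\<^sub>M restrict_space borel {0..T}"
    proof (rule measurable_compose[OF measurable_fst], rule measurable_restrict_space2[OF _ PA_snd])
      show "snd \<in> space PA \<rightarrow> {0..T}" using t_nonneg by (auto simp: space_PA)
    qed
    have 1: "(\<lambda>u. w (snd (fst u), snd u)) \<in> borel_measurable (PA \<Otimes>\<^sub>M \<Gamma>)"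
      by (rule measurable_compose[OF _ w_meas]) (intro measurable_Pair idr measurable_snd)
    have 2: "(\<lambda>u. w (snd (fst u), Xm (snd (fst u)) (fst (fst u)))) \<in> borel_measurable (PA \<Otimes>\<^sub>M \<Gamma>)"
      by (rule measurable_compose[OF _ w_meas])
        (intro measurable_Pair idr measurable_compose[OF measurable_fst Xm_PA])
    have 3: "(\<lambda>u. if s < snd (fst u) then B (fst (fst u)) else 0) \<in> borel_measurable (PA \<Otimes>\<^sub>M \<Gamma>)"
      by (rule measurable_compose[OF measurable_fst PA_measurable_after[OF s B(1)]]) simp
    have [measurable]: "(\<lambda>u. snd (fst u)) \<in> borel_measurable (PA \<Otimes>\<^sub>M \<Gamma>)"
      by (rule measurable_compose[OF measurable_fst PA_snd])
    have 4: "{p \<in> space (PA \<Otimes>\<^sub>M \<Gamma>). snd (fst p) \<le> u} \<in> sets (PA \<Otimes>\<^sub>M \<Gamma>)" by measurable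
    show ?thesis
      unfolding field_iff flat_def Z_def
      by (intro borel_measurable_times 3 measurable_If borel_measurable_diff 1 2 4 borel_measurable_const)
  qed
  have Z_bound: "\<bar>Z r \<omega> y\<bar> \<le> b * (2 * D)" if o: "\<omega> \<in> \<Omega>" and r: "r \<in> {t..T}" and y: "y \<in> space \<Gamma>" for r \<omega> y
  proof -
    have r0: "r \<in> {0..T}" using r t_nonneg by auto
    have "\<bar>if s < r then B \<omega> else 0\<bar> \<le> b" using B(2)[OF o] b0[OF o] by simp
    moreover have D0: "\<bar>w (r, y)\<bar> \<le> D" "\<bar>w (r, Xm r \<omega>)\<bar> \<le> D"
      unfolding D_def using w_bound[OF r0] y Xm_in_space[OF o] by auto
    then have "\<bar>if r \<le> u then w (r, y) - w (r, Xm r \<omega>) else 0\<bar> \<le> 2 * D" by auto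
    ultimately show ?thesis unfolding Z_def abs_mult by (intro mult_mono) (use b0[OF o] D0 in auto)
  qed
  have sq_bd: "z\<^sup>2 \<le> (b * (2 * D))\<^sup>2" if "\<bar>z\<bar> \<le> b * (2 * D)" for z :: real
    using power_mono[OF that abs_ge_zero, of 2] by simp
  have iZ: "integrable mu (\<lambda>u. (flat Z u)\<^sup>2)"
  proof (rule mu.integrable_const_bound[where B="(b * (2 * D))\<^sup>2"])
    show "AE u in mu. norm ((flat Z u)\<^sup>2) \<le> (b * (2 * D))\<^sup>2"
      by (rule AE_I2) (auto simp: space_mu space_pair_measure intro!: sq_bd Z_bound)
  qed (use field_mu[OF fZ] in measurable)
  have iN: "integrable PM (\<lambda>p. (N (snd p) (fst p))\<^sup>2)"
  proof (rule PMf.integrable_const_bound[where B="(b * (2 * D))\<^sup>2"])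
    show "AE p in PM. norm ((N (snd p) (fst p))\<^sup>2) \<le> (b * (2 * D))\<^sup>2"
      by (rule AE_I2) (auto simp: space_pair_measure intro!: sq_bd N_bound)
  qed (use progressive_PM[OF prog] in measurable)
  have NTm: "N T \<in> borel_measurable M" using t_less by (intro measurable_F_M[OF bspec[OF ad]]) simp
  have iNT: "integrable M (\<lambda>\<omega>. (N T \<omega>)\<^sup>2)"
    by (rule integrable_const_bound[where B="(b * (2 * D))\<^sup>2"])
      (rule AE_I2, simp add: sq_bd N_bound, rule borel_measurable_power[OF NTm])
  have eq: "N q \<omega> = N T \<omega> + (LINT r:{q<..T}|lborel. 0) - (jump_sum Z q \<omega> - (LINT r:{q<..T}|lborel. comp Z (\<omega>, r)))"
    if o: "\<omega> \<in> \<Omega>" and q: "q \<in> {t..T}" for \<omega> q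
  proof -
    have cT: "c T = u" using u s by (auto simp: c_def)
    have iff: "q < r \<and> s < r \<and> r \<le> u \<longleftrightarrow> c q < r \<and> r \<le> u" for r unfolding c_def by auto
    have jz: "jump_sum Z q \<omega> = B \<omega> * (\<Sum>\<tau>\<in>J \<omega> \<inter> {c q<..u}. w (\<tau>, X \<tau> \<omega>) - w (\<tau>, Xm \<tau> \<omega>))"
    proof -
      have "(\<Sum>\<tau>\<in>J \<omega> \<inter> {q<..}. Z \<tau> \<omega> (X \<tau> \<omega>)) = (\<Sum>\<tau>\<in>J \<omega> \<inter> {c q<..u}. Z \<tau> \<omega> (X \<tau> \<omega>))"
      proof (rule sum.mono_neutral_right)
        show "finite (J \<omega> \<inter> {q<..})" using finite_J[OF o] by simp
        have "q < \<tau>" if "c q < \<tau>" "\<tau> \<le> u" for \<tau> using iff[of \<tau>] that by blast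
        then show "J \<omega> \<inter> {c q<..u} \<subseteq> J \<omega> \<inter> {q<..}" by auto
        show "\<forall>\<tau>\<in>J \<omega> \<inter> {q<..} - J \<omega> \<inter> {c q<..u}. Z \<tau> \<omega> (X \<tau> \<omega>) = 0"
        proof
          fix \<tau> assume "\<tau> \<in> J \<omega> \<inter> {q<..} - J \<omega> \<inter> {c q<..u}"
          then have "\<not> (s < \<tau> \<and> \<tau> \<le> u)" using iff[of \<tau>] by auto
          then show "Z \<tau> \<omega> (X \<tau> \<omega>) = 0" by (auto simp: Z_def)
        qed
      qed
      also have "\<dots> = (\<Sum>\<tau>\<in>J \<omega> \<inter> {c q<..u}. B \<omega> * (w (\<tau>, X \<tau> \<omega>) - w (\<tau>, Xm \<tau> \<omega>)))"
      proof (rule sum.cong[OF refl])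
        fix \<tau> assume "\<tau> \<in> J \<omega> \<inter> {c q<..u}"
        then have "s < \<tau>" "\<tau> \<le> u" using iff[of \<tau>] by auto
        then show "Z \<tau> \<omega> (X \<tau> \<omega>) = B \<omega> * (w (\<tau>, X \<tau> \<omega>) - w (\<tau>, Xm \<tau> \<omega>))" by (simp add: Z_def)
      qed
      finally show ?thesis unfolding jump_sum_def by (simp add: sum_distrib_left)
    qed
    have cz: "indicator {q<..T} r * comp Z (\<omega>, r) = B \<omega> * (indicator {c q<..u} r * gen w (r, Xm r \<omega>))" for r
    proof (cases "q < r \<and> s < r \<and> r \<le> u")
      case True
      then have "comp Z (\<omega>, r) = B \<omega> * gen w (r, Xm r \<omega>)"
        by (simp add: comp_def Z_def gen_def kernel_def)
      moreover have "r \<in> {q<..T}" "r \<in> {c q<..u}" using True iff[of r] u by auto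
      ultimately show ?thesis by simp
    next
      case False
      then have "r \<notin> {c q<..u}" using iff[of r] by auto
      moreover have "r \<in> {q<..T} \<Longrightarrow> comp Z (\<omega>, r) = 0" using False by (auto simp: comp_def Z_def)
      ultimately show ?thesis by (auto simp: indicator_def)
    qed
    have cz': "(LINT r:{q<..T}|lborel. comp Z (\<omega>, r)) = B \<omega> * (LINT r:{c q<..u}|lborel. gen w (r, Xm r \<omega>))"
      unfolding set_lebesgue_integral_def real_scaleR_def cz by (rule integral_mult_right_zero)
    have "w (u, X u \<omega>) - w (c q, X (c q) \<omega>)
      = (\<Sum>\<tau>\<in>J \<omega> \<inter> {c q<..u}. w (\<tau>, X \<tau> \<omega>) - w (\<tau>, Xm \<tau> \<omega>)) - (LINT r:{c q<..u}|lborel. gen w (r, Xm r \<omega>))"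
      using c_range[of q] by (intro path[OF o]) auto
    then have "B \<omega> * (w (u, X u \<omega>) - w (c q, X (c q) \<omega>)) = jump_sum Z q \<omega> - (LINT r:{q<..T}|lborel. comp Z (\<omega>, r))"
      unfolding jz cz' by (simp add: right_diff_distrib)
    then show ?thesis by (simp add: N_def cT set_lebesgue_integral_def right_diff_distrib)
  qed
  have "linear_bsde (\<lambda>_ _. 0) N Z"
    unfolding linear_bsde_def
  proof (intro conjI prog fZ iN iZ)
    show "AE \<omega> in M. \<forall>s\<in>{t..T}. N s \<omega> = N T \<omega> + (LINT r:{s<..T}|lborel. 0)
      - (jump_sum Z s \<omega> - (LINT r:{s<..T}|lborel. comp Z (\<omega>, r)))"
      by (rule AE_I2, rule ballI, rule eq) simp_all
  qed simp_all
  moreover have "N T \<omega> = B \<omega> * (\<phi> (X u \<omega>) - kw \<phi> u (s, X s \<omega>))" if "\<omega> \<in> \<Omega>" for \<omega>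
  proof -
    have cT: "c T = u" using u s by (auto simp: c_def)
    have "X u \<omega> \<in> space \<Gamma>" using u' t_nonneg that by (intro X_in_space) auto
    then show ?thesis unfolding N_def cT w_terminal[OF \<open>X u \<omega> \<in> space \<Gamma>\<close>] by (simp add: w_def)
  qed
  ultimately show ?thesis unfolding Rep_def using iNT by (auto intro!: AE_I2)
qed

end

section \<open>Closure properties of the representable variables\<close>

context jump_markov_started
begin

lemma Rep_lincomb:
  assumes "Rep \<eta>" "Rep \<eta>'" shows "Rep (\<lambda>\<omega>. a * \<eta> \<omega> + b * \<eta>' \<omega>)"
proof -
  obtain N Z where N: "linear_bsde (\<lambda>_ _. 0) N Z" "integrable M (\<lambda>\<omega>. (N T \<omega>)\<^sup>2)" "AE \<omega> in M. N T \<omega> = \<eta> \<omega>"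
    using assms(1) unfolding Rep_def by blast
  obtain N' Z' where N': "linear_bsde (\<lambda>_ _. 0) N' Z'" "integrable M (\<lambda>\<omega>. (N' T \<omega>)\<^sup>2)" "AE \<omega> in M. N' T \<omega> = \<eta>' \<omega>"
    using assms(2) unfolding Rep_def by blast
  have m: "N T \<in> borel_measurable M" "N' T \<in> borel_measurable M"
    using progressive_adapted[OF linear_bsdeD(1)[OF N(1)]] progressive_adapted[OF linear_bsdeD(1)[OF N'(1)]] t_less
    by (auto intro!: measurable_F_M[of _ T])
  have "AE \<omega> in M. a * N T \<omega> + b * N' T \<omega> = a * \<eta> \<omega> + b * \<eta>' \<omega>"
    using N(3) N'(3) by eventually_elim simp
  with linear_bsde_lincomb[OF N(1) N'(1), of a b] integrable_square_lincomb[OF m N(2) N'(2), of a b]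
  show ?thesis unfolding Rep_def by (intro exI conjI) simp_all
qed

lemma Rep_cong_AE: "Rep \<eta> \<Longrightarrow> (AE \<omega> in M. \<eta> \<omega> = \<eta>' \<omega>) \<Longrightarrow> Rep \<eta>'"
proof -
  assume "Rep \<eta>" and ae: "AE \<omega> in M. \<eta> \<omega> = \<eta>' \<omega>"
  then obtain N Z where N: "linear_bsde (\<lambda>_ _. 0) N Z" "integrable M (\<lambda>\<omega>. (N T \<omega>)\<^sup>2)" "AE \<omega> in M. N T \<omega> = \<eta> \<omega>"
    unfolding Rep_def by blast
  have "AE \<omega> in M. N T \<omega> = \<eta>' \<omega>" using N(3) ae by eventually_elim simp
  then show "Rep \<eta>'" unfolding Rep_def using N by blast
qed

lemma Rep_const: "Rep (\<lambda>_. c)"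
proof -
  have "linear_bsde (\<lambda>_ _. 0) (\<lambda>_ _. c) (\<lambda>_ _ _. 0)"
    unfolding linear_bsde_def
    by (simp add: progressive_def predictable_field_def jump_sum_def comp_def flat_def case_prod_beta')
  then show ?thesis unfolding Rep_def by (intro exI[of _ "\<lambda>_ _. c"] exI[of _ "\<lambda>_ _ _. 0"]) simp
qed

text \<open>Induction on the latest time \<open>m\<close>. Replacing \<open>\<phi> (X u)\<close> by
  \<open>kw \<phi> u (m, X m)\<close>, which plays the role of its conditional expectation at
  \<open>m\<close>, costs a representable term by \<open>Rep_step\<close>; the new factor is
  absorbed into a function of \<open>X m\<close>, and one time fewer remains. For this reason the
  claim is made for general bounded \<open>\<phi>\<close> and not only for indicators.\<close>

lemma Rep_cylinder:
  assumes "finite I" "I \<subseteq> {t..T}" "\<And>i. A i \<in> sets \<Gamma>"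
    and "u \<in> {t..T}" "\<forall>i\<in>I. i \<le> u" "\<phi> \<in> borel_measurable \<Gamma>" "\<And>z. z \<in> space \<Gamma> \<Longrightarrow> \<bar>\<phi> z\<bar> \<le> C"
  shows "Rep (\<lambda>\<omega>. (\<Prod>i\<in>I. indicator (A i) (X i \<omega>)) * \<phi> (X u \<omega>))"
  using assms
proof (induction I arbitrary: u \<phi> C rule: finite_linorder_max_induct)
  case empty
  note \<phi> = empty.prems(5,6) and u = empty.prems(3)
  have s: "t \<in> {t..T}" using t_less by simp
  \<comment> \<open>With no time left the step goes back to \<open>t\<close>, where
    \<open>X t\<close> equals \<open>x\<close> almost surely, and the remaining term is a
    constant.\<close>
  have "Rep (\<lambda>\<omega>. 1 * (\<phi> (X u \<omega>) - kw \<phi> u (t, X t \<omega>)))"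
    using u by (intro Rep_step[OF \<phi>(1) _ s, where C=C and b=1]) (auto intro: \<phi>(2))
  from Rep_lincomb[OF this Rep_const[of 1], of 1 "kw \<phi> u (t, x)"]
  have "Rep (\<lambda>\<omega>. \<phi> (X u \<omega>) - kw \<phi> u (t, X t \<omega>) + kw \<phi> u (t, x))" by simp
  then show ?case
    by (rule Rep_cong_AE) (use X_start in \<open>eventually_elim, simp\<close>)
next
  case (insert m I)
  note \<phi> = insert.prems(5,6) and u = insert.prems(3)
  have m: "m \<in> {t..T}" "m \<le> u" "m \<notin> I" using insert.prems insert.hyps by auto
  define B where "B \<omega> = (\<Prod>i\<in>insert m I. indicator (A i) (X i \<omega>) :: real)" for \<omega>
  have uT: "u \<le> T" using u by simp
  have B: "B \<in> borel_measurable (F m)"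
    unfolding B_def
  proof (rule borel_measurable_prod)
    fix i assume i: "i \<in> insert m I"
    then have "i \<in> {t..m}" using insert by fastforce
    from measurable_compose[OF X_measurable_F[OF this] borel_measurable_indicator[OF insert.prems(2)]]
    show "(\<lambda>\<omega>. indicator (A i) (X i \<omega>) :: real) \<in> borel_measurable (F m)" .
  qed
  have Bb: "\<bar>B \<omega>\<bar> \<le> 1" for \<omega>
    unfolding B_def abs_prod by (rule prod_le_1) (auto simp: indicator_def)
  have 1: "Rep (\<lambda>\<omega>. B \<omega> * (\<phi> (X u \<omega>) - kw \<phi> u (m, X m \<omega>)))"
    by (rule Rep_step[OF \<phi>(1) _ m(1,2) uT B Bb, where C=C]) (rule \<phi>(2))
  define \<psi> where "\<psi> z = indicator (A m) z * kw \<phi> u (m, z)" for z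
  have m0: "m \<in> {0..T}" using m t_nonneg by auto
  have \<psi>m: "\<psi> \<in> borel_measurable \<Gamma>"
    unfolding \<psi>_def using insert.prems(2)
    by (intro borel_measurable_times borel_measurable_indicator w_section[OF kw_props(1)[OF \<phi>(1) _ uT] m0]) (auto intro: \<phi>(2))
  have \<psi>b: "\<bar>\<psi> z\<bar> \<le> 2 * C * EK 0" if z: "z \<in> space \<Gamma>" for z
  proof -
    have "\<bar>kw \<phi> u (m, z)\<bar> \<le> 2 * C * EK 0" by (rule kw_props(2)[OF \<phi>(1) _ uT m0 z]) (rule \<phi>(2))
    then show ?thesis by (auto simp: \<psi>_def indicator_def)
  qed
  have 2: "Rep (\<lambda>\<omega>. (\<Prod>i\<in>I. indicator (A i) (X i \<omega>)) * \<psi> (X m \<omega>))"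
  proof (rule insert.IH[OF _ insert.prems(2) m(1) _ \<psi>m \<psi>b])
    show "I \<subseteq> {t..T}" using insert.prems(1) by simp
    show "\<forall>i\<in>I. i \<le> m" using insert.hyps(2) by (simp add: less_imp_le)
  qed
  have eq: "(\<Prod>i\<in>I. indicator (A i) (X i \<omega>)) * \<psi> (X m \<omega>) = B \<omega> * kw \<phi> u (m, X m \<omega>)" for \<omega>
    unfolding B_def \<psi>_def using insert.hyps(1) m(3) by simp
  from Rep_lincomb[OF 1 2[unfolded eq], of 1 1]
  have "Rep (\<lambda>\<omega>. B \<omega> * \<phi> (X u \<omega>))" by (simp add: right_diff_distrib)
  then show ?case by (simp only: B_def)
qed

lemma AE_summable:
  fixes f :: "nat \<Rightarrow> 'c \<Rightarrow> real"
  assumes [measurable]: "\<And>n. f n \<in> borel_measurable N" and nn: "\<And>n x. 0 \<le> f n x" and c: "0 \<le> c"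
    and b: "\<And>n. (\<integral>\<^sup>+x. ennreal (f n x) \<partial>N) \<le> ennreal (c * (1/2)^n)"
  shows "AE x in N. summable (\<lambda>n. f n x)"
proof -
  have "(\<integral>\<^sup>+x. (\<Sum>n. ennreal (f n x)) \<partial>N) = (\<Sum>n. (\<integral>\<^sup>+x. ennreal (f n x) \<partial>N))"
    by (rule nn_integral_suminf) simp
  also have "\<dots> \<le> (\<Sum>n. ennreal (c * (1/2)^n))" using b by (intro suminf_le) auto
  also have "\<dots> = ennreal (\<Sum>n. c * (1/2)^n)" using c by (intro suminf_ennreal2) auto
  finally have "(\<integral>\<^sup>+x. (\<Sum>n. ennreal (f n x)) \<partial>N) \<noteq> \<infinity>" by (auto simp: top_unique)
  then have "AE x in N. (\<Sum>n. ennreal (f n x)) \<noteq> \<infinity>" by (intro nn_integral_PInf_AE) simp_all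
  then show ?thesis
    by eventually_elim (rule summable_suminf_not_top, simp_all add: nn)
qed

text \<open>Young's inequality with weight \<open>2^n\<close>. Squares of size
  \<open>(1/4)^n\<close> thus control first powers of size \<open>(1/2)^n\<close>, which are
  summable.\<close>

lemma square_le_weighted: "\<bar>z\<bar> \<le> (1/2)^n + 2^n * z\<^sup>2" for z :: real
proof -
  have "0 \<le> (1 - 2 ^ n * \<bar>z\<bar>)\<^sup>2" by simp
  then have "2 * (2 ^ n * \<bar>z\<bar>) \<le> 1 + (2 ^ n * \<bar>z\<bar>)\<^sup>2" by (simp add: power2_diff)
  also have "(2 ^ n * \<bar>z\<bar>)\<^sup>2 = 2 ^ n * (2 ^ n * z\<^sup>2)" by (simp add: power2_eq_square)
  finally have "2 * (2 ^ n * \<bar>z\<bar>) \<le> 2^n * ((1/2)^n + 2 ^ n * z\<^sup>2)"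
    by (simp add: distrib_left power_mult_distrib[symmetric])
  then have "2^n * (2 * \<bar>z\<bar>) \<le> 2^n * ((1/2)^n + 2 ^ n * z\<^sup>2)" by (simp only: mult.left_commute)
  then have "2 * \<bar>z\<bar> \<le> (1/2)^n + 2 ^ n * z\<^sup>2" by simp
  then show ?thesis using abs_ge_zero[of z] by linarith
qed

text \<open>Two choices of the weight: the constant 1 has derivative 0 and isolates
  \<open>Z\<close>, while \<open>1 + r - t\<close> has derivative 1 and brings in
  \<open>N\<close>.\<close>

lemma linear_zero_energy:
  assumes lin: "linear_bsde (\<lambda>_ _. 0) N Z" and T2: "integrable M (\<lambda>\<omega>. (N T \<omega>)\<^sup>2)"
  shows "(\<integral>p. (N (snd p) (fst p))\<^sup>2 \<partial>PM) \<le> (1 + T - t) * (\<integral>\<omega>. (N T \<omega>)\<^sup>2 \<partial>M)"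
    and "(\<integral>u. (flat Z u)\<^sup>2 \<partial>mu) \<le> (\<integral>\<omega>. (N T \<omega>)\<^sup>2 \<partial>M)"
proof -
  note D = linear_bsdeD[OF lin]
  have f2: "field (\<lambda>r \<omega> y. (Z r \<omega> y)\<^sup>2)" by (rule field_square[OF D(2)])
  have fl: "flat (\<lambda>r \<omega> y. (Z r \<omega> y)\<^sup>2) = (\<lambda>u. (flat Z u)\<^sup>2)" by (simp add: flat_def)
  have c2: "(\<integral>p. comp (\<lambda>r \<omega> y. (Z r \<omega> y)\<^sup>2) p \<partial>PM) = (\<integral>u. (flat Z u)\<^sup>2 \<partial>mu)"
    using integrable_comp(2)[OF f2] D(4) by (simp add: fl)
  have cnn: "0 \<le> comp (\<lambda>r \<omega> y. (Z r \<omega> y)\<^sup>2) p" for p by (simp add: comp_def)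
  have "(\<integral>p. 0 * (N (snd p) (fst p))\<^sup>2 \<partial>PM) + (\<integral>p. 1 * comp (\<lambda>r \<omega> y. (Z r \<omega> y)\<^sup>2) p \<partial>PM)
    \<le> 1 * (\<integral>\<omega>. (N T \<omega>)\<^sup>2 \<partial>M) + 2 * (\<integral>p. 1 * (N (snd p) (fst p) * 0) \<partial>PM)"
    by (rule weighted_energy[OF lin T2, of "\<lambda>_. 1" "\<lambda>_. 0"]) (auto intro!: derivative_eq_intros)
  then show "(\<integral>u. (flat Z u)\<^sup>2 \<partial>mu) \<le> (\<integral>\<omega>. (N T \<omega>)\<^sup>2 \<partial>M)" by (simp add: c2)
  have "(\<integral>p. 1 * (N (snd p) (fst p))\<^sup>2 \<partial>PM) + (\<integral>p. (1 + snd p - t) * comp (\<lambda>r \<omega> y. (Z r \<omega> y)\<^sup>2) p \<partial>PM)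
    \<le> (1 + T - t) * (\<integral>\<omega>. (N T \<omega>)\<^sup>2 \<partial>M) + 2 * (\<integral>p. (1 + snd p - t) * (N (snd p) (fst p) * 0) \<partial>PM)"
    by (rule weighted_energy[OF lin T2, of "\<lambda>r. 1 + r - t" "\<lambda>_. 1"]) (auto intro!: derivative_eq_intros)
  moreover have "0 \<le> (\<integral>p. (1 + snd p - t) * comp (\<lambda>r \<omega> y. (Z r \<omega> y)\<^sup>2) p \<partial>PM)"
    by (intro integral_nonneg_AE AE_I2 mult_nonneg_nonneg cnn) (auto simp: space_pair_measure)
  ultimately show "(\<integral>p. (N (snd p) (fst p))\<^sup>2 \<partial>PM) \<le> (1 + T - t) * (\<integral>\<omega>. (N T \<omega>)\<^sup>2 \<partial>M)" by simp
qed

text \<open>Convergence in \<open>L2\<close> of \<open>mu\<close> by itself says nothing about the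
  values of \<open>Z\<close> at the jump points, where the equation evaluates it. The compensator
  formula turns the rate of convergence into almost sure summability of the squared jumps, so
  \<open>Z n\<close> converges at every jump of almost every path, and the equation passes to the
  limit at all times simultaneously.\<close>

lemma Rep_fast_limit:
  assumes lin: "\<And>n. linear_bsde (\<lambda>_ _. 0) (N n) (Z n)" and T2: "\<And>n. integrable M (\<lambda>\<omega>. (N n T \<omega>)\<^sup>2)"
    and \<eta>: "\<eta> \<in> borel_measurable M" "integrable M (\<lambda>\<omega>. (\<eta> \<omega>)\<^sup>2)"
    and fast: "\<And>n. (\<integral>\<omega>. (N n T \<omega> - \<eta> \<omega>)\<^sup>2 \<partial>M) \<le> (1/4)^n"
  shows "Rep \<eta>"
proof -
  note D = linear_bsdeD[OF lin]
  have Nm: "N n s \<in> borel_measurable (F s)" if "s \<in> {t..T}" for n s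
    using progressive_adapted[OF D(1)] that by blast
  have NTm: "N n T \<in> borel_measurable M" for n using Nm[of T n] t_less by (intro measurable_F_M) simp
  have idiff: "integrable M (\<lambda>\<omega>. (N n T \<omega> - \<eta> \<omega>)\<^sup>2)" for n
    using integrable_square_lincomb[OF NTm[of n] \<eta>(1) T2[of n] \<eta>(2), of 1 "-1"] by simp
  define dN where "dN n r \<omega> = 1 * N (Suc n) r \<omega> + (-1) * N n r \<omega>" for n r \<omega>
  define dZ where "dZ n r \<omega> y = 1 * Z (Suc n) r \<omega> y + (-1) * Z n r \<omega> y" for n r \<omega> y
  have dlin: "linear_bsde (\<lambda>_ _. 0) (dN n) (dZ n)" for n
    using linear_bsde_lincomb[OF lin[of "Suc n"] lin[of n], of 1 "-1"] unfolding dN_def[abs_def] dZ_def[abs_def] by simp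
  have dT2: "integrable M (\<lambda>\<omega>. (dN n T \<omega>)\<^sup>2)" for n
    unfolding dN_def by (rule integrable_square_lincomb[OF NTm NTm T2 T2])
  have dT: "(\<integral>\<omega>. (dN n T \<omega>)\<^sup>2 \<partial>M) \<le> 4 * (1/4)^n" for n
  proof -
    have "(\<integral>\<omega>. (dN n T \<omega>)\<^sup>2 \<partial>M) \<le> (\<integral>\<omega>. 2 * (N (Suc n) T \<omega> - \<eta> \<omega>)\<^sup>2 + 2 * (N n T \<omega> - \<eta> \<omega>)\<^sup>2 \<partial>M)"
    proof (rule integral_mono[OF dT2])
      fix \<omega>
      have "(a - b)\<^sup>2 \<le> 2 * (a - e)\<^sup>2 + 2 * (b - e)\<^sup>2" for a b e :: real
        using zero_le_power2[of "a + b - 2 * e"] by (simp add: power2_eq_square algebra_simps)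
      then show "(dN n T \<omega>)\<^sup>2 \<le> 2 * (N (Suc n) T \<omega> - \<eta> \<omega>)\<^sup>2 + 2 * (N n T \<omega> - \<eta> \<omega>)\<^sup>2"
        by (simp add: dN_def)
    qed (use idiff in simp)
    also have "\<dots> = 2 * (\<integral>\<omega>. (N (Suc n) T \<omega> - \<eta> \<omega>)\<^sup>2 \<partial>M) + 2 * (\<integral>\<omega>. (N n T \<omega> - \<eta> \<omega>)\<^sup>2 \<partial>M)"
      using idiff[of n] idiff[of "Suc n"] by simp
    also have "\<dots> \<le> 2 * (1/4)^(Suc n) + 2 * (1/4)^n"
      using fast[of n] fast[of "Suc n"] by (intro add_mono mult_left_mono) auto
    also have "\<dots> \<le> 4 * (1/4)^n" by simp
    finally show ?thesis .
  qed
  \<comment> \<open>The limit is taken at every point and not up to null sets of \<open>mu\<close>: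
    it has to be predictable and to have the right values at the jumps.\<close>
  define Zl where "Zl r \<omega> y = lim (\<lambda>n. Z n r \<omega> y)" for r \<omega> y
  have fZl: "field Zl" unfolding Zl_def[abs_def] by (rule field_lim[OF D(2)])
  have flZl: "flat Zl u = lim (\<lambda>n. flat (Z n) u)" for u by (simp add: flat_def Zl_def)
  have nn_dZ: "(\<integral>\<^sup>+u. ennreal ((flat (Z (Suc n)) u - flat (Z n) u)\<^sup>2) \<partial>mu) \<le> ennreal (4 * (1/4)^n)" for n
  proof -
    have fl: "flat (dZ n) u = flat (Z (Suc n)) u - flat (Z n) u" for u by (simp add: flat_def dZ_def)
    have "(\<integral>\<^sup>+u. ennreal ((flat (dZ n) u)\<^sup>2) \<partial>mu) = ennreal (\<integral>u. (flat (dZ n) u)\<^sup>2 \<partial>mu)"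
      using linear_bsdeD(4)[OF dlin] by (intro nn_integral_eq_integral) auto
    also have "\<dots> \<le> ennreal (4 * (1/4)^n)"
      using linear_zero_energy(2)[OF dlin dT2] dT by (intro ennreal_leI) (rule order.trans)
    finally show ?thesis by (simp add: fl)
  qed
  note Zfast = fast_Cauchy_L2[of "\<lambda>n. flat (Z n)" mu 4, OF field_mu[OF D(2)] _ nn_dZ, folded flZl]
  have nn_dN: "(\<integral>\<^sup>+p. ennreal ((N (Suc n) (snd p) (fst p) - N n (snd p) (fst p))\<^sup>2) \<partial>PM) \<le> ennreal ((1 + T - t) * 4 * (1/4)^n)" for n
  proof -
    have "(\<integral>\<^sup>+p. ennreal ((dN n (snd p) (fst p))\<^sup>2) \<partial>PM) = ennreal (\<integral>p. (dN n (snd p) (fst p))\<^sup>2 \<partial>PM)"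
      using linear_bsdeD(3)[OF dlin] by (intro nn_integral_eq_integral) auto
    also have "\<dots> \<le> ennreal ((1 + T - t) * (4 * (1/4)^n))"
    proof (intro ennreal_leI order.trans[OF linear_zero_energy(1)[OF dlin dT2]])
      show "(1 + T - t) * (\<integral>\<omega>. (dN n T \<omega>)\<^sup>2 \<partial>M) \<le> (1 + T - t) * (4 * (1/4)^n)"
        using dT t_less by (intro mult_left_mono) auto
    qed
    finally show ?thesis unfolding dN_def mult.assoc by simp
  qed
  note Nfast = fast_Cauchy_L2[of "\<lambda>n p. N n (snd p) (fst p)" PM "(1 + T - t) * 4", OF progressive_PM[OF D(1)] _ nn_dN]
  have iZl: "integrable mu (\<lambda>u. (flat Zl u)\<^sup>2)"
  proof -
    have i: "integrable mu (\<lambda>u. (1 * (flat Zl u - flat (Z 0) u) + 1 * flat (Z 0) u)\<^sup>2)"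
    proof (rule integrable_square_lincomb)
      have "(\<integral>\<^sup>+u. ennreal ((flat Zl u - flat (Z 0) u)\<^sup>2) \<partial>mu) < \<infinity>"
        using Zfast(2)[of 0] by (auto simp: le_less_trans)
      then show "integrable mu (\<lambda>u. (flat Zl u - flat (Z 0) u)\<^sup>2)"
        using field_mu[OF fZl] field_mu[OF D(2)] by (intro integrableI_bounded) auto
    qed (use field_mu[OF fZl] field_mu[OF D(2)] D(4) in auto)
    then show ?thesis by simp
  qed
  have ae_N: "AE \<omega> in M. (\<lambda>n. N n T \<omega>) \<longlonglongrightarrow> \<eta> \<omega>"
  proof -
    have "AE \<omega> in M. summable (\<lambda>n. (N n T \<omega> - \<eta> \<omega>)\<^sup>2)"
    proof (rule AE_summable[where c=1])
      fix n
      have "(\<integral>\<^sup>+\<omega>. ennreal ((N n T \<omega> - \<eta> \<omega>)\<^sup>2) \<partial>M) = ennreal (\<integral>\<omega>. (N n T \<omega> - \<eta> \<omega>)\<^sup>2 \<partial>M)"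
        using idiff by (intro nn_integral_eq_integral) auto
      also have "\<dots> \<le> ennreal (1 * (1/2)^n)"
      proof (intro ennreal_leI order.trans[OF fast])
        show "(1/4)^n \<le> 1 * (1/2 :: real)^n" by (simp add: power_mono)
      qed
      finally show "(\<integral>\<^sup>+\<omega>. ennreal ((N n T \<omega> - \<eta> \<omega>)\<^sup>2) \<partial>M) \<le> ennreal (1 * (1/2)^n)" .
    qed (use NTm \<eta>(1) in auto)
    then show ?thesis
    proof eventually_elim
      case (elim \<omega>)
      have "(\<lambda>n. sqrt ((N n T \<omega> - \<eta> \<omega>)\<^sup>2)) \<longlonglongrightarrow> sqrt 0"
        by (intro tendsto_real_sqrt summable_LIMSEQ_zero elim)
      then show ?case by (simp add: tendsto_rabs_zero_iff LIM_zero_iff)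
    qed
  qed
  have ae_J: "AE \<omega> in M. \<forall>\<tau>\<in>J \<omega>. (\<lambda>n. Z n \<tau> \<omega> (X \<tau> \<omega>)) \<longlonglongrightarrow> Zl \<tau> \<omega> (X \<tau> \<omega>)"
  proof -
    \<comment> \<open>The weight \<open>2^n\<close> is affordable because the energies decay like
      \<open>(1/4)^n\<close>; it is what makes the increments at a jump absolutely summable.\<close>
    define S where "S n \<omega> = 2^n * jump_sum (\<lambda>r \<omega> y. (dZ n r \<omega> y)\<^sup>2) t \<omega>" for n \<omega>
    have s: "t \<in> {t..T}" using t_less by simp
    have jm: "jump_sum (\<lambda>r \<omega> y. (dZ n r \<omega> y)\<^sup>2) t \<in> borel_measurable M" for n
      by (rule jump_functional_measurable[OF dlin s, of "\<lambda>u z. z\<^sup>2"]) auto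
    have fl2: "flat (\<lambda>r \<omega> y. (dZ n r \<omega> y)\<^sup>2) = (\<lambda>u. (flat (dZ n) u)\<^sup>2)" for n by (simp add: flat_def)
    have i2: "integrable mu (flat (\<lambda>r \<omega> y. (dZ n r \<omega> y)\<^sup>2))" for n
      unfolding fl2 by (rule linear_bsdeD(4)[OF dlin])
    have jnn: "0 \<le> jump_sum (\<lambda>r \<omega> y. (dZ n r \<omega> y)\<^sup>2) t \<omega>" for n \<omega>
      unfolding jump_sum_def by (intro sum_nonneg) simp
    note je = jump_sum_expectation_nonneg[OF field_square[OF linear_bsdeD(2)[OF dlin]] _ i2 s jm]
    have "AE \<omega> in M. summable (\<lambda>n. S n \<omega>)"
    proof (rule AE_summable[where c=4])
      fix n
      have "(\<integral>\<^sup>+\<omega>. ennreal (S n \<omega>) \<partial>M) = ennreal (\<integral>\<omega>. S n \<omega> \<partial>M)"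
        unfolding S_def using je(1) jnn by (intro nn_integral_eq_integral) auto
      also have "(\<integral>\<omega>. S n \<omega> \<partial>M) = 2^n * (\<integral>u. indicator {t<..} (snd (fst u)) * (flat (dZ n) u)\<^sup>2 \<partial>mu)"
        unfolding S_def using je(2) by (simp add: fl2)
      also have "\<dots> \<le> 2^n * (\<integral>u. (flat (dZ n) u)\<^sup>2 \<partial>mu)"
        using je(3)[of n] i2[of n] unfolding fl2
        by (intro mult_left_mono integral_mono) (auto simp: indicator_def)
      also have "\<dots> \<le> 2^n * (4 * (1/4)^n)"
        using order.trans[OF linear_zero_energy(2)[OF dlin dT2] dT, of n] by (rule mult_left_mono) simp
      also have "\<dots> = 4 * (1/2)^n"
      proof -
        have "(2::real)^n * (1/4)^n = (1/2)^n" by (simp add: power_mult_distrib[symmetric])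
        then show ?thesis by simp
      qed
      finally show "(\<integral>\<^sup>+\<omega>. ennreal (S n \<omega>) \<partial>M) \<le> ennreal (4 * (1/2)^n)" by (simp add: ennreal_leI)
    qed (use jm jnn in \<open>auto simp: S_def[abs_def]\<close>)
    then show ?thesis
      using AE_space
    proof eventually_elim
      case (elim \<omega>)
      show ?case
      proof
        fix \<tau> assume \<tau>: "\<tau> \<in> J \<omega>"
        have fin: "finite (J \<omega> \<inter> {t<..})" "\<tau> \<in> J \<omega> \<inter> {t<..}"
          using finite_J[of \<omega>] elim(2) \<tau> J_subset[of \<omega>] by auto
        have "summable (\<lambda>n. dZ n \<tau> \<omega> (X \<tau> \<omega>))"
        proof (rule summable_comparison_test)
          show "summable (\<lambda>n. (1/2)^n + S n \<omega>)" using elim(1) by (intro summable_add) auto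
          have "\<bar>dZ n \<tau> \<omega> (X \<tau> \<omega>)\<bar> \<le> (1/2)^n + S n \<omega>" for n
          proof -
            have "(dZ n \<tau> \<omega> (X \<tau> \<omega>))\<^sup>2 \<le> jump_sum (\<lambda>r \<omega> y. (dZ n r \<omega> y)\<^sup>2) t \<omega>"
              unfolding jump_sum_def using fin by (intro member_le_sum[of \<tau>]) auto
            then have "2^n * (dZ n \<tau> \<omega> (X \<tau> \<omega>))\<^sup>2 \<le> S n \<omega>" unfolding S_def by simp
            then show ?thesis using square_le_weighted[of "dZ n \<tau> \<omega> (X \<tau> \<omega>)" n] by linarith
          qed
          then show "\<exists>n0. \<forall>n\<ge>n0. norm (dZ n \<tau> \<omega> (X \<tau> \<omega>)) \<le> (1/2)^n + S n \<omega>" by simp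
        qed
        then have "summable (\<lambda>n. Z (Suc n) \<tau> \<omega> (X \<tau> \<omega>) - Z n \<tau> \<omega> (X \<tau> \<omega>))" by (simp add: dZ_def)
        then have "convergent (\<lambda>n. \<Sum>j<n. Z (Suc j) \<tau> \<omega> (X \<tau> \<omega>) - Z j \<tau> \<omega> (X \<tau> \<omega>))"
          by (simp add: summable_iff_convergent)
        then have "convergent (\<lambda>n. Z n \<tau> \<omega> (X \<tau> \<omega>) - Z 0 \<tau> \<omega> (X \<tau> \<omega>))"
          unfolding sum_lessThan_telescope[of "\<lambda>n. Z n \<tau> \<omega> (X \<tau> \<omega>)"] .
        then have "convergent (\<lambda>n. (Z n \<tau> \<omega> (X \<tau> \<omega>) - Z 0 \<tau> \<omega> (X \<tau> \<omega>)) + Z 0 \<tau> \<omega> (X \<tau> \<omega>))"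
          by (intro convergent_add convergent_const)
        then show "(\<lambda>n. Z n \<tau> \<omega> (X \<tau> \<omega>)) \<longlonglongrightarrow> Zl \<tau> \<omega> (X \<tau> \<omega>)"
          unfolding Zl_def by (simp add: convergent_LIMSEQ_iff)
      qed
    qed
  qed
  have iZ: "integrable mu (flat (Z n))" for n by (rule integrable_mu_L1[OF D(2,4)])
  have iZl1: "integrable mu (flat Zl)" by (rule integrable_mu_L1[OF fZl iZl])
  have ae_C: "AE \<omega> in M. \<forall>s\<in>{t..T}. (\<lambda>n. LINT r:{s<..T}|lborel. comp (Z n) (\<omega>, r)) \<longlonglongrightarrow> (LINT r:{s<..T}|lborel. comp Zl (\<omega>, r))"
  proof -
    define dC where "dC n r \<omega> y = 1 * Z n r \<omega> y + (-1) * Zl r \<omega> y" for n r \<omega> y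
    have fC: "field (dC n)" for n unfolding dC_def[abs_def] by (rule field_lincomb[OF D(2) fZl])
    have flC: "flat (dC n) u = flat (Z n) u - flat Zl u" for n u by (simp add: flat_def dC_def)
    have iC: "integrable mu (flat (dC n))" for n unfolding flC[abs_def] using iZ iZl1 by simp
    have iC2: "integrable mu (\<lambda>u. (flat (dC n) u)\<^sup>2)" for n
      unfolding flC using integrable_square_lincomb[OF field_mu[OF D(2)[of n]] field_mu[OF fZl] D(4)[of n] iZl, of 1 "-1"] by simp
    have C2: "(\<integral>u. (flat (dC n) u)\<^sup>2 \<partial>mu) \<le> 16 * (1/4)^n" for n
    proof -
      have "ennreal (\<integral>u. (flat (dC n) u)\<^sup>2 \<partial>mu) = (\<integral>\<^sup>+u. ennreal ((flat (dC n) u)\<^sup>2) \<partial>mu)"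
        using iC2 by (intro nn_integral_eq_integral[symmetric]) auto
      also have "\<dots> \<le> ennreal (16 * (1/4)^n)"
        using Zfast(2)[of n] by (simp add: flC power2_commute)
      finally show ?thesis by (subst (asm) ennreal_le_iff) auto
    qed
    \<comment> \<open>The integral of the absolute value over the whole interval bounds the error of
      the compensator integrals from every \<open>s\<close> at once.\<close>
    define f where "f n \<omega> = (\<integral>r. \<bar>comp (dC n) (\<omega>, r)\<bar> \<partial>time)" for n \<omega>
    have ic: "integrable PM (comp (dC n))" for n by (rule integrable_comp(1)[OF fC iC])
    define m where "m = measure mu (space mu)"
    have fint: "integrable M (f n)" and fE: "(\<integral>\<omega>. f n \<omega> \<partial>M) \<le> (m + 16) * (1/2)^n" for n
    proof -
      show "integrable M (f n)" unfolding f_def[abs_def] using PMs.integrable_fst'[OF integrable_abs[OF ic]] by simp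
      have fA: "field (\<lambda>r \<omega> y. \<bar>dC n r \<omega> y\<bar>)" by (rule field_lift[OF fC]) measurable
      have iA: "integrable mu (flat (\<lambda>r \<omega> y. \<bar>dC n r \<omega> y\<bar>))"
        using integrable_abs[OF iC[of n]] by (simp add: flat_def)
      have "(\<integral>\<omega>. f n \<omega> \<partial>M) = (\<integral>p. \<bar>comp (dC n) p\<bar> \<partial>PM)"
        unfolding f_def using PMs.integral_fst'[OF integrable_abs[OF ic]] by simp
      also have "\<dots> \<le> (\<integral>p. comp (\<lambda>r \<omega> y. \<bar>dC n r \<omega> y\<bar>) p \<partial>PM)"
        by (intro integral_mono integrable_abs ic integrable_comp(1)[OF fA iA]) (simp add: comp_def integral_abs_bound)
      also have "\<dots> = (\<integral>u. \<bar>flat (dC n) u\<bar> \<partial>mu)"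
        using integrable_comp(2)[OF fA iA] by (simp add: flat_def)
      also have "\<dots> \<le> (\<integral>u. (1/2)^n + 2^n * (flat (dC n) u)\<^sup>2 \<partial>mu)"
        using iC iC2 by (intro integral_mono square_le_weighted) auto
      also have "\<dots> = (1/2)^n * m + 2^n * (\<integral>u. (flat (dC n) u)\<^sup>2 \<partial>mu)"
        using iC2[of n] by (simp add: m_def)
      also have "\<dots> \<le> (1/2)^n * m + 2^n * (16 * (1/4)^n)"
        using C2[of n] by (intro add_left_mono mult_left_mono) auto
      also have "\<dots> = (m + 16) * (1/2)^n"
      proof -
        have "(2::real)^n * (1/4)^n = (1/2)^n" by (simp add: power_mult_distrib[symmetric])
        then show ?thesis by (simp add: algebra_simps)
      qed
      finally show "(\<integral>\<omega>. f n \<omega> \<partial>M) \<le> (m + 16) * (1/2)^n" .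
    qed
    have fnn: "0 \<le> f n \<omega>" for n \<omega> by (simp add: f_def)
    have sm: "AE \<omega> in M. summable (\<lambda>n. f n \<omega>)"
    proof (rule AE_summable[where c="m + 16"])
      fix n
      have "(\<integral>\<^sup>+\<omega>. ennreal (f n \<omega>) \<partial>M) = ennreal (\<integral>\<omega>. f n \<omega> \<partial>M)"
        using fint fnn by (intro nn_integral_eq_integral) auto
      then show "(\<integral>\<^sup>+\<omega>. ennreal (f n \<omega>) \<partial>M) \<le> ennreal ((m + 16) * (1/2)^n)"
        using fE[of n] by (simp add: ennreal_leI)
    qed (use fint fnn in \<open>auto simp: m_def\<close>)
    have lc: "AE \<omega> in M. \<forall>n. \<forall>s\<in>{t..T}. (LINT r:{s<..T}|lborel. comp (dC n) (\<omega>, r))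
      = 1 * (LINT r:{s<..T}|lborel. comp (Z n) (\<omega>, r)) + (-1) * (LINT r:{s<..T}|lborel. comp Zl (\<omega>, r))"
      unfolding AE_all_countable dC_def[abs_def] using comp_lincomb[OF D(2) iZ fZl iZl1] by blast
    have ii: "AE \<omega> in M. \<forall>n. set_integrable lborel {t<..T} (\<lambda>r. comp (dC n) (\<omega>, r))"
      unfolding AE_all_countable using AE_PM_integrable[OF ic] by blast
    show ?thesis using sm lc ii
    proof eventually_elim
      case (elim \<omega>)
      show ?case
      proof
        fix s assume s: "s \<in> {t..T}"
        have bd: "\<bar>(LINT r:{s<..T}|lborel. comp (Z n) (\<omega>, r)) - (LINT r:{s<..T}|lborel. comp Zl (\<omega>, r))\<bar> \<le> f n \<omega>" for n
        proof -
          have it: "integrable time (\<lambda>r. comp (dC n) (\<omega>, r))" using elim(3) by (simp add: integrable_time_iff)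
          have "(LINT r:{s<..T}|lborel. comp (Z n) (\<omega>, r)) - (LINT r:{s<..T}|lborel. comp Zl (\<omega>, r))
            = (\<integral>r. indicator {s<..} r * comp (dC n) (\<omega>, r) \<partial>time)"
            using elim(2) s by (simp add: integral_time_after[symmetric])
          also have "\<bar>\<dots>\<bar> \<le> (\<integral>r. \<bar>indicator {s<..} r * comp (dC n) (\<omega>, r)\<bar> \<partial>time)" by (rule integral_abs_bound)
          also have "\<dots> \<le> f n \<omega>"
            unfolding f_def
          proof (rule integral_mono)
            show i1: "integrable time (\<lambda>r. \<bar>comp (dC n) (\<omega>, r)\<bar>)" using it by simp
            have "(\<lambda>r. indicator {s<..} r :: real) \<in> borel_measurable time"
              unfolding time_def by (rule measurable_restrict_space1) simp
            then show "integrable time (\<lambda>r. \<bar>indicator {s<..} r * comp (dC n) (\<omega>, r)\<bar>)"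
              using it by (intro Bochner_Integration.integrable_bound[OF i1]) (auto simp: indicator_def)
          qed (auto simp: indicator_def)
          finally show ?thesis .
        qed
        have "(\<lambda>n. (LINT r:{s<..T}|lborel. comp (Z n) (\<omega>, r)) - (LINT r:{s<..T}|lborel. comp Zl (\<omega>, r))) \<longlonglongrightarrow> 0"
          by (rule Lim_null_comparison[OF _ summable_LIMSEQ_zero[OF elim(1)]]) (simp add: bd)
        then show "(\<lambda>n. LINT r:{s<..T}|lborel. comp (Z n) (\<omega>, r)) \<longlonglongrightarrow> (LINT r:{s<..T}|lborel. comp Zl (\<omega>, r))"
          by (rule LIM_zero_cancel)
      qed
    qed
  qed
  \<comment> \<open>The limit process is defined by the equation itself, for every \<open>s\<close>.
    That it is also the limit of \<open>N n s\<close> serves to show that it is adapted and square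
    integrable.\<close>
  define Nl where "Nl s \<omega> = \<eta> \<omega> + (LINT r:{s<..T}|lborel. comp Zl (\<omega>, r)) - jump_sum Zl s \<omega>" for s \<omega>
  have NlT: "Nl T \<omega> = \<eta> \<omega>" for \<omega>
  proof -
    have "J \<omega> \<inter> {T<..} = {}" using J_subset[of \<omega>] by auto
    then show ?thesis by (simp add: Nl_def jump_sum_def set_lebesgue_integral_def)
  qed
  have conv: "AE \<omega> in M. \<forall>s\<in>{t..T}. (\<lambda>n. N n s \<omega>) \<longlonglongrightarrow> Nl s \<omega>"
  proof -
    have "AE \<omega> in M. \<forall>n. \<forall>s\<in>{t..T}. N n s \<omega> = N n T \<omega> + (LINT r:{s<..T}|lborel. 0)
      - (jump_sum (Z n) s \<omega> - (LINT r:{s<..T}|lborel. comp (Z n) (\<omega>, r)))"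
      unfolding AE_all_countable using D(7) by blast
    then show ?thesis using ae_N ae_J ae_C
    proof eventually_elim
      case (elim \<omega>)
      show ?case
      proof
        fix s assume s: "s \<in> {t..T}"
        have "(\<lambda>n. N n T \<omega> + (LINT r:{s<..T}|lborel. comp (Z n) (\<omega>, r)) - jump_sum (Z n) s \<omega>) \<longlonglongrightarrow> Nl s \<omega>"
          unfolding Nl_def jump_sum_def
          by (intro tendsto_intros elim(2) elim(4)[rule_format, OF s] elim(3)[rule_format]) simp
        moreover have "N n T \<omega> + (LINT r:{s<..T}|lborel. comp (Z n) (\<omega>, r)) - jump_sum (Z n) s \<omega> = N n s \<omega>" for n
          using elim(1)[rule_format, OF s, of n] by (simp add: set_lebesgue_integral_def)
        ultimately show "(\<lambda>n. N n s \<omega>) \<longlonglongrightarrow> Nl s \<omega>" by simp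
      qed
    qed
  qed
  have ad: "adapted Nl"
  proof
    fix s assume s: "s \<in> {t..T}"
    have "(\<lambda>\<omega>. lim (\<lambda>n. N n s \<omega>)) \<in> borel_measurable (F s)"
      by (rule borel_measurable_lim_metric) (rule Nm[OF s])
    then show "Nl s \<in> borel_measurable (F s)"
      by (rule measurable_F_AE) (use conv in \<open>eventually_elim, use s in \<open>blast intro: limI\<close>\<close>)
  qed
  have path: "AE \<omega> in M. path_equation (\<lambda>r \<omega>. 0 + comp Zl (\<omega>, r)) Nl Zl \<omega>"
    using AE_PM_integrable[OF integrable_comp(1)[OF fZl iZl1]] AE_space
    by eventually_elim (simp add: path_equation_def NlT, simp add: Nl_def)
  obtain Y where Y: "progressive F t T Y" "AE \<omega> in M. \<forall>s. Y s \<omega> = Nl s \<omega>"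
    using linear_bsdeI_path[OF ad fZl iZl path] by blast
  have Ylim: "AE p in PM. Y (snd p) (fst p) = lim (\<lambda>n. N n (snd p) (fst p))"
  proof (rule AE_PM)
    have [measurable]: "(\<lambda>p. lim (\<lambda>n. N n (snd p) (fst p))) \<in> borel_measurable PM"
      by (rule borel_measurable_lim_metric) (rule progressive_PM[OF D(1)])
    note [measurable] = progressive_PM[OF Y(1)]
    show "{p \<in> space PM. Y (snd p) (fst p) = lim (\<lambda>n. N n (snd p) (fst p))} \<in> sets PM" by measurable
    show "AE \<omega> in M. AE r in time. Y (snd (\<omega>, r)) (fst (\<omega>, r)) = lim (\<lambda>n. N n (snd (\<omega>, r)) (fst (\<omega>, r)))"
      using conv Y(2)
    proof eventually_elim
      case (elim \<omega>)
      show ?case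
      proof (rule AE_I2)
        fix r assume "r \<in> space time"
        then show "Y (snd (\<omega>, r)) (fst (\<omega>, r)) = lim (\<lambda>n. N n (snd (\<omega>, r)) (fst (\<omega>, r)))"
          using limI[OF elim(1)[rule_format, of r]] elim(2) by simp
      qed
    qed
  qed
  have Lm: "(\<lambda>p. lim (\<lambda>n. N n (snd p) (fst p))) \<in> borel_measurable PM"
    by (rule borel_measurable_lim_metric) (rule progressive_PM[OF D(1)])
  have iY: "integrable PM (\<lambda>p. (Y (snd p) (fst p))\<^sup>2)"
  proof -
    have "(\<integral>\<^sup>+p. ennreal ((lim (\<lambda>n. N n (snd p) (fst p)) - N 0 (snd p) (fst p))\<^sup>2) \<partial>PM) < \<infinity>"
      using Nfast(2)[of 0] t_less by (auto simp: le_less_trans)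
    then have "integrable PM (\<lambda>p. (lim (\<lambda>n. N n (snd p) (fst p)) - N 0 (snd p) (fst p))\<^sup>2)"
      using Lm progressive_PM[OF D(1)] by (intro integrableI_bounded) auto
    from integrable_square_lincomb[OF _ _ this D(3)[of 0], of 1 1]
    have "integrable PM (\<lambda>p. (lim (\<lambda>n. N n (snd p) (fst p)))\<^sup>2)"
      using Lm progressive_PM[OF D(1)] by simp
    then show ?thesis
    proof (rule integrable_cong_AE_imp)
      show "AE p in PM. (lim (\<lambda>n. N n (snd p) (fst p)))\<^sup>2 = (Y (snd p) (fst p))\<^sup>2"
        using Ylim by eventually_elim simp
    qed (use progressive_PM[OF Y(1)] in simp)
  qed
  have YT: "AE \<omega> in M. \<eta> \<omega> = Y T \<omega>" using Y(2) by eventually_elim (simp add: NlT)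
  have "linear_bsde (\<lambda>_ _. 0) Y Zl"
    unfolding linear_bsde_def
  proof (intro conjI Y(1) fZl iY iZl)
    show "AE \<omega> in M. \<forall>s\<in>{t..T}. Y s \<omega> = Y T \<omega> + (LINT r:{s<..T}|lborel. 0)
      - (jump_sum Zl s \<omega> - (LINT r:{s<..T}|lborel. comp Zl (\<omega>, r)))"
      using Y(2) by eventually_elim (simp add: NlT, simp add: Nl_def set_lebesgue_integral_def)
  qed simp_all
  moreover have "integrable M (\<lambda>\<omega>. (Y T \<omega>)\<^sup>2)"
  proof (rule integrable_cong_AE_imp[OF \<eta>(2)])
    show "(\<lambda>\<omega>. (Y T \<omega>)\<^sup>2) \<in> borel_measurable M"
      using progressive_adapted[OF Y(1)] t_less by (intro borel_measurable_power measurable_F_M[of _ T]) auto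
    show "AE \<omega> in M. (\<eta> \<omega>)\<^sup>2 = (Y T \<omega>)\<^sup>2" using YT by eventually_elim simp
  qed
  moreover have "AE \<omega> in M. Y T \<omega> = \<eta> \<omega>" using YT by eventually_elim simp
  ultimately show ?thesis unfolding Rep_def by blast
qed

end

section \<open>From cylinder events to all square integrable variables\<close>

context jump_markov_started
begin

lemma Rep_limit:
  assumes R: "\<And>n. Rep (\<eta>s n)" and \<eta>: "\<eta> \<in> borel_measurable M" "integrable M (\<lambda>\<omega>. (\<eta> \<omega>)\<^sup>2)"
    and lim: "(\<lambda>n. \<integral>\<omega>. (\<eta>s n \<omega> - \<eta> \<omega>)\<^sup>2 \<partial>M) \<longlonglongrightarrow> 0"
  shows "Rep \<eta>"
proof -
  have "\<exists>N Z. linear_bsde (\<lambda>_ _. 0) N Z \<and> integrable M (\<lambda>\<omega>. (N T \<omega>)\<^sup>2) \<and>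
    (\<integral>\<omega>. (N T \<omega> - \<eta> \<omega>)\<^sup>2 \<partial>M) \<le> (1/4)^n" for n :: nat
  proof -
    have "\<forall>\<^sub>F k in sequentially. (\<integral>\<omega>. (\<eta>s k \<omega> - \<eta> \<omega>)\<^sup>2 \<partial>M) < (1/4)^n"
      by (rule order_tendstoD(2)[OF lim]) simp
    from eventually_happens'[OF sequentially_bot this]
    obtain k where k: "(\<integral>\<omega>. (\<eta>s k \<omega> - \<eta> \<omega>)\<^sup>2 \<partial>M) < (1/4)^n" by blast
    obtain N Z where N: "linear_bsde (\<lambda>_ _. 0) N Z" "integrable M (\<lambda>\<omega>. (N T \<omega>)\<^sup>2)" "AE \<omega> in M. N T \<omega> = \<eta>s k \<omega>"
      using R[of k] unfolding Rep_def by blast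
    have m: "N T \<in> borel_measurable M"
      using progressive_adapted[OF linear_bsdeD(1)[OF N(1)]] t_less by (auto intro!: measurable_F_M[of _ T])
    have "\<eta>s k \<in> borel_measurable M" by (rule measurable_M_AE[OF m N(3)])
    then have "(\<integral>\<omega>. (N T \<omega> - \<eta> \<omega>)\<^sup>2 \<partial>M) = (\<integral>\<omega>. (\<eta>s k \<omega> - \<eta> \<omega>)\<^sup>2 \<partial>M)"
    proof (intro integral_cong_AE)
      assume *: "\<eta>s k \<in> borel_measurable M"
      show "(\<lambda>\<omega>. (N T \<omega> - \<eta> \<omega>)\<^sup>2) \<in> borel_measurable M" using m \<eta>(1) by simp
      show "(\<lambda>\<omega>. (\<eta>s k \<omega> - \<eta> \<omega>)\<^sup>2) \<in> borel_measurable M" using * \<eta>(1) by simp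
      show "AE \<omega> in M. (N T \<omega> - \<eta> \<omega>)\<^sup>2 = (\<eta>s k \<omega> - \<eta> \<omega>)\<^sup>2"
        using N(3) by eventually_elim simp
    qed
    then have "(\<integral>\<omega>. (N T \<omega> - \<eta> \<omega>)\<^sup>2 \<partial>M) \<le> (1/4)^n" using k by linarith
    then show ?thesis using N(1,2) by blast
  qed
  then have "\<forall>n. \<exists>q. linear_bsde (\<lambda>_ _. 0) (fst q) (snd q) \<and> integrable M (\<lambda>\<omega>. (fst q T \<omega>)\<^sup>2) \<and>
    (\<integral>\<omega>. (fst q T \<omega> - \<eta> \<omega>)\<^sup>2 \<partial>M) \<le> (1/4)^n" unfolding split_paired_Ex fst_conv snd_conv by blast
  from choice[OF this] obtain q where "\<And>n. linear_bsde (\<lambda>_ _. 0) (fst (q n)) (snd (q n))"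
    "\<And>n. integrable M (\<lambda>\<omega>. (fst (q n) T \<omega>)\<^sup>2)" "\<And>n. (\<integral>\<omega>. (fst (q n) T \<omega> - \<eta> \<omega>)\<^sup>2 \<partial>M) \<le> (1/4)^n" by blast
  then show ?thesis by (rule Rep_fast_limit[OF _ _ \<eta>])
qed

lemma Rep_sum: "finite I \<Longrightarrow> (\<And>i. i \<in> I \<Longrightarrow> Rep (f i)) \<Longrightarrow> Rep (\<lambda>\<omega>. \<Sum>i\<in>I. f i \<omega>)"
proof (induction I rule: finite_induct)
  case (insert i I)
  then have "Rep (\<lambda>\<omega>. 1 * f i \<omega> + 1 * (\<Sum>i\<in>I. f i \<omega>))" by (intro Rep_lincomb) auto
  then show ?case using insert by simp
qed (simp add: Rep_const)

definition cyl :: "real set \<Rightarrow> (real \<Rightarrow> 'g set) \<Rightarrow> 'w set" where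
  "cyl I A = {\<omega>\<in>\<Omega>. \<forall>i\<in>I. X i \<omega> \<in> A i}"

text \<open>The null events are included because the filtration is completed. The family remains
  stable under intersection, since a subset of a null event is again one.\<close>

definition cyls :: "'w set set" where
  "cyls = {cyl I A | I A. finite I \<and> I \<subseteq> {t..T} \<and> (\<forall>i. A i \<in> sets \<Gamma>)} \<union> null_sets M"

lemma cyls_Pow: "cyls \<subseteq> Pow \<Omega>"
  using sets.sets_into_space[of _ M] by (fastforce simp: cyls_def cyl_def null_sets_def)

lemma Int_stable_cyls: "Int_stable cyls"
proof (rule Int_stableI)
  fix C D assume C: "C \<in> cyls" and D: "D \<in> cyls"
  show "C \<inter> D \<in> cyls"
  proof (cases "C \<in> null_sets M \<or> D \<in> null_sets M")
    case True
    then have "C \<inter> D \<in> null_sets M"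
      using subset_null_sets[of "C \<inter> D" C] subset_null_sets[of "C \<inter> D" D] by blast
    then show ?thesis by (simp add: cyls_def)
  next
    case False
    then obtain I A I' A' where 1: "C = cyl I A" "finite I" "I \<subseteq> {t..T}" "\<forall>i. A i \<in> sets \<Gamma>"
      and 2: "D = cyl I' A'" "finite I'" "I' \<subseteq> {t..T}" "\<forall>i. A' i \<in> sets \<Gamma>"
      using C D unfolding cyls_def by blast
    \<comment> \<open>A time constrained by only one of the two cylinders gets the whole space from
      the other.\<close>
    define A'' where "A'' i = (if i \<in> I then A i else space \<Gamma>) \<inter> (if i \<in> I' then A' i else space \<Gamma>)" for i
    have sp: "X i \<omega> \<in> space \<Gamma>" if "i \<in> I \<union> I'" "\<omega> \<in> \<Omega>" for i \<omega>
    proof (rule X_in_space)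
      show "0 \<le> i" using that 1(3) 2(3) t_nonneg by auto
    qed (rule that)
    have "C \<inter> D = cyl (I \<union> I') A''"
      unfolding 1(1) 2(1) cyl_def A''_def using sp by auto
    moreover have "\<forall>i. A'' i \<in> sets \<Gamma>" using 1(4) 2(4) by (auto simp: A''_def)
    ultimately show ?thesis using 1 2 unfolding cyls_def by blast
  qed
qed

lemma sets_FT_cyls: "sets (F T) \<subseteq> sigma_sets \<Omega> cyls"
  unfolding sets_F
proof (rule sigma_sets_mono, rule Un_least)
  show "null_sets M \<subseteq> sigma_sets \<Omega> cyls" unfolding cyls_def by (auto intro: sigma_sets.Basic)
  show "sets (process_algebra \<Gamma> \<Omega> X {t..T}) \<subseteq> sigma_sets \<Omega> cyls"
    unfolding sets_process_algebra
  proof (rule sigma_sets_mono, safe)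
    fix r A assume r: "r \<in> {t..T}" and A: "A \<in> sets \<Gamma>"
    have "X r -` A \<inter> \<Omega> = cyl {r} (\<lambda>_. A)" by (auto simp: cyl_def)
    then have "X r -` A \<inter> \<Omega> \<in> cyls" using r A unfolding cyls_def by blast
    then show "X r -` A \<inter> \<Omega> \<in> sigma_sets \<Omega> cyls" by (rule sigma_sets.Basic)
  qed
qed

lemma cyls_M: "sigma_sets \<Omega> cyls \<subseteq> sets M"
proof (rule sets.sigma_sets_subset[where M=M, simplified], safe)
  fix C assume "C \<in> cyls"
  then consider "C \<in> null_sets M" | I A where "C = cyl I A" "finite I" "I \<subseteq> {t..T}" "\<forall>i. A i \<in> sets \<Gamma>"
    unfolding cyls_def by blast
  then show "C \<in> sets M"
  proof cases
    case (2 I A)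
    have "cyl I A = (if I = {} then \<Omega> else (\<Inter>i\<in>I. X i -` A i \<inter> \<Omega>))" by (auto simp: cyl_def)
    moreover have "X i -` A i \<inter> \<Omega> \<in> sets M" if "i \<in> I" for i
      using measurable_sets[OF measurable_F_M[OF X_measurable_F[of i T]], of "A i"] that 2 by auto
    ultimately show ?thesis unfolding 2(1)
      using 2(2) sets.top[of M] sets.finite_INT[of I "\<lambda>i. X i -` A i \<inter> \<Omega>" M] by simp
  qed auto
qed

text \<open>Dynkin's pi-lambda argument. Complements use constants and linearity; countable disjoint
  unions need \<open>Rep_limit\<close>, the partial sums being indicators and hence convergent in
  \<open>L2\<close> by domination.\<close>

lemma Rep_indicator: "A \<in> sets (F T) \<Longrightarrow> Rep (indicator A)"
proof -
  assume "A \<in> sets (F T)"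
  then have "A \<in> sigma_sets \<Omega> cyls" using sets_FT_cyls by blast
  with Int_stable_cyls cyls_Pow show ?thesis
  proof (induction A rule: sigma_sets_induct_disjoint)
    case (basic A)
    then consider "A \<in> null_sets M" | I B where "A = cyl I B" "finite I" "I \<subseteq> {t..T}" "\<forall>i. B i \<in> sets \<Gamma>"
      unfolding cyls_def by blast
    then show ?case
    proof cases
      case 1
      have "AE \<omega> in M. 0 = indicat_real A \<omega>" using AE_not_in[OF 1] by eventually_elim simp
      then show ?thesis by (rule Rep_cong_AE[OF Rep_const])
    next
      case (2 I B)
      have "Rep (\<lambda>\<omega>. (\<Prod>i\<in>I. indicator (B i) (X i \<omega>)) * (\<lambda>_. 1) (X T \<omega>))"
        using 2 t_less by (intro Rep_cylinder[where C=1 and u=T]) auto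
      moreover have "AE \<omega> in M. (\<Prod>i\<in>I. indicator (B i) (X i \<omega>)) * (\<lambda>_. 1) (X T \<omega>) = indicat_real A \<omega>"
      proof (rule AE_I2)
        fix \<omega> assume o: "\<omega> \<in> space M"
        show "(\<Prod>i\<in>I. indicator (B i) (X i \<omega>)) * (\<lambda>_. 1) (X T \<omega>) = indicat_real A \<omega>"
        proof (cases "\<omega> \<in> A")
          case True
          then show ?thesis unfolding 2(1) by (simp add: cyl_def)
        next
          case False
          then obtain i where "i \<in> I" "X i \<omega> \<notin> B i" using o unfolding 2(1) by (auto simp: cyl_def)
          then have "(\<Prod>i\<in>I. indicat_real (B i) (X i \<omega>)) = 0" using 2(2) by (intro prod_zero bexI[of _ i]) auto
          then show ?thesis using False by simp
        qed
      qed
      ultimately show ?thesis by (rule Rep_cong_AE)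
    qed
  next
    case empty
    show ?case using Rep_const[of 0] by (simp add: indicator_def[abs_def])
  next
    case (compl A)
    have "Rep (\<lambda>\<omega>. 1 * 1 + (-1) * indicat_real A \<omega>)" by (rule Rep_lincomb[OF Rep_const compl.IH])
    moreover have "AE \<omega> in M. 1 * 1 + (-1) * indicat_real A \<omega> = indicat_real (\<Omega> - A) \<omega>"
      by (rule AE_I2) (auto simp: indicator_def)
    ultimately show ?case by (rule Rep_cong_AE)
  next
    case (union A)
    have Am: "A i \<in> sets M" for i using union.hyps(2) cyls_M by blast
    define S where "S n \<omega> = (\<Sum>i<n. indicat_real (A i) \<omega>)" for n \<omega>
    have S: "S n \<omega> = indicat_real (\<Union>i<n. A i) \<omega>" for n \<omega>
      unfolding S_def using union.hyps(1)
      by (subst indicator_UN_disjoint) (auto simp: disjoint_family_on_def)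
    show ?case
    proof (rule Rep_limit)
      show "Rep (S n)" for n unfolding S_def[abs_def] by (intro Rep_sum union.IH) auto
      have "(\<lambda>n. \<integral>\<omega>. (S n \<omega> - indicat_real (\<Union>i. A i) \<omega>)\<^sup>2 \<partial>M) \<longlonglongrightarrow> (\<integral>\<omega>. 0 \<partial>M)"
      proof (rule integral_dominated_convergence[where w="\<lambda>_. 1"])
        show "(\<lambda>\<omega>. (S n \<omega> - indicat_real (\<Union>i. A i) \<omega>)\<^sup>2) \<in> borel_measurable M" for n
          unfolding S using Am by measurable
        show "AE \<omega> in M. (\<lambda>n. (S n \<omega> - indicat_real (\<Union>i. A i) \<omega>)\<^sup>2) \<longlonglongrightarrow> 0"
        proof (rule AE_I2)
          fix \<omega>
          have "(\<lambda>n. indicat_real (\<Union>i<n. A i) \<omega>) \<longlonglongrightarrow> indicat_real (\<Union>i. A i) \<omega>"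
            by (rule LIMSEQ_indicator_UN)
          then have "(\<lambda>n. (S n \<omega> - indicat_real (\<Union>i. A i) \<omega>)\<^sup>2) \<longlonglongrightarrow> (indicat_real (\<Union>i. A i) \<omega> - indicat_real (\<Union>i. A i) \<omega>)\<^sup>2"
            unfolding S by (intro tendsto_intros)
          then show "(\<lambda>n. (S n \<omega> - indicat_real (\<Union>i. A i) \<omega>)\<^sup>2) \<longlonglongrightarrow> 0" by simp
        qed
        show "AE \<omega> in M. norm ((S n \<omega> - indicat_real (\<Union>i. A i) \<omega>)\<^sup>2) \<le> 1" for n
          unfolding S by (rule AE_I2) (auto simp: indicator_def)
      qed simp_all
      then show "(\<lambda>n. \<integral>\<omega>. (S n \<omega> - indicat_real (\<Union>i. A i) \<omega>)\<^sup>2 \<partial>M) \<longlonglongrightarrow> 0" by simp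
      show "indicat_real (\<Union>i. A i) \<in> borel_measurable M" using Am by measurable
      show "integrable M (\<lambda>\<omega>. (indicat_real (\<Union>i. A i) \<omega>)\<^sup>2)"
        by (rule integrable_const_bound[where B=1]) (use Am in \<open>auto simp: indicator_def\<close>)
    qed
  qed
qed

theorem martingale_representation:
  assumes \<eta>: "\<eta> \<in> borel_measurable (F T)" "integrable M (\<lambda>\<omega>. (\<eta> \<omega>)\<^sup>2)"
  shows "Rep \<eta>"
proof -
  obtain S where S: "\<And>i. simple_function (F T) (S i)" "\<And>\<omega>. \<omega> \<in> \<Omega> \<Longrightarrow> (\<lambda>i. S i \<omega>) \<longlonglongrightarrow> \<eta> \<omega>"
    "\<And>i \<omega>. \<omega> \<in> \<Omega> \<Longrightarrow> \<bar>S i \<omega>\<bar> \<le> 2 * \<bar>\<eta> \<omega>\<bar>"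
    using borel_measurable_implies_sequence_metric[OF \<eta>(1), of 0] unfolding dist_real_def diff_zero space_F
    by blast
  have Sm: "S i \<in> borel_measurable M" for i
    using borel_measurable_simple_function[OF S(1)] by (rule measurable_F_M)
  have m: "\<eta> \<in> borel_measurable M" using \<eta>(1) by (rule measurable_F_M)
  show ?thesis
  proof (rule Rep_limit[OF _ m \<eta>(2)])
    fix i
    have fin: "finite (S i ` \<Omega>)" using simple_functionD(1)[OF S(1)[of i]] by simp
    \<comment> \<open>The summand \<open>0 * 0\<close> only gives each term the shape of a
      combination of two representable variables.\<close>
    have "Rep (\<lambda>\<omega>. \<Sum>y\<in>S i ` \<Omega>. y * indicat_real (S i -` {y} \<inter> \<Omega>) \<omega> + 0 * 0)"
      using simple_functionD(2)[OF S(1)[of i]]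
      by (intro Rep_sum fin Rep_lincomb Rep_indicator Rep_const) simp
    moreover have "AE \<omega> in M. (\<Sum>y\<in>S i ` \<Omega>. y * indicat_real (S i -` {y} \<inter> \<Omega>) \<omega> + 0 * 0) = S i \<omega>"
    proof (rule AE_I2)
      fix \<omega> assume o: "\<omega> \<in> space M"
      have "(\<Sum>y\<in>S i ` \<Omega>. y * indicat_real (S i -` {y} \<inter> \<Omega>) \<omega> + 0 * 0)
        = (\<Sum>y\<in>S i ` \<Omega>. if S i \<omega> = y then y else 0)"
        using o by (intro sum.cong) (auto simp: indicator_def)
      then show "(\<Sum>y\<in>S i ` \<Omega>. y * indicat_real (S i -` {y} \<inter> \<Omega>) \<omega> + 0 * 0) = S i \<omega>"
        using fin o by simp
    qed
    ultimately show "Rep (S i)" by (rule Rep_cong_AE)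
  next
    \<comment> \<open>The simple functions are bounded by
      \<open>2 * \<bar>\<eta> \<omega>\<bar>\<close>, so the error is at most
      \<open>3 * \<bar>\<eta> \<omega>\<bar>\<close>, and 9 is the square of that factor.\<close>
    have "(\<lambda>n. \<integral>\<omega>. (S n \<omega> - \<eta> \<omega>)\<^sup>2 \<partial>M) \<longlonglongrightarrow> (\<integral>\<omega>. 0 \<partial>M)"
    proof (rule integral_dominated_convergence[where w="\<lambda>\<omega>. 9 * (\<eta> \<omega>)\<^sup>2"])
      show "AE \<omega> in M. (\<lambda>n. (S n \<omega> - \<eta> \<omega>)\<^sup>2) \<longlonglongrightarrow> 0"
      proof (rule AE_I2)
        fix \<omega> assume "\<omega> \<in> space M"
        then have "(\<lambda>n. (S n \<omega> - \<eta> \<omega>)\<^sup>2) \<longlonglongrightarrow> (\<eta> \<omega> - \<eta> \<omega>)\<^sup>2" by (intro tendsto_intros S(2)) simp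
        then show "(\<lambda>n. (S n \<omega> - \<eta> \<omega>)\<^sup>2) \<longlonglongrightarrow> 0" by simp
      qed
      show "AE \<omega> in M. norm ((S n \<omega> - \<eta> \<omega>)\<^sup>2) \<le> 9 * (\<eta> \<omega>)\<^sup>2" for n
      proof (rule AE_I2)
        fix \<omega> assume "\<omega> \<in> space M"
        then have "\<bar>S n \<omega>\<bar> \<le> 2 * \<bar>\<eta> \<omega>\<bar>" by (intro S(3)) simp
        then have "\<bar>S n \<omega> - \<eta> \<omega>\<bar> \<le> 3 * \<bar>\<eta> \<omega>\<bar>" by linarith
        from power_mono[OF this, of 2] show "norm ((S n \<omega> - \<eta> \<omega>)\<^sup>2) \<le> 9 * (\<eta> \<omega>)\<^sup>2"
          by (simp add: power_mult_distrib)
      qed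
    qed (use Sm m \<eta>(2) in auto)
    then show "(\<lambda>n. \<integral>\<omega>. (S n \<omega> - \<eta> \<omega>)\<^sup>2 \<partial>M) \<longlonglongrightarrow> 0" by simp
  qed
qed

end

section \<open>Linear equations and the contraction estimate\<close>

context jump_markov_started
begin

lemma measure_time: "measure time (space time) = T - t"
proof -
  have "emeasure time {t..T} = ennreal (T - t)"
    unfolding time_def using t_less by (subst emeasure_restrict_space) auto
  then show ?thesis using t_less by (simp add: measure_def)
qed

lemma integrable_time_indicator:
  fixes f :: "real \<Rightarrow> real"
  assumes f: "integrable time f" and C: "C \<in> sets borel"
  shows "integrable time (\<lambda>r. indicator C r * f r)"
proof (rule Bochner_Integration.integrable_bound[OF f])
  have "(\<lambda>r. indicator C r :: real) \<in> borel_measurable time"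
    unfolding time_def using C by (intro measurable_restrict_space1) simp
  then show "(\<lambda>r. indicator C r * f r) \<in> borel_measurable time"
    using borel_measurable_integrable[OF f] by (rule borel_measurable_times)
qed (simp add: indicator_def)

text \<open>Cauchy-Schwarz against the constant 1, read as nonnegativity of the variance about the
  mean \<open>c\<close>.\<close>

lemma time_integral_square:
  fixes f :: "real \<Rightarrow> real"
  assumes f: "integrable time f" "integrable time (\<lambda>r. (f r)\<^sup>2)"
  shows "(\<integral>r. f r \<partial>time)\<^sup>2 \<le> (T - t) * (\<integral>r. (f r)\<^sup>2 \<partial>time)"
proof -
  define l where "l = T - t"
  define c where "c = (\<integral>r. f r \<partial>time) / l"
  have l: "0 < l" using t_less by (simp add: l_def)
  have I: "(\<integral>r. f r \<partial>time) = c * l" using l by (simp add: c_def)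
  have "0 \<le> (\<integral>r. (f r - c)\<^sup>2 \<partial>time)" by simp
  also have "\<dots> = (\<integral>r. (f r)\<^sup>2 - 2 * c * f r + c\<^sup>2 \<partial>time)"
    by (intro Bochner_Integration.integral_cong) (auto simp: power2_eq_square algebra_simps)
  also have "\<dots> = (\<integral>r. (f r)\<^sup>2 \<partial>time) - 2 * c * (\<integral>r. f r \<partial>time) + c\<^sup>2 * l"
    using f by (simp add: measure_time[simplified] l_def mult.commute)
  also have "\<dots> = (\<integral>r. (f r)\<^sup>2 \<partial>time) - c\<^sup>2 * l" unfolding I by (simp add: power2_eq_square)
  finally have "c\<^sup>2 * l * l \<le> (\<integral>r. (f r)\<^sup>2 \<partial>time) * l" using l by (intro mult_right_mono) auto
  then show ?thesis unfolding I l_def[symmetric] by (simp add: power2_eq_square mult_ac)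
qed

lemma integrable_PM_fst:
  fixes \<Phi> :: "'w \<Rightarrow> real"
  assumes \<Phi>: "integrable M \<Phi>" shows "integrable PM (\<lambda>p. \<Phi> (fst p))"
proof (rule integrableI_bounded)
  have [measurable]: "\<Phi> \<in> borel_measurable M" using \<Phi> by simp
  show "(\<lambda>p. \<Phi> (fst p)) \<in> borel_measurable PM" by measurable
  have "(\<integral>\<^sup>+p. ennreal (norm (\<Phi> (fst p))) \<partial>PM) = (\<integral>\<^sup>+\<omega>. \<integral>\<^sup>+r. ennreal (norm (\<Phi> \<omega>)) \<partial>time \<partial>M)"
    by (subst nn_integral_PM[symmetric]) auto
  also have "\<dots> = (\<integral>\<^sup>+\<omega>. ennreal (norm (\<Phi> \<omega>)) * emeasure time (space time) \<partial>M)" by simp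
  also have "\<dots> = (\<integral>\<^sup>+\<omega>. ennreal (norm (\<Phi> \<omega>)) \<partial>M) * emeasure time (space time)"
    by (rule nn_integral_multc) measurable
  also have "\<dots> < \<infinity>"
    using \<Phi> time.emeasure_finite[of "space time"]
    by (auto simp: integrable_iff_bounded less_top[symmetric] ennreal_mult_eq_top_iff)
  finally show "(\<integral>\<^sup>+p. ennreal (norm (\<Phi> (fst p))) \<partial>PM) < \<infinity>" .
qed

text \<open>Joint measurability on \<open>F s\<close> times \<open>[t, s]\<close> is what lets
  Fubini return an \<open>F s\<close>-measurable integral; measurability of each single
  \<open>g r\<close> would not suffice.\<close>

lemma progressive_integral_adapted:
  assumes g: "progressive F t T g" and s: "s \<in> {t..T}"
  shows "(\<lambda>\<omega>. \<integral>r. indicator {..s} r * g r \<omega> \<partial>time) \<in> borel_measurable (F s)"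
proof -
  let ?L = "restrict_space lborel {t..s}"
  interpret L: finite_measure ?L
    by (rule finite_measureI) (use s in \<open>auto simp: emeasure_restrict_space space_restrict_space\<close>)
  have sL: "sets ?L = sets (restrict_space borel {t..s})" by (intro sets_restrict_space_cong) simp
  have "(\<lambda>p. g (snd p) (fst p)) \<in> borel_measurable (F s \<Otimes>\<^sub>M ?L)"
    using progressive_on[OF g s] measurable_cong_sets[OF sets_pair_measure_cong[OF refl sL] refl] by blast
  then have "(\<lambda>(\<omega>, r). g r \<omega>) \<in> borel_measurable (F s \<Otimes>\<^sub>M ?L)" by (simp add: case_prod_beta')
  then have "(\<lambda>\<omega>. \<integral>r. g r \<omega> \<partial>?L) \<in> borel_measurable (F s)"
    by (rule L.borel_measurable_lebesgue_integral)
  moreover have "(\<integral>r. g r \<omega> \<partial>?L) = (\<integral>r. indicator {..s} r * g r \<omega> \<partial>time)" for \<omega>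
    unfolding time_def using s
    by (subst (1 2) integral_restrict_space) (auto intro!: Bochner_Integration.integral_cong simp: indicator_def)
  ultimately show ?thesis by simp
qed

text \<open>The accumulated generator is moved into the terminal value: \<open>\<xi> + G T\<close>
  is represented by a solution \<open>N\<close> with zero generator, and \<open>G\<close> is
  subtracted afterwards.\<close>

theorem linear_exists:
  assumes \<xi>: "\<xi> \<in> borel_measurable (F T)" "integrable M (\<lambda>\<omega>. (\<xi> \<omega>)\<^sup>2)"
    and g: "progressive F t T g" "integrable PM (\<lambda>p. (g (snd p) (fst p))\<^sup>2)"
  shows "\<exists>Y Z. linear_bsde g Y Z \<and> (AE \<omega> in M. Y T \<omega> = \<xi> \<omega>)"
proof -
  have TT: "T \<in> {t..T}" using t_less by simp
  have gm: "(\<lambda>p. g (snd p) (fst p)) \<in> borel_measurable PM" by (rule progressive_PM[OF g(1)])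
  have gi: "integrable PM (\<lambda>p. g (snd p) (fst p))" by (rule integrable_PM_L1[OF gm g(2)])
  define G where "G s \<omega> = (\<integral>r. indicator {..s} r * g r \<omega> \<partial>time)" for s \<omega>
  \<comment> \<open>A single integrable variable that dominates
    \<open>(G s \<omega>)\<^sup>2\<close> for all \<open>s\<close>: it yields square integrability
    of the terminal value and of \<open>Y\<close> on the product space.\<close>
  define \<Phi> where "\<Phi> \<omega> = (T - t) * (\<integral>r. (g r \<omega>)\<^sup>2 \<partial>time)" for \<omega>
  have \<Phi>i: "integrable M \<Phi>" unfolding \<Phi>_def[abs_def] using PMs.integrable_fst'[OF g(2)] by simp
  have Gm: "G s \<in> borel_measurable (F s)" if "s \<in> {t..T}" for s
    unfolding G_def[abs_def] by (rule progressive_integral_adapted[OF g(1) that])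
  have Gb: "AE \<omega> in M. \<forall>s. (G s \<omega>)\<^sup>2 \<le> \<Phi> \<omega>"
    using PMs.AE_integrable_fst'[OF gi] PMs.AE_integrable_fst'[OF g(2)]
  proof eventually_elim
    case (elim \<omega>)
    then have e: "integrable time (\<lambda>r. g r \<omega>)" "integrable time (\<lambda>r. (g r \<omega>)\<^sup>2)" by simp_all
    show ?case
    proof
      fix s
      have i: "integrable time (\<lambda>r. indicator {..s} r * g r \<omega>)"
        by (rule integrable_time_indicator[OF e(1)]) simp
      have "(indicator {..s} r * g r \<omega>)\<^sup>2 = indicator {..s} r * (g r \<omega>)\<^sup>2" for r
        by (simp add: indicator_def)
      then have i2: "integrable time (\<lambda>r. (indicator {..s} r * g r \<omega>)\<^sup>2)"
        using integrable_time_indicator[OF e(2), of "{..s}"] by simp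
      have "(G s \<omega>)\<^sup>2 \<le> (T - t) * (\<integral>r. (indicator {..s} r * g r \<omega>)\<^sup>2 \<partial>time)"
        unfolding G_def by (rule time_integral_square[OF i i2])
      also have "\<dots> \<le> \<Phi> \<omega>"
        unfolding \<Phi>_def using t_less e(2) i2
        by (intro mult_left_mono integral_mono) (auto simp: indicator_def)
      finally show "(G s \<omega>)\<^sup>2 \<le> \<Phi> \<omega>" .
    qed
  qed
  define \<eta> where "\<eta> \<omega> = \<xi> \<omega> + G T \<omega>" for \<omega>
  have \<xi>M: "\<xi> \<in> borel_measurable M" and GM: "G T \<in> borel_measurable M"
    using \<xi>(1) Gm[OF TT] by (auto intro: measurable_F_M)
  have GTi: "integrable M (\<lambda>\<omega>. (G T \<omega>)\<^sup>2)"
  proof (rule Bochner_Integration.integrable_bound[OF \<Phi>i])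
    show "AE \<omega> in M. norm ((G T \<omega>)\<^sup>2) \<le> norm (\<Phi> \<omega>)"
      using Gb by eventually_elim (metis abs_ge_self norm_power order.trans power2_abs real_norm_def)
  qed (use GM in simp)
  have "Rep \<eta>"
  proof (rule martingale_representation)
    show "\<eta> \<in> borel_measurable (F T)" unfolding \<eta>_def[abs_def] using \<xi>(1) Gm[OF TT] by simp
    show "integrable M (\<lambda>\<omega>. (\<eta> \<omega>)\<^sup>2)"
      unfolding \<eta>_def using integrable_square_lincomb[OF \<xi>M GM \<xi>(2) GTi, of 1 1] by simp
  qed
  then obtain N Z where N: "linear_bsde (\<lambda>_ _. 0) N Z" "AE \<omega> in M. N T \<omega> = \<eta> \<omega>"
    unfolding Rep_def by blast
  note D = linear_bsdeD[OF N(1)]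
  define Y0 where "Y0 s \<omega> = N s \<omega> - G s \<omega>" for s \<omega>
  have ad: "adapted Y0"
    unfolding Y0_def using progressive_adapted[OF D(1)] Gm by auto
  have path: "AE \<omega> in M. path_equation (\<lambda>r \<omega>. g r \<omega> + comp Z (\<omega>, r)) Y0 Z \<omega>"
    using linear_bsde_path[OF N(1)] AE_PM_integrable[OF gi] AE_PM_integrable[OF linear_bsde_integrable(3)[OF N(1)]]
  proof eventually_elim
    case (elim \<omega>)
    have gI: "set_integrable lborel {t<..T} (\<lambda>r. g r \<omega>)" and cI: "set_integrable lborel {t<..T} (\<lambda>r. comp Z (\<omega>, r))"
      using elim by simp_all
    have o: "\<omega> \<in> \<Omega>" and Ns: "\<And>s. s \<in> {t..T} \<Longrightarrow> N s \<omega> = N T \<omega> + (LINT r:{s<..T}|lborel. comp Z (\<omega>, r)) - jump_sum Z s \<omega>"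
    proof -
      have dr: "drift (\<lambda>_ _. 0) Z = (\<lambda>r \<omega>. comp Z (\<omega>, r))" by (simp add: drift_def fun_eq_iff)
      note elim(1)[unfolded dr path_equation_def]
      then show "\<omega> \<in> \<Omega>" "\<And>s. s \<in> {t..T} \<Longrightarrow> N s \<omega> = N T \<omega> + (LINT r:{s<..T}|lborel. comp Z (\<omega>, r)) - jump_sum Z s \<omega>"
        by blast+
    qed
    have gt: "integrable time (\<lambda>r. g r \<omega>)" using gI by (simp add: integrable_time_iff)
    have "Y0 s \<omega> = Y0 T \<omega> + (LINT r:{s<..T}|lborel. g r \<omega> + comp Z (\<omega>, r)) - jump_sum Z s \<omega>" if s: "s \<in> {t..T}" for s
    proof -
      have si: "set_integrable lborel {s<..T} f" if "set_integrable lborel {t<..T} f" for f :: "real \<Rightarrow> real"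
        using s by (intro set_integrable_subset[OF that]) auto
      have i1: "integrable time (\<lambda>r. indicator {..s} r * g r \<omega>)" and i2: "integrable time (\<lambda>r. indicator {s<..} r * g r \<omega>)"
        by (rule integrable_time_indicator[OF gt], simp)+
      have "G T \<omega> = (\<integral>r. indicator {..s} r * g r \<omega> + indicator {s<..} r * g r \<omega> \<partial>time)"
        unfolding G_def by (intro Bochner_Integration.integral_cong) (auto simp: indicator_def)
      also have "\<dots> = G s \<omega> + (LINT r:{s<..T}|lborel. g r \<omega>)"
        unfolding G_def using i1 i2 s by (simp add: integral_time_after)
      finally have GT: "G T \<omega> = G s \<omega> + (LINT r:{s<..T}|lborel. g r \<omega>)" .
      have sp: "(LINT r:{s<..T}|lborel. g r \<omega> + comp Z (\<omega>, r)) = (LINT r:{s<..T}|lborel. g r \<omega>) + (LINT r:{s<..T}|lborel. comp Z (\<omega>, r))"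
        by (rule set_integral_add(2)[OF si[OF gI] si[OF cI]])
      show ?thesis unfolding Y0_def sp GT using Ns[OF s] by linarith
    qed
    then show ?case unfolding path_equation_def using o set_integral_add(1)[OF gI cI] by blast
  qed
  obtain Y where Y: "progressive F t T Y" "AE \<omega> in M. \<forall>s. Y s \<omega> = Y0 s \<omega>"
    using linear_bsdeI_path[OF ad D(2,4) path] by blast
  have iY: "integrable PM (\<lambda>p. (Y (snd p) (fst p))\<^sup>2)"
  proof (rule Bochner_Integration.integrable_bound)
    show ib: "integrable PM (\<lambda>p. 2 * (N (snd p) (fst p))\<^sup>2 + 2 * \<Phi> (fst p))"
      using D(3) integrable_PM_fst[OF \<Phi>i] by simp
    show "(\<lambda>p. (Y (snd p) (fst p))\<^sup>2) \<in> borel_measurable PM" using progressive_PM[OF Y(1)] by simp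
    show "AE p in PM. norm ((Y (snd p) (fst p))\<^sup>2) \<le> norm (2 * (N (snd p) (fst p))\<^sup>2 + 2 * \<Phi> (fst p))"
    proof (rule AE_PM)
      note [measurable] = progressive_PM[OF Y(1)] borel_measurable_integrable[OF ib]
      show "{p \<in> space PM. norm ((Y (snd p) (fst p))\<^sup>2) \<le> norm (2 * (N (snd p) (fst p))\<^sup>2 + 2 * \<Phi> (fst p))} \<in> sets PM"
        by measurable
      show "AE \<omega> in M. AE r in time. norm ((Y (snd (\<omega>, r)) (fst (\<omega>, r)))\<^sup>2) \<le> norm (2 * (N (snd (\<omega>, r)) (fst (\<omega>, r)))\<^sup>2 + 2 * \<Phi> (fst (\<omega>, r)))"
        using Y(2) Gb
      proof eventually_elim
        case (elim \<omega>)
        have "(Y r \<omega>)\<^sup>2 \<le> 2 * (N r \<omega>)\<^sup>2 + 2 * \<Phi> \<omega>" for r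
        proof -
          have "(a - b)\<^sup>2 \<le> 2 * a\<^sup>2 + 2 * b\<^sup>2" for a b :: real
            using zero_le_power2[of "a + b"] by (simp add: power2_eq_square algebra_simps)
          from this[of "N r \<omega>" "G r \<omega>"] have "(Y r \<omega>)\<^sup>2 \<le> 2 * (N r \<omega>)\<^sup>2 + 2 * (G r \<omega>)\<^sup>2"
            using elim(1) by (simp add: Y0_def)
          then show ?thesis using elim(2)[rule_format, of r] by linarith
        qed
        then show ?case by (intro AE_I2) (simp add: order.trans[OF _ abs_ge_self])
      qed
    qed
  qed
  have "linear_bsde g Y Z"
    unfolding linear_bsde_def
  proof (intro conjI Y(1) D(2,4) iY gm g(2))
    show "AE \<omega> in M. \<forall>s\<in>{t..T}. Y s \<omega> = Y T \<omega> + (LINT r:{s<..T}|lborel. g r \<omega>)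
      - (jump_sum Z s \<omega> - (LINT r:{s<..T}|lborel. comp Z (\<omega>, r)))"
      using Y(2) path AE_PM_integrable[OF gi] AE_PM_integrable[OF linear_bsde_integrable(3)[OF N(1)]]
    proof eventually_elim
      case (elim \<omega>)
      show ?case
      proof
        fix s assume s: "s \<in> {t..T}"
        have si: "set_integrable lborel {s<..T} f" if "set_integrable lborel {t<..T} f" for f :: "real \<Rightarrow> real"
          using s by (intro set_integrable_subset[OF that]) auto
        have sp: "(LINT r:{s<..T}|lborel. g r \<omega> + comp Z (\<omega>, r)) = (LINT r:{s<..T}|lborel. g r \<omega>) + (LINT r:{s<..T}|lborel. comp Z (\<omega>, r))"
          using si[OF elim(3)] si[OF elim(4)] by (intro set_integral_add(2)) simp_all
        have "Y0 s \<omega> = Y0 T \<omega> + (LINT r:{s<..T}|lborel. g r \<omega> + comp Z (\<omega>, r)) - jump_sum Z s \<omega>"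
          using elim(2) s unfolding path_equation_def by blast
        then show "Y s \<omega> = Y T \<omega> + (LINT r:{s<..T}|lborel. g r \<omega>) - (jump_sum Z s \<omega> - (LINT r:{s<..T}|lborel. comp Z (\<omega>, r)))"
          unfolding sp using elim(1)[rule_format, of s] elim(1)[rule_format, of T] by linarith
      qed
    qed
  qed
  moreover have "AE \<omega> in M. Y T \<omega> = \<xi> \<omega>"
    using Y(2) N(2) by eventually_elim (simp add: Y0_def \<eta>_def)
  ultimately show ?thesis by blast
qed

end

text \<open>Below the level, Young's inequality with \<open>4 * lip\<^sup>2\<close> leaves a quarter
  of \<open>(a + b)\<^sup>2\<close>, hence at most half of \<open>a\<^sup>2 + b\<^sup>2\<close>:
  this half becomes the contraction factor. Above the level the growth bound is sublinear, and
  \<open>m \<le> V\<close> converts \<open>V powr (2 * \<alpha>)\<close> into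
  \<open>V\<^sup>2\<close> times the negative power \<open>m powr (- 2 * (1 - \<alpha>))\<close>.
  The constant 6 stands for three terms in each of two generators.\<close>

lemma truncation_estimate:
  fixes D d lip a b V m lam \<alpha> :: real
  assumes "\<alpha> < 1" "0 \<le> d" "1 \<le> m"
    and small: "V < m \<Longrightarrow> d \<le> lip * (a + b)" and large: "m \<le> V \<Longrightarrow> d \<le> 6 * lam * V powr \<alpha>"
  shows "2 * (D * d) \<le> (4 * lip\<^sup>2 + 1) * D\<^sup>2 + (a\<^sup>2 + b\<^sup>2) / 2 + 36 * lam\<^sup>2 * m powr (- 2 * (1 - \<alpha>)) * V\<^sup>2"
proof (cases "V < m")
  case True
  have "2 * (D * d) \<le> 2 * (\<bar>D\<bar> * d)" using assms(2) by (simp add: mult_right_mono)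
  also have "\<dots> \<le> 2 * (\<bar>D\<bar> * (lip * (a + b)))" using small[OF True] by (intro mult_left_mono) auto
  also have "\<dots> \<le> 4 * lip\<^sup>2 * D\<^sup>2 + (a + b)\<^sup>2 / 4"
  proof -
    have "2 * (q * (lip * (a + b))) \<le> 4 * lip\<^sup>2 * q\<^sup>2 + (a + b)\<^sup>2 / 4" for q :: real
      using zero_le_power2[of "2 * lip * q - (a + b) / 2"] by (simp add: power2_eq_square algebra_simps)
    from this[of "\<bar>D\<bar>"] show ?thesis by (simp only: power2_abs)
  qed
  also have "\<dots> \<le> 4 * lip\<^sup>2 * D\<^sup>2 + (a\<^sup>2 + b\<^sup>2) / 2"
    using zero_le_power2[of "a - b"] by (simp add: power2_eq_square algebra_simps)
  also have "\<dots> \<le> (4 * lip\<^sup>2 + 1) * D\<^sup>2 + (a\<^sup>2 + b\<^sup>2) / 2 + 36 * lam\<^sup>2 * m powr (- 2 * (1 - \<alpha>)) * V\<^sup>2"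
  proof -
    have "0 \<le> 36 * lam\<^sup>2 * m powr (- 2 * (1 - \<alpha>)) * V\<^sup>2" "0 \<le> D\<^sup>2" by simp_all
    then show ?thesis unfolding distrib_right mult_1 by linarith
  qed
  finally show ?thesis .
next
  case False
  then have V: "m \<le> V" "0 < V" using assms(3) by auto
  have "V powr (2 * \<alpha>) = V powr (- 2 * (1 - \<alpha>)) * V\<^sup>2"
  proof -
    have "V\<^sup>2 = V powr 2" using V by (simp add: powr_numeral)
    then show ?thesis by (simp add: powr_add[symmetric])
  qed
  also have "\<dots> \<le> m powr (- 2 * (1 - \<alpha>)) * V\<^sup>2"
    using V assms by (intro mult_right_mono powr_mono2') auto
  finally have le: "V powr (2 * \<alpha>) \<le> m powr (- 2 * (1 - \<alpha>)) * V\<^sup>2" .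
  have "d\<^sup>2 \<le> (6 * lam * V powr \<alpha>)\<^sup>2" using large[OF V(1)] assms(2) by (rule power_mono)
  also have "\<dots> = 36 * lam\<^sup>2 * (V powr (2 * \<alpha>))"
    by (simp add: power2_eq_square powr_add[symmetric])
  also have "\<dots> \<le> 36 * lam\<^sup>2 * (m powr (- 2 * (1 - \<alpha>)) * V\<^sup>2)" using le by (rule mult_left_mono) simp
  finally have "2 * (D * d) \<le> D\<^sup>2 + 36 * lam\<^sup>2 * (m powr (- 2 * (1 - \<alpha>)) * V\<^sup>2)"
    using sum_squares_bound[of D d] by simp
  moreover have "0 \<le> 4 * (lip\<^sup>2 * D\<^sup>2)" "0 \<le> (a\<^sup>2 + b\<^sup>2) / 2" by simp_all
  ultimately show ?thesis unfolding distrib_right mult_1 mult.assoc by linarith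
qed

lemma powr_le_one_add: "0 \<le> a \<Longrightarrow> 0 < \<alpha> \<Longrightarrow> \<alpha> < 1 \<Longrightarrow> a powr \<alpha> \<le> 1 + (a::real)"
proof -
  assume a: "0 \<le> a" "0 < \<alpha>" "\<alpha> < 1"
  show ?thesis
  proof (cases "a \<le> 1")
    case True
    then have "a powr \<alpha> \<le> 1 powr \<alpha>" using a by (intro powr_mono2) auto
    then show ?thesis using a by simp
  next
    case False
    then have "a powr \<alpha> \<le> a powr 1" using a by (intro powr_mono) auto
    then show ?thesis using a by simp
  qed
qed

section \<open>The nonlinear generator along the process\<close>

locale bsde_data = jump_markov_started \<Gamma> \<Omega> X P T v t x
  for \<Gamma> :: "'g measure" and \<Omega> :: "'w set" and X :: "real \<Rightarrow> 'w \<Rightarrow> 'g"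
    and P :: "real \<Rightarrow> 'g \<Rightarrow> 'w measure" and T :: real and v :: "real \<Rightarrow> 'g \<Rightarrow> 'g measure"
    and t :: real and x :: 'g +
  fixes h :: "'g \<Rightarrow> real" and f :: "'g gen" and lam \<alpha> L :: real and Lip :: "nat \<Rightarrow> real"
  assumes h: "h \<in> borel_measurable \<Gamma>" "integrable M (\<lambda>\<omega>. (h (X T \<omega>))\<^sup>2)"
    and f: "generator \<Gamma> M F X v t T f"
    and lam: "0 < lam" and \<alpha>: "0 < \<alpha>" "\<alpha> < 1"
    and growth:
      "\<And>s x y z. s \<in> {0..T} \<Longrightarrow> x \<in> space \<Gamma> \<Longrightarrow> z \<in> L2 (v s x) \<Longrightarrow>
         \<bar>f s x y z\<bar> \<le> lam * (1 + \<bar>y\<bar> powr \<alpha> + L2_norm (v s x) z powr \<alpha>)"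
    and Lip_pos: "\<And>m. 1 \<le> m \<Longrightarrow> 0 < Lip m"
    and locally_lipschitz:
      "\<And>m. 1 \<le> m \<Longrightarrow>
         AE \<omega> in M. \<forall>s\<in>{t..T}. \<forall>y y'. \<forall>z\<in>L2 (v s (X s \<omega>)). \<forall>z'\<in>L2 (v s (X s \<omega>)).
           \<bar>y\<bar> < real m \<longrightarrow> \<bar>y'\<bar> < real m \<longrightarrow>
           L2_norm (v s (X s \<omega>)) z < real m \<longrightarrow> L2_norm (v s (X s \<omega>)) z' < real m \<longrightarrow>
           \<bar>f s (X s \<omega>) y z - f s (X s \<omega>) y' z'\<bar>
             \<le> Lip m * (\<bar>y - y'\<bar> + L2_norm (v s (X s \<omega>)) (\<lambda>u. z u - z' u))"
    and L: "0 < L"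
    and log_growth: "\<And>m. 1 \<le> m \<Longrightarrow> Lip m \<le> L + sqrt (ln (real m))"
begin

definition BB :: "(real \<Rightarrow> 'w \<Rightarrow> real) \<Rightarrow> (real \<Rightarrow> 'w \<Rightarrow> 'g \<Rightarrow> real) \<Rightarrow> bool" where
  "BB Y Z \<longleftrightarrow> progressive F t T Y \<and> field Z \<and>
    integrable PM (\<lambda>p. (Y (snd p) (fst p))\<^sup>2) \<and> integrable mu (\<lambda>u. (flat Z u)\<^sup>2)"

definition gf :: "(real \<Rightarrow> 'w \<Rightarrow> real) \<Rightarrow> (real \<Rightarrow> 'w \<Rightarrow> 'g \<Rightarrow> real) \<Rightarrow> real \<Rightarrow> 'w \<Rightarrow> real" where
  "gf Y Z r \<omega> = gen_eval v f r (X r \<omega>) (Y r \<omega>) (Z r \<omega>)"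

text \<open>The squared norm of \<open>Z\<close> at \<open>(\<omega>, r)\<close>, taken with the
  state just before \<open>r\<close>; off the jumps this is the norm that occurs in the hypotheses
  on \<open>f\<close>.\<close>

definition cs :: "(real \<Rightarrow> 'w \<Rightarrow> 'g \<Rightarrow> real) \<Rightarrow> 'w \<times> real \<Rightarrow> real" where
  "cs Z = comp (\<lambda>r \<omega> y. (Z r \<omega> y)\<^sup>2)"

lemma BBD:
  assumes "BB Y Z"
  shows "progressive F t T Y" "field Z" "integrable PM (\<lambda>p. (Y (snd p) (fst p))\<^sup>2)"
    "integrable mu (\<lambda>u. (flat Z u)\<^sup>2)"
  using assms by (auto simp: BB_def)

lemma linear_BB: "linear_bsde g Y Z \<Longrightarrow> BB Y Z"
  using linear_bsdeD[of g Y Z] by (simp add: BB_def)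

lemma cs_nonneg: "0 \<le> cs Z p"
  by (simp add: cs_def comp_def)

lemma L2_norm_kernel: "L2_norm (kernel p) (Z (snd p) (fst p)) = sqrt (cs Z p)"
  by (simp add: L2_norm_def cs_def comp_def)

lemma cs_integrable:
  assumes Z: "field Z" "integrable mu (\<lambda>u. (flat Z u)\<^sup>2)"
  shows "integrable PM (cs Z)" "(\<integral>p. cs Z p \<partial>PM) = (\<integral>u. (flat Z u)\<^sup>2 \<partial>mu)"
    "AE p in PM. Z (snd p) (fst p) \<in> L2 (kernel p)"
proof -
  have fl: "flat (\<lambda>r \<omega> y. (Z r \<omega> y)\<^sup>2) = (\<lambda>u. (flat Z u)\<^sup>2)" by (simp add: flat_def)
  note i = integrable_comp[OF field_square[OF Z(1)] Z(2)[folded fl]]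
  show "integrable PM (cs Z)" "(\<integral>p. cs Z p \<partial>PM) = (\<integral>u. (flat Z u)\<^sup>2 \<partial>mu)"
    unfolding cs_def using i(1,2) by (simp_all add: fl)
  show "AE p in PM. Z (snd p) (fst p) \<in> L2 (kernel p)"
    using i(3) AE_space
  proof eventually_elim
    case (elim p)
    then have "Z (snd p) (fst p) \<in> borel_measurable (kernel (fst p, snd p))"
      by (intro measurable_kernel field_y Z(1)) (auto simp: space_pair_measure)
    then show ?case using elim(1) by (simp add: L2_def)
  qed
qed

lemma BB_diff: "BB Y Z \<Longrightarrow> BB Y' Z' \<Longrightarrow> BB (\<lambda>r \<omega>. Y r \<omega> - Y' r \<omega>) (\<lambda>r \<omega> y. Z r \<omega> y - Z' r \<omega> y)"
proof -
  assume a: "BB Y Z" "BB Y' Z'"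
  note D = BBD[OF a(1)] and D' = BBD[OF a(2)]
  show ?thesis
    unfolding BB_def
    using progressive_lincomb[OF D(1) D'(1), of 1 "-1"] field_lincomb[OF D(2) D'(2), of 1 "-1"]
      integrable_square_lincomb[OF progressive_PM[OF D(1)] progressive_PM[OF D'(1)] D(3) D'(3), of 1 "-1"]
      integrable_square_lincomb[OF field_mu[OF D(2)] field_mu[OF D'(2)] D(4) D'(4), of 1 "-1"]
    by (simp add: flat_def)
qed

lemma Z_sqnorm_eq: "field Z \<Longrightarrow> Z_sqnorm M X v t T Z = (\<integral>\<^sup>+u. ennreal ((flat Z u)\<^sup>2) \<partial>mu)"
  for Z :: "real \<Rightarrow> 'w \<Rightarrow> 'g \<Rightarrow> real"
proof -
  assume Z: "field Z"
  have m: "(\<lambda>u. ennreal ((flat Z u)\<^sup>2)) \<in> borel_measurable (PM \<Otimes>\<^sub>M \<Gamma>)"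
    using field_PM[OF Z] by measurable
  have "Z_sqnorm M X v t T Z = (\<integral>\<^sup>+\<omega>. \<integral>\<^sup>+r. (\<integral>\<^sup>+y. ennreal ((Z r \<omega> y)\<^sup>2) \<partial>kernel (\<omega>, r)) \<partial>time \<partial>M)"
    unfolding Z_sqnorm_def nn_integral_time[symmetric]
  proof (rule nn_integral_cong, rule nn_integral_cong_AE)
    fix \<omega> assume "\<omega> \<in> space M"
    then have "AE r in time. Xm r \<omega> = X r \<omega>" by (intro AE_time_Xm) simp
    then show "AE r in time. (\<integral>\<^sup>+y. ennreal ((Z r \<omega> y)\<^sup>2) \<partial>v r (X r \<omega>)) = (\<integral>\<^sup>+y. ennreal ((Z r \<omega> y)\<^sup>2) \<partial>kernel (\<omega>, r))"
      by eventually_elim (simp add: kernel_def)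
  qed
  also have "\<dots> = (\<integral>\<^sup>+p. (\<integral>\<^sup>+y. ennreal ((flat Z (p, y))\<^sup>2) \<partial>kernel p) \<partial>PM)"
    using PK.nn_measurable[OF m] by (subst nn_integral_PM[symmetric]) auto
  also have "\<dots> = (\<integral>\<^sup>+u. ennreal ((flat Z u)\<^sup>2) \<partial>mu)" by (rule nn_integral_mu[OF m, symmetric])
  finally show ?thesis .
qed

lemma Y_sqnorm_eq: "progressive F t T Y \<Longrightarrow> Y_sqnorm M t T Y = (\<integral>\<^sup>+p. ennreal ((Y (snd p) (fst p))\<^sup>2) \<partial>PM)"
  unfolding Y_sqnorm_def nn_integral_time[symmetric]
  using progressive_PM[of Y] by (subst nn_integral_PM[symmetric]) auto

lemma in_B_iff: "in_B \<Gamma> M F X v t T Y Z \<longleftrightarrow> BB Y Z"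
proof (cases "progressive F t T Y \<and> field Z")
  case True
  then have Y: "progressive F t T Y" and Z: "field Z" by auto
  note m = progressive_PM[OF Y] field_mu[OF Z]
  show ?thesis
    unfolding in_B_def BB_def B_sqnorm_def Y_sqnorm_eq[OF Y] Z_sqnorm_eq[OF Z]
    using True m by (auto simp: integrable_iff_bounded)
qed (auto simp: in_B_def BB_def)

lemma gf_progressive: "BB Y Z \<Longrightarrow> progressive F t T (gf Y Z)"
proof -
  assume B: "BB Y Z"
  then have "in_B \<Gamma> M F X v t T Y Z" by (simp add: in_B_iff)
  then have "Z_sqnorm M X v t T Z < \<infinity>"
    by (auto simp: in_B_def B_sqnorm_def)
  then show ?thesis
    using f BBD[OF B] unfolding generator_def gf_def[abs_def] by blast
qed

text \<open>At a jump the hypothesis speaks of \<open>v\<close> at the new state and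
  \<open>cs\<close> of \<open>v\<close> at the old one, so jump times are left out. Where
  \<open>Z\<close> is not square integrable, the default value 0 of \<open>gen_eval\<close>
  satisfies the bound as well.\<close>

lemma gf_growth:
  assumes o: "\<omega> \<in> \<Omega>" and r: "r \<in> {t<..T}" "r \<notin> J \<omega>"
  shows "\<bar>gf Y Z r \<omega>\<bar> \<le> lam * (1 + \<bar>Y r \<omega>\<bar> powr \<alpha> + sqrt (cs Z (\<omega>, r)) powr \<alpha>)"
proof -
  have k: "v r (X r \<omega>) = kernel (\<omega>, r)" using Xm_eq_X[OF o r] by (simp add: kernel_def)
  show ?thesis
  proof (cases "Z r \<omega> \<in> L2 (v r (X r \<omega>))")
    case True
    have "\<bar>f r (X r \<omega>) (Y r \<omega>) (Z r \<omega>)\<bar> \<le> lam * (1 + \<bar>Y r \<omega>\<bar> powr \<alpha> + L2_norm (v r (X r \<omega>)) (Z r \<omega>) powr \<alpha>)"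
      using r t_nonneg o True by (intro growth) (auto intro: X_in_space)
    then show ?thesis using True L2_norm_kernel[of "(\<omega>, r)" Z] by (simp add: gf_def gen_eval_def k)
  next
    case False
    have "0 \<le> lam * (1 + \<bar>Y r \<omega>\<bar> powr \<alpha> + sqrt (cs Z (\<omega>, r)) powr \<alpha>)"
      using lam by (intro mult_nonneg_nonneg add_nonneg_nonneg) auto
    then show ?thesis using False by (simp add: gf_def gen_eval_def)
  qed
qed

text \<open>The set of pairs \<open>(\<omega>, r)\<close> with a jump at \<open>r\<close> need not
  be measurable in the product. It is therefore removed path by path, where it is finite, and the
  measurability that Fubini requires is asked of \<open>Q\<close> instead.\<close>

lemma AE_PM_except_jumps:
  assumes "{p \<in> space PM. Q p} \<in> sets PM" "AE \<omega> in M. R \<omega>" "AE p in PM. S p"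
    and "\<And>\<omega> r. \<omega> \<in> \<Omega> \<Longrightarrow> R \<omega> \<Longrightarrow> r \<in> {t<..T} \<Longrightarrow> r \<notin> J \<omega> \<Longrightarrow> S (\<omega>, r) \<Longrightarrow> Q (\<omega>, r)"
  shows "AE p in PM. Q p"
proof (rule AE_PM[OF assms(1)])
  show "AE \<omega> in M. AE r in time. Q (\<omega>, r)"
    using assms(2) AE_PM_D[OF assms(3)] AE_space
  proof eventually_elim
    case (elim \<omega>)
    then have o: "\<omega> \<in> \<Omega>" by simp
    have "AE r in time. r \<in> {t<..T} \<and> r \<notin> J \<omega>"
      by (rule AE_time_except[OF finite_J[OF o]]) auto
    with elim(2) show ?case
      by eventually_elim (use assms(4)[OF o elim(1)] in auto)
  qed
qed

text \<open>A power with exponent \<alpha> is at most 1 plus its base, which makes the constant part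
  of the growth bound 3, with square 9; the factor 3 in front comes from squaring a sum of three
  terms.\<close>

lemma gf_square_bound:
  assumes B: "BB Y Z"
  shows "AE p in PM. (gf Y Z (snd p) (fst p))\<^sup>2 \<le> 3 * lam\<^sup>2 * (9 + (Y (snd p) (fst p))\<^sup>2 + cs Z p)"
proof (rule AE_PM_except_jumps[where R="\<lambda>_. True" and S="\<lambda>_. True"])
  note [measurable] = progressive_PM[OF gf_progressive[OF B]] progressive_PM[OF BBD(1)[OF B]]
    borel_measurable_integrable[OF cs_integrable(1)[OF BBD(2,4)[OF B]]]
  show "{p \<in> space PM. (gf Y Z (snd p) (fst p))\<^sup>2 \<le> 3 * lam\<^sup>2 * (9 + (Y (snd p) (fst p))\<^sup>2 + cs Z p)} \<in> sets PM"
    by measurable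
  fix \<omega> r assume o: "\<omega> \<in> \<Omega>" "r \<in> {t<..T}" "r \<notin> J \<omega>"
  have "\<bar>gf Y Z r \<omega>\<bar> \<le> lam * (1 + \<bar>Y r \<omega>\<bar> powr \<alpha> + sqrt (cs Z (\<omega>, r)) powr \<alpha>)" by (rule gf_growth[OF o])
  also have "\<dots> \<le> lam * (3 + \<bar>Y r \<omega>\<bar> + sqrt (cs Z (\<omega>, r)))"
    using lam powr_le_one_add[OF abs_ge_zero \<alpha>, of "Y r \<omega>"] powr_le_one_add[OF _ \<alpha>, of "sqrt (cs Z (\<omega>, r))"] cs_nonneg[of Z "(\<omega>, r)"]
    by (intro mult_left_mono) auto
  finally have "(gf Y Z r \<omega>)\<^sup>2 \<le> (lam * (3 + \<bar>Y r \<omega>\<bar> + sqrt (cs Z (\<omega>, r))))\<^sup>2"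
    using power_mono[of "\<bar>gf Y Z r \<omega>\<bar>" _ 2] by simp
  also have "\<dots> = lam\<^sup>2 * (3 + \<bar>Y r \<omega>\<bar> + sqrt (cs Z (\<omega>, r)))\<^sup>2" by (simp add: power_mult_distrib)
  also have "\<dots> \<le> lam\<^sup>2 * (3 * (9 + (Y r \<omega>)\<^sup>2 + cs Z (\<omega>, r)))"
  proof (rule mult_left_mono)
    have "(a + b + c)\<^sup>2 \<le> 3 * (a\<^sup>2 + b\<^sup>2 + c\<^sup>2)" for a b c :: real
      using zero_le_power2[of "a - b"] zero_le_power2[of "b - c"] zero_le_power2[of "a - c"]
      by (simp add: power2_eq_square algebra_simps)
    from this[of 3 "\<bar>Y r \<omega>\<bar>" "sqrt (cs Z (\<omega>, r))"]
    show "(3 + \<bar>Y r \<omega>\<bar> + sqrt (cs Z (\<omega>, r)))\<^sup>2 \<le> 3 * (9 + (Y r \<omega>)\<^sup>2 + cs Z (\<omega>, r))"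
      using cs_nonneg[of Z "(\<omega>, r)"] by simp
  qed simp
  finally show "(gf Y Z (snd (\<omega>, r)) (fst (\<omega>, r)))\<^sup>2 \<le> 3 * lam\<^sup>2 * (9 + (Y (snd (\<omega>, r)) (fst (\<omega>, r)))\<^sup>2 + cs Z (\<omega>, r))"
    by (simp only: fst_conv snd_conv mult_ac)
qed simp_all

lemma gf_integrable:
  assumes B: "BB Y Z" shows "integrable PM (\<lambda>p. (gf Y Z (snd p) (fst p))\<^sup>2)"
proof (rule Bochner_Integration.integrable_bound)
  show "integrable PM (\<lambda>p. 3 * lam\<^sup>2 * (9 + (Y (snd p) (fst p))\<^sup>2 + cs Z p))"
    using BBD(3)[OF B] cs_integrable(1)[OF BBD(2,4)[OF B]] by simp
  show "(\<lambda>p. (gf Y Z (snd p) (fst p))\<^sup>2) \<in> borel_measurable PM"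
    using progressive_PM[OF gf_progressive[OF B]] by simp
  show "AE p in PM. norm ((gf Y Z (snd p) (fst p))\<^sup>2) \<le> norm (3 * lam\<^sup>2 * (9 + (Y (snd p) (fst p))\<^sup>2 + cs Z p))"
    using gf_square_bound[OF B] by eventually_elim (simp add: order.trans[OF _ abs_ge_self])
qed

text \<open>One Picard step: the generator is frozen along \<open>(Y, Z)\<close> and thereby becomes
  a given progressive process.\<close>

lemma Phi_exists: "BB Y Z \<Longrightarrow> \<exists>Y' Z'. linear_bsde (gf Y Z) Y' Z' \<and> (AE \<omega> in M. Y' T \<omega> = h (X T \<omega>))"
proof (rule linear_exists)
  have "X T \<in> F T \<rightarrow>\<^sub>M \<Gamma>" using t_less by (intro X_measurable_F) simp
  then show "(\<lambda>\<omega>. h (X T \<omega>)) \<in> borel_measurable (F T)" using h(1) by (rule measurable_compose)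
qed (use h gf_progressive gf_integrable in auto)

text \<open>The truncation level of the local Lipschitz condition is made to depend on time: with the level
  \<open>exp (\<theta> r)\<close>, the weight that absorbs the Lipschitz constant stays below
  \<open>exp ((1 - \<alpha>) * \<theta> r)\<close>, which the tail estimate beats on the whole interval at once.\<close>

definition \<theta> :: "real \<Rightarrow> real \<Rightarrow> real" where "\<theta> N r = N * exp (8 / (1 - \<alpha>) * (r - t))"
definition C1 :: real where "C1 = 8 * L\<^sup>2 + 10"
definition W :: "real \<Rightarrow> real \<Rightarrow> real" where "W N r = exp (C1 * (r - t) + (1 - \<alpha>) * (\<theta> N r - N))"
definition W' :: "real \<Rightarrow> real \<Rightarrow> real" where "W' N r = (C1 + 8 * \<theta> N r) * W N r"
definition kap :: "real \<Rightarrow> real" where "kap N = 144 * lam\<^sup>2 * exp (C1 * (T - t) - (1 - \<alpha>) * N)"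

lemma W_deriv: "(W N has_real_derivative W' N r) (at r)"
proof -
  have \<theta>: "(\<theta> N has_real_derivative 8 / (1 - \<alpha>) * \<theta> N r) (at r)"
  proof -
    have "((\<lambda>r. N * exp (k * (r - t))) has_real_derivative k * (N * exp (k * (r - t)))) (at r)" for k
      by (auto intro!: derivative_eq_intros)
    then show ?thesis unfolding \<theta>_def[abs_def] .
  qed
  have eq: "C1 + (1 - \<alpha>) * (8 / (1 - \<alpha>) * \<theta> N r) = C1 + 8 * \<theta> N r" using \<alpha> by simp
  have "(W N has_real_derivative exp (C1 * (r - t) + (1 - \<alpha>) * (\<theta> N r - N)) * (C1 + (1 - \<alpha>) * (8 / (1 - \<alpha>) * \<theta> N r))) (at r)"
    unfolding W_def[abs_def] by (rule derivative_eq_intros \<theta> refl)+ simp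
  then show ?thesis unfolding W'_def eq W_def by (simp only: mult.commute)
qed

lemma \<theta>_continuous: "continuous_on UNIV (\<theta> N)"
  unfolding \<theta>_def[abs_def] by (intro continuous_intros)

lemma W_continuous: "continuous_on UNIV (W N)" "continuous_on UNIV (W' N)"
  unfolding W'_def[abs_def] W_def[abs_def]
  by (intro continuous_intros \<theta>_continuous)+

lemma \<theta>_ge: "t \<le> r \<Longrightarrow> 0 \<le> N \<Longrightarrow> N \<le> \<theta> N r"
  unfolding \<theta>_def using \<alpha> by (simp add: mult_le_cancel_left1)

lemma W_ge: "t \<le> r \<Longrightarrow> 0 \<le> N \<Longrightarrow> 1 \<le> W N r"
  unfolding W_def using \<theta>_ge[of r N] \<alpha> L by (simp add: C1_def)

text \<open>The level \<open>m\<close> exceeds \<open>exp (\<theta> N r)\<close> by at most 1, so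
  its logarithm is at most \<open>\<theta> N r + 1\<close>, and
  \<open>4 * (Lip m)\<^sup>2 + 1\<close> is at most
  \<open>8 * L\<^sup>2 + 8 * \<theta> N r + 9\<close>. This is
  \<open>C1 + 8 * \<theta> N r - 1\<close>, and the 1 to spare later pays for the left-hand side of
  the contraction. The rate \<open>8 / (1 - \<alpha>)\<close> in \<theta> is chosen so that the
  logarithmic derivative of the weight is exactly \<open>C1 + 8 * \<theta> N r\<close>. In the last
  claim the weight costs \<open>(1 - \<alpha>) * \<theta> N r\<close> in the exponent while the
  power of \<open>m\<close> gains twice that; the factor 4 anticipates the square of a sum of four
  terms, whence \<open>144 = 36 * 4\<close>.\<close>

lemma Lip_estimate:
  assumes N: "0 \<le> N" and r: "r \<in> {t..T}"
  defines "m \<equiv> nat \<lceil>exp (\<theta> N r)\<rceil>"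
  shows "1 \<le> m" "W N r * (4 * (Lip m)\<^sup>2 + 1) \<le> W' N r - W N r"
    "W N r * (36 * lam\<^sup>2 * real m powr (- 2 * (1 - \<alpha>))) * 4 \<le> kap N"
proof -
  have \<theta>0: "0 \<le> \<theta> N r" using \<theta>_ge[of r N] r N by auto
  have ge: "exp (\<theta> N r) \<le> real m"
    unfolding m_def by (simp add: of_nat_nat)
  have m1: "1 \<le> real m" using ge \<theta>0 by (meson one_le_exp_iff order.trans)
  then show m: "1 \<le> m" by simp
  have le: "real m \<le> exp (\<theta> N r) + 1"
    unfolding m_def by (simp add: of_nat_nat)
  also have "\<dots> \<le> 2 * exp (\<theta> N r)" using \<theta>0 by simp
  also have "\<dots> \<le> exp 1 * exp (\<theta> N r)" using exp_ge_add_one_self[of 1] by (intro mult_right_mono) auto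
  also have "\<dots> = exp (\<theta> N r + 1)" by (simp add: exp_add)
  finally have "ln (real m) \<le> ln (exp (\<theta> N r + 1))" using m1 by (subst ln_le_cancel_iff) auto
  then have ln: "ln (real m) \<le> \<theta> N r + 1" by simp
  have ln0: "0 \<le> ln (real m)" using m1 by simp
  have "(Lip m)\<^sup>2 \<le> (L + sqrt (ln (real m)))\<^sup>2"
    using log_growth[OF m] Lip_pos[OF m] by (intro power_mono) auto
  also have "\<dots> \<le> 2 * L\<^sup>2 + 2 * ln (real m)"
    using zero_le_power2[of "L - sqrt (ln (real m))"] ln0 by (simp add: power2_eq_square algebra_simps)
  also have "\<dots> \<le> 2 * L\<^sup>2 + 2 * (\<theta> N r + 1)" using ln by simp
  finally have "4 * (Lip m)\<^sup>2 + 1 \<le> C1 + 8 * \<theta> N r - 1" by (simp add: C1_def)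
  then have "W N r * (4 * (Lip m)\<^sup>2 + 1) \<le> W N r * (C1 + 8 * \<theta> N r - 1)"
    by (intro mult_left_mono) (simp_all add: W_def)
  then show "W N r * (4 * (Lip m)\<^sup>2 + 1) \<le> W' N r - W N r" by (simp add: W'_def algebra_simps)
  have "real m powr (- 2 * (1 - \<alpha>)) \<le> exp (\<theta> N r) powr (- 2 * (1 - \<alpha>))"
    using ge \<alpha> by (intro powr_mono2') auto
  also have "\<dots> = exp (- 2 * (1 - \<alpha>) * \<theta> N r)" by (simp add: exp_powr_real mult.commute)
  finally have "W N r * real m powr (- 2 * (1 - \<alpha>)) \<le> W N r * exp (- 2 * (1 - \<alpha>) * \<theta> N r)"
    by (intro mult_left_mono) (simp_all add: W_def)
  also have "\<dots> = exp (C1 * (r - t) - (1 - \<alpha>) * (\<theta> N r + N))"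
    unfolding W_def exp_add[symmetric] by (rule arg_cong[where f=exp]) (simp add: algebra_simps)
  also have "\<dots> \<le> exp (C1 * (T - t) - (1 - \<alpha>) * N)"
  proof -
    have "C1 * (r - t) \<le> C1 * (T - t)" using r by (intro mult_left_mono) (auto simp: C1_def)
    moreover have "(1 - \<alpha>) * N \<le> (1 - \<alpha>) * (\<theta> N r + N)" using \<theta>0 \<alpha> by (intro mult_left_mono) auto
    ultimately show ?thesis by simp
  qed
  finally have "144 * lam\<^sup>2 * (W N r * real m powr (- 2 * (1 - \<alpha>))) \<le> 144 * lam\<^sup>2 * exp (C1 * (T - t) - (1 - \<alpha>) * N)"
    by (intro mult_left_mono) auto
  then show "W N r * (36 * lam\<^sup>2 * real m powr (- 2 * (1 - \<alpha>))) * 4 \<le> kap N"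
    unfolding kap_def by (simp add: mult_ac)
qed

definition dens :: "(real \<Rightarrow> 'w \<Rightarrow> real) \<Rightarrow> (real \<Rightarrow> 'w \<Rightarrow> 'g \<Rightarrow> real) \<Rightarrow> 'w \<times> real \<Rightarrow> real" where
  "dens Y Z p = (Y (snd p) (fst p))\<^sup>2 + cs Z p"

lemma dens_nonneg: "0 \<le> dens Y Z p" by (simp add: dens_def cs_nonneg)

lemma dens_integrable: "BB Y Z \<Longrightarrow> integrable PM (dens Y Z)"
  unfolding dens_def[abs_def] using BBD(3) cs_integrable(1)[OF BBD(2) BBD(4)] by simp

abbreviation (input) dY where "dY Y Y' \<equiv> \<lambda>r \<omega>. Y r \<omega> - Y' r \<omega>"
abbreviation (input) dZ where "dZ Z Z' \<equiv> \<lambda>r \<omega> y. Z r \<omega> y - Z' r \<omega> y"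

text \<open>\<open>truncation_estimate\<close> is used at each time with its own level
  \<open>m\<close> and multiplied by the weight. The Lipschitz part is swallowed by
  \<open>W' - W\<close>, and the tail part is of size \<open>kap N\<close> uniformly in
  time.\<close>

lemma pointwise_estimate:
  assumes B: "BB y z" "BB y' z'" and D: "progressive F t T D" and N: "0 \<le> N"
  shows "AE p in PM. 2 * (W N (snd p) * (D (snd p) (fst p) * (gf y z (snd p) (fst p) - gf y' z' (snd p) (fst p))))
    \<le> (W' N (snd p) - W N (snd p)) * (D (snd p) (fst p))\<^sup>2
      + W N (snd p) * dens (dY y y') (dZ z z') p / 2 + kap N * (dens y z p + dens y' z' p)"
proof -
  note b = BBD[OF B(1)] and b' = BBD[OF B(2)]
  have Wm: "(\<lambda>p. W N (snd p)) \<in> borel_measurable PM" "(\<lambda>p. W' N (snd p)) \<in> borel_measurable PM"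
    using W_continuous[of N, THEN borel_measurable_continuous_onI]
    by (auto intro!: measurable_compose[OF measurable_compose[OF id_PA_PM PA_snd]])
  note [measurable] = Wm progressive_PM[OF D] progressive_PM[OF gf_progressive[OF B(1)]]
    progressive_PM[OF gf_progressive[OF B(2)]]
    borel_measurable_integrable[OF dens_integrable[OF B(1)]] borel_measurable_integrable[OF dens_integrable[OF B(2)]]
    borel_measurable_integrable[OF dens_integrable[OF BB_diff[OF B]]]
  \<comment> \<open>The level varies with \<open>r\<close>, so one null event must serve all levels;
    there are only countably many.\<close>
  have lip: "AE \<omega> in M. \<forall>m\<in>{1..}. \<forall>s\<in>{t..T}. \<forall>y y'. \<forall>z\<in>L2 (v s (X s \<omega>)). \<forall>z'\<in>L2 (v s (X s \<omega>)).
           \<bar>y\<bar> < real m \<longrightarrow> \<bar>y'\<bar> < real m \<longrightarrow>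
           L2_norm (v s (X s \<omega>)) z < real m \<longrightarrow> L2_norm (v s (X s \<omega>)) z' < real m \<longrightarrow>
           \<bar>f s (X s \<omega>) y z - f s (X s \<omega>) y' z'\<bar>
             \<le> Lip m * (\<bar>y - y'\<bar> + L2_norm (v s (X s \<omega>)) (\<lambda>u. z u - z' u))" (is "AE \<omega> in M. ?lip \<omega>")
    unfolding AE_ball_countable[OF countableI_type] by (intro ballI locally_lipschitz) simp
  have l2: "AE p in PM. z (snd p) (fst p) \<in> L2 (kernel p) \<and> z' (snd p) (fst p) \<in> L2 (kernel p)"
    using cs_integrable(3)[OF b(2,4)] cs_integrable(3)[OF b'(2,4)] by eventually_elim simp
  show ?thesis
  proof (rule AE_PM_except_jumps[OF _ lip l2])
    fix \<omega> r
    assume o: "\<omega> \<in> \<Omega>" and lip: "?lip \<omega>" and r: "r \<in> {t<..T}" "r \<notin> J \<omega>"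
      and l2: "z (snd (\<omega>, r)) (fst (\<omega>, r)) \<in> L2 (kernel (\<omega>, r)) \<and> z' (snd (\<omega>, r)) (fst (\<omega>, r)) \<in> L2 (kernel (\<omega>, r))"
    have r': "r \<in> {t..T}" using r by simp
    have k: "v r (X r \<omega>) = kernel (\<omega>, r)" using Xm_eq_X[OF o r] by (simp add: kernel_def)
    have zl: "z r \<omega> \<in> L2 (v r (X r \<omega>))" "z' r \<omega> \<in> L2 (v r (X r \<omega>))" using l2 k by simp_all
    define m where "m = nat \<lceil>exp (\<theta> N r)\<rceil>"
    note est = Lip_estimate[OF N r', folded m_def]
    define d where "d = \<bar>gf y z r \<omega> - gf y' z' r \<omega>\<bar>"
    define n1 where "n1 = sqrt (cs z (\<omega>, r))"
    define n2 where "n2 = sqrt (cs z' (\<omega>, r))"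
    define a where "a = \<bar>y r \<omega> - y' r \<omega>\<bar>"
    define b where "b = sqrt (cs (dZ z z') (\<omega>, r))"
    \<comment> \<open>The sum of all four sizes: if it is below the level, so is each of them, and
      in any case each of their powers is at most the power of \<open>V\<close>.\<close>
    define V where "V = \<bar>y r \<omega>\<bar> + \<bar>y' r \<omega>\<bar> + n1 + n2"
    have nn: "0 \<le> n1" "0 \<le> n2" by (simp_all add: n1_def n2_def cs_nonneg)
    have norms: "L2_norm (v r (X r \<omega>)) (z r \<omega>) = n1" "L2_norm (v r (X r \<omega>)) (z' r \<omega>) = n2"
      "L2_norm (v r (X r \<omega>)) (\<lambda>u. z r \<omega> u - z' r \<omega> u) = b"
      using L2_norm_kernel[of "(\<omega>, r)" z] L2_norm_kernel[of "(\<omega>, r)" z'] L2_norm_kernel[of "(\<omega>, r)" "dZ z z'"]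
      by (simp_all add: k n1_def n2_def b_def)
    have "2 * (\<bar>D r \<omega>\<bar> * d) \<le> (4 * (Lip m)\<^sup>2 + 1) * \<bar>D r \<omega>\<bar>\<^sup>2 + (a\<^sup>2 + b\<^sup>2) / 2
      + 36 * lam\<^sup>2 * real m powr (- 2 * (1 - \<alpha>)) * V\<^sup>2"
    proof (rule truncation_estimate[OF \<alpha>(2)])
      show "0 \<le> d" by (simp add: d_def)
      show "1 \<le> real m" using est(1) by simp
      show "d \<le> Lip m * (a + b)" if "V < real m"
      proof -
        have small: "\<bar>y r \<omega>\<bar> < real m" "\<bar>y' r \<omega>\<bar> < real m" "n1 < real m" "n2 < real m"
          using that nn abs_ge_zero[of "y r \<omega>"] abs_ge_zero[of "y' r \<omega>"] unfolding V_def by linarith+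
        have "\<bar>f r (X r \<omega>) (y r \<omega>) (z r \<omega>) - f r (X r \<omega>) (y' r \<omega>) (z' r \<omega>)\<bar> \<le> Lip m * (a + b)"
          using lip[rule_format, of m r "z r \<omega>" "z' r \<omega>" "y r \<omega>" "y' r \<omega>"] est(1) r' zl small
          unfolding norms a_def by simp
        then show ?thesis using zl by (simp add: d_def gf_def gen_eval_def)
      qed
      show "d \<le> 6 * lam * V powr \<alpha>" if "real m \<le> V"
      proof -
        have V1: "1 \<le> V" using that est(1) by simp
        have p: "q powr \<alpha> \<le> V powr \<alpha>" if "0 \<le> q" "q \<le> V" for q using that \<alpha> by (intro powr_mono2) auto
        have one: "1 \<le> V powr \<alpha>" using p[of 1] V1 by simp
        have le: "\<bar>y r \<omega>\<bar> \<le> V" "\<bar>y' r \<omega>\<bar> \<le> V" "n1 \<le> V" "n2 \<le> V" using nn by (auto simp: V_def)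
        have "\<bar>gf y z r \<omega>\<bar> \<le> lam * (1 + \<bar>y r \<omega>\<bar> powr \<alpha> + n1 powr \<alpha>)"
          unfolding n1_def by (rule gf_growth[OF o r])
        also have "\<dots> \<le> lam * (V powr \<alpha> + V powr \<alpha> + V powr \<alpha>)"
          using lam nn le by (intro mult_left_mono add_mono one p) auto
        finally have 1: "\<bar>gf y z r \<omega>\<bar> \<le> 3 * lam * V powr \<alpha>" by simp
        have "\<bar>gf y' z' r \<omega>\<bar> \<le> lam * (1 + \<bar>y' r \<omega>\<bar> powr \<alpha> + n2 powr \<alpha>)"
          unfolding n2_def by (rule gf_growth[OF o r])
        also have "\<dots> \<le> lam * (V powr \<alpha> + V powr \<alpha> + V powr \<alpha>)"
          using lam nn le by (intro mult_left_mono add_mono one p) auto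
        finally have 2: "\<bar>gf y' z' r \<omega>\<bar> \<le> 3 * lam * V powr \<alpha>" by simp
        show ?thesis unfolding d_def using 1 2 by linarith
      qed
    qed
    then have "W N r * (2 * (\<bar>D r \<omega>\<bar> * d)) \<le> W N r * ((4 * (Lip m)\<^sup>2 + 1) * (D r \<omega>)\<^sup>2 + (a\<^sup>2 + b\<^sup>2) / 2
      + 36 * lam\<^sup>2 * real m powr (- 2 * (1 - \<alpha>)) * V\<^sup>2)"
      by (intro mult_left_mono) (simp_all add: W_def)
    also have "\<dots> = W N r * (4 * (Lip m)\<^sup>2 + 1) * (D r \<omega>)\<^sup>2 + W N r * (a\<^sup>2 + b\<^sup>2) / 2
      + W N r * (36 * lam\<^sup>2 * real m powr (- 2 * (1 - \<alpha>))) * V\<^sup>2"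
      by (simp add: algebra_simps)
    also have "\<dots> \<le> (W' N r - W N r) * (D r \<omega>)\<^sup>2 + W N r * (a\<^sup>2 + b\<^sup>2) / 2
      + W N r * (36 * lam\<^sup>2 * real m powr (- 2 * (1 - \<alpha>))) * (4 * (dens y z (\<omega>, r) + dens y' z' (\<omega>, r)))"
    proof (intro add_mono mult_right_mono est(2) order.refl mult_left_mono)
      have "(p + q + i + j)\<^sup>2 \<le> 4 * (p\<^sup>2 + i\<^sup>2 + (q\<^sup>2 + j\<^sup>2))" for p q i j :: real
        using zero_le_power2[of "p - q"] zero_le_power2[of "p - i"] zero_le_power2[of "p - j"]
          zero_le_power2[of "q - i"] zero_le_power2[of "q - j"] zero_le_power2[of "i - j"]
        by (simp add: power2_eq_square algebra_simps)
      from this[of "\<bar>y r \<omega>\<bar>" "\<bar>y' r \<omega>\<bar>" n1 n2]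
      show "V\<^sup>2 \<le> 4 * (dens y z (\<omega>, r) + dens y' z' (\<omega>, r))"
        by (simp add: V_def dens_def n1_def n2_def cs_nonneg)
      show "0 \<le> W N r * (36 * lam\<^sup>2 * real m powr (- 2 * (1 - \<alpha>)))" by (simp add: W_def)
    qed simp
    also have "W N r * (36 * lam\<^sup>2 * real m powr (- 2 * (1 - \<alpha>))) * (4 * (dens y z (\<omega>, r) + dens y' z' (\<omega>, r)))
      \<le> kap N * (dens y z (\<omega>, r) + dens y' z' (\<omega>, r))"
      unfolding mult.assoc[symmetric, of _ 4]
      by (intro mult_right_mono est(3) add_nonneg_nonneg dens_nonneg)
    finally have main: "W N r * (2 * (\<bar>D r \<omega>\<bar> * d)) \<le> (W' N r - W N r) * (D r \<omega>)\<^sup>2 + W N r * (a\<^sup>2 + b\<^sup>2) / 2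
      + kap N * (dens y z (\<omega>, r) + dens y' z' (\<omega>, r))" by simp
    have "D r \<omega> * (gf y z r \<omega> - gf y' z' r \<omega>) \<le> \<bar>D r \<omega>\<bar> * d"
      unfolding d_def abs_mult[symmetric] by simp
    then have "2 * (W N r * (D r \<omega> * (gf y z r \<omega> - gf y' z' r \<omega>))) \<le> W N r * (2 * (\<bar>D r \<omega>\<bar> * d))"
      by (simp add: W_def)
    also note main
    also have "a\<^sup>2 + b\<^sup>2 = dens (dY y y') (dZ z z') (\<omega>, r)"
      by (simp add: a_def b_def dens_def cs_nonneg)
    finally show "2 * (W N (snd (\<omega>, r)) * (D (snd (\<omega>, r)) (fst (\<omega>, r)) * (gf y z (snd (\<omega>, r)) (fst (\<omega>, r)) - gf y' z' (snd (\<omega>, r)) (fst (\<omega>, r)))))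
    \<le> (W' N (snd (\<omega>, r)) - W N (snd (\<omega>, r))) * (D (snd (\<omega>, r)) (fst (\<omega>, r)))\<^sup>2
      + W N (snd (\<omega>, r)) * dens (dY y y') (dZ z z') (\<omega>, r) / 2 + kap N * (dens y z (\<omega>, r) + dens y' z' (\<omega>, r))"
      by simp
  qed measurable
qed

end

context jump_markov_started
begin

lemma linear_bsde_cong_generator:
  assumes lin: "linear_bsde g Y Z" and g': "(\<lambda>p. g' (snd p) (fst p)) \<in> borel_measurable PM"
    and ae: "AE p in PM. g (snd p) (fst p) = g' (snd p) (fst p)"
  shows "linear_bsde g' Y Z"
proof -
  note D = linear_bsdeD[OF lin]
  have i2: "integrable PM (\<lambda>p. (g' (snd p) (fst p))\<^sup>2)"
  proof (rule integrable_cong_AE_imp[OF D(6)])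
    show "AE p in PM. (g (snd p) (fst p))\<^sup>2 = (g' (snd p) (fst p))\<^sup>2" using ae by eventually_elim simp
  qed (use g' in simp)
  have gi: "integrable PM (\<lambda>p. g (snd p) (fst p))" "integrable PM (\<lambda>p. g' (snd p) (fst p))"
    using integrable_PM_L1[OF D(5,6)] integrable_PM_L1[OF g' i2] by simp_all
  have "AE \<omega> in M. \<forall>s\<in>{t..T}. (LINT r:{s<..T}|lborel. g r \<omega>) = (LINT r:{s<..T}|lborel. g' r \<omega>)"
    using AE_PM_D[OF ae] AE_PM_integrable[OF gi(1)] AE_PM_integrable[OF gi(2)]
  proof eventually_elim
    case (elim \<omega>)
    show ?case
    proof
      fix s assume s: "s \<in> {t..T}"
      have si: "(\<lambda>r. indicator {s<..T} r *\<^sub>R k r) \<in> borel_measurable lborel" if "set_integrable lborel {t<..T} k" for k :: "real \<Rightarrow> real"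
      proof -
        have "set_integrable lborel {s<..T} k" by (rule set_integrable_subset[OF that]) (use s in auto)
        then show ?thesis unfolding set_integrable_def by (rule borel_measurable_integrable)
      qed
      show "(LINT r:{s<..T}|lborel. g r \<omega>) = (LINT r:{s<..T}|lborel. g' r \<omega>)"
        unfolding set_lebesgue_integral_def
      proof (rule integral_cong_AE)
        show "AE r in lborel. indicator {s<..T} r *\<^sub>R g r \<omega> = indicator {s<..T} r *\<^sub>R g' r \<omega>"
          using elim(1)[unfolded AE_time] by eventually_elim (use s in \<open>auto simp: indicator_def\<close>)
      qed (use si elim(2,3) in simp_all)
    qed
  qed
  with D(7) have "AE \<omega> in M. \<forall>s\<in>{t..T}. Y s \<omega> = Y T \<omega> + (LINT r:{s<..T}|lborel. g' r \<omega>)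
      - (jump_sum Z s \<omega> - (LINT r:{s<..T}|lborel. comp Z (\<omega>, r)))"
  proof eventually_elim
    case (elim \<omega>)
    show ?case
    proof
      fix s assume s: "s \<in> {t..T}"
      show "Y s \<omega> = Y T \<omega> + (LINT r:{s<..T}|lborel. g' r \<omega>)
        - (jump_sum Z s \<omega> - (LINT r:{s<..T}|lborel. comp Z (\<omega>, r)))"
        using bspec[OF elim(1) s] bspec[OF elim(2) s] by linarith
    qed
  qed
  then show ?thesis unfolding linear_bsde_def using D(1-4) g' i2 by blast
qed

end

section \<open>Contraction up to an error term, and the fixed point\<close>

context bsde_data
begin

text \<open>The difference of the two images has terminal value 0, and its generator is the
  difference of the two generators. In the weighted energy inequality the term with
  \<open>W'\<close> cancels against \<open>pointwise_estimate\<close> and leaves \<open>W\<close>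
  times the squared difference on the left. The error is multiplied by the norms of the arguments,
  not by their distance.\<close>

theorem contraction:
  assumes B: "BB y z" "BB y' z'" and lin: "linear_bsde (gf y z) Y Z" "linear_bsde (gf y' z') Y' Z'"
    and tval: "AE \<omega> in M. Y T \<omega> = Y' T \<omega>" and N: "0 \<le> N"
  shows "(\<integral>p. W N (snd p) * dens (dY Y Y') (dZ Z Z') p \<partial>PM)
    \<le> (\<integral>p. W N (snd p) * dens (dY y y') (dZ z z') p \<partial>PM) / 2
      + kap N * ((\<integral>p. dens y z p \<partial>PM) + (\<integral>p. dens y' z' p \<partial>PM))"
proof -
  define D where "D = dY Y Y'"
  define E where "E = dZ Z Z'"
  define \<delta> where "\<delta> r \<omega> = gf y z r \<omega> - gf y' z' r \<omega>" for r \<omega>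
  have l: "linear_bsde \<delta> D E"
    using linear_bsde_lincomb[OF lin, of 1 "-1"] by (simp add: D_def E_def \<delta>_def[abs_def])
  note d = linear_bsdeD[OF l]
  have ae0: "AE \<omega> in M. 0 = (D T \<omega>)\<^sup>2" using tval by eventually_elim (simp add: D_def)
  have DTm: "(\<lambda>\<omega>. (D T \<omega>)\<^sup>2) \<in> borel_measurable M"
    using progressive_adapted[OF d(1)] t_less by (intro borel_measurable_power measurable_F_M[of _ T]) auto
  have T2: "integrable M (\<lambda>\<omega>. (D T \<omega>)\<^sup>2)"
    by (rule integrable_cong_AE_imp[OF _ DTm ae0]) simp
  have T0: "(\<integral>\<omega>. (D T \<omega>)\<^sup>2 \<partial>M) = 0"
    using integral_cong_AE[OF _ DTm ae0] by simp
  have BE: "BB D E" by (rule linear_BB[OF l])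
  have W0: "0 \<le> W N t" by (simp add: W_def)
  note Wi = weight_PM(1)[OF _ W_continuous(1)[of N]] and Wi' = weight_PM(1)[OF _ W_continuous(2)[of N]]
  have iDd: "integrable PM (\<lambda>p. D (snd p) (fst p) * \<delta> (snd p) (fst p))"
    by (rule integrable_square_mult[OF progressive_PM[OF d(1)] d(5,3,6)])
  note iC = cs_integrable(1)[OF d(2,4)]
  have "(\<integral>p. W' N (snd p) * (D (snd p) (fst p))\<^sup>2 \<partial>PM) + (\<integral>p. W N (snd p) * cs E p \<partial>PM)
    \<le> 2 * (\<integral>p. W N (snd p) * (D (snd p) (fst p) * \<delta> (snd p) (fst p)) \<partial>PM)"
    using weighted_energy[OF l T2 W_deriv W_continuous(2) W0] by (simp add: T0 cs_def)
  also have "\<dots> = (\<integral>p. 2 * (W N (snd p) * (D (snd p) (fst p) * \<delta> (snd p) (fst p))) \<partial>PM)" by simp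
  also have "\<dots> \<le> (\<integral>p. (W' N (snd p) * (D (snd p) (fst p))\<^sup>2 - W N (snd p) * (D (snd p) (fst p))\<^sup>2)
      + W N (snd p) * dens (dY y y') (dZ z z') p / 2 + kap N * (dens y z p + dens y' z' p) \<partial>PM)"
  proof (rule integral_mono_AE)
    show "integrable PM (\<lambda>p. 2 * (W N (snd p) * (D (snd p) (fst p) * \<delta> (snd p) (fst p))))"
      using Wi[OF iDd] by simp
    show "integrable PM (\<lambda>p. (W' N (snd p) * (D (snd p) (fst p))\<^sup>2 - W N (snd p) * (D (snd p) (fst p))\<^sup>2)
      + W N (snd p) * dens (dY y y') (dZ z z') p / 2 + kap N * (dens y z p + dens y' z' p))"
      using Wi[OF d(3)] Wi'[OF d(3)] Wi[OF dens_integrable[OF BB_diff[OF B]]] dens_integrable[OF B(1)] dens_integrable[OF B(2)]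
      by simp
    show "AE p in PM. 2 * (W N (snd p) * (D (snd p) (fst p) * \<delta> (snd p) (fst p)))
      \<le> (W' N (snd p) * (D (snd p) (fst p))\<^sup>2 - W N (snd p) * (D (snd p) (fst p))\<^sup>2)
      + W N (snd p) * dens (dY y y') (dZ z z') p / 2 + kap N * (dens y z p + dens y' z' p)"
      using pointwise_estimate[OF B d(1) N] unfolding \<delta>_def left_diff_distrib .
  qed
  also have "\<dots> = (\<integral>p. W' N (snd p) * (D (snd p) (fst p))\<^sup>2 \<partial>PM) - (\<integral>p. W N (snd p) * (D (snd p) (fst p))\<^sup>2 \<partial>PM)
      + (\<integral>p. W N (snd p) * dens (dY y y') (dZ z z') p \<partial>PM) / 2
      + kap N * ((\<integral>p. dens y z p \<partial>PM) + (\<integral>p. dens y' z' p \<partial>PM))"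
    using Wi[OF d(3)] Wi'[OF d(3)] Wi[OF dens_integrable[OF BB_diff[OF B]]] dens_integrable[OF B(1)] dens_integrable[OF B(2)]
    by simp
  finally have "(\<integral>p. W N (snd p) * (D (snd p) (fst p))\<^sup>2 \<partial>PM) + (\<integral>p. W N (snd p) * cs E p \<partial>PM)
    \<le> (\<integral>p. W N (snd p) * dens (dY y y') (dZ z z') p \<partial>PM) / 2
      + kap N * ((\<integral>p. dens y z p \<partial>PM) + (\<integral>p. dens y' z' p \<partial>PM))" by simp
  moreover have "(\<integral>p. W N (snd p) * dens D E p \<partial>PM)
    = (\<integral>p. W N (snd p) * (D (snd p) (fst p))\<^sup>2 \<partial>PM) + (\<integral>p. W N (snd p) * cs E p \<partial>PM)"
    unfolding dens_def distrib_left using Wi[OF d(3)] Wi[OF iC] by simp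
  ultimately show ?thesis unfolding D_def E_def by simp
qed

text \<open>Linear growth suffices here, and no truncation enters. Young's inequality with constant
  \<open>6 * lam\<^sup>2\<close> turns the bound on the squared generator, with its
  \<open>3 * lam\<^sup>2\<close>, into one half of the density; the rate of the weight exceeds that
  constant by 1, which keeps the full square of \<open>Y\<close> on the left.\<close>

lemma apriori_bound:
  obtains C where "0 \<le> C" "\<And>y z Y Z. BB y z \<Longrightarrow> linear_bsde (gf y z) Y Z \<Longrightarrow> (AE \<omega> in M. Y T \<omega> = h (X T \<omega>)) \<Longrightarrow>
    (\<integral>p. exp ((6 * lam\<^sup>2 + 1) * (snd p - t)) * dens Y Z p \<partial>PM)
    \<le> C + (\<integral>p. exp ((6 * lam\<^sup>2 + 1) * (snd p - t)) * dens y z p \<partial>PM) / 2"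
proof
  define V where "V r = exp ((6 * lam\<^sup>2 + 1) * (r - t))" for r
  have Vd: "(V has_real_derivative (6 * lam\<^sup>2 + 1) * V r) (at r)" for r
    unfolding V_def[abs_def] by (auto intro!: derivative_eq_intros)
  have Vc: "continuous_on UNIV V" "continuous_on UNIV (\<lambda>r. (6 * lam\<^sup>2 + 1) * V r)"
    unfolding V_def[abs_def] by (intro continuous_intros)+
  note Vi = weight_PM(1)[OF _ Vc(1)]
  define C where "C = V T * (\<integral>\<omega>. (h (X T \<omega>))\<^sup>2 \<partial>M) + (\<integral>p. V (snd p) * 9 \<partial>PM) / 2"
  show "0 \<le> C" unfolding C_def
    by (intro add_nonneg_nonneg mult_nonneg_nonneg divide_nonneg_nonneg integral_nonneg_AE AE_I2) (simp_all add: V_def)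
  fix y z Y Z
  assume B: "BB y z" and lin: "linear_bsde (gf y z) Y Z" and tval: "AE \<omega> in M. Y T \<omega> = h (X T \<omega>)"
  note d = linear_bsdeD[OF lin]
  have XT: "X T \<in> M \<rightarrow>\<^sub>M \<Gamma>" using t_less by (intro measurable_F_M[OF X_measurable_F[of T T]]) simp
  have hm: "(\<lambda>\<omega>. (h (X T \<omega>))\<^sup>2) \<in> borel_measurable M" by (intro borel_measurable_power measurable_compose[OF XT h(1)])
  have ae: "AE \<omega> in M. (h (X T \<omega>))\<^sup>2 = (Y T \<omega>)\<^sup>2" using tval by eventually_elim simp
  have YTm: "(\<lambda>\<omega>. (Y T \<omega>)\<^sup>2) \<in> borel_measurable M"
    using progressive_adapted[OF d(1)] t_less by (intro borel_measurable_power measurable_F_M[of _ T]) auto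
  have T2: "integrable M (\<lambda>\<omega>. (Y T \<omega>)\<^sup>2)" by (rule integrable_cong_AE_imp[OF h(2) YTm ae])
  have TE: "(\<integral>\<omega>. (Y T \<omega>)\<^sup>2 \<partial>M) = (\<integral>\<omega>. (h (X T \<omega>))\<^sup>2 \<partial>M)" using integral_cong_AE[OF hm YTm ae] by simp
  have V0: "0 \<le> V t" by (simp add: V_def)
  have iYg: "integrable PM (\<lambda>p. Y (snd p) (fst p) * gf y z (snd p) (fst p))"
    by (rule integrable_square_mult[OF progressive_PM[OF d(1)] d(5,3,6)])
  note iC = cs_integrable(1)[OF d(2,4)]
  have i9: "integrable PM (\<lambda>p. V (snd p) * 9)" using Vi[of "\<lambda>_. 9"] by simp
  have "(\<integral>p. ((6 * lam\<^sup>2 + 1) * V (snd p)) * (Y (snd p) (fst p))\<^sup>2 \<partial>PM) + (\<integral>p. V (snd p) * cs Z p \<partial>PM)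
    \<le> V T * (\<integral>\<omega>. (h (X T \<omega>))\<^sup>2 \<partial>M) + 2 * (\<integral>p. V (snd p) * (Y (snd p) (fst p) * gf y z (snd p) (fst p)) \<partial>PM)"
    using weighted_energy[OF lin T2 Vd Vc(2) V0] by (simp add: TE cs_def)
  also have "2 * (\<integral>p. V (snd p) * (Y (snd p) (fst p) * gf y z (snd p) (fst p)) \<partial>PM)
    = (\<integral>p. 2 * (V (snd p) * (Y (snd p) (fst p) * gf y z (snd p) (fst p))) \<partial>PM)" by simp
  also have "\<dots> \<le> (\<integral>p. 6 * lam\<^sup>2 * (V (snd p) * (Y (snd p) (fst p))\<^sup>2) + (V (snd p) * 9 + V (snd p) * dens y z p) / 2 \<partial>PM)"
  proof (rule integral_mono_AE)
    show "integrable PM (\<lambda>p. 2 * (V (snd p) * (Y (snd p) (fst p) * gf y z (snd p) (fst p))))" using Vi[OF iYg] by simp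
    show "integrable PM (\<lambda>p. 6 * lam\<^sup>2 * (V (snd p) * (Y (snd p) (fst p))\<^sup>2) + (V (snd p) * 9 + V (snd p) * dens y z p) / 2)"
      using Vi[OF d(3)] i9 Vi[OF dens_integrable[OF B]] by simp
    show "AE p in PM. 2 * (V (snd p) * (Y (snd p) (fst p) * gf y z (snd p) (fst p)))
      \<le> 6 * lam\<^sup>2 * (V (snd p) * (Y (snd p) (fst p))\<^sup>2) + (V (snd p) * 9 + V (snd p) * dens y z p) / 2"
      using gf_square_bound[OF B]
    proof eventually_elim
      case (elim p)
      define a where "a = Y (snd p) (fst p)"
      define b where "b = gf y z (snd p) (fst p)"
      define c where "c = 6 * lam\<^sup>2"
      have c: "0 < c" using lam by (simp add: c_def)
      have "2 * (a * b) \<le> c * a\<^sup>2 + b\<^sup>2 / c"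
      proof -
        have "0 \<le> (c * a - b)\<^sup>2 / c" using c by simp
        also have "(c * a - b)\<^sup>2 / c = c * a\<^sup>2 + b\<^sup>2 / c - 2 * (a * b)"
          using c by (simp add: field_simps power2_eq_square)
        finally show ?thesis by simp
      qed
      also have "b\<^sup>2 / c \<le> (9 + dens y z p) / 2"
      proof -
        have "b\<^sup>2 \<le> c * ((9 + dens y z p) / 2)" using elim by (simp add: b_def c_def dens_def add.assoc)
        then show ?thesis using c by (simp add: pos_divide_le_eq mult.commute)
      qed
      finally have "V (snd p) * (2 * (a * b)) \<le> V (snd p) * (c * a\<^sup>2 + (9 + dens y z p) / 2)"
        by (intro mult_left_mono) (auto simp: V_def)
      then show ?case unfolding a_def b_def c_def by (simp add: algebra_simps)
    qed
  qed
  also have "\<dots> = 6 * lam\<^sup>2 * (\<integral>p. V (snd p) * (Y (snd p) (fst p))\<^sup>2 \<partial>PM)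
      + ((\<integral>p. V (snd p) * 9 \<partial>PM) + (\<integral>p. V (snd p) * dens y z p \<partial>PM)) / 2"
    using Vi[OF d(3)] i9 Vi[OF dens_integrable[OF B]] by simp
  finally have "(\<integral>p. ((6 * lam\<^sup>2 + 1) * V (snd p)) * (Y (snd p) (fst p))\<^sup>2 \<partial>PM) + (\<integral>p. V (snd p) * cs Z p \<partial>PM)
    \<le> V T * (\<integral>\<omega>. (h (X T \<omega>))\<^sup>2 \<partial>M) + (6 * lam\<^sup>2 * (\<integral>p. V (snd p) * (Y (snd p) (fst p))\<^sup>2 \<partial>PM)
      + ((\<integral>p. V (snd p) * 9 \<partial>PM) + (\<integral>p. V (snd p) * dens y z p \<partial>PM)) / 2)" by simp
  moreover have "(\<integral>p. ((6 * lam\<^sup>2 + 1) * V (snd p)) * (Y (snd p) (fst p))\<^sup>2 \<partial>PM)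
    = (6 * lam\<^sup>2 + 1) * (\<integral>p. V (snd p) * (Y (snd p) (fst p))\<^sup>2 \<partial>PM)" by (simp add: mult.assoc)
  moreover have "(\<integral>p. V (snd p) * dens Y Z p \<partial>PM)
    = (\<integral>p. V (snd p) * (Y (snd p) (fst p))\<^sup>2 \<partial>PM) + (\<integral>p. V (snd p) * cs Z p \<partial>PM)"
    unfolding dens_def distrib_left using Vi[OF d(3)] Vi[OF iC] by simp
  ultimately have "(\<integral>p. V (snd p) * dens Y Z p \<partial>PM) \<le> C + (\<integral>p. V (snd p) * dens y z p \<partial>PM) / 2"
    unfolding C_def distrib_right by (simp add: add_divide_distrib)
  then show "(\<integral>p. exp ((6 * lam\<^sup>2 + 1) * (snd p - t)) * dens Y Z p \<partial>PM)
    \<le> C + (\<integral>p. exp ((6 * lam\<^sup>2 + 1) * (snd p - t)) * dens y z p \<partial>PM) / 2" unfolding V_def .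
qed

text \<open>The squared distance in the Banach space. Left squared it compares directly with the
  weighted integrals, at the price of a factor 2 in the triangle inequality.\<close>

definition dd where "dd Y Z Y' Z' = (\<integral>p. dens (dY Y Y') (dZ Z Z') p \<partial>PM)"

lemma dd_eq:
  assumes "BB Y Z" "BB Y' Z'"
  shows "dd Y Z Y' Z' = (\<integral>p. (Y (snd p) (fst p) - Y' (snd p) (fst p))\<^sup>2 \<partial>PM) + (\<integral>u. (flat Z u - flat Z' u)\<^sup>2 \<partial>mu)"
proof -
  note B = BBD[OF BB_diff[OF assms]]
  show ?thesis
    unfolding dd_def dens_def using B(3) cs_integrable[OF B(2,4)] by (simp add: flat_def)
qed

lemma dd_nonneg: "0 \<le> dd Y Z Y' Z'"
  unfolding dd_def by (intro integral_nonneg_AE AE_I2 dens_nonneg)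

lemma dd_commute: "BB Y Z \<Longrightarrow> BB Y' Z' \<Longrightarrow> dd Y Z Y' Z' = dd Y' Z' Y Z"
  by (simp add: dd_eq power2_commute)

lemma dd_triangle:
  assumes B: "BB Y Z" "BB Y' Z'" "BB Y'' Z''"
  shows "dd Y Z Y'' Z'' \<le> 2 * dd Y Z Y' Z' + 2 * dd Y' Z' Y'' Z''"
proof -
  note i12 = BBD[OF BB_diff[OF B(1,2)]] and i23 = BBD[OF BB_diff[OF B(2,3)]] and i13 = BBD[OF BB_diff[OF B(1,3)]]
  have sq: "(a - c)\<^sup>2 \<le> 2 * (a - b)\<^sup>2 + 2 * (b - c)\<^sup>2" for a b c :: real
    using zero_le_power2[of "a + c - 2 * b"] by (simp add: power2_eq_square algebra_simps)
  have "(\<integral>p. (Y (snd p) (fst p) - Y'' (snd p) (fst p))\<^sup>2 \<partial>PM)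
    \<le> (\<integral>p. 2 * (Y (snd p) (fst p) - Y' (snd p) (fst p))\<^sup>2 + 2 * (Y' (snd p) (fst p) - Y'' (snd p) (fst p))\<^sup>2 \<partial>PM)"
    using i12(3) i23(3) i13(3) by (intro integral_mono sq) auto
  moreover have "(\<integral>u. (flat Z u - flat Z'' u)\<^sup>2 \<partial>mu) \<le> (\<integral>u. 2 * (flat Z u - flat Z' u)\<^sup>2 + 2 * (flat Z' u - flat Z'' u)\<^sup>2 \<partial>mu)"
    using i12(4) i23(4) i13(4) by (intro integral_mono sq) (auto simp: flat_def)
  ultimately show ?thesis
    unfolding dd_eq[OF B(1,2)] dd_eq[OF B(2,3)] dd_eq[OF B(1,3)]
    using i12(3,4) i23(3,4) by (simp add: flat_def)
qed

lemma W_compare: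
  assumes B: "BB Y Z" and N: "0 \<le> N"
  shows "(\<integral>p. dens Y Z p \<partial>PM) \<le> (\<integral>p. W N (snd p) * dens Y Z p \<partial>PM)"
  using dens_integrable[OF B] weight_PM(1)[OF dens_integrable[OF B] W_continuous(1)]
proof (rule integral_mono)
  fix p assume "p \<in> space PM"
  then have "1 \<le> W N (snd p)" using N by (intro W_ge) (auto simp: space_pair_measure)
  then show "dens Y Z p \<le> W N (snd p) * dens Y Z p" using dens_nonneg[of Y Z p] by (simp add: mult_le_cancel_right1)
qed

text \<open>The constant depends on \<open>N\<close>, so it may be used only with \<open>N\<close>
  fixed, while the number of iterations tends to infinity.\<close>

lemma W_bound: obtains C where "0 \<le> C" "\<And>Y Z. BB Y Z \<Longrightarrow> (\<integral>p. W N (snd p) * dens Y Z p \<partial>PM) \<le> C * (\<integral>p. dens Y Z p \<partial>PM)"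
proof -
  have "bounded (W N ` {t..T})"
    by (intro compact_imp_bounded compact_continuous_image continuous_on_subset[OF W_continuous(1)]) auto
  then obtain C where "\<forall>y\<in>W N ` {t..T}. norm y \<le> C" unfolding bounded_iff by blast
  then have C: "W N r \<le> C" if "r \<in> {t..T}" for r using that by (auto intro: order.trans[OF abs_ge_self])
  show ?thesis
  proof
    show "0 \<le> C" using C[of t] t_less by (auto simp: W_def intro: order.trans[OF exp_ge_zero])
    fix Y Z assume B: "BB Y Z"
    have "(\<integral>p. W N (snd p) * dens Y Z p \<partial>PM) \<le> (\<integral>p. C * dens Y Z p \<partial>PM)"
    proof (rule integral_mono[OF weight_PM(1)[OF dens_integrable[OF B] W_continuous(1)]])
      fix p assume "p \<in> space PM"
      then show "W N (snd p) * dens Y Z p \<le> C * dens Y Z p"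
        by (intro mult_right_mono C dens_nonneg) (auto simp: space_pair_measure)
    qed (use dens_integrable[OF B] in simp)
    then show "(\<integral>p. W N (snd p) * dens Y Z p \<partial>PM) \<le> C * (\<integral>p. dens Y Z p \<partial>PM)" by simp
  qed
qed

lemma kap_nonneg: "0 \<le> kap N" by (simp add: kap_def)

lemma kap_tendsto: "(\<lambda>n. kap (real n)) \<longlonglongrightarrow> 0"
proof -
  have eq: "kap (real n) = 144 * lam\<^sup>2 * exp (C1 * (T - t)) * exp (- (1 - \<alpha>)) ^ n" for n
    unfolding kap_def exp_of_nat_mult[symmetric] mult.assoc exp_add[symmetric] by (simp add: algebra_simps)
  have "(\<lambda>n. exp (- (1 - \<alpha>)) ^ n) \<longlonglongrightarrow> 0" using \<alpha> by (intro LIMSEQ_realpow_zero) auto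
  then show ?thesis unfolding eq by (rule tendsto_mult_right_zero)
qed

text \<open>Distance zero identifies \<open>Z\<close> and \<open>Z'\<close> only up to null sets of
  the rate measure; the generator does not see these, being defined on equivalence classes.\<close>

lemma gf_cong:
  assumes B: "BB Y Z" "BB Y' Z'" and z: "dd Y Z Y' Z' = 0"
  shows "AE p in PM. gf Y Z (snd p) (fst p) = gf Y' Z' (snd p) (fst p)"
proof -
  note i = BBD[OF BB_diff[OF B]]
  have nn: "0 \<le> (\<integral>p. (Y (snd p) (fst p) - Y' (snd p) (fst p))\<^sup>2 \<partial>PM)" "0 \<le> (\<integral>u. (flat Z u - flat Z' u)\<^sup>2 \<partial>mu)" by simp_all
  have z1: "(\<integral>p. (Y (snd p) (fst p) - Y' (snd p) (fst p))\<^sup>2 \<partial>PM) = 0" and z2: "(\<integral>u. (flat Z u - flat Z' u)\<^sup>2 \<partial>mu) = 0"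
    using z nn unfolding dd_eq[OF B] by linarith+
  have Yae: "AE p in PM. Y (snd p) (fst p) = Y' (snd p) (fst p)"
    using integral_nonneg_eq_0_iff_AE[OF i(3)] z1 by simp
  have "AE u in mu. flat Z u = flat Z' u"
    using integral_nonneg_eq_0_iff_AE[of mu "\<lambda>u. (flat Z u - flat Z' u)\<^sup>2"] i(4) z2 by (simp add: flat_def)
  from AE_mu[OF this] have Zae: "AE p in PM. AE y in kernel p. Z (snd p) (fst p) y = Z' (snd p) (fst p) y" by simp
  have S: "AE p in PM. Y (snd p) (fst p) = Y' (snd p) (fst p) \<and> (AE y in kernel p. Z (snd p) (fst p) y = Z' (snd p) (fst p) y)
    \<and> Z (snd p) (fst p) \<in> L2 (kernel p) \<and> Z' (snd p) (fst p) \<in> L2 (kernel p)"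
    using Yae Zae cs_integrable(3)[OF BBD(2,4)[OF B(1)]] cs_integrable(3)[OF BBD(2,4)[OF B(2)]]
    by eventually_elim simp
  show ?thesis
  proof (rule AE_PM_except_jumps[OF _ _ S, where R="\<lambda>_. True"])
    note [measurable] = progressive_PM[OF gf_progressive[OF B(1)]] progressive_PM[OF gf_progressive[OF B(2)]]
    show "{p \<in> space PM. gf Y Z (snd p) (fst p) = gf Y' Z' (snd p) (fst p)} \<in> sets PM" by measurable
    fix \<omega> r assume o: "\<omega> \<in> \<Omega>" "r \<in> {t<..T}" "r \<notin> J \<omega>"
      and S: "Y (snd (\<omega>, r)) (fst (\<omega>, r)) = Y' (snd (\<omega>, r)) (fst (\<omega>, r)) \<and> (AE y in kernel (\<omega>, r). Z (snd (\<omega>, r)) (fst (\<omega>, r)) y = Z' (snd (\<omega>, r)) (fst (\<omega>, r)) y)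
        \<and> Z (snd (\<omega>, r)) (fst (\<omega>, r)) \<in> L2 (kernel (\<omega>, r)) \<and> Z' (snd (\<omega>, r)) (fst (\<omega>, r)) \<in> L2 (kernel (\<omega>, r))"
    have k: "kernel (\<omega>, r) = v r (X r \<omega>)" using Xm_eq_X[OF o] by (simp add: kernel_def)
    have S1: "Y r \<omega> = Y' r \<omega>" and S2: "AE y in v r (X r \<omega>). Z r \<omega> y = Z' r \<omega> y"
      and S3: "Z r \<omega> \<in> L2 (v r (X r \<omega>))" "Z' r \<omega> \<in> L2 (v r (X r \<omega>))" using S unfolding k by simp_all
    have r: "r \<in> {0..T}" "X r \<omega> \<in> space \<Gamma>" using o t_nonneg by (auto intro: X_in_space)
    have "f r (X r \<omega>) (Y r \<omega>) (Z r \<omega>) = f r (X r \<omega>) (Y r \<omega>) (Z' r \<omega>)"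
      using f r S2 S3 unfolding generator_def by blast
    then show "gf Y Z (snd (\<omega>, r)) (fst (\<omega>, r)) = gf Y' Z' (snd (\<omega>, r)) (fst (\<omega>, r))"
      using S1 S3 by (simp add: gf_def gen_eval_def)
  qed simp
qed

text \<open>For two fixed points the contraction estimate bounds the weighted distance by
  \<open>2 * kap N\<close> times norms that do not depend on \<open>N\<close>. The weight is at
  least 1, so \<open>N\<close> may tend to infinity.\<close>

lemma fixed_point_unique:
  assumes lin: "linear_bsde (gf Y Z) Y Z" "linear_bsde (gf Y' Z') Y' Z'" and tval: "AE \<omega> in M. Y T \<omega> = Y' T \<omega>"
  shows "dd Y Z Y' Z' = 0"
proof -
  note B = linear_BB[OF lin(1)] linear_BB[OF lin(2)]
  define R where "R = (\<integral>p. dens Y Z p \<partial>PM) + (\<integral>p. dens Y' Z' p \<partial>PM)"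
  have le: "dd Y Z Y' Z' \<le> 2 * (kap (real n) * R)" for n
    using contraction[OF B lin tval, of "real n"] W_compare[OF BB_diff[OF B], of "real n"]
    unfolding R_def[symmetric] dd_def[symmetric] by simp
  have "(\<lambda>n. 2 * (kap (real n) * R)) \<longlonglongrightarrow> 2 * (0 * R)"
    by (intro tendsto_intros kap_tendsto)
  then have "dd Y Z Y' Z' \<le> 2 * (0 * R)"
    by (rule LIMSEQ_le_const) (use le in blast)
  then show ?thesis using dd_nonneg[of Y Z Y' Z'] by simp
qed

text \<open>The estimate is not a contraction in any one norm. For each accuracy \<open>N\<close> is
  chosen first, which makes the error small for all iterates at once thanks to their common bound,
  and the number of iterations only afterwards.\<close>

theorem fixed_point_exists: "\<exists>Y Z. linear_bsde (gf Y Z) Y Z \<and> (AE \<omega> in M. Y T \<omega> = h (X T \<omega>))"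
proof -
  have "\<forall>q. \<exists>q'. BB (fst q) (snd q) \<longrightarrow> linear_bsde (gf (fst q) (snd q)) (fst q') (snd q') \<and> (AE \<omega> in M. fst q' T \<omega> = h (X T \<omega>))"
  proof (intro allI)
    fix q
    show "\<exists>q'. BB (fst q) (snd q) \<longrightarrow> linear_bsde (gf (fst q) (snd q)) (fst q') (snd q') \<and> (AE \<omega> in M. fst q' T \<omega> = h (X T \<omega>))"
      using Phi_exists[of "fst q" "snd q"] by (cases "BB (fst q) (snd q)") auto
  qed
  from choice[OF this] obtain Phi where Phi: "\<And>q. BB (fst q) (snd q) \<Longrightarrow>
    linear_bsde (gf (fst q) (snd q)) (fst (Phi q)) (snd (Phi q)) \<and> (AE \<omega> in M. fst (Phi q) T \<omega> = h (X T \<omega>))" by blast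
  \<comment> \<open>Starting from zero makes the distance between the start and any iterate equal to
    the norm of that iterate, which is bounded.\<close>
  define U where "U n = (Phi ^^ n) (\<lambda>_ _. 0, \<lambda>_ _ _. 0)" for n
  define Y where "Y n = fst (U n)" for n
  define Z where "Z n = snd (U n)" for n
  have Y0: "Y 0 = (\<lambda>_ _. 0)" "Z 0 = (\<lambda>_ _ _. 0)" by (simp_all add: Y_def Z_def U_def)
  have BB: "BB (Y n) (Z n)" for n
  proof (induction n)
    case 0
    show ?case unfolding Y0 by (simp add: BB_def progressive_def predictable_field_def flat_def case_prod_beta')
  next
    case (Suc n)
    then show ?case using Phi[of "U n"] by (auto simp: Y_def Z_def U_def intro: linear_BB)
  qed
  have step: "linear_bsde (gf (Y n) (Z n)) (Y (Suc n)) (Z (Suc n))" and tval: "AE \<omega> in M. Y (Suc n) T \<omega> = h (X T \<omega>)" for n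
    using Phi[of "U n"] BB[of n] by (auto simp: Y_def Z_def U_def)
  obtain C where C: "0 \<le> C" "\<And>y z Y Z. BB y z \<Longrightarrow> linear_bsde (gf y z) Y Z \<Longrightarrow> (AE \<omega> in M. Y T \<omega> = h (X T \<omega>)) \<Longrightarrow>
    (\<integral>p. exp ((6 * lam\<^sup>2 + 1) * (snd p - t)) * dens Y Z p \<partial>PM)
    \<le> C + (\<integral>p. exp ((6 * lam\<^sup>2 + 1) * (snd p - t)) * dens y z p \<partial>PM) / 2"
    using apriori_bound by blast
  \<comment> \<open>\<open>2 * C\<close> solves \<open>R = C + R / 2\<close>, so the bound
    reproduces itself along the iteration.\<close>
  define R where "R = 2 * C"
  have R0: "0 \<le> R" using C(1) by (simp add: R_def)
  have S: "(\<integral>p. exp ((6 * lam\<^sup>2 + 1) * (snd p - t)) * dens (Y n) (Z n) p \<partial>PM) \<le> R" for n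
  proof (induction n)
    case 0
    have "dens (Y 0) (Z 0) p = 0" for p by (simp add: Y0 dens_def cs_def comp_def)
    then show ?case using R0 by simp
  next
    case (Suc n)
    then show ?case using C(2)[OF BB[of n] step tval] by (simp add: R_def)
  qed
  have bd: "(\<integral>p. dens (Y n) (Z n) p \<partial>PM) \<le> R" for n
  proof -
    have c: "continuous_on UNIV (\<lambda>r. exp ((6 * lam\<^sup>2 + 1) * (r - t)))" by (intro continuous_intros)
    have "(\<integral>p. dens (Y n) (Z n) p \<partial>PM) \<le> (\<integral>p. exp ((6 * lam\<^sup>2 + 1) * (snd p - t)) * dens (Y n) (Z n) p \<partial>PM)"
      using dens_integrable[OF BB] weight_PM(1)[OF dens_integrable[OF BB] c]
    proof (rule integral_mono)
      fix p assume "p \<in> space PM"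
      then have "t \<le> snd p" by (auto simp: space_pair_measure)
      then have "1 \<le> exp ((6 * lam\<^sup>2 + 1) * (snd p - t))" by simp
      then show "dens (Y n) (Z n) p \<le> exp ((6 * lam\<^sup>2 + 1) * (snd p - t)) * dens (Y n) (Z n) p"
        using dens_nonneg[of "Y n" "Z n" p] by (simp add: mult_le_cancel_right1)
    qed
    then show ?thesis using S[of n] by simp
  qed
  \<comment> \<open>The two arguments contribute at most \<open>2 * R * kap N\<close> per step, and
    \<open>4 * R * kap N\<close> is unchanged by halving and adding that amount.\<close>
  have geo: "(\<integral>p. W N (snd p) * dens (dY (Y k) (Y (k + j))) (dZ (Z k) (Z (k + j))) p \<partial>PM)
    \<le> (1/2)^k * (\<integral>p. W N (snd p) * dens (dY (Y 0) (Y j)) (dZ (Z 0) (Z j)) p \<partial>PM) + 4 * R * kap N"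
    if N: "0 \<le> N" for N k j
  proof (induction k)
    case 0
    show ?case using R0 kap_nonneg[of N] by simp
  next
    case (Suc k)
    have t': "AE \<omega> in M. Y (Suc k) T \<omega> = Y (Suc (k + j)) T \<omega>"
      using tval[of k] tval[of "k + j"] by eventually_elim simp
    have "(\<integral>p. W N (snd p) * dens (dY (Y (Suc k)) (Y (Suc (k + j)))) (dZ (Z (Suc k)) (Z (Suc (k + j)))) p \<partial>PM)
      \<le> (\<integral>p. W N (snd p) * dens (dY (Y k) (Y (k + j))) (dZ (Z k) (Z (k + j))) p \<partial>PM) / 2
        + kap N * ((\<integral>p. dens (Y k) (Z k) p \<partial>PM) + (\<integral>p. dens (Y (k + j)) (Z (k + j)) p \<partial>PM))"
      by (rule contraction[OF BB BB step step t' N])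
    also have "\<dots> \<le> ((1/2)^k * (\<integral>p. W N (snd p) * dens (dY (Y 0) (Y j)) (dZ (Z 0) (Z j)) p \<partial>PM) + 4 * R * kap N) / 2
        + kap N * (R + R)"
      using Suc.IH by (intro add_mono divide_right_mono mult_left_mono bd kap_nonneg) auto
    also have "\<dots> = (1/2)^(Suc k) * (\<integral>p. W N (snd p) * dens (dY (Y 0) (Y j)) (dZ (Z 0) (Z j)) p \<partial>PM) + 4 * R * kap N"
      by (simp add: field_simps)
    finally show ?case by simp
  qed
  have cauchy: "\<exists>k0. \<forall>k\<ge>k0. \<forall>j. dd (Y k) (Z k) (Y (k + j)) (Z (k + j)) \<le> e" if e: "0 < e" for e
  proof -
    have "(\<lambda>n. 4 * R * kap (real n)) \<longlonglongrightarrow> 4 * R * 0" by (intro tendsto_intros kap_tendsto)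
    then have "\<forall>\<^sub>F n in sequentially. 4 * R * kap (real n) < e / 2" using e by (intro order_tendstoD(2)) auto
    from eventually_happens'[OF sequentially_bot this] obtain n where n: "4 * R * kap (real n) < e / 2" by blast
    obtain D where D: "0 \<le> D" "\<And>Y Z. BB Y Z \<Longrightarrow> (\<integral>p. W (real n) (snd p) * dens Y Z p \<partial>PM) \<le> D * (\<integral>p. dens Y Z p \<partial>PM)"
      using W_bound[of "real n"] by blast
    have d0: "(\<integral>p. W (real n) (snd p) * dens (dY (Y 0) (Y j)) (dZ (Z 0) (Z j)) p \<partial>PM) \<le> D * R" for j
    proof -
      have "dens (dY (Y 0) (Y j)) (dZ (Z 0) (Z j)) = dens (Y j) (Z j)"
        by (simp add: dens_def[abs_def] Y0 cs_def comp_def[abs_def])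
      then show ?thesis using D(2)[OF BB[of j]] mult_left_mono[OF bd[of j] D(1)] by simp
    qed
    have "(\<lambda>k. (1/2)^k * (D * R)) \<longlonglongrightarrow> 0 * (D * R)" by (intro tendsto_intros LIMSEQ_realpow_zero) auto
    then have "\<forall>\<^sub>F k in sequentially. (1/2)^k * (D * R) < e / 2" using e by (intro order_tendstoD(2)) auto
    then obtain k0 where k0: "\<And>k. k0 \<le> k \<Longrightarrow> (1/2)^k * (D * R) < e / 2" by (auto simp: eventually_sequentially)
    have "dd (Y k) (Z k) (Y (k + j)) (Z (k + j)) \<le> e" if "k0 \<le> k" for k j
    proof -
      have "dd (Y k) (Z k) (Y (k + j)) (Z (k + j)) \<le> (1/2)^k * (\<integral>p. W (real n) (snd p) * dens (dY (Y 0) (Y j)) (dZ (Z 0) (Z j)) p \<partial>PM) + 4 * R * kap (real n)"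
        unfolding dd_def by (rule order.trans[OF W_compare[OF BB_diff[OF BB BB]] geo]) simp_all
      also have "\<dots> \<le> (1/2)^k * (D * R) + 4 * R * kap (real n)" using d0 by (intro add_right_mono mult_left_mono) auto
      also have "\<dots> \<le> e" using k0[OF that] n by simp
      finally show ?thesis .
    qed
    then show ?thesis by blast
  qed
  have "\<forall>i. \<exists>k0. \<forall>k\<ge>k0. \<forall>j. dd (Y k) (Z k) (Y (k + j)) (Z (k + j)) \<le> (1/4)^i" using cauchy by simp
  from choice[OF this] obtain \<kappa> where \<kappa>: "\<And>i k j. \<kappa> i \<le> k \<Longrightarrow> dd (Y k) (Z k) (Y (k + j)) (Z (k + j)) \<le> (1/4)^i" by blast
  \<comment> \<open>Cumulative sums make the indices nondecreasing with increment
    \<open>\<kappa> (Suc i)\<close>, so that consecutive terms of the subsequence have the form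
    \<open>k\<close>, \<open>k + j\<close> with \<open>k\<close> at least
    \<open>\<kappa> i\<close>.\<close>
  define n where "n i = (\<Sum>j\<le>i. \<kappa> j)" for i
  have n_ge: "\<kappa> i \<le> n i" for i unfolding n_def by (rule member_le_sum) auto
  have fast: "dd (Y (n i)) (Z (n i)) (Y (n (Suc i))) (Z (n (Suc i))) \<le> (1/4)^i" for i
    using \<kappa>[OF n_ge[of i], of "\<kappa> (Suc i)"] by (simp add: n_def)
  have next1: "dd (Y (n i)) (Z (n i)) (Y (Suc (n i))) (Z (Suc (n i))) \<le> (1/4)^i" for i
    using \<kappa>[OF n_ge[of i], of 1] by simp
  define Yl where "Yl r \<omega> = lim (\<lambda>i. Y (n i) r \<omega>)" for r \<omega>
  define Zl where "Zl r \<omega> y = lim (\<lambda>i. Z (n i) r \<omega> y)" for r \<omega> y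
  have Yp: "progressive F t T Yl"
    unfolding progressive_def case_prod_beta' Yl_def
    by (intro ballI borel_measurable_lim_metric progressive_on BBD(1)[OF BB])
  have Zf: "field Zl" unfolding Zl_def[abs_def] by (rule field_lim[OF BBD(2)[OF BB]])
  note diff = BBD[OF BB_diff[OF BB BB]]
  have nnY: "(\<integral>\<^sup>+p. ennreal ((Y (n (Suc i)) (snd p) (fst p) - Y (n i) (snd p) (fst p))\<^sup>2) \<partial>PM) \<le> ennreal (1 * (1/4)^i)" for i
  proof -
    have "(\<integral>\<^sup>+p. ennreal ((Y (n (Suc i)) (snd p) (fst p) - Y (n i) (snd p) (fst p))\<^sup>2) \<partial>PM)
      = ennreal (\<integral>p. (Y (n (Suc i)) (snd p) (fst p) - Y (n i) (snd p) (fst p))\<^sup>2 \<partial>PM)"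
      using diff(3) by (intro nn_integral_eq_integral) auto
    also have "\<dots> \<le> ennreal (1 * (1/4)^i)"
    proof (rule ennreal_leI)
      have "0 \<le> (\<integral>u. (flat (Z (n i)) u - flat (Z (n (Suc i))) u)\<^sup>2 \<partial>mu)" by simp
      then show "(\<integral>p. (Y (n (Suc i)) (snd p) (fst p) - Y (n i) (snd p) (fst p))\<^sup>2 \<partial>PM) \<le> 1 * (1/4)^i"
        using fast[of i] unfolding dd_eq[OF BB BB] power2_commute[of "Y (n (Suc i)) _ _"] by linarith
    qed
    finally show ?thesis .
  qed
  have nnZ: "(\<integral>\<^sup>+u. ennreal ((flat (Z (n (Suc i))) u - flat (Z (n i)) u)\<^sup>2) \<partial>mu) \<le> ennreal (1 * (1/4)^i)" for i
  proof -
    have "(\<integral>\<^sup>+u. ennreal ((flat (Z (n (Suc i))) u - flat (Z (n i)) u)\<^sup>2) \<partial>mu)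
      = ennreal (\<integral>u. (flat (Z (n (Suc i))) u - flat (Z (n i)) u)\<^sup>2 \<partial>mu)"
      using diff(4) by (intro nn_integral_eq_integral) (auto simp: flat_def)
    also have "\<dots> \<le> ennreal (1 * (1/4)^i)"
    proof (rule ennreal_leI)
      have "0 \<le> (\<integral>p. (Y (n i) (snd p) (fst p) - Y (n (Suc i)) (snd p) (fst p))\<^sup>2 \<partial>PM)" by simp
      then show "(\<integral>u. (flat (Z (n (Suc i))) u - flat (Z (n i)) u)\<^sup>2 \<partial>mu) \<le> 1 * (1/4)^i"
        using fast[of i] unfolding dd_eq[OF BB BB] power2_commute[of "flat (Z (n (Suc i))) _"] by linarith
    qed
    finally show ?thesis .
  qed
  have Ym: "(\<lambda>p. Y k (snd p) (fst p)) \<in> borel_measurable PM" for k by (rule progressive_PM[OF BBD(1)[OF BB]])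
  have Zm: "flat (Z k) \<in> borel_measurable mu" for k by (rule field_mu[OF BBD(2)[OF BB]])
  have limY: "(\<integral>\<^sup>+p. ennreal ((Yl (snd p) (fst p) - Y (n i) (snd p) (fst p))\<^sup>2) \<partial>PM) \<le> ennreal (4 * 1 * (1/4)^i)" for i
    unfolding Yl_def by (rule fast_Cauchy_L2(2)[of "\<lambda>i p. Y (n i) (snd p) (fst p)"]) (use Ym nnY in auto)
  have limZ: "(\<integral>\<^sup>+u. ennreal ((flat Zl u - flat (Z (n i)) u)\<^sup>2) \<partial>mu) \<le> ennreal (4 * 1 * (1/4)^i)" for i
  proof -
    have "flat Zl u = lim (\<lambda>i. flat (Z (n i)) u)" for u by (simp add: flat_def Zl_def)
    then show ?thesis using fast_Cauchy_L2(2)[of "\<lambda>i. flat (Z (n i))" mu 1 i] Zm nnZ by simp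
  qed
  have iY: "integrable PM (\<lambda>p. (Yl (snd p) (fst p) - Y (n i) (snd p) (fst p))\<^sup>2)" for i
    using le_less_trans[OF limY[of i]] progressive_PM[OF Yp] Ym by (intro integrableI_bounded) auto
  have iZ: "integrable mu (\<lambda>u. (flat Zl u - flat (Z (n i)) u)\<^sup>2)" for i
    using le_less_trans[OF limZ[of i]] field_mu[OF Zf] Zm by (intro integrableI_bounded) auto
  have BBl: "BB Yl Zl"
    unfolding BB_def
  proof (intro conjI Yp Zf)
    show "integrable PM (\<lambda>p. (Yl (snd p) (fst p))\<^sup>2)"
      using integrable_square_lincomb[OF _ Ym[of "n 0"] iY[of 0] BBD(3)[OF BB[of "n 0"]], of 1 1] progressive_PM[OF Yp] Ym by simp
    show "integrable mu (\<lambda>u. (flat Zl u)\<^sup>2)"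
      using integrable_square_lincomb[OF _ Zm[of "n 0"] iZ[of 0] BBD(4)[OF BB[of "n 0"]], of 1 1] field_mu[OF Zf] Zm by simp
  qed
  have ddl: "dd Yl Zl (Y (n i)) (Z (n i)) \<le> 8 * (1/4)^i" for i
  proof -
    have "ennreal (\<integral>p. (Yl (snd p) (fst p) - Y (n i) (snd p) (fst p))\<^sup>2 \<partial>PM) \<le> ennreal (4 * 1 * (1/4)^i)"
      using limY[of i] iY by (subst nn_integral_eq_integral[symmetric]) auto
    moreover have "ennreal (\<integral>u. (flat Zl u - flat (Z (n i)) u)\<^sup>2 \<partial>mu) \<le> ennreal (4 * 1 * (1/4)^i)"
      using limZ[of i] iZ by (subst nn_integral_eq_integral[symmetric]) auto
    ultimately show ?thesis unfolding dd_eq[OF BBl BB] by (simp add: ennreal_le_iff)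
  qed
  \<comment> \<open>The limit is fed once more into the Picard map. Its image is compared with the
    successor of the iterate number \<open>n i\<close>: first \<open>i\<close> tends to infinity for
    fixed \<open>N\<close>, then \<open>N\<close> does, and the image and the limit turn out to have
    distance zero.\<close>
  define Ys where "Ys = fst (Phi (Yl, Zl))"
  define Zs where "Zs = snd (Phi (Yl, Zl))"
  have lins: "linear_bsde (gf Yl Zl) Ys Zs" and terms: "AE \<omega> in M. Ys T \<omega> = h (X T \<omega>)"
    using Phi[of "(Yl, Zl)"] BBl by (auto simp: Ys_def Zs_def)
  note BBs = linear_BB[OF lins]
  define Q where "Q = (\<integral>p. dens Yl Zl p \<partial>PM) + R"
  have "dd Ys Zs Yl Zl \<le> 2 * (kap (real N) * Q)" for N :: nat
  proof -
    obtain D where D: "0 \<le> D" "\<And>Y Z. BB Y Z \<Longrightarrow> (\<integral>p. W (real N) (snd p) * dens Y Z p \<partial>PM) \<le> D * (\<integral>p. dens Y Z p \<partial>PM)"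
      using W_bound[of "real N"] by blast
    \<comment> \<open>The number 18 is \<open>2 * 1 + 2 * 8\<close> and 36 is its double, from two
      uses of the triangle inequality for squared distances.\<close>
    have b: "dd Ys Zs Yl Zl \<le> 2 * (D * (8 * (1/4)^i) / 2 + kap (real N) * Q) + 36 * (1/4)^i" for i
    proof -
      have t': "AE \<omega> in M. Ys T \<omega> = Y (Suc (n i)) T \<omega>" using terms tval[of "n i"] by eventually_elim simp
      have "dd Ys Zs (Y (Suc (n i))) (Z (Suc (n i)))
        \<le> (\<integral>p. W (real N) (snd p) * dens (dY Yl (Y (n i))) (dZ Zl (Z (n i))) p \<partial>PM) / 2
          + kap (real N) * ((\<integral>p. dens Yl Zl p \<partial>PM) + (\<integral>p. dens (Y (n i)) (Z (n i)) p \<partial>PM))"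
        unfolding dd_def
        by (rule order.trans[OF W_compare[OF BB_diff[OF BBs BB]] contraction[OF BBl BB lins step t']]) simp_all
      also have "\<dots> \<le> D * dd Yl Zl (Y (n i)) (Z (n i)) / 2 + kap (real N) * Q"
        unfolding Q_def dd_def
        by (intro add_mono divide_right_mono D(2) BB_diff BBl BB mult_left_mono bd kap_nonneg order.refl) simp
      also have "\<dots> \<le> D * (8 * (1/4)^i) / 2 + kap (real N) * Q"
        using ddl[of i] D(1) by (intro add_right_mono divide_right_mono mult_left_mono) auto
      finally have 1: "dd Ys Zs (Y (Suc (n i))) (Z (Suc (n i))) \<le> D * (8 * (1/4)^i) / 2 + kap (real N) * Q" .
      have "dd (Y (Suc (n i))) (Z (Suc (n i))) Yl Zl
        \<le> 2 * dd (Y (Suc (n i))) (Z (Suc (n i))) (Y (n i)) (Z (n i)) + 2 * dd (Y (n i)) (Z (n i)) Yl Zl"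
        by (rule dd_triangle[OF BB BB BBl])
      also have "\<dots> \<le> 2 * (1/4)^i + 2 * (8 * (1/4)^i)"
        using next1[of i] ddl[of i] dd_commute[OF BB BB, of "n i" "Suc (n i)"] dd_commute[OF BBl BB, of "n i"]
        by (intro add_mono mult_left_mono) auto
      finally have 2: "dd (Y (Suc (n i))) (Z (Suc (n i))) Yl Zl \<le> 18 * (1/4)^i" by simp
      have "a \<le> 2 * b' + 36 * e" if "a \<le> 2 * b + 2 * c" "b \<le> b'" "c \<le> 18 * e" for a b b' c e :: real
        using that by linarith
      from this[OF dd_triangle[OF BBs BB BBl] 1 2] show ?thesis .
    qed
    have "(\<lambda>i. 2 * (D * (8 * (1/4)^i) / 2 + kap (real N) * Q) + 36 * (1/4)^i)
      \<longlonglongrightarrow> 2 * (D * (8 * 0) / 2 + kap (real N) * Q) + 36 * 0"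
      by (intro tendsto_intros LIMSEQ_realpow_zero) auto
    from LIMSEQ_le_const[OF this] b show ?thesis by auto
  qed
  moreover have "(\<lambda>N. 2 * (kap (real N) * Q)) \<longlonglongrightarrow> 2 * (0 * Q)" by (intro tendsto_intros kap_tendsto)
  ultimately have "dd Ys Zs Yl Zl \<le> 2 * (0 * Q)" by (intro LIMSEQ_le_const[of "\<lambda>n. 2 * (kap (real n) * Q)"]) blast+
  then have z: "dd Yl Zl Ys Zs = 0" using dd_nonneg[of Ys Zs Yl Zl] dd_commute[OF BBs BBl] by simp
  \<comment> \<open>The solution is the image and not the pointwise limit: the image satisfies an
    equation at every time, whereas the limit agrees with it only up to null sets. Only the
    generator has to be replaced, and it changes on a null set of the product.\<close>
  have "linear_bsde (gf Ys Zs) Ys Zs"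
    by (rule linear_bsde_cong_generator[OF lins progressive_PM[OF gf_progressive[OF BBs]] gf_cong[OF BBl BBs z]])
  then show ?thesis using terms by blast
qed

text \<open>At \<open>s = T\<close> all integrals run over empty intervals, which extracts the
  terminal condition. Conversely, square integrability with respect to finite measures provides both
  integrability clauses along almost every path.\<close>

lemma solution_iff:
  "bsde_solution \<Gamma> M F X v t T f h Y Z \<longleftrightarrow> linear_bsde (gf Y Z) Y Z \<and> (AE \<omega> in M. Y T \<omega> = h (X T \<omega>))"
proof
  assume sol: "bsde_solution \<Gamma> M F X v t T f h Y Z"
  then have B: "BB Y Z" by (simp add: bsde_solution_def in_B_iff)
  have eq: "AE \<omega> in M. \<omega> \<in> \<Omega> \<and> (\<forall>s\<in>{t..T}. Y s \<omega> = h (X T \<omega>)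
      + (LINT r:{s<..T}|lborel. gf Y Z r \<omega>) - q_integral \<Gamma> X v t s T Z \<omega>)"
    using sol AE_space unfolding bsde_solution_def gf_def by (auto elim: AE_mp)
  have tval: "AE \<omega> in M. Y T \<omega> = h (X T \<omega>)"
    using eq
  proof eventually_elim
    case (elim \<omega>)
    have "J \<omega> \<inter> {T<..} = {}" using J_subset[of \<omega>] by auto
    then have "q_integral \<Gamma> X v t T T Z \<omega> = 0"
      using elim t_less by (subst q_integral_eq[OF BBD(2)[OF B]]) (auto simp: jump_sum_def set_lebesgue_integral_def)
    then show ?case using elim t_less by (auto simp: set_lebesgue_integral_def dest!: bspec[of _ _ T])
  qed
  have "AE \<omega> in M. \<forall>s\<in>{t..T}. Y s \<omega> = Y T \<omega> + (LINT r:{s<..T}|lborel. gf Y Z r \<omega>)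
      - (jump_sum Z s \<omega> - (LINT r:{s<..T}|lborel. comp Z (\<omega>, r)))"
    using eq tval
  proof eventually_elim
    case (elim \<omega>)
    show ?case
    proof
      fix s assume s: "s \<in> {t..T}"
      have "Y s \<omega> = h (X T \<omega>) + (LINT r:{s<..T}|lborel. gf Y Z r \<omega>) - q_integral \<Gamma> X v t s T Z \<omega>"
        using elim(1) s by blast
      then show "Y s \<omega> = Y T \<omega> + (LINT r:{s<..T}|lborel. gf Y Z r \<omega>)
        - (jump_sum Z s \<omega> - (LINT r:{s<..T}|lborel. comp Z (\<omega>, r)))"
        unfolding elim(2) using q_integral_eq[OF BBD(2)[OF B] _ s] elim(1) by simp
    qed
  qed
  then have "linear_bsde (gf Y Z) Y Z"
    unfolding linear_bsde_def using BBD[OF B] progressive_PM[OF gf_progressive[OF B]] gf_integrable[OF B] by blast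
  then show "linear_bsde (gf Y Z) Y Z \<and> (AE \<omega> in M. Y T \<omega> = h (X T \<omega>))" using tval by blast
next
  assume a: "linear_bsde (gf Y Z) Y Z \<and> (AE \<omega> in M. Y T \<omega> = h (X T \<omega>))"
  then have lin: "linear_bsde (gf Y Z) Y Z" and tval: "AE \<omega> in M. Y T \<omega> = h (X T \<omega>)" by auto
  note D = linear_bsdeD[OF lin] and B = linear_BB[OF lin]
  have Zi: "integrable mu (flat Z)" by (rule integrable_mu_L1[OF D(2,4)])
  have fin: "AE \<omega> in M. (\<integral>\<^sup>+r\<in>{t<..T}. (\<integral>\<^sup>+y. ennreal \<bar>Z r \<omega> y\<bar> \<partial>v r (left_limit X r \<omega>)) \<partial>lborel) < \<infinity>"
  proof -
    have m: "(\<lambda>u. ennreal \<bar>flat Z u\<bar>) \<in> borel_measurable (PM \<Otimes>\<^sub>M \<Gamma>)" using field_PM[OF D(2)] by measurable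
    note pm = PK.nn_measurable[OF m]
    have "(\<integral>\<^sup>+\<omega>. \<integral>\<^sup>+r. (\<integral>\<^sup>+y. ennreal \<bar>flat Z ((\<omega>, r), y)\<bar> \<partial>kernel (\<omega>, r)) \<partial>time \<partial>M) = (\<integral>\<^sup>+u. ennreal \<bar>flat Z u\<bar> \<partial>mu)"
      unfolding nn_integral_mu[OF m] by (rule nn_integral_PM[OF pm])
    also have "\<dots> < \<infinity>" using Zi by (simp add: integrable_iff_bounded)
    finally have "AE \<omega> in M. (\<integral>\<^sup>+r. (\<integral>\<^sup>+y. ennreal \<bar>flat Z ((\<omega>, r), y)\<bar> \<partial>kernel (\<omega>, r)) \<partial>time) \<noteq> \<infinity>"
      using time.borel_measurable_nn_integral_fst[OF pm] by (intro nn_integral_PInf_AE) auto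
    then show ?thesis
    proof eventually_elim
      case (elim \<omega>)
      have "(\<integral>\<^sup>+r\<in>{t<..T}. (\<integral>\<^sup>+y. ennreal \<bar>Z r \<omega> y\<bar> \<partial>v r (left_limit X r \<omega>)) \<partial>lborel)
        = (\<integral>\<^sup>+r. (\<integral>\<^sup>+y. ennreal \<bar>flat Z ((\<omega>, r), y)\<bar> \<partial>kernel (\<omega>, r)) \<partial>time)"
        unfolding nn_integral_time' by (intro nn_integral_cong) (auto simp: kernel_def Xm_def indicator_def)
      then show ?case using elim by (simp add: less_top)
    qed
  qed
  have "AE \<omega> in M. set_integrable lborel {t<..T} (\<lambda>r. gen_eval v f r (X r \<omega>) (Y r \<omega>) (Z r \<omega>)) \<and>
        (\<integral>\<^sup>+r\<in>{t<..T}. (\<integral>\<^sup>+y. ennreal \<bar>Z r \<omega> y\<bar> \<partial>v r (left_limit X r \<omega>)) \<partial>lborel) < \<infinity> \<and>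
        (\<forall>s\<in>{t..T}. Y s \<omega> = h (X T \<omega>)
             + (LINT r:{s<..T}|lborel. gen_eval v f r (X r \<omega>) (Y r \<omega>) (Z r \<omega>)) - q_integral \<Gamma> X v t s T Z \<omega>)"
    using AE_PM_integrable[OF integrable_PM_L1[OF D(5,6)]] fin D(7) tval AE_space
  proof eventually_elim
    case (elim \<omega>)
    have "Y s \<omega> = h (X T \<omega>) + (LINT r:{s<..T}|lborel. gf Y Z r \<omega>) - q_integral \<Gamma> X v t s T Z \<omega>" if s: "s \<in> {t..T}" for s
      using bspec[OF elim(3) s] q_integral_eq[OF D(2) _ s, of \<omega>] elim(4,5) by simp
    then show ?case using elim(1,2) by (simp add: gf_def)
  qed
  then show "bsde_solution \<Gamma> M F X v t T f h Y Z"
    unfolding bsde_solution_def using B by (simp add: in_B_iff)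
qed

theorem bsde_well_posed:
  "\<exists>Y Z. bsde_solution \<Gamma> M F X v t T f h Y Z \<and>
     (\<forall>Y' Z'. bsde_solution \<Gamma> M F X v t T f h Y' Z' \<longrightarrow> B_equal M X v t T Y Z Y' Z')"
proof -
  obtain Y Z where lin: "linear_bsde (gf Y Z) Y Z" and tval: "AE \<omega> in M. Y T \<omega> = h (X T \<omega>)"
    using fixed_point_exists by blast
  have "B_equal M X v t T Y Z Y' Z'" if "bsde_solution \<Gamma> M F X v t T f h Y' Z'" for Y' Z'
  proof -
    have lin': "linear_bsde (gf Y' Z') Y' Z'" and tval': "AE \<omega> in M. Y' T \<omega> = h (X T \<omega>)"
      using that by (simp_all add: solution_iff)
    have "AE \<omega> in M. Y T \<omega> = Y' T \<omega>" using tval tval' by eventually_elim simp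
    from fixed_point_unique[OF lin lin' this] have z: "dd Y Z Y' Z' = 0" .
    note B = linear_BB[OF lin] linear_BB[OF lin']
    note d = BBD[OF BB_diff[OF B]]
    have nn: "0 \<le> (\<integral>p. (Y (snd p) (fst p) - Y' (snd p) (fst p))\<^sup>2 \<partial>PM)" "0 \<le> (\<integral>u. (flat Z u - flat Z' u)\<^sup>2 \<partial>mu)" by simp_all
    have z1: "(\<integral>p. (Y (snd p) (fst p) - Y' (snd p) (fst p))\<^sup>2 \<partial>PM) = 0" and z2: "(\<integral>u. (flat Z u - flat Z' u)\<^sup>2 \<partial>mu) = 0"
      using z nn unfolding dd_eq[OF B] by linarith+
    have "Y_sqnorm M t T (dY Y Y') = ennreal (\<integral>p. (Y (snd p) (fst p) - Y' (snd p) (fst p))\<^sup>2 \<partial>PM)"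
      unfolding Y_sqnorm_eq[OF d(1)] using d(3) by (intro nn_integral_eq_integral) auto
    moreover have "Z_sqnorm M X v t T (dZ Z Z') = ennreal (\<integral>u. (flat Z u - flat Z' u)\<^sup>2 \<partial>mu)"
      unfolding Z_sqnorm_eq[OF d(2)] using d(4) by (subst nn_integral_eq_integral) (auto simp: flat_def)
    ultimately show ?thesis unfolding B_equal_def B_sqnorm_def z1 z2 by simp
  qed
  then show ?thesis using lin tval solution_iff by blast
qed

end

theorem theorem2:
  fixes \<Gamma> :: "'g measure"
    and \<Omega> :: "'w set"
    and X :: "real \<Rightarrow> 'w \<Rightarrow> 'g"
    and P :: "real \<Rightarrow> 'g \<Rightarrow> 'w measure"
    and T t :: real
    and v :: "real \<Rightarrow> 'g \<Rightarrow> 'g measure"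
    and x :: 'g
    and M :: "'w measure"
    and F :: "real \<Rightarrow> 'w measure"
    and h :: "'g \<Rightarrow> real"
    and f :: "real \<Rightarrow> 'g \<Rightarrow> real \<Rightarrow> ('g \<Rightarrow> real) \<Rightarrow> real"
    and lam \<alpha> L :: real
    and Lip :: "nat \<Rightarrow> real"
  assumes process: "jump_markov_process_with_rate \<Gamma> \<Omega> X P T v"
    and t: "0 \<le> t" "t < T"
    and x: "x \<in> space \<Gamma>"
    and M: "M = completion (P t x)"
    and F: "F = completed_filtration \<Gamma> X (P t x) t"
    and h: "h \<in> borel_measurable \<Gamma>" "integrable M (\<lambda>\<omega>. \<bar>h (X T \<omega>)\<bar>\<^sup>2)"
    and f: "generator \<Gamma> M F X v t T f"
    and continuity:
      "AE (\<omega>, s) in M \<Otimes>\<^sub>M restrict_space lborel {t..T}.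
         continuous_on_real_L2 (v s (X s \<omega>)) (f s (X s \<omega>))"
    and lam: "0 < lam"
    and \<alpha>: "0 < \<alpha>" "\<alpha> < 1"
    and growth:
      "\<And>s x y z. s \<in> {0..T} \<Longrightarrow> x \<in> space \<Gamma> \<Longrightarrow> z \<in> L2 (v s x) \<Longrightarrow>
         \<bar>f s x y z\<bar> \<le> lam * (1 + \<bar>y\<bar> powr \<alpha> + L2_norm (v s x) z powr \<alpha>)"
    and Lip_pos: "\<And>m. 1 \<le> m \<Longrightarrow> 0 < Lip m"
    and locally_lipschitz:
      "\<And>m. 1 \<le> m \<Longrightarrow>
         AE \<omega> in M. \<forall>s\<in>{t..T}. \<forall>y y'. \<forall>z\<in>L2 (v s (X s \<omega>)). \<forall>z'\<in>L2 (v s (X s \<omega>)).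
           \<bar>y\<bar> < real m \<longrightarrow> \<bar>y'\<bar> < real m \<longrightarrow>
           L2_norm (v s (X s \<omega>)) z < real m \<longrightarrow> L2_norm (v s (X s \<omega>)) z' < real m \<longrightarrow>
           \<bar>f s (X s \<omega>) y z - f s (X s \<omega>) y' z'\<bar>
             \<le> Lip m * (\<bar>y - y'\<bar> + L2_norm (v s (X s \<omega>)) (\<lambda>u. z u - z' u))"
    and L: "0 < L"
    and log_growth: "\<And>m. 1 \<le> m \<Longrightarrow> Lip m \<le> L + sqrt (ln (real m))"
  shows "\<exists>Y Z. bsde_solution \<Gamma> M F X v t T f h Y Z \<and>
           (\<forall>Y' Z'. bsde_solution \<Gamma> M F X v t T f h Y' Z' \<longrightarrow> B_equal M X v t T Y Z Y' Z')"
proof -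
  interpret S: jump_markov_started \<Gamma> \<Omega> X P T v t x
    using process t x by (simp add: jump_markov_started_def jump_markov_started_axioms_def)
  have MS: "M = S.M" and FS: "F = S.F" by (simp_all add: M F S.M_def S.F_def)
  interpret D: bsde_data \<Gamma> \<Omega> X P T v t x h f lam \<alpha> L Lip
  proof
    show "integrable S.M (\<lambda>\<omega>. (h (X T \<omega>))\<^sup>2)" using h(2) by (simp add: MS)
    show "generator \<Gamma> S.M S.F X v t T f" using f by (simp add: MS FS)
  qed (use h lam \<alpha> growth Lip_pos locally_lipschitz[unfolded MS] L log_growth in blast)+
  show ?thesis unfolding MS FS by (rule D.bsde_well_posed)
qed

end
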